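(* For each $N$ let $\vec Y^N=(Y^1,\dots,Y^N)\sim\psi^N$, the unique stationary distribution of the $N$-BBM recentred at its leftmost particle. Then the empirical measure $\Theta^N(\vec Y^N)=\frac1N\sum_{i=1}^N\delta_{Y^i}$ converges weakly in probability, as $N\to\infty$, to the probability measure $\pi_{\min}(x)\,dx$ with $\pi_{\min}(x)=2xe^{-\sqrt2 x}$ for $x>0$ (and $0$ for $x\le0$).
   Context: The $N$-BBM $\vec X^N_t=(X^1_t,\dots,X^N_t)$ consists of $N$ particles in $\mathbb{R}$ moving as independent standard Brownian motions; each particle branches at rate 1, and at each branching event the leftmost particle is removed and its label given to the newborn particle (equivalently, at rate $N-1$ the leftmost particle jumps onto one of the other $N-1$ particles chosen uniformly at random). With $L^N_t=\min_iX^i_t$, the recentred process $\vec Y^N_t=(X^i_t-L^N_t)_{i}$ is a Markov process on $\Gamma_N=\{\vec y\in\mathbb{R}^N_{\ge0}: y_i=0\text{ for some }i\}$ with a unique stationary distribution $\psi^N$. "Weakly in probability" means that for a metric $d$ metrising weak convergence on probability measures on $\mathbb{R}$, $d(\Theta^N(\vec Y^N),\pi_{\min})\to0$ in probability. *)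

theory Defs
  imports "HOL-Probability.Probability"
begin

definition state_space :: "nat \<Rightarrow> (nat \<Rightarrow> real) measure" where
  "state_space N = PiM {..<N} (\<lambda>_. borel)"

definition Gamma :: "nat \<Rightarrow> (nat \<Rightarrow> real) set" where
  "Gamma N = {y \<in> extensional {..<N}. (\<forall>i<N. 0 \<le> y i) \<and> (\<exists>i<N. y i = 0)}"

text \<open>Index of the leftmost particle (ties, a null event, broken by lowest index).\<close>
definition leftmost :: "nat \<Rightarrow> (nat \<Rightarrow> real) \<Rightarrow> nat" where
  "leftmost N x = (LEAST i. i < N \<and> (\<forall>j<N. x i \<le> x j))"

text \<open>Branching event: particle u branches; the leftmost particle is removed and its
  label is given to the newborn particle, which sits at the position of particle u.\<close>
definition branch :: "nat \<Rightarrow> (nat \<Rightarrow> real) \<Rightarrow> nat \<Rightarrow> (nat \<Rightarrow> real)" where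
  "branch N x u = x(leftmost N x := x u)"

text \<open>Independent Brownian displacement over a time span s, from standard Gaussian vector z.\<close>
definition diffuse :: "nat \<Rightarrow> (nat \<Rightarrow> real) \<Rightarrow> real \<Rightarrow> (nat \<Rightarrow> real) \<Rightarrow> (nat \<Rightarrow> real)" where
  "diffuse N x s z = restrict (\<lambda>i. x i + sqrt s * z i) {..<N}"

text \<open>Driving noise for one branching event: the waiting time (exponential with total
  branching rate N, each of the N particles branching at rate 1), a standard Gaussian vector
  (Brownian increments, rescaled by the square root of the elapsed time), and the index of the
  branching particle (uniform among the N particles).\<close>
definition noise_step :: "nat \<Rightarrow> (real \<times> (nat \<Rightarrow> real) \<times> nat) measure" where
  "noise_step N =
     density lborel (exponential_density (real N)) \<Otimes>\<^sub>M
     (PiM {..<N} (\<lambda>_. density lborel std_normal_density) \<Otimes>\<^sub>M uniform_count_measure {..<N})"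

definition noise :: "nat \<Rightarrow> (real \<times> (nat \<Rightarrow> real) \<times> nat) stream measure" where
  "noise N = stream_space (noise_step N)"

primrec after_jumps :: "nat \<Rightarrow> (nat \<Rightarrow> real) \<Rightarrow> (real \<times> (nat \<Rightarrow> real) \<times> nat) stream
    \<Rightarrow> nat \<Rightarrow> (nat \<Rightarrow> real)" where
  "after_jumps N x \<omega> 0 = x"
| "after_jumps N x \<omega> (Suc k) =
     (case \<omega> !! k of (\<tau>, z, u) \<Rightarrow> branch N (diffuse N (after_jumps N x \<omega> k) \<tau> z) u)"

definition jump_time :: "(real \<times> (nat \<Rightarrow> real) \<times> nat) stream \<Rightarrow> nat \<Rightarrow> real" where
  "jump_time \<omega> k = (\<Sum>i<k. fst (\<omega> !! i))"

definition num_jumps :: "real \<Rightarrow> (real \<times> (nat \<Rightarrow> real) \<times> nat) stream \<Rightarrow> nat" where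
  "num_jumps t \<omega> = (LEAST k. t < jump_time \<omega> (Suc k))"

definition NBBM :: "nat \<Rightarrow> (nat \<Rightarrow> real) \<Rightarrow> real \<Rightarrow> (real \<times> (nat \<Rightarrow> real) \<times> nat) stream
    \<Rightarrow> (nat \<Rightarrow> real)" where
  "NBBM N x t \<omega> =
     (let k = num_jumps t \<omega> in
      diffuse N (after_jumps N x \<omega> k) (t - jump_time \<omega> k) (fst (snd (\<omega> !! k))))"

definition recentre :: "nat \<Rightarrow> (nat \<Rightarrow> real) \<Rightarrow> (nat \<Rightarrow> real)" where
  "recentre N x = restrict (\<lambda>i. x i - Min (x ` {..<N})) {..<N}"

definition NBBM_stationary :: "nat \<Rightarrow> (nat \<Rightarrow> real) measure \<Rightarrow> bool" where
  "NBBM_stationary N \<psi> \<longleftrightarrow>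
     prob_space \<psi> \<and> sets \<psi> = sets (state_space N) \<and> (AE y in \<psi>. y \<in> Gamma N) \<and>
     (\<forall>t\<ge>0. distr (\<psi> \<Otimes>\<^sub>M noise N) (state_space N)
                 (\<lambda>(y, \<omega>). recentre N (NBBM N y t \<omega>)) = \<psi>)"

definition empirical :: "nat \<Rightarrow> (nat \<Rightarrow> real) \<Rightarrow> real measure" where
  "empirical N y = distr (uniform_count_measure {..<N}) borel y"

definition pi_min_density :: "real \<Rightarrow> real" where
  "pi_min_density x = (if 0 < x then 2 * x * exp (- sqrt 2 * x) else 0)"

definition pi_min :: "real measure" where
  "pi_min = density lborel (\<lambda>x. ennreal (pi_min_density x))"

text \<open>Levy metric on probability measures on the real line (metrises weak convergence).\<close>
definition levy_dist :: "real measure \<Rightarrow> real measure \<Rightarrow> real" where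
  "levy_dist \<mu> \<nu> = Inf {e. 0 < e \<and> (\<forall>x. measure \<mu> {..x - e} - e \<le> measure \<nu> {..x}
                                       \<and> measure \<nu> {..x} \<le> measure \<mu> {..x + e} + e)}"

end

theory Submission
  imports Defs "HOL-Real_Asymp.Real_Asymp"
begin

text \<open>Over a short time \<open>d\<close> the tail \<open>emp_tail\<close> of a large system is diffused by the heat kernel,
  multiplied by \<open>exp d\<close> and capped at \<open>1\<close>. Growing before or after diffusing gives a lower and an
  upper flow, \<open>lo\<close> and \<open>up\<close>, which stay within \<open>d\<close> of each other under iteration. By total
  positivity of the heat kernel the flow started from any tail is at least as stretched as the flow
  started from a step, whose profiles, seen from the front, increase to a wave. Its Laplace transform
  is determined as \<open>d\<close> tends to \<open>0\<close>, and any speed below \<open>sqrt 2\<close> is excluded because the corresponding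
  wave oscillates; what remains is the wave \<open>pi_tail\<close> of \<open>pi_min\<close>. Chernoff bounds for the particle
  system, obtained from renewal at the branching events and Yule generating functions,
  transfer this: under the stationary law the tail is asymptotically at least \<open>pi_tail\<close>.

  Conversely, stationarity of the logarithm of \<open>\<Sum>i. exp (sqrt 2 * (x i - mean))\<close> shows that the
  stationary mean of the tail has integral at most \<open>sqrt 2 + o(1)\<close>, which is exactly the integral of
  \<open>pi_tail\<close>. Hence the lower bound is sharp at every point, and the tails converge in probability.\<close>

section \<open>Upper and lower tail flows\<close>

text \<open>Neither tightness nor regularity of the stationary law is known beforehand, so every
  estimate on the particle system has to be uniform in the starting configuration. This is what the
  step is for: it is the steepest tail, so a fixed number of steps of a fixed length d lifts every
  initial tail, up to a small error, above the wave, and only afterwards does the number of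
  particles tend to infinity. The comparison is one-sided, since an initial tail may be arbitrarily
  spread out and stay so during the fixed time. The missing upper bound comes from a balance of
  speeds. Formally, the sum of \<open>exp (sqrt 2 * x i)\<close> grows at rate at most 2, one unit
  from diffusion and one from branching, while the mean position moves at the average distance to
  the leftmost particle. Stationarity of the logarithm forces sqrt 2 times that average to be at
  most 2. The average distance is the integral of the tail, and the bound sqrt 2 coincides with the
  integral of the limiting tail because the exponent sqrt 2 is the one that minimises the speed s /
  2 + 1 / s.\<close>

abbreviation std_gauss :: "real measure" where
  "std_gauss \<equiv> density lborel std_normal_density"

interpretation gauss: prob_space std_gauss
  by (rule prob_space_normal_density) simp

lemma prob_gauss_UNIV [simp]: "gauss.prob UNIV = 1"
  using gauss.prob_space by simp

text \<open>If F is the tail of X, this is the tail of X + sqrt d * Z with an independent standard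
  Gaussian Z; hence the minus sign.\<close>

definition heat :: "real \<Rightarrow> (real \<Rightarrow> real) \<Rightarrow> real \<Rightarrow> real" where
  "heat d F a = (\<integral>z. F (a - sqrt d * z) \<partial>std_gauss)"

definition tailfn :: "(real \<Rightarrow> real) \<Rightarrow> bool" where
  "tailfn F \<longleftrightarrow> antimono F \<and> (\<forall>a. 0 \<le> F a \<and> F a \<le> 1) \<and> (F \<longlongrightarrow> 1) at_bot \<and> (F \<longlongrightarrow> 0) at_top"

definition grow :: "real \<Rightarrow> (real \<Rightarrow> real) \<Rightarrow> real \<Rightarrow> real" where
  "grow d U a = min (exp d * U a) 1"

text \<open>Capping a tail at \<open>1\<close> is the removal of the excess mass on the left.\<close>
definition up :: "real \<Rightarrow> (real \<Rightarrow> real) \<Rightarrow> real \<Rightarrow> real" where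
  "up d F = grow d (heat d F)"

definition lo :: "real \<Rightarrow> (real \<Rightarrow> real) \<Rightarrow> real \<Rightarrow> real" where
  "lo d F = heat d (grow d F)"

lemma borel_measurable_antimono:
  fixes F :: "real \<Rightarrow> real"
  assumes "antimono F" shows "F \<in> borel_measurable borel"
proof -
  have "mono (\<lambda>x. - F x)" using assms by (auto simp: antimono_def mono_def)
  from borel_measurable_mono[OF this] have "(\<lambda>x. - (- F x)) \<in> borel_measurable borel" by measurable
  then show ?thesis by simp
qed

section \<open>The heat operator on bounded functions and on tails\<close>

lemma heat_integrable:
  fixes F :: "real \<Rightarrow> real"
  assumes "F \<in> borel_measurable borel" "\<And>a. \<bar>F a\<bar> \<le> C"
  shows "integrable std_gauss (\<lambda>z. F (a - sqrt d * z))"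
proof (rule gauss.integrable_const_bound[where B=C])
  show "AE x in std_gauss. norm (F (a - sqrt d * x)) \<le> C" using assms(2) by simp
  show "(\<lambda>z. F (a - sqrt d * z)) \<in> borel_measurable std_gauss" using assms(1) by measurable
qed

lemma heat_mono:
  assumes "F \<in> borel_measurable borel" "\<And>a. \<bar>F a\<bar> \<le> C"
    and "G \<in> borel_measurable borel" "\<And>a. \<bar>G a\<bar> \<le> C'" and "\<And>a. F a \<le> G a"
  shows "heat d F a \<le> heat d G a"
  unfolding heat_def using assms
  by (intro integral_mono heat_integrable[where C=C] heat_integrable[where C=C']) auto

lemma heat_add_const:
  assumes "F \<in> borel_measurable borel" "\<And>a. \<bar>F a\<bar> \<le> C"
  shows "heat d (\<lambda>x. F x + c) a = heat d F a + c"
  unfolding heat_def using heat_integrable[OF assms] by simp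

lemma heat_const [simp]: "heat d (\<lambda>x. c) a = c"
  unfolding heat_def by simp

lemma heat_diff:
  assumes "F \<in> borel_measurable borel" "\<And>a. \<bar>F a\<bar> \<le> C"
    and "G \<in> borel_measurable borel" "\<And>a. \<bar>G a\<bar> \<le> C'"
  shows "heat d (\<lambda>x. F x - G x) a = heat d F a - heat d G a"
  unfolding heat_def using heat_integrable[OF assms(1,2)] heat_integrable[OF assms(3,4)] by simp

lemma heat_shift: "heat d (\<lambda>x. F (x + b)) a = heat d F (a + b)"
  unfolding heat_def by (simp add: algebra_simps)

lemma antimono_heat:
  fixes F :: "real \<Rightarrow> real"
  assumes "antimono F" "\<And>a. \<bar>F a\<bar> \<le> C"
  shows "antimono (heat d F)"
proof (rule antimonoI)
  fix x y :: real assume "x \<le> y"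
  then show "heat d F y \<le> heat d F x"
    unfolding heat_def
    by (intro integral_mono heat_integrable[where C=C] borel_measurable_antimono assms)
       (use assms(1) in \<open>auto simp: antimono_def\<close>)
qed

lemma heat_bounds:
  assumes "F \<in> borel_measurable borel" "\<And>a. 0 \<le> F a \<and> F a \<le> 1"
  shows "0 \<le> heat d F a \<and> heat d F a \<le> 1"
proof -
  have i: "integrable std_gauss (\<lambda>z. F (a - sqrt d * z))"
    using assms by (intro heat_integrable[where C=1]) auto
  have "heat d F a \<le> (\<integral>z. 1 \<partial>std_gauss)"
    unfolding heat_def by (intro integral_mono i) (use assms in auto)
  then show ?thesis unfolding heat_def using assms by simp
qed

lemma countable_AE_gauss:
  assumes "countable (A :: real set)" shows "AE z in std_gauss. z \<notin> A"
proof -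
  have "AE z in lborel. z \<notin> A"
    using assms by (intro AE_not_in countable_imp_null_set_lborel)
  then show ?thesis by (subst AE_density) (auto)
qed

lemma countable_discont_antimono:
  fixes F :: "real \<Rightarrow> real"
  assumes "antimono F" shows "countable {a. \<not> isCont F a}"
proof -
  have "mono (\<lambda>x. - F x)" using assms by (auto simp: antimono_def mono_def)
  from mono_ctble_discont[OF this] have "countable {a. \<not> isCont (\<lambda>x. - F x) a}" .
  moreover have "isCont F a" if "isCont (\<lambda>x. - F x) a" for a
    using continuous_minus[OF that] by simp
  then have "{a. \<not> isCont F a} \<subseteq> {a. \<not> isCont (\<lambda>x. - F x) a}" by blast
  ultimately show ?thesis by (rule countable_subset[rotated])
qed

text \<open>A monotone F has only countably many jumps, and the Gaussian law has no atoms: for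
  almost every z the point a - sqrt d * z is a continuity point of F, and dominated convergence
  applies.\<close>

lemma isCont_heat:
  assumes F: "antimono F" "\<And>a. \<bar>F a\<bar> \<le> C" and d: "0 < d"
  shows "isCont (heat d F) a"
proof (subst continuous_at_sequentially, intro allI impI)
  fix X assume X: "X \<longlonglongrightarrow> a"
  have [measurable]: "F \<in> borel_measurable borel" using F(1) by (rule borel_measurable_antimono)
  let ?D = "{a. \<not> isCont F a}"
  have eq: "{z. a - sqrt d * z \<in> ?D} = (\<lambda>y. (a - y) / sqrt d) ` ?D"
    using d by (force simp: image_iff field_simps)
  have "countable {z. a - sqrt d * z \<in> ?D}"
    unfolding eq by (intro countable_image countable_discont_antimono F)
  then have "AE z in std_gauss. isCont F (a - sqrt d * z)"
    using countable_AE_gauss by fastforce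
  then have *: "AE z in std_gauss. (\<lambda>n. F (X n - sqrt d * z)) \<longlonglongrightarrow> F (a - sqrt d * z)"
  proof (eventually_elim)
    case (elim z)
    have "(\<lambda>n. X n - sqrt d * z) \<longlonglongrightarrow> a - sqrt d * z" using X by (intro tendsto_intros)
    then show ?case using elim by (rule isCont_tendsto_compose[rotated])
  qed
  show "(heat d F \<circ> X) \<longlonglongrightarrow> heat d F a"
    unfolding heat_def comp_def
    by (rule integral_dominated_convergence[where w="\<lambda>_. C"]) (use * F in auto)
qed

lemma heat_tendsto_seq:
  assumes F: "antimono F" "\<And>a. \<bar>F a\<bar> \<le> C"
    and l: "\<And>b. (\<lambda>n. F (X n + b)) \<longlonglongrightarrow> c"
  shows "(\<lambda>n. heat d F (X n)) \<longlonglongrightarrow> c"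
proof -
  have [measurable]: "F \<in> borel_measurable borel" using F(1) by (rule borel_measurable_antimono)
  have "(\<lambda>n. heat d F (X n)) \<longlonglongrightarrow> (\<integral>z. c \<partial>std_gauss)"
    unfolding heat_def
  proof (rule integral_dominated_convergence[where w="\<lambda>_. C"])
    show "AE x in std_gauss. (\<lambda>i. F (X i - sqrt d * x)) \<longlonglongrightarrow> c"
      using l[of "- (sqrt d * _)"] by simp
  qed (use F in auto)
  then show ?thesis by simp
qed

lemma tailfn_heat:
  assumes F: "tailfn F" shows "tailfn (heat d F)"
proof -
  have a: "antimono F" "\<And>a. 0 \<le> F a \<and> F a \<le> 1" and b: "\<And>a. \<bar>F a\<bar> \<le> 1"
    and l: "(F \<longlongrightarrow> 1) at_bot" "(F \<longlongrightarrow> 0) at_top"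
    using F by (auto simp: tailfn_def)
  have bot: "(heat d F \<longlongrightarrow> 1) at_bot"
  proof (rule tendsto_at_botI_sequentially)
    fix X :: "nat \<Rightarrow> real" assume X: "filterlim X at_bot sequentially"
    have "filterlim (\<lambda>n. X n + b) at_bot sequentially" for b
      using X filterlim_tendsto_add_at_bot_iff[OF tendsto_const, of b X] by (simp add: add.commute)
    then have "(\<lambda>n. F (X n + b)) \<longlonglongrightarrow> 1" for b
      using filterlim_compose[OF l(1)] by blast
    then show "(\<lambda>n. heat d F (X n)) \<longlonglongrightarrow> 1" by (rule heat_tendsto_seq[OF a(1) b])
  qed
  have top: "(heat d F \<longlongrightarrow> 0) at_top"
  proof (rule tendsto_at_topI_sequentially)
    fix X :: "nat \<Rightarrow> real" assume X: "filterlim X at_top sequentially"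
    have "filterlim (\<lambda>n. X n + b) at_top sequentially" for b
      using filterlim_tendsto_add_at_top[OF tendsto_const X, of b] by (simp add: add.commute)
    then have "(\<lambda>n. F (X n + b)) \<longlonglongrightarrow> 0" for b
      using filterlim_compose[OF l(2)] by blast
    then show "(\<lambda>n. heat d F (X n)) \<longlonglongrightarrow> 0" by (rule heat_tendsto_seq[OF a(1) b])
  qed
  have "antimono (heat d F)" by (rule antimono_heat[OF a(1) b])
  moreover have "0 \<le> heat d F x \<and> heat d F x \<le> 1" for x
    using a by (intro heat_bounds borel_measurable_antimono) auto
  ultimately show ?thesis using bot top by (simp add: tailfn_def)
qed

lemma tailfn_grow:
  assumes F: "tailfn F" and d: "0 \<le> d" shows "tailfn (grow d F)"
proof -
  have a: "antimono F" "\<And>a. 0 \<le> F a \<and> F a \<le> 1"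
    and l: "(F \<longlongrightarrow> 1) at_bot" "(F \<longlongrightarrow> 0) at_top"
    using F by (auto simp: tailfn_def)
  have "((\<lambda>a. min (exp d * F a) 1) \<longlongrightarrow> min (exp d * 1) 1) at_bot"
       "((\<lambda>a. min (exp d * F a) 1) \<longlongrightarrow> min (exp d * 0) 1) at_top"
    by (intro tendsto_intros l)+
  moreover have "antimono (grow d F)"
    using a(1) by (auto simp: antimono_def grow_def min_le_iff_disj)
  ultimately show ?thesis
    using a d by (simp add: tailfn_def grow_def[abs_def])
qed

lemma tailfn_up: "tailfn F \<Longrightarrow> 0 \<le> d \<Longrightarrow> tailfn (up d F)"
  by (simp add: up_def tailfn_grow tailfn_heat)

lemma tailfn_lo: "tailfn F \<Longrightarrow> 0 \<le> d \<Longrightarrow> tailfn (lo d F)"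
  by (simp add: lo_def tailfn_grow tailfn_heat)

lemma tailfn_up_iter: "tailfn F \<Longrightarrow> 0 \<le> d \<Longrightarrow> tailfn ((up d ^^ n) F)"
  by (induction n) (auto intro: tailfn_up)

lemma tailfn_lo_iter: "tailfn F \<Longrightarrow> 0 \<le> d \<Longrightarrow> tailfn ((lo d ^^ n) F)"
  by (induction n) (auto intro: tailfn_lo)

lemma tailfnD:
  assumes "tailfn F"
  shows "antimono F" "0 \<le> F a" "F a \<le> 1" "\<bar>F a\<bar> \<le> 1" "F \<in> borel_measurable borel"
  using assms by (auto simp: tailfn_def intro: borel_measurable_antimono)

lemma tailfn_less:
  assumes F: "tailfn F" and c: "0 < c" shows "\<exists>b. F b < c"
proof -
  from F have "(F \<longlongrightarrow> 0) at_top" by (simp add: tailfn_def)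
  from order_tendstoD(2)[OF this c] show ?thesis
    unfolding eventually_at_top_linorder by blast
qed

lemma isCont_heat_tailfn: "tailfn F \<Longrightarrow> 0 < d \<Longrightarrow> isCont (heat d F) a"
  by (rule isCont_heat[where C=1]) (auto simp: tailfnD)

lemma isCont_grow: "isCont F a \<Longrightarrow> isCont (grow d F) a"
  unfolding grow_def by (intro continuous_intros)

lemma isCont_up: "tailfn F \<Longrightarrow> 0 < d \<Longrightarrow> isCont (up d F) a"
  unfolding up_def by (intro isCont_grow isCont_heat_tailfn)

lemma isCont_lo: "tailfn F \<Longrightarrow> 0 < d \<Longrightarrow> isCont (lo d F) a"
  unfolding lo_def by (intro isCont_heat_tailfn tailfn_grow) auto

lemma IVT_tailfn:
  assumes F: "tailfn F" "\<And>a. isCont F a" and c: "0 < c" "c < 1"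
  obtains x where "F x = c"
proof -
  from F have "(F \<longlongrightarrow> 0) at_top" "(F \<longlongrightarrow> 1) at_bot" by (auto simp: tailfn_def)
  from order_tendstoD(2)[OF this(1) c(1)] order_tendstoD(1)[OF this(2) c(2)]
  obtain a b where a: "\<And>x. a \<le> x \<Longrightarrow> F x < c" and b: "\<And>x. x \<le> b \<Longrightarrow> c < F x"
    unfolding eventually_at_top_linorder eventually_at_bot_linorder by blast
  have "\<exists>x. min a b \<le> x \<and> x \<le> max a b \<and> F x = c"
    by (rule IVT2) (use a[of "max a b"] b[of "min a b"] F(2) in auto)
  then show ?thesis using that by blast
qed

text \<open>Averaging keeps a uniform error, the factor exp d scales it, and the cap does not
  increase it. Errors made in single steps therefore grow at most geometrically; the case e = 0 is
  monotonicity of the flow.\<close>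

lemma up_mono_err:
  assumes "F \<in> borel_measurable borel" "\<And>a. \<bar>F a\<bar> \<le> C"
    and G: "G \<in> borel_measurable borel" "\<And>a. \<bar>G a\<bar> \<le> C'" and "\<And>a. F a \<le> G a + e" and e: "0 \<le> e"
  shows "up d F a \<le> up d G a + exp d * e"
proof -
  have "heat d F a \<le> heat d (\<lambda>x. G x + e) a"
    by (rule heat_mono[where C=C and C'="C'+e"]) (use assms in \<open>auto intro: order_trans[OF abs_triangle_ineq]\<close>)
  also have "\<dots> = heat d G a + e" by (rule heat_add_const[OF G])
  finally have "exp d * heat d F a \<le> exp d * heat d G a + exp d * e"
    by (simp flip: distrib_left)
  moreover have "0 \<le> exp d * e" using e by simp
  ultimately show ?thesis unfolding up_def grow_def by linarith
qed

lemma lo_mono_err: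
  assumes "antimono F" "\<And>a. \<bar>F a\<bar> \<le> C"
    and G: "antimono G" "\<And>a. \<bar>G a\<bar> \<le> C'" and FG: "\<And>a. F a \<le> G a + e" and e: "0 \<le> e"
  shows "lo d F a \<le> lo d G a + exp d * e"
proof -
  have m: "grow d F \<in> borel_measurable borel" "grow d G \<in> borel_measurable borel"
    using assms borel_measurable_antimono[OF assms(1)] borel_measurable_antimono[OF G(1)]
    unfolding grow_def[abs_def] by simp_all
  have b: "\<bar>grow d F a\<bar> \<le> exp d * C + 1" "\<bar>grow d G a\<bar> \<le> exp d * C' + 1" for a
  proof -
    have "exp d * \<bar>F a\<bar> \<le> exp d * C" "exp d * \<bar>G a\<bar> \<le> exp d * C'" by (simp_all add: assms)
    moreover have "\<bar>exp d * F a\<bar> = exp d * \<bar>F a\<bar>" "\<bar>exp d * G a\<bar> = exp d * \<bar>G a\<bar>"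
      by (simp_all add: abs_mult)
    ultimately show "\<bar>grow d F a\<bar> \<le> exp d * C + 1" "\<bar>grow d G a\<bar> \<le> exp d * C' + 1"
      unfolding grow_def by linarith+
  qed
  have le: "grow d F a \<le> grow d G a + exp d * e" for a
  proof -
    have "exp d * F a \<le> exp d * G a + exp d * e" using FG[of a] by (simp flip: distrib_left)
    moreover have "0 \<le> exp d * e" using e by simp
    ultimately show ?thesis unfolding grow_def by linarith
  qed
  have "heat d (grow d F) a \<le> heat d (\<lambda>x. grow d G x + exp d * e) a"
  proof (rule heat_mono[OF m(1) b(1)])
    show "\<bar>grow d G a + exp d * e\<bar> \<le> exp d * C' + 1 + exp d * e" for a
      using b(2)[of a] e by (intro order_trans[OF abs_triangle_ineq]) (simp add: abs_mult)
  qed (use m le in auto)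
  also have "\<dots> = heat d (grow d G) a + exp d * e" by (rule heat_add_const[OF m(2) b(2)])
  finally show ?thesis by (simp add: lo_def)
qed

text \<open>Both sides alternate the same two operations: the flows are conjugate by half a
  step.\<close>

lemma grow_lo_iter: "grow d ((lo d ^^ n) F) = (up d ^^ n) (grow d F)"
  by (induction n) (simp_all add: lo_def up_def)

lemma up_iter_mono:
  assumes "tailfn F" "tailfn G" "0 \<le> d" "\<And>a. F a \<le> G a"
  shows "(up d ^^ n) F a \<le> (up d ^^ n) G a"
proof (induction n arbitrary: a)
  case (Suc n)
  have "up d ((up d ^^ n) F) a \<le> up d ((up d ^^ n) G) a + exp d * 0"
    by (rule up_mono_err[where C=1 and C'=1]) (use Suc assms in \<open>auto simp: tailfnD tailfn_up_iter\<close>)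
  then show ?case by simp
qed (use assms in simp)

text \<open>Growing the initial tail once only raises it, and by conjugacy the upper flow from the
  grown tail is the lower flow grown once more. All n steps together thus cost a single growth, and
  the gap does not accumulate with n.\<close>

lemma up_iter_le_lo_iter:
  assumes F: "tailfn F" and d: "0 \<le> d"
  shows "(up d ^^ n) F a \<le> (lo d ^^ n) F a + d"
proof -
  have t: "tailfn ((lo d ^^ n) F)" by (rule tailfn_lo_iter[OF F d])
  have "F a \<le> grow d F a" for a
  proof -
    have "1 * F a \<le> exp d * F a" using d F by (intro mult_right_mono) (auto simp: tailfnD)
    then show ?thesis using tailfnD(3)[OF F, of a] by (simp add: grow_def)
  qed
  then have "(up d ^^ n) F a \<le> (up d ^^ n) (grow d F) a"
    using F d by (intro up_iter_mono tailfn_grow) auto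
  also have "\<dots> = grow d ((lo d ^^ n) F) a" by (simp add: grow_lo_iter)
  also have "\<dots> \<le> (lo d ^^ n) F a + d"
  proof -
    define u where "u = (lo d ^^ n) F a"
    have u: "0 \<le> u" "u \<le> 1" using t by (auto simp: u_def tailfnD)
    have e: "1 - exp (-d) \<le> d" using exp_ge_add_one_self[of "-d"] by simp
    \<comment> \<open>The gain of one growth is largest at u = exp (-d), where the cap sets
      in.\<close>
    have "min (exp d * u) 1 \<le> u + (1 - exp (-d))"
    proof (cases "u \<le> exp (-d)")
      case True
      have "(exp d - 1) * u \<le> (exp d - 1) * exp (-d)" using True d by (intro mult_left_mono) auto
      also have "\<dots> = 1 - exp (-d)" by (simp add: algebra_simps flip: exp_add)
      finally show ?thesis by (simp add: algebra_simps min_le_iff_disj)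
    qed auto
    then show ?thesis using e by (simp add: grow_def u_def)
  qed
  finally show ?thesis .
qed

section \<open>Stretching\<close>

lemma heat_eq_normal_density:
  assumes d: "0 < d" and [measurable]: "F \<in> borel_measurable borel"
  shows "heat d F a = (\<integral>y. F y * normal_density a (sqrt d) y \<partial>lborel)"
proof -
  have e: "normal_density a (sqrt d) (a - sqrt d * z) = std_normal_density z / sqrt d" for z
    using d by (simp add: normal_density_def power_mult_distrib real_sqrt_mult)
  have "(\<integral>y. F y * normal_density a (sqrt d) y \<partial>lborel)
      = \<bar>- sqrt d\<bar> *\<^sub>R (\<integral>z. F (a + - sqrt d * z) * normal_density a (sqrt d) (a + - sqrt d * z) \<partial>lborel)"
    using d by (intro lborel_integral_real_affine) simp
  also have "\<dots> = sqrt d * (\<integral>z. (F (a - sqrt d * z) * std_normal_density z) / sqrt d \<partial>lborel)"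
    using d by (simp add: e)
  also have "\<dots> = (\<integral>z. F (a - sqrt d * z) * std_normal_density z \<partial>lborel)"
    using d by simp
  also have "\<dots> = heat d F a"
    unfolding heat_def by (subst integral_density) (auto simp: mult.commute)
  finally show ?thesis by simp
qed

lemma integrable_mult_normal_density:
  fixes F :: "real \<Rightarrow> real"
  assumes [measurable]: "F \<in> borel_measurable borel" and F: "\<And>a. \<bar>F a\<bar> \<le> C" and d: "0 < d"
  shows "integrable lborel (\<lambda>y. F y * normal_density a (sqrt d) y)"
proof (rule Bochner_Integration.integrable_bound)
  show "integrable lborel (\<lambda>y. C * normal_density a (sqrt d) y)" using d by simp
  have C: "0 \<le> C" using F[of 0] by linarith
  show "AE x in lborel. norm (F x * normal_density a (sqrt d) x) \<le> norm (C * normal_density a (sqrt d) x)"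
    using C F by (auto simp: abs_mult intro!: mult_right_mono)
qed simp

text \<open>The Gaussian kernel is totally positive of order two: the ratio of the kernels seen from
  two points is monotone, so a single sign change stays a single sign change.\<close>
lemma heat_one_sign_change:
  assumes D: "D \<in> borel_measurable borel" "\<And>a. \<bar>D a\<bar> \<le> C" and d: "0 < d"
    and sgn: "\<And>x x'. x < x' \<Longrightarrow> 0 < D x \<Longrightarrow> 0 \<le> D x'"
    and xx: "x < x'" and pos: "0 < heat d D x"
  shows "0 \<le> heat d D x'"
proof -
  note [measurable] = D(1)
  let ?A = "{y. 0 < D y}"
  define n where "n = (\<lambda>x y. normal_density x (sqrt d) y)"
  have h: "heat d D x = (\<integral>y. D y * n x y \<partial>lborel)" for x
    unfolding n_def by (rule heat_eq_normal_density[OF d D(1)])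
  have i: "integrable lborel (\<lambda>y. D y * n x y)" for x
    unfolding n_def by (rule integrable_mult_normal_density[OF D d])
  have n0: "0 \<le> n x y" for x y by (simp add: n_def)
  have ne: "?A \<noteq> {}"
  proof
    assume "?A = {}"
    then have "D y \<le> 0" for y by (auto simp: not_less)
    then have "D y * n x y \<le> 0" for y using n0 by (rule mult_nonpos_nonneg)
    then have "(\<integral>y. D y * n x y \<partial>lborel) \<le> (\<integral>y. 0 \<partial>(lborel::real measure))"
      by (intro integral_mono[OF i]) auto
    then show False using pos by (simp add: h)
  qed
  show ?thesis
  proof (cases "bdd_below ?A")
    case False
    have "0 \<le> D y" for y
    proof -
      obtain z where "z \<in> ?A" "z < y" using False by (auto simp: bdd_below_def not_le)
      then show ?thesis using sgn by blast
    qed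
    then show ?thesis unfolding h using n0 by (intro Bochner_Integration.integral_nonneg mult_nonneg_nonneg)
  next
    case True
    define x0 where "x0 = Inf ?A"
    have right: "0 \<le> D y" if "x0 < y" for y
    proof -
      have "Inf ?A < y" using that by (simp add: x0_def)
      then obtain z where "z \<in> ?A" "z < y" using cInf_lessD[OF ne] by blast
      then show ?thesis using sgn by blast
    qed
    have left: "D y \<le> 0" if "y < x0" for y
      using cInf_lower[OF _ True, of y] that by (force simp: x0_def not_less)
    \<comment> \<open>Quotient of the Gaussian kernels seen from x' and from x; it increases in y
      because x < x'.\<close>
    define r where "r = (\<lambda>y. exp ((x' - x) * (2 * y - x - x') / (2 * d)))"
    have nr: "n x' y = r y * n x y" for y
    proof -
      have "- (y - x')\<^sup>2 / (2 * d) = (x' - x) * (2 * y - x - x') / (2 * d) + - (y - x)\<^sup>2 / (2 * d)"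
        using d by (simp add: field_simps power2_eq_square)
      then have "exp (- (y - x')\<^sup>2 / (2 * d)) = r y * exp (- (y - x)\<^sup>2 / (2 * d))"
        unfolding r_def by (metis exp_add)
      then show ?thesis using d by (simp add: n_def normal_density_def)
    qed
    have rm: "r y \<le> r y'" if "y \<le> y'" for y y'
    proof -
      have "(x' - x) * (2 * y - x - x') \<le> (x' - x) * (2 * y' - x - x')"
        using that xx by (intro mult_left_mono) auto
      then show ?thesis unfolding r_def using d by (simp add: divide_right_mono)
    qed
    \<comment> \<open>The factors D y and r y - r x0 change sign together at x0, so their product is
      nonnegative.\<close>
    have "r x0 * (D y * n x y) \<le> D y * n x' y" for y
    proof -
      have "r x0 * D y \<le> r y * D y"
      proof (cases y x0 rule: linorder_cases)
        case less
        show ?thesis by (rule mult_right_mono_neg) (use less left rm in auto)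
      next
        case greater
        show ?thesis by (rule mult_right_mono) (use greater right rm in auto)
      qed simp
      then have "(r x0 * D y) * n x y \<le> (r y * D y) * n x y" by (rule mult_right_mono) (rule n0)
      then show ?thesis by (simp add: nr mult_ac)
    qed
    then have "(\<integral>y. r x0 * (D y * n x y) \<partial>lborel) \<le> heat d D x'"
      unfolding h by (intro integral_mono i integrable_mult_right) auto
    moreover have "0 \<le> r x0 * heat d D x" using pos by (simp add: r_def)
    ultimately show ?thesis by (simp add: h)
  qed
qed

text \<open>\<open>U\<close> is the steeper profile: \<open>G\<close> crosses every translate of \<open>U\<close> at most once, from below.\<close>
definition stretch :: "(real \<Rightarrow> real) \<Rightarrow> (real \<Rightarrow> real) \<Rightarrow> bool" where
  "stretch G U \<longleftrightarrow> (\<forall>a x x'. x < x' \<longrightarrow> U (x - a) < G x \<longrightarrow> U (x' - a) \<le> G x')"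

text \<open>Translation by x - z aligns the two arguments. In this form the property compares
  profiles without mentioning translates.\<close>

lemma stretch_profile:
  assumes "stretch G U" "U z < G x" "0 \<le> w"
  shows "U (z + w) \<le> G (x + w)"
proof (cases "w = 0")
  case False
  then have "x < x + w" using assms by simp
  with assms(1,2) have "U (x + w - (x - z)) \<le> G (x + w)"
    unfolding stretch_def by (metis diff_diff_eq2 add_diff_cancel_left')
  then show ?thesis by (simp add: algebra_simps)
qed (use assms in simp)

lemma stretch_grow: "stretch G U \<Longrightarrow> stretch (grow d G) (grow d U)"
proof -
  assume s: "stretch G U"
  show ?thesis
    unfolding stretch_def
  proof (intro allI impI)
    fix a x x' :: real assume "x < x'" "grow d U (x - a) < grow d G x"
    then have "exp d * U (x - a) < exp d * G x" unfolding grow_def by linarith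
    then have "U (x - a) < G x" by simp
    with s \<open>x < x'\<close> have "U (x' - a) \<le> G x'" unfolding stretch_def by blast
    then have "exp d * U (x' - a) \<le> exp d * G x'" by simp
    then show "grow d U (x' - a) \<le> grow d G x'" unfolding grow_def by linarith
  qed
qed

text \<open>The difference of G and a translate of U changes sign at most once, from negative to
  positive, and diffusion commutes with differences and translations.\<close>

lemma stretch_heat:
  assumes G: "G \<in> borel_measurable borel" "\<And>a. \<bar>G a\<bar> \<le> C"
    and U: "U \<in> borel_measurable borel" "\<And>a. \<bar>U a\<bar> \<le> C'"
    and d: "0 < d" and s: "stretch G U"
  shows "stretch (heat d G) (heat d U)"
  unfolding stretch_def
proof (intro allI impI)
  fix a x x' :: real assume x: "x < x'" and lt: "heat d U (x - a) < heat d G x"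
  note [measurable] = G(1) U(1)
  let ?U = "\<lambda>x. U (x + - a)"
  have h: "heat d (\<lambda>x. G x - ?U x) y = heat d G y - heat d U (y - a)" for y
  proof -
    have "heat d (\<lambda>x. G x - ?U x) y = heat d G y - heat d ?U y"
      using U(2) by (intro heat_diff[OF G]) measurable
    then show ?thesis using heat_shift[of d U "-a" y] by simp
  qed
  have "0 \<le> heat d (\<lambda>x. G x - ?U x) x'"
  proof (rule heat_one_sign_change[where C="C + C'", OF _ _ d _ x])
    show "\<bar>G b - ?U b\<bar> \<le> C + C'" for b using G(2)[of b] U(2)[of "b + -a"] by linarith
    show "0 < heat d (\<lambda>x. G x - ?U x) x" unfolding h using lt by simp
    show "0 \<le> G y' - ?U y'" if "y < y'" "0 < G y - ?U y" for y y'
      using s that unfolding stretch_def by simp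
  qed measurable
  then show "heat d U (x' - a) \<le> heat d G x'" using h[of x'] by linarith
qed

lemma stretch_up_iter:
  assumes "tailfn G" "tailfn U" "0 < d" "stretch G U"
  shows "stretch ((up d ^^ n) G) ((up d ^^ n) U)"
proof (induction n)
  case (Suc n)
  have t: "tailfn ((up d ^^ n) G)" "tailfn ((up d ^^ n) U)" using assms by (auto intro: tailfn_up_iter)
  have "stretch (heat d ((up d ^^ n) G)) (heat d ((up d ^^ n) U))"
    by (rule stretch_heat[OF tailfnD(5,4)[OF t(1)] tailfnD(5,4)[OF t(2)] assms(3) Suc])
  from stretch_grow[OF this] show ?case by (simp add: up_def[of d "(up d ^^ n) G"] up_def[of d "(up d ^^ n) U"])
qed (use assms in simp)

definition heaviside :: "real \<Rightarrow> real" where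
  "heaviside x = (if x < 0 then 1 else 0)"

lemma tailfn_heaviside: "tailfn heaviside"
proof -
  have "eventually (\<lambda>x. heaviside x = 1) at_bot" "eventually (\<lambda>x. heaviside x = 0) at_top"
    unfolding heaviside_def eventually_at_bot_linorder eventually_at_top_linorder
    by (intro exI[of _ "-1"] exI[of _ 0]; simp)+
  then have "(heaviside \<longlongrightarrow> 1) at_bot" "(heaviside \<longlongrightarrow> 0) at_top"
    by (auto intro: tendsto_eventually)
  then show ?thesis by (auto simp: tailfn_def heaviside_def antimono_def)
qed

text \<open>A value of at most 1 can exceed a translate of the step only where the step has dropped
  to 0, and from there on the step stays 0. The step is therefore the extremal initial tail.\<close>

lemma stretch_heaviside:
  assumes "tailfn G" shows "stretch G heaviside"
proof -
  have "0 \<le> G x" "G x \<le> 1" for x using assms by (auto simp: tailfnD)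
  then show ?thesis unfolding stretch_def heaviside_def by (auto simp: not_less dest: leD)
qed

section \<open>Profiles seen from the front\<close>

text \<open>In the limiting particle system this is the position of the leftmost particle: all mass
  lies to its right.\<close>

definition front :: "(real \<Rightarrow> real) \<Rightarrow> real" where
  "front F = Sup {x. F x = 1}"

text \<open>The value 1 has to be attained for \<open>front\<close> to be a maximum. Diffusion alone
  need not achieve this; the cap after the growth does.\<close>

definition saturated :: "(real \<Rightarrow> real) \<Rightarrow> bool" where
  "saturated F \<longleftrightarrow> tailfn F \<and> (\<forall>a. isCont F a) \<and> (\<exists>b. F b = 1)"

lemma front_iff:
  assumes F: "saturated F" shows "F x = 1 \<longleftrightarrow> x \<le> front F"
proof -
  have t: "tailfn F" and c: "\<And>a. isCont F a" and b: "\<exists>b. F b = 1"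
    using F by (auto simp: saturated_def)
  obtain u where u: "F u < 1" using tailfn_less[OF t, of 1] by auto
  have le: "x \<le> u" if "F x = 1" for x
    using antimonoD[OF tailfnD(1)[OF t], of u x] u that by (cases "x \<le> u") auto
  have bdd: "bdd_above {x. F x = 1}" using le by (intro bdd_aboveI[of _ u]) auto
  have "closed {x. F x = 1}"
    using continuous_closed_preimage_constant[of UNIV F 1] c
    by (auto simp: continuous_on_eq_continuous_at)
  then have m: "F (front F) = 1"
    using closed_contains_Sup[OF _ bdd] b by (auto simp: front_def)
  show ?thesis
  proof
    assume "F x = 1" then show "x \<le> front F" using cSup_upper[OF _ bdd] by (auto simp: front_def)
  next
    assume "x \<le> front F"
    then have "F (front F) \<le> F x" using antimonoD[OF tailfnD(1)[OF t]] by blast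
    then show "F x = 1" using m tailfnD(3)[OF t, of x] by simp
  qed
qed

lemma front_less: "saturated F \<Longrightarrow> front F < x \<Longrightarrow> F x < 1"
  using front_iff[of F x] tailfnD(3)[of F x] by (auto simp: saturated_def)

lemma saturated_up:
  assumes F: "tailfn F" and d: "0 < d" shows "saturated (up d F)"
proof -
  have "tailfn (heat d F)" by (rule tailfn_heat[OF F])
  then have l: "(heat d F \<longlongrightarrow> 1) at_bot" by (simp add: tailfn_def)
  have "exp (-d) < 1" using d by simp
  from order_tendstoD(1)[OF l this] obtain b where "exp (-d) < heat d F b"
    unfolding eventually_at_bot_linorder by blast
  then have "exp d * exp (-d) \<le> exp d * heat d F b" by (intro mult_left_mono) auto
  then have "up d F b = 1" by (simp add: up_def grow_def flip: exp_add)
  then show ?thesis using F d by (auto simp: saturated_def intro: tailfn_up isCont_up)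
qed

text \<open>Stretching starts from a strict inequality, but at the fronts both profiles equal 1.
  Just to the right of its front U is below 1, an intermediate value of G provides the strict
  inequality, and continuity lets the point return to the front.\<close>

lemma stretch_front:
  assumes s: "stretch G U" and G: "saturated G" and U: "saturated U"
  shows "U (front U + w) \<le> G (front G + w)"
proof (cases "0 \<le> w")
  case True
  have *: "U (z + w) \<le> G (front G + w)" if z: "front U < z" for z
  proof -
    have "U z < 1" by (rule front_less[OF U z])
    then obtain q where q: "U z < q" "q < 1" using dense by blast
    have "0 \<le> U z" using U by (auto simp: saturated_def tailfnD)
    then obtain x where x: "G x = q"
      using IVT_tailfn[of G q] G q by (auto simp: saturated_def)
    then have "front G \<le> x" using front_iff[OF G, of x] q by auto
    then have "G (x + w) \<le> G (front G + w)"
      using antimonoD[OF tailfnD(1)] G by (simp add: saturated_def)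
    then show ?thesis using stretch_profile[OF s, of z x w] q x True by simp
  qed
  have "isCont (\<lambda>z. U (z + w)) (front U)"
    using U by (intro isCont_o2[where g=U and f="\<lambda>z. z + w"]) (simp_all add: saturated_def)
  then have "((\<lambda>z. U (z + w)) \<longlongrightarrow> U (front U + w)) (at_right (front U))"
    unfolding isCont_def by (simp add: filterlim_at_split)
  moreover have "\<forall>\<^sub>F z in at_right (front U). U (z + w) \<le> G (front G + w)"
    using eventually_at_right_less[of "front U"] by (rule eventually_mono) (rule *)
  ultimately show ?thesis
    by (rule tendsto_upperbound) simp
next
  case False
  then have "G (front G + w) = 1" using front_iff[OF G, of "front G + w"] by simp
  moreover have "U (front U + w) \<le> 1" using U tailfnD(3) by (simp add: saturated_def)
  ultimately show ?thesis by simp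
qed

lemma front_mono:
  assumes F: "saturated F" and G: "saturated G" and le: "\<And>x. F x \<le> G x"
  shows "front F \<le> front G"
proof -
  have "F (front F) = 1" using front_iff[OF F] by simp
  moreover have "G (front F) \<le> 1" using G tailfnD(3) by (simp add: saturated_def)
  ultimately have "G (front F) = 1" using le[of "front F"] by simp
  then show ?thesis using front_iff[OF G] by simp
qed

lemma front_shift:
  assumes "saturated F" shows "saturated (\<lambda>x. F (x + b))" "front (\<lambda>x. F (x + b)) = front F - b"
proof -
  have t: "tailfn F" using assms by (simp add: saturated_def)
  have sh: "filterlim (\<lambda>x. x + b) at_top at_top" "filterlim (\<lambda>x. x + b) at_bot at_bot"
    by real_asymp+
  have l: "(F \<longlongrightarrow> 1) at_bot" "(F \<longlongrightarrow> 0) at_top" using t by (auto simp: tailfn_def)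
  have "((\<lambda>x. F (x + b)) \<longlongrightarrow> 1) at_bot" "((\<lambda>x. F (x + b)) \<longlongrightarrow> 0) at_top"
    by (rule filterlim_compose[OF l(1) sh(2)], rule filterlim_compose[OF l(2) sh(1)])
  moreover have "antimono (\<lambda>x. F (x + b))"
    using antimonoD[OF tailfnD(1)[OF t]] by (intro antimonoI) simp
  ultimately have "tailfn (\<lambda>x. F (x + b))"
    by (simp add: tailfn_def tailfnD(2,3)[OF t])
  moreover have "isCont (\<lambda>x. F (x + b)) a" for a
    using assms by (intro isCont_o2[where g=F and f="\<lambda>x. x + b"]) (simp_all add: saturated_def)
  moreover obtain c where "F c = 1" using assms by (auto simp: saturated_def)
  then have "\<exists>c. F (c + b) = 1" by (intro exI[of _ "c - b"]) simp
  ultimately show s: "saturated (\<lambda>x. F (x + b))" by (simp add: saturated_def)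
  have "x \<le> front (\<lambda>x. F (x + b)) \<longleftrightarrow> x \<le> front F - b" for x
    using front_iff[OF s, of x] front_iff[OF assms, of "x + b"] by (auto simp: le_diff_eq)
  from this[of "front (\<lambda>x. F (x + b))"] this[of "front F - b"]
  show "front (\<lambda>x. F (x + b)) = front F - b" by linarith
qed

lemma up_shift: "up d (\<lambda>x. F (x + b)) a = up d F (a + b)"
  by (simp add: up_def grow_def heat_shift)

section \<open>Gaussian exponential moments\<close>

lemma nn_integral_exp_gauss: "(\<integral>\<^sup>+z. ennreal (exp (s * z)) \<partial>std_gauss) = ennreal (exp (s\<^sup>2 / 2))"
proof -
  have "(\<integral>\<^sup>+z. ennreal (exp (s * z)) \<partial>std_gauss)
      = (\<integral>\<^sup>+z. ennreal (std_normal_density z) * ennreal (exp (s * z)) \<partial>lborel)"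
    by (intro nn_integral_density) auto
  also have "\<dots> = (\<integral>\<^sup>+z. ennreal (exp (s\<^sup>2 / 2)) * ennreal (normal_density s 1 z) \<partial>lborel)"
  proof (intro nn_integral_cong)
    fix z :: real
    have "s * z + - z\<^sup>2 / 2 = s\<^sup>2 / 2 + - (z - s)\<^sup>2 / 2" by (simp add: power2_eq_square field_simps)
    then have "exp (s * z) * exp (- z\<^sup>2 / 2) = exp (s\<^sup>2 / 2) * exp (- (z - s)\<^sup>2 / 2)"
      by (simp flip: exp_add)
    then have "std_normal_density z * exp (s * z) = exp (s\<^sup>2 / 2) * normal_density s 1 z"
      by (simp add: normal_density_def mult_ac)
    then show "ennreal (std_normal_density z) * ennreal (exp (s * z)) = ennreal (exp (s\<^sup>2 / 2)) * ennreal (normal_density s 1 z)"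
      by (simp flip: ennreal_mult)
  qed
  also have "\<dots> = ennreal (exp (s\<^sup>2 / 2)) * (\<integral>\<^sup>+z. ennreal (normal_density s 1 z) \<partial>lborel)"
    by (intro nn_integral_cmult) auto
  also have "(\<integral>\<^sup>+z. ennreal (normal_density s 1 z) \<partial>lborel) = 1"
    by (subst nn_integral_eq_integral) auto
  finally show ?thesis by simp
qed

lemma integrable_exp_gauss: "integrable std_gauss (\<lambda>z. exp (s * z))"
  and integral_exp_gauss: "(\<integral>z. exp (s * z) \<partial>std_gauss) = exp (s\<^sup>2 / 2)"
proof -
  show i: "integrable std_gauss (\<lambda>z. exp (s * z))"
    by (rule integrableI_nonneg) (auto simp: nn_integral_exp_gauss)
  show "(\<integral>z. exp (s * z) \<partial>std_gauss) = exp (s\<^sup>2 / 2)"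
    using nn_integral_eq_integral[OF i] by (simp add: nn_integral_exp_gauss)
qed

text \<open>Exponentials are eigenfunctions of the heat semigroup, so an exponential bound is
  propagated with an explicit rate.\<close>

lemma heat_le_exp:
  assumes [measurable]: "F \<in> borel_measurable borel" and F: "\<And>a. \<bar>F a\<bar> \<le> C"
    and le: "\<And>a. F a \<le> c * exp (s * a)" and d: "0 \<le> d"
  shows "heat d F a \<le> c * exp (s * a + s\<^sup>2 * d / 2)"
proof -
  have e: "c * exp (s * (a - sqrt d * z)) = c * exp (s * a) * exp (- (s * sqrt d) * z)" for z
    by (simp add: algebra_simps flip: exp_add)
  have "heat d F a \<le> (\<integral>z. c * exp (s * (a - sqrt d * z)) \<partial>std_gauss)"
    unfolding heat_def
  proof (intro integral_mono heat_integrable[OF assms(1) F] le)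
    show "integrable std_gauss (\<lambda>z. c * exp (s * (a - sqrt d * z)))"
      unfolding e by (intro integrable_mult_right integrable_exp_gauss)
  qed
  also have "\<dots> = c * exp (s * a) * exp ((- (s * sqrt d))\<^sup>2 / 2)"
    unfolding e by (simp only: integral_mult_right_zero integral_exp_gauss)
  also have "\<dots> = c * exp (s * a + s\<^sup>2 * d / 2)"
    using d by (simp add: power_mult_distrib exp_add)
  finally show ?thesis .
qed

text \<open>The index is shifted by one because the step itself is discontinuous; after one
  application of \<open>up\<close> every profile is saturated.\<close>

definition prof :: "real \<Rightarrow> nat \<Rightarrow> real \<Rightarrow> real" where
  "prof d n = (up d ^^ Suc n) heaviside"

text \<open>Distribution function of the profile seen from its front. It vanishes on the negative
  half-line, so its Laplace transform is finite at every positive argument.\<close>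

definition prof_cdf :: "real \<Rightarrow> nat \<Rightarrow> real \<Rightarrow> real" where
  "prof_cdf d n w = 1 - prof d n (front (prof d n) + w)"

definition front_incr :: "real \<Rightarrow> nat \<Rightarrow> real" where
  "front_incr d n = front (prof d (Suc n)) - front (prof d n)"

lemma prof_Suc: "prof d (Suc n) = up d (prof d n)"
  by (simp add: prof_def)

context
  fixes d :: real
  assumes d: "0 < d"
begin

lemma tailfn_prof: "tailfn (prof d n)"
  unfolding prof_def using d by (intro tailfn_up_iter tailfn_heaviside) simp

lemma saturated_prof: "saturated (prof d n)"
proof (cases n)
  case 0
  then show ?thesis using saturated_up[OF tailfn_heaviside d] by (simp add: prof_def)
next
  case (Suc m)
  then show ?thesis using saturated_up[OF tailfn_prof[of m] d] by (simp add: prof_Suc)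
qed

text \<open>The profile with index Suc n results from the same number of steps started from
  \<open>up d heaviside\<close>, which like every tail is stretched relative to the step.\<close>

lemma stretch_prof: "stretch (prof d (Suc n)) (prof d n)"
proof -
  have "stretch ((up d ^^ Suc n) (up d heaviside)) ((up d ^^ Suc n) heaviside)"
    using d by (intro stretch_up_iter tailfn_up tailfn_heaviside stretch_heaviside) auto
  then show ?thesis unfolding prof_def by (simp add: funpow_swap1)
qed

lemma prof_cdf_bounds: "0 \<le> prof_cdf d n w" "prof_cdf d n w \<le> 1" "\<bar>prof_cdf d n w\<bar> \<le> 1"
  using tailfnD(2,3)[OF tailfn_prof, of n] by (auto simp: prof_cdf_def abs_le_iff add_increasing2)

lemma prof_cdf_nonpos: "w \<le> 0 \<Longrightarrow> prof_cdf d n w = 0"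
  using front_iff[OF saturated_prof, of n "front (prof d n) + w"] by (simp add: prof_cdf_def)

lemma mono_prof_cdf: "mono (prof_cdf d n)"
  using antimonoD[OF tailfnD(1)[OF tailfn_prof]] by (auto simp: mono_def prof_cdf_def)

lemma measurable_prof_cdf [measurable]: "prof_cdf d n \<in> borel_measurable borel"
  by (rule borel_measurable_mono[OF mono_prof_cdf])

lemma prof_cdf_Suc_le: "prof_cdf d (Suc n) w \<le> prof_cdf d n w"
  using stretch_front[OF stretch_prof saturated_prof saturated_prof] by (simp add: prof_cdf_def)

lemma heat_prof_cdf: "heat d (prof_cdf d n) w = 1 - heat d (prof d n) (front (prof d n) + w)"
proof -
  have "heat d (\<lambda>w. 1 - prof d n (w + front (prof d n))) w
      = heat d (\<lambda>w. 1) w - heat d (\<lambda>w. prof d n (w + front (prof d n))) w"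
    using tailfnD(5)[OF tailfn_prof[of n]] tailfnD(4)[OF tailfn_prof[of n]]
    by (intro heat_diff[where C=1 and C'=1]) auto
  then show ?thesis
    by (simp add: heat_shift prof_cdf_def[abs_def] add.commute)
qed

text \<open>Growth turns the total mass 1 into exp d. The subtracted minimum is the mass cut off on
  the left, which saturates at the excess exp d - 1. The shift of the argument is the advance of the
  front.\<close>

lemma prof_cdf_rec:
  "prof_cdf d (Suc n) (w - front_incr d n)
    = exp d * heat d (prof_cdf d n) w - min (exp d * heat d (prof_cdf d n) w) (exp d - 1)"
proof -
  have "prof_cdf d (Suc n) (w - front_incr d n) = 1 - prof d (Suc n) (front (prof d n) + w)"
    by (simp add: prof_cdf_def front_incr_def algebra_simps)
  also have "\<dots> = 1 - min (exp d * (1 - heat d (prof_cdf d n) w)) 1"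
    by (simp add: prof_Suc up_def grow_def heat_prof_cdf)
  also have "\<dots> = exp d * heat d (prof_cdf d n) w - min (exp d * heat d (prof_cdf d n) w) (exp d - 1)"
    unfolding right_diff_distrib min_def by auto
  finally show ?thesis .
qed

lemma heat_prof_cdf_ge:
  assumes "front_incr d n < w" shows "exp d - 1 \<le> exp d * heat d (prof_cdf d n) w"
proof -
  have "prof d (Suc n) (front (prof d n) + w) < 1"
    using assms by (intro front_less saturated_prof) (simp add: front_incr_def)
  then show ?thesis
    by (simp add: prof_Suc up_def grow_def heat_prof_cdf algebra_simps)
qed

text \<open>Seen from the front the profiles rise with n, and the flow is monotone: started from a
  common front position, the later profile advances at least as far.\<close>

lemma front_incr_mono: "front_incr d n \<le> front_incr d (Suc n)"
proof -
  define W where "W = (\<lambda>n w. prof d n (w + front (prof d n)))"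
  have s: "saturated (W n)" for n unfolding W_def by (rule front_shift[OF saturated_prof])
  have t: "tailfn (W n)" for n using s by (simp add: saturated_def)
  have le: "W n w \<le> W (Suc n) w" for w n
    using prof_cdf_Suc_le[of n w] by (simp add: W_def prof_cdf_def add.commute)
  have f: "front (up d (W n)) = front_incr d n" for n
  proof -
    have "up d (W n) = (\<lambda>w. prof d (Suc n) (w + front (prof d n)))"
      by (simp add: W_def fun_eq_iff up_shift prof_Suc)
    then show ?thesis using front_shift(2)[OF saturated_prof] by (simp add: front_incr_def)
  qed
  have "(up d ^^ 1) (W n) w \<le> (up d ^^ 1) (W (Suc n)) w" for w
    using d by (intro up_iter_mono t le) simp
  then have "front (up d (W n)) \<le> front (up d (W (Suc n)))"
    by (intro front_mono saturated_up t d) simp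
  then show ?thesis by (simp add: f)
qed

text \<open>The exponent sqrt 2 minimises the speed s / 2 + 1 / s of an exponential supersolution.
  With it each step contributes d from growth and d from diffusion, whence the factor 2.\<close>

lemma up_iter_heaviside_le: "(up d ^^ n) heaviside x \<le> exp (2 * real n * d) * exp (- sqrt 2 * x)"
proof (induction n arbitrary: x)
  case 0
  have "1 \<le> exp (- sqrt 2 * x)" if "x < 0"
    using that by (simp add: mult_nonneg_nonpos)
  then show ?case by (auto simp: heaviside_def)
next
  case (Suc n)
  have t: "tailfn ((up d ^^ n) heaviside)" using d by (intro tailfn_up_iter tailfn_heaviside) simp
  have "(up d ^^ Suc n) heaviside x \<le> exp d * heat d ((up d ^^ n) heaviside) x"
    by (simp add: up_def grow_def)
  also have "\<dots> \<le> exp d * (exp (2 * real n * d) * exp (- sqrt 2 * x + (- sqrt 2)\<^sup>2 * d / 2))"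
    by (intro mult_left_mono heat_le_exp[OF tailfnD(5,4)[OF t] Suc]) (use d in auto)
  also have "\<dots> = exp (2 * real (Suc n) * d) * exp (- sqrt 2 * x)"
    by (simp add: algebra_simps flip: exp_add)
  finally show ?case .
qed

lemma front_prof_le: "front (prof d n) \<le> sqrt 2 * (Suc n * d)"
proof -
  have "1 = prof d n (front (prof d n))" using front_iff[OF saturated_prof] by simp
  also have "\<dots> \<le> exp (2 * real (Suc n) * d + - sqrt 2 * front (prof d n))"
    unfolding prof_def exp_add by (rule up_iter_heaviside_le)
  finally have "sqrt 2 * front (prof d n) \<le> 2 * (Suc n * d)" by (simp add: algebra_simps)
  also have "2 * (Suc n * d) = sqrt 2 * (sqrt 2 * (Suc n * d))" by (simp flip: mult.assoc)
  finally show ?thesis by (rule mult_left_le_imp_le) simp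
qed

text \<open>The increments never decrease, so a single one above sqrt 2 * d would force a linear
  advance faster than \<open>front_prof_le\<close> allows.\<close>

lemma front_incr_le: "front_incr d n \<le> sqrt 2 * d"
proof (rule ccontr)
  assume "\<not> ?thesis"
  then have e: "0 < front_incr d n - sqrt 2 * d" by simp
  have m: "front_incr d n \<le> front_incr d (n + k)" for k
    by (induction k) (auto intro: order_trans front_incr_mono)
  have "front (prof d n) + k * front_incr d n \<le> front (prof d (n + k))" for k
  proof (induction k)
    case (Suc k)
    then show ?case using m[of k] by (simp add: front_incr_def algebra_simps)
  qed simp
  then have "front (prof d n) + k * front_incr d n \<le> sqrt 2 * (Suc (n + k) * d)" for k
    using front_prof_le order_trans by blast
  then have k: "k * (front_incr d n - sqrt 2 * d) \<le> sqrt 2 * (Suc n * d) - front (prof d n)" for k :: nat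
    by (simp add: algebra_simps)
  obtain k :: nat where "sqrt 2 * (Suc n * d) - front (prof d n) < k * (front_incr d n - sqrt 2 * d)"
    using reals_Archimedean3[OF e] by blast
  then show False using k[of k] by simp
qed

end

section \<open>Laplace transforms and the selected wave\<close>

text \<open>Two-sided, since diffusion carries mass to the negative half-line, and with values in
  \<open>ennreal\<close>, so that integrals can be interchanged freely.\<close>

definition lap :: "real \<Rightarrow> (real \<Rightarrow> real) \<Rightarrow> ennreal" where
  "lap r D = (\<integral>\<^sup>+x. ennreal (exp (- r * x) * D x) \<partial>lborel)"

lemma lap_mono: "(\<And>x. D x \<le> E x) \<Longrightarrow> lap r D \<le> lap r E"
  unfolding lap_def by (intro nn_integral_mono ennreal_leI mult_left_mono) auto

lemma lap_shift:
  assumes [measurable]: "D \<in> borel_measurable borel"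
  shows "lap r (\<lambda>x. D (x - c)) = ennreal (exp (- r * c)) * lap r D"
proof -
  have "lap r (\<lambda>x. D (x - c)) = (\<integral>\<^sup>+x. ennreal (exp (- r * (c + 1 * x)) * D (c + 1 * x - c)) \<partial>lborel)"
    unfolding lap_def by (subst nn_integral_real_affine[where c=1 and t=c]) simp_all
  also have "\<dots> = (\<integral>\<^sup>+x. ennreal (exp (- r * c)) * ennreal (exp (- r * x) * D x) \<partial>lborel)"
    by (intro nn_integral_cong) (simp add: algebra_simps flip: exp_add ennreal_mult')
  also have "\<dots> = ennreal (exp (- r * c)) * lap r D"
    unfolding lap_def by (intro nn_integral_cmult) simp
  finally show ?thesis .
qed

lemma lap_heat:
  assumes [measurable]: "D \<in> borel_measurable borel" and D: "\<And>x. 0 \<le> D x" "\<And>x. \<bar>D x\<bar> \<le> C" and d: "0 \<le> d"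
  shows "lap r (heat d D) = ennreal (exp (r\<^sup>2 * d / 2)) * lap r D"
proof -
  interpret pair_sigma_finite lborel std_gauss
    by (intro pair_sigma_finite.intro sigma_finite_lborel gauss.sigma_finite_measure_axioms)
  have h: "ennreal (heat d D x) = (\<integral>\<^sup>+z. ennreal (D (x - sqrt d * z)) \<partial>std_gauss)" for x
    unfolding heat_def using D by (intro nn_integral_eq_integral[symmetric] heat_integrable[where C=C]) auto
  have "lap r (heat d D) = (\<integral>\<^sup>+x. \<integral>\<^sup>+z. ennreal (exp (- r * x) * D (x - sqrt d * z)) \<partial>std_gauss \<partial>lborel)"
    unfolding lap_def by (simp add: ennreal_mult' h nn_integral_cmult)
  also have "\<dots> = (\<integral>\<^sup>+z. \<integral>\<^sup>+x. ennreal (exp (- r * x) * D (x - sqrt d * z)) \<partial>lborel \<partial>std_gauss)"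
    by (rule Fubini'[symmetric]) measurable
  also have "\<dots> = (\<integral>\<^sup>+z. lap r (\<lambda>x. D (x - sqrt d * z)) \<partial>std_gauss)"
    by (simp add: lap_def)
  also have "\<dots> = (\<integral>\<^sup>+z. ennreal (exp ((- r * sqrt d) * z)) * lap r D \<partial>std_gauss)"
    by (simp add: lap_shift mult.assoc)
  also have "\<dots> = ennreal (exp (r\<^sup>2 * d / 2)) * lap r D"
    using d by (subst nn_integral_multc) (simp_all only: nn_integral_exp_gauss, simp_all add: power_mult_distrib)
  finally show ?thesis .
qed

lemma nn_integral_exp_Ioi:
  assumes "0 < r" shows "(\<integral>\<^sup>+x. ennreal (exp (- r * x)) * indicator {c<..} x \<partial>lborel) = ennreal (exp (- r * c) / r)"
proof -
  have "(\<integral>\<^sup>+x. ennreal (exp (- r * x)) * indicator {c<..} x \<partial>lborel)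
      = (\<integral>\<^sup>+x. ennreal (exp (- r * x)) * indicator {c..} x \<partial>lborel)"
    by (intro nn_integral_cong_AE) (use AE_lborel_singleton[of c] in \<open>auto elim!: eventually_mono split: split_indicator\<close>)
  also have "\<dots> = ennreal (0 - (- exp (- r * c) / r))"
  proof (rule nn_integral_FTC_atLeast)
    show "((\<lambda>x. - exp (- r * x) / r) \<longlongrightarrow> 0) at_top" using assms by real_asymp
    show "((\<lambda>x. - exp (- r * x) / r) has_real_derivative exp (- r * x)) (at x)" for x
      using assms by (auto intro!: derivative_eq_intros)
  qed auto
  finally show ?thesis by simp
qed

lemma nn_integral_exp_Iio:
  assumes "0 < r" shows "(\<integral>\<^sup>+x. ennreal (exp (r * x)) * indicator {..<c} x \<partial>lborel) = ennreal (exp (r * c) / r)"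
proof -
  have "(\<integral>\<^sup>+x. ennreal (exp (r * x)) * indicator {..<c} x \<partial>lborel)
      = (\<integral>\<^sup>+x. ennreal (exp (r * (0 + - 1 * x))) * indicator {..<c} (0 + - 1 * x) \<partial>lborel)"
    by (subst nn_integral_real_affine[where c="-1" and t=0]) simp_all
  also have "\<dots> = (\<integral>\<^sup>+x. ennreal (exp (- r * x)) * indicator {- c<..} x \<partial>lborel)"
    by (intro nn_integral_cong) (auto split: split_indicator)
  finally show ?thesis using nn_integral_exp_Ioi[OF assms, of "-c"] by simp
qed

lemma lap_Ioi: "0 < r \<Longrightarrow> lap r (\<lambda>x. b * indicator {c<..} x) = ennreal b * ennreal (exp (- r * c) / r)" if "0 \<le> b"
proof -
  assume "0 < r"
  have "lap r (\<lambda>x. b * indicator {c<..} x) = (\<integral>\<^sup>+x. ennreal b * (ennreal (exp (- r * x)) * indicator {c<..} x) \<partial>lborel)"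
    unfolding lap_def using that
    by (intro nn_integral_cong) (auto split: split_indicator simp: ennreal_mult' mult.commute)
  then show ?thesis using nn_integral_exp_Ioi[OF \<open>0 < r\<close>] by (simp add: nn_integral_cmult)
qed

context
  fixes d :: real
  assumes d: "0 < d"
begin

lemma lap_prof_cdf_le:
  assumes r: "0 < r" shows "lap r (prof_cdf d n) \<le> ennreal (1 / r)"
proof -
  have "lap r (prof_cdf d n) \<le> lap r (\<lambda>x. 1 * indicator {0<..} x)"
    by (intro lap_mono) (use prof_cdf_bounds[OF d] prof_cdf_nonpos[OF d] in \<open>auto split: split_indicator simp: not_less\<close>)
  also have "\<dots> = ennreal (1 / r)" using r by (subst lap_Ioi) auto
  finally show ?thesis .
qed

definition cut_mass :: "real \<Rightarrow> nat \<Rightarrow> ennreal" where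
  "cut_mass r n = lap r (\<lambda>x. min (exp d * heat d (prof_cdf d n) x) (exp d - 1))"

lemma measurable_heat_prof_cdf: "heat d (prof_cdf d n) \<in> borel_measurable borel"
proof -
  have "heat d (prof_cdf d n) = (\<lambda>w. 1 - heat d (prof d n) (front (prof d n) + w))"
    using heat_prof_cdf[OF d] by blast
  moreover have "(\<lambda>w. 1 - heat d (prof d n) (front (prof d n) + w)) \<in> borel_measurable borel"
    using tailfnD(5)[OF tailfn_heat[OF tailfn_prof[OF d]]] by measurable
  ultimately show ?thesis by simp
qed

text \<open>The mass balance is stated as a sum because subtraction in \<open>ennreal\<close>
  truncates; it is solved for the cut part once finiteness has been established.\<close>

lemma lap_prof_cdf_rec:
  "ennreal (exp (- r * front_incr d n)) * lap r (prof_cdf d (Suc n)) + cut_mass r n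
    = ennreal (exp (d + r\<^sup>2 * d / 2)) * lap r (prof_cdf d n)"
proof -
  note [measurable] = measurable_heat_prof_cdf measurable_prof_cdf[OF d]
  have h0: "0 \<le> heat d (prof_cdf d n) x" for x
    using heat_bounds[of "prof_cdf d n"] prof_cdf_bounds[OF d] by simp
  have "lap r (\<lambda>x. prof_cdf d (Suc n) (x - front_incr d n)) + cut_mass r n
      = (\<integral>\<^sup>+x. ennreal (exp (- r * x) * prof_cdf d (Suc n) (x - front_incr d n))
          + ennreal (exp (- r * x) * min (exp d * heat d (prof_cdf d n) x) (exp d - 1)) \<partial>lborel)"
    unfolding lap_def cut_mass_def by (subst nn_integral_add) auto
  also have "\<dots> = (\<integral>\<^sup>+x. ennreal (exp d) * ennreal (exp (- r * x) * heat d (prof_cdf d n) x) \<partial>lborel)"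
  proof (intro nn_integral_cong)
    fix x
    have "ennreal (exp (- r * x) * prof_cdf d (Suc n) (x - front_incr d n))
        + ennreal (exp (- r * x) * min (exp d * heat d (prof_cdf d n) x) (exp d - 1))
      = ennreal (exp (- r * x) * prof_cdf d (Suc n) (x - front_incr d n)
         + exp (- r * x) * min (exp d * heat d (prof_cdf d n) x) (exp d - 1))"
      using h0[of x] d prof_cdf_bounds[OF d] by (intro ennreal_plus[symmetric]) auto
    also have "\<dots> = ennreal (exp d * (exp (- r * x) * heat d (prof_cdf d n) x))"
      unfolding prof_cdf_rec[OF d] by (simp add: algebra_simps)
    finally show "ennreal (exp (- r * x) * prof_cdf d (Suc n) (x - front_incr d n))
        + ennreal (exp (- r * x) * min (exp d * heat d (prof_cdf d n) x) (exp d - 1))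
      = ennreal (exp d) * ennreal (exp (- r * x) * heat d (prof_cdf d n) x)"
      by (simp add: ennreal_mult')
  qed
  also have "\<dots> = ennreal (exp d) * lap r (heat d (prof_cdf d n))"
    unfolding lap_def by (intro nn_integral_cmult) simp
  also have "\<dots> = ennreal (exp d) * (ennreal (exp (r\<^sup>2 * d / 2)) * lap r (prof_cdf d n))"
    using prof_cdf_bounds[OF d] d by (subst lap_heat[where C=1]) auto
  finally show ?thesis
    by (simp add: lap_shift exp_add ennreal_mult' mult.assoc)
qed

text \<open>To the right of the new front the cut is complete, that is, equal to exp d - 1.\<close>

lemma cut_mass_ge:
  assumes r: "0 < r" shows "ennreal ((exp d - 1) * (exp (- r * front_incr d n) / r)) \<le> cut_mass r n"
proof -
  have h0: "0 \<le> heat d (prof_cdf d n) x" for x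
    using heat_bounds[of "prof_cdf d n"] prof_cdf_bounds[OF d] measurable_prof_cdf[OF d] by simp
  have "ennreal ((exp d - 1) * (exp (- r * front_incr d n) / r)) = ennreal (exp d - 1) * ennreal (exp (- r * front_incr d n) / r)"
    using d by (intro ennreal_mult') simp
  also have "\<dots> = lap r (\<lambda>x. (exp d - 1) * indicator {front_incr d n<..} x)"
    using d r by (subst lap_Ioi) auto
  also have "\<dots> \<le> cut_mass r n"
    unfolding cut_mass_def
    by (intro lap_mono) (use heat_prof_cdf_ge[OF d] h0 d in \<open>auto split: split_indicator\<close>)
  finally show ?thesis .
qed

text \<open>To the right of -h the cut is at most exp d - 1. To the left only mass that diffused
  over a distance of more than h is present, and an exponential of the steeper rate s bounds it. The
  parameters s and h stay free until d tends to 0.\<close>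

lemma cut_mass_le:
  assumes r: "0 < r" and s: "r < s" and h: "0 \<le> h"
  shows "cut_mass r n \<le> ennreal ((exp d - 1) * (exp (r * h) / r) + exp (d + s\<^sup>2 * d / 2) * (exp (- (s - r) * h) / (s - r)))"
proof -
  note [measurable] = measurable_heat_prof_cdf measurable_prof_cdf[OF d]
  have le: "heat d (prof_cdf d n) x \<le> 1 * exp (s * x + s\<^sup>2 * d / 2)" for x
  proof (rule heat_le_exp)
    show "prof_cdf d n a \<le> 1 * exp (s * a)" for a
    proof (cases "a \<le> 0")
      case False
      then have "1 \<le> exp (s * a)" using r s by simp
      then show ?thesis using prof_cdf_bounds(2)[OF d, of n a] by linarith
    qed (simp add: prof_cdf_nonpos[OF d])
  qed (use d prof_cdf_bounds[OF d] in auto)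
  have "cut_mass r n \<le> (\<integral>\<^sup>+x. ennreal (exp (- r * x) * ((exp d - 1) * indicator {-h<..} x))
      + ennreal (exp (d + s\<^sup>2 * d / 2)) * (ennreal (exp ((s - r) * x)) * indicator {..<-h} x) \<partial>lborel)"
    unfolding cut_mass_def lap_def
  proof (intro nn_integral_mono_AE)
    have "ennreal (exp (- r * x) * min (exp d * heat d (prof_cdf d n) x) (exp d - 1))
       \<le> ennreal (exp (- r * x) * ((exp d - 1) * indicator {-h<..} x))
        + ennreal (exp (d + s\<^sup>2 * d / 2)) * (ennreal (exp ((s - r) * x)) * indicator {..<-h} x)" if "x \<noteq> -h" for x
    proof (cases "x < -h")
      case True
      have "exp (- r * x) * min (exp d * heat d (prof_cdf d n) x) (exp d - 1)
          \<le> exp (- r * x) * (exp d * exp (s * x + s\<^sup>2 * d / 2))"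
        using le[of x] by (intro mult_left_mono) (auto simp: min_le_iff_disj)
      also have "\<dots> = exp (d + s\<^sup>2 * d / 2) * exp ((s - r) * x)"
        by (simp add: algebra_simps flip: exp_add)
      finally have "ennreal (exp (- r * x) * min (exp d * heat d (prof_cdf d n) x) (exp d - 1))
          \<le> ennreal (exp (d + s\<^sup>2 * d / 2) * exp ((s - r) * x))" by (rule ennreal_leI)
      also have "\<dots> = ennreal (exp (d + s\<^sup>2 * d / 2)) * ennreal (exp ((s - r) * x))"
        by (rule ennreal_mult') simp
      finally show ?thesis using True by simp
    next
      case False
      then show ?thesis using that by (auto intro!: ennreal_leI mult_left_mono)
    qed
    then show "AE x in lborel. ennreal (exp (- r * x) * min (exp d * heat d (prof_cdf d n) x) (exp d - 1))
       \<le> ennreal (exp (- r * x) * ((exp d - 1) * indicator {-h<..} x))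
        + ennreal (exp (d + s\<^sup>2 * d / 2)) * (ennreal (exp ((s - r) * x)) * indicator {..<-h} x)"
      using AE_lborel_singleton[of "-h"] by (auto elim!: eventually_mono)
  qed
  also have "\<dots> = lap r (\<lambda>x. (exp d - 1) * indicator {-h<..} x)
      + ennreal (exp (d + s\<^sup>2 * d / 2)) * (\<integral>\<^sup>+x. ennreal (exp ((s - r) * x)) * indicator {..<-h} x \<partial>lborel)"
    unfolding lap_def by (subst nn_integral_add) (auto simp: nn_integral_cmult)
  also have "\<dots> = ennreal (exp d - 1) * ennreal (exp (- r * - h) / r) + ennreal (exp (d + s\<^sup>2 * d / 2)) * ennreal (exp ((s - r) * - h) / (s - r))"
    using d r s by (subst lap_Ioi) (simp_all add: nn_integral_exp_Iio)
  also have "ennreal (exp d - 1) * ennreal (exp (- r * - h) / r) = ennreal ((exp d - 1) * (exp (r * h) / r))"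
    using d r by (subst ennreal_mult'[symmetric]) auto
  also have "ennreal (exp (d + s\<^sup>2 * d / 2)) * ennreal (exp ((s - r) * - h) / (s - r))
      = ennreal (exp (d + s\<^sup>2 * d / 2) * (exp (- (s - r) * h) / (s - r)))"
    by (subst ennreal_mult'[symmetric]) (simp_all add: left_diff_distrib)
  also have "ennreal ((exp d - 1) * (exp (r * h) / r)) + \<dots>
      = ennreal ((exp d - 1) * (exp (r * h) / r) + exp (d + s\<^sup>2 * d / 2) * (exp (- (s - r) * h) / (s - r)))"
    using d r s by (intro ennreal_plus[symmetric] mult_nonneg_nonneg divide_nonneg_pos) auto
  finally show ?thesis .
qed

text \<open>Advance per time step, not per unit of time: the velocity is the quotient by d.\<close>

definition speed :: real where "speed = lim (front_incr d)"

definition wave_cdf :: "real \<Rightarrow> real" where "wave_cdf w = lim (\<lambda>n. prof_cdf d n w)"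

lemma front_incr_tendsto: "front_incr d \<longlonglongrightarrow> speed" and speed_le: "speed \<le> sqrt 2 * d"
proof -
  have "incseq (front_incr d)" using front_incr_mono[OF d] by (rule incseq_SucI)
  moreover have "\<forall>n. front_incr d n \<le> sqrt 2 * d" using front_incr_le[OF d] by simp
  ultimately obtain L where L: "front_incr d \<longlonglongrightarrow> L" by (rule incseq_convergent)
  then show c: "front_incr d \<longlonglongrightarrow> speed" by (simp add: speed_def limI)
  show "speed \<le> sqrt 2 * d" by (rule LIMSEQ_le_const2[OF c]) (use front_incr_le[OF d] in auto)
qed

lemma wave_cdf_tendsto: "(\<lambda>n. prof_cdf d n w) \<longlonglongrightarrow> wave_cdf w"
proof -
  have "decseq (\<lambda>n. prof_cdf d n w)" using prof_cdf_Suc_le[OF d] by (rule decseq_SucI)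
  moreover have "\<forall>n. 0 \<le> prof_cdf d n w" using prof_cdf_bounds(1)[OF d] by simp
  ultimately obtain L where "(\<lambda>n. prof_cdf d n w) \<longlonglongrightarrow> L" by (rule decseq_convergent)
  then show ?thesis by (simp add: wave_cdf_def limI)
qed

lemma wave_cdf_bounds: "0 \<le> wave_cdf w" "wave_cdf w \<le> 1"
  by (rule LIMSEQ_le_const[OF wave_cdf_tendsto], use prof_cdf_bounds[OF d] in auto)
     (rule LIMSEQ_le_const2[OF wave_cdf_tendsto], use prof_cdf_bounds[OF d] in auto)

lemma mono_wave_cdf: "mono wave_cdf"
proof (rule monoI)
  fix x y :: real assume "x \<le> y"
  then have "prof_cdf d n x \<le> prof_cdf d n y" for n by (rule monoD[OF mono_prof_cdf[OF d]])
  then show "wave_cdf x \<le> wave_cdf y" by (intro LIMSEQ_le[OF wave_cdf_tendsto wave_cdf_tendsto]) auto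
qed

lemma wave_cdf_nonpos: "w \<le> 0 \<Longrightarrow> wave_cdf w = 0"
  using LIMSEQ_unique[OF wave_cdf_tendsto[of w]] by (simp add: prof_cdf_nonpos[OF d])

lemma lap_tendsto:
  assumes r: "0 < r" shows "(\<lambda>n. lap r (prof_cdf d n)) \<longlonglongrightarrow> lap r wave_cdf"
  unfolding lap_def
proof (rule nn_integral_dominated_convergence[where w="\<lambda>x. ennreal (exp (- r * x)) * indicator {0<..} x"])
  note [measurable] = measurable_prof_cdf[OF d] borel_measurable_mono[OF mono_wave_cdf]
  show "(\<lambda>x. ennreal (exp (- r * x) * prof_cdf d j x)) \<in> borel_measurable lborel" for j by simp
  show "(\<lambda>x. ennreal (exp (- r * x) * wave_cdf x)) \<in> borel_measurable lborel" by simp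
  show "AE x in lborel. ennreal (exp (- r * x) * prof_cdf d j x) \<le> ennreal (exp (- r * x)) * indicator {0<..} x" for j
    using prof_cdf_bounds[OF d] prof_cdf_nonpos[OF d]
    by (auto split: split_indicator simp: not_less intro!: ennreal_leI mult_left_le)
  show "AE x in lborel. (\<lambda>i. ennreal (exp (- r * x) * prof_cdf d i x)) \<longlonglongrightarrow> ennreal (exp (- r * x) * wave_cdf x)"
    by (intro AE_I2 tendsto_ennrealI tendsto_mult tendsto_const wave_cdf_tendsto)
  show "(\<integral>\<^sup>+ x. ennreal (exp (- r * x)) * indicator {0<..} x \<partial>lborel) < \<infinity>"
    using nn_integral_exp_Ioi[OF r, of 0] by simp
qed simp

lemma lap_wave_cdf_le: "0 < r \<Longrightarrow> lap r wave_cdf \<le> ennreal (1 / r)"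
  by (rule LIMSEQ_le_const2[OF lap_tendsto]) (use lap_prof_cdf_le in auto)

definition wave_lap :: "real \<Rightarrow> real" where "wave_lap r = enn2real (lap r wave_cdf)"

lemma wave_lap: "0 < r \<Longrightarrow> lap r wave_cdf = ennreal (wave_lap r)" "0 \<le> wave_lap r" "0 < r \<Longrightarrow> wave_lap r \<le> 1 / r"
proof -
  assume r: "0 < r"
  have fin: "lap r wave_cdf < top" using lap_wave_cdf_le[OF r] by (rule le_less_trans) simp
  then show e: "lap r wave_cdf = ennreal (wave_lap r)" by (simp add: wave_lap_def)
  show "wave_lap r \<le> 1 / r" using lap_wave_cdf_le[OF r] r unfolding e by simp
qed (simp add: wave_lap_def)

text \<open>In the limit the profiles of two consecutive steps agree, so the mass balance becomes an
  equation for one transform: K times it is the limit of the cut mass.\<close>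

lemma wave_lap_bounds:
  assumes r: "0 < r"
  defines "K \<equiv> exp (d + r\<^sup>2 * d / 2) - exp (- r * speed)"
  shows "(exp d - 1) * (exp (- r * speed) / r) \<le> K * wave_lap r"
    and "r < s \<Longrightarrow> 0 \<le> h \<Longrightarrow> K * wave_lap r \<le> (exp d - 1) * (exp (r * h) / r) + exp (d + s\<^sup>2 * d / 2) * (exp (- (s - r) * h) / (s - r))"
proof -
  define l where "l n = enn2real (lap r (prof_cdf d n))" for n
  have fin: "lap r (prof_cdf d n) < top" for n
    using lap_prof_cdf_le[OF r] by (rule le_less_trans) simp
  have l: "lap r (prof_cdf d n) = ennreal (l n)" "0 \<le> l n" for n
    using fin[of n] by (auto simp: l_def)
  have lt: "l \<longlonglongrightarrow> wave_lap r"
    using lap_tendsto[OF r] by (simp add: l(1) wave_lap(1)[OF r] l(2) wave_lap(2))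
  define m where "m n = exp (d + r\<^sup>2 * d / 2) * l n - exp (- r * front_incr d n) * l (Suc n)" for n
  have m: "cut_mass r n = ennreal (m n)" "0 \<le> m n" for n
  proof -
    have eq: "ennreal (exp (- r * front_incr d n) * l (Suc n)) + cut_mass r n = ennreal (exp (d + r\<^sup>2 * d / 2) * l n)"
      using lap_prof_cdf_rec[of r n] l by (simp add: ennreal_mult')
    then have "cut_mass r n \<noteq> top" by (metis ennreal_add_eq_top ennreal_neq_top infinity_ennreal_def)
    then obtain c where c: "cut_mass r n = ennreal c" "0 \<le> c" by (cases "cut_mass r n") auto
    have "exp (- r * front_incr d n) * l (Suc n) + c = exp (d + r\<^sup>2 * d / 2) * l n"
      using eq l(2) c by (simp add: ennreal_plus[symmetric] del: ennreal_plus)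
    then have "c = m n" by (simp add: m_def)
    then show "cut_mass r n = ennreal (m n)" "0 \<le> m n" using c by auto
  qed
  have "m \<longlonglongrightarrow> exp (d + r\<^sup>2 * d / 2) * wave_lap r - exp (- r * speed) * wave_lap r"
    unfolding m_def by (intro tendsto_intros lt LIMSEQ_Suc front_incr_tendsto)
  then have mt: "m \<longlonglongrightarrow> K * wave_lap r" by (simp add: K_def algebra_simps)
  have ge: "(exp d - 1) * (exp (- r * front_incr d n) / r) \<le> m n" for n
    using cut_mass_ge[OF r, of n] m[of n] by (metis ennreal_le_iff)
  have "(\<lambda>n. (exp d - 1) * (exp (- r * front_incr d n) / r)) \<longlonglongrightarrow> (exp d - 1) * (exp (- r * speed) / r)"
    by (intro tendsto_intros front_incr_tendsto) (use r in auto)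
  then show "(exp d - 1) * (exp (- r * speed) / r) \<le> K * wave_lap r"
    by (rule LIMSEQ_le[OF _ mt]) (use ge in auto)
  assume s: "r < s" "0 \<le> h"
  have "m n \<le> (exp d - 1) * (exp (r * h) / r) + exp (d + s\<^sup>2 * d / 2) * (exp (- (s - r) * h) / (s - r))" for n
  proof -
    have "0 \<le> (exp d - 1) * (exp (r * h) / r) + exp (d + s\<^sup>2 * d / 2) * (exp (- (s - r) * h) / (s - r))"
      using r s d by (intro add_nonneg_nonneg mult_nonneg_nonneg divide_nonneg_pos) auto
    then show ?thesis using cut_mass_le[OF r s, of n] m[of n] by simp
  qed
  then show "K * wave_lap r \<le> (exp d - 1) * (exp (r * h) / r) + exp (d + s\<^sup>2 * d / 2) * (exp (- (s - r) * h) / (s - r))"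
    by (intro LIMSEQ_le_const2[OF mt]) auto
qed

lemma speed_nonneg: "0 \<le> speed"
proof (rule ccontr)
  assume "\<not> ?thesis" then have c: "speed < 0" by simp
  \<comment> \<open>The bound 1 / r on the transform yields - r * speed \<le> r^2 * d / 2, whereas
    for this r the left side equals r^2 * d.\<close>
  define r where "r = - speed / d"
  have r: "0 < r" using c d by (simp add: r_def divide_neg_pos)
  have K: "0 < exp (d + r\<^sup>2 * d / 2) - exp (- r * speed)"
  proof -
    have "0 < (exp d - 1) * (exp (- r * speed) / r)" using d r by simp
    also note wave_lap_bounds(1)[OF r]
    finally show ?thesis using wave_lap(2)[of r] by (simp add: zero_less_mult_iff)
  qed
  have "(exp d - 1) * (exp (- r * speed) / r) \<le> (exp (d + r\<^sup>2 * d / 2) - exp (- r * speed)) * (1 / r)"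
    using wave_lap_bounds(1)[OF r] mult_left_mono[OF wave_lap(3)[OF r], of "exp (d + r\<^sup>2 * d / 2) - exp (- r * speed)"] K
    by linarith
  then have "exp d * exp (- r * speed) \<le> exp (d + r\<^sup>2 * d / 2)"
    using r by (simp add: field_simps)
  then have "- r * speed \<le> r\<^sup>2 * d / 2" by (simp flip: exp_add)
  moreover have "- r * speed = r\<^sup>2 * d"
    using d by (simp add: r_def power2_eq_square)
  moreover have "0 < r\<^sup>2 * d" using r d by simp
  ultimately show False by linarith
qed

end

text \<open>After division by the step length the balance becomes (1 + r^2 / 2 + r * c) * L = 1 / r.
  This is the Laplace transform of D'' / 2 + c * D' + D = 1 with D and D' vanishing at 0, the
  equation of a wave of velocity c seen from its front.\<close>

lemma wave_lap_tendsto: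
  fixes X :: "nat \<Rightarrow> real"
  assumes X: "\<And>j. 0 < X j" "X \<longlonglongrightarrow> 0" and c: "(\<lambda>j. speed (X j) / X j) \<longlonglongrightarrow> c" and r: "0 < r"
  shows "(\<lambda>j. wave_lap (X j) r) \<longlonglongrightarrow> 2 / (r * (r\<^sup>2 + 2 * c * r + 2))"
proof -
  have X0: "filterlim X (at_right 0) sequentially"
    using X by (intro tendsto_imp_filterlim_at_right) auto
  define v where "v j = speed (X j) / X j" for j
  have v: "speed (X j) = v j * X j" "0 \<le> v j" "v j \<le> sqrt 2" for j
    using X(1)[of j] speed_nonneg[OF X(1), of j] speed_le[OF X(1), of j]
    by (auto simp: v_def divide_le_eq)
  have vc: "v \<longlonglongrightarrow> c" using c by (simp add: v_def[abs_def])
  have c0: "0 \<le> c" by (rule LIMSEQ_le_const[OF vc]) (use v in auto)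
  define K where "K j = exp (X j + r\<^sup>2 * X j / 2) - exp (- r * speed (X j))" for j
  have v0: "(\<lambda>j. v j * X j) \<longlonglongrightarrow> 0" using tendsto_mult[OF vc X(2)] by simp
  have K: "(\<lambda>j. K j / X j) \<longlonglongrightarrow> (1 + r\<^sup>2 / 2) + r * c"
  proof -
    have "((\<lambda>d. (exp (d + r\<^sup>2 * d / 2) - 1) / d) \<longlongrightarrow> 1 + r\<^sup>2 / 2) (at_right 0)"
      by real_asymp
    then have 1: "(\<lambda>j. (exp (X j + r\<^sup>2 * X j / 2) - 1) / X j) \<longlonglongrightarrow> 1 + r\<^sup>2 / 2"
      by (rule filterlim_compose[OF _ X0])
    have 2: "(\<lambda>j. (1 - exp (- (r * (v j * X j)))) / X j) \<longlonglongrightarrow> r * c"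
    proof (rule tendsto_sandwich)
      \<comment> \<open>The velocity v j varies along the sequence, so explicit second order bounds
        replace an expansion in the step length.\<close>
      have b: "x - x\<^sup>2 / 2 \<le> 1 - exp (- x) \<and> 1 - exp (- x) \<le> x" if "0 \<le> x" for x :: real
      proof -
        have "exp (- x) \<le> 1 + (- x) + (- x)\<^sup>2 / 2"
        proof (cases "x = 0")
          case False
          then have x: "0 < x" using that by simp
          have "0 \<le> (\<lambda>t. 1 - t + t\<^sup>2 / 2 - exp (- t)) x"
          proof (rule DERIV_nonneg_imp_nondecreasing[of 0 x, THEN order_trans[rotated]])
            fix t :: real assume "0 \<le> t" "t \<le> x"
            then show "\<exists>y. ((\<lambda>t. 1 - t + t\<^sup>2 / 2 - exp (- t)) has_real_derivative y) (at t) \<and> 0 \<le> y"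
              using exp_ge_add_one_self[of "-t"]
              by (intro exI[of _ "-1 + t + exp (- t)"]) (auto intro!: derivative_eq_intros)
          qed (use x in auto)
          then show ?thesis by simp
        qed simp
        then show ?thesis using exp_ge_add_one_self[of "-x"] by simp
      qed
      have nn: "0 \<le> r * (v j * X j)" for j using r v(2)[of j] X(1)[of j] by simp
      show "\<forall>\<^sub>F j in sequentially. r * v j - r\<^sup>2 * v j * (v j * X j) / 2 \<le> (1 - exp (- (r * (v j * X j)))) / X j"
      proof (intro always_eventually allI)
        fix j
        have "(r * v j - r\<^sup>2 * v j * (v j * X j) / 2) * X j = r * (v j * X j) - (r * (v j * X j))\<^sup>2 / 2"
          by (simp add: power2_eq_square field_simps)
        also have "\<dots> \<le> 1 - exp (- (r * (v j * X j)))" using b[OF nn] by blast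
        finally show "r * v j - r\<^sup>2 * v j * (v j * X j) / 2 \<le> (1 - exp (- (r * (v j * X j)))) / X j"
          using X(1)[of j] by (simp add: pos_le_divide_eq)
      qed
      show "\<forall>\<^sub>F j in sequentially. (1 - exp (- (r * (v j * X j)))) / X j \<le> r * v j"
      proof (intro always_eventually allI)
        fix j
        have "1 - exp (- (r * (v j * X j))) \<le> (r * v j) * X j" using b[OF nn, of j] by (simp add: mult.assoc)
        then show "(1 - exp (- (r * (v j * X j)))) / X j \<le> r * v j"
          using X(1)[of j] by (simp add: pos_divide_le_eq)
      qed
      have "(\<lambda>j. r * v j - r\<^sup>2 * v j * (v j * X j) / 2) \<longlonglongrightarrow> r * c - r\<^sup>2 * c * 0 / 2"
        by (intro tendsto_intros vc v0) simp
      then show "(\<lambda>j. r * v j - r\<^sup>2 * v j * (v j * X j) / 2) \<longlonglongrightarrow> r * c" by simp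
      show "(\<lambda>j. r * v j) \<longlonglongrightarrow> r * c" by (intro tendsto_intros vc)
    qed
    have "K j / X j = (exp (X j + r\<^sup>2 * X j / 2) - 1) / X j + (1 - exp (- (r * (v j * X j)))) / X j" for j
      by (simp add: K_def v(1) add_divide_distrib[symmetric])
    then show ?thesis using tendsto_add[OF 1 2] by simp
  qed
  have pos: "0 < 1 + r\<^sup>2 / 2 + r * c" using r c0 by (intro add_pos_nonneg) (auto intro: add_pos_nonneg)
  define lb where "lb d = (exp d - 1) / d" for d :: real
  have "((\<lambda>d. (exp d - 1) / d) \<longlongrightarrow> 1) (at_right (0::real))" by real_asymp
  then have lb: "(\<lambda>j. lb (X j)) \<longlonglongrightarrow> 1"
    unfolding lb_def by (rule filterlim_compose[OF _ X0])
  \<comment> \<open>The choices are s = 1 / sqrt d and h = d^(1/4). Then s^2 * d equals 1 and h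
    tends to 0, while (s - r) * h grows like d^(-1/4), so that the diffusive error is negligible
    even after division by d.\<close>
  define ub where "ub d = ((exp d - 1) * (exp (r * sqrt (sqrt d)) / r)
      + exp (d + (1 / sqrt d)\<^sup>2 * d / 2) * (exp (- (1 / sqrt d - r) * sqrt (sqrt d)) / (1 / sqrt d - r))) / d" for d
  have "((\<lambda>d. ((exp d - 1) * (exp (r * sqrt (sqrt d)) / r)
      + exp (d + (1 / sqrt d)\<^sup>2 * d / 2) * (exp (- (1 / sqrt d - r) * sqrt (sqrt d)) / (1 / sqrt d - r))) / d) \<longlongrightarrow> inverse r) (at_right 0)"
    using r by real_asymp
  then have ub0: "(\<lambda>j. ub (X j)) \<longlonglongrightarrow> inverse r"
    unfolding ub_def by (rule filterlim_compose[OF _ X0])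
  then have ub: "(\<lambda>j. ub (X j)) \<longlonglongrightarrow> 1 / r" by (simp add: inverse_eq_divide)
  have ev: "\<forall>\<^sub>F j in sequentially. r < 1 / sqrt (X j)"
  proof -
    have "\<forall>\<^sub>F d in at_right 0. r < 1 / sqrt d" using r by real_asymp
    then show ?thesis using X0 by (auto simp: filterlim_iff)
  qed
  have evK: "\<forall>\<^sub>F j in sequentially. 0 < K j / X j" by (rule order_tendstoD(1)[OF K pos])
  have "(\<lambda>j. wave_lap (X j) r) \<longlonglongrightarrow> (1 / r) / (1 + r\<^sup>2 / 2 + r * c)"
  proof (rule tendsto_sandwich)
    show "\<forall>\<^sub>F j in sequentially. lb (X j) * (exp (- r * (v j * X j)) / r) / (K j / X j) \<le> wave_lap (X j) r"
      using evK
    proof eventually_elim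
      case (elim j)
      have "(exp (X j) - 1) * (exp (- r * speed (X j)) / r) \<le> K j * wave_lap (X j) r"
        unfolding K_def by (rule wave_lap_bounds(1)[OF X(1) r])
      then have "(exp (X j) - 1) * (exp (- r * speed (X j)) / r) / X j \<le> K j * wave_lap (X j) r / X j"
        using X(1)[of j] by (intro divide_right_mono) auto
      then have "lb (X j) * (exp (- r * (v j * X j)) / r) \<le> K j / X j * wave_lap (X j) r"
        by (simp add: lb_def v(1) mult.commute)
      then show ?case by (intro pos_divide_le_eq[OF elim, THEN iffD2]) (simp only: mult.commute)
    qed
    show "\<forall>\<^sub>F j in sequentially. wave_lap (X j) r \<le> ub (X j) / (K j / X j)"
      using evK ev
    proof eventually_elim
      case (elim j)
      have "K j * wave_lap (X j) r / X j \<le> ub (X j)"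
        unfolding K_def ub_def
        using X(1)[of j] by (intro divide_right_mono wave_lap_bounds(2)[OF X(1) r elim(2)]) auto
      then have "wave_lap (X j) r * (K j / X j) \<le> ub (X j)" by (simp add: mult.commute)
      then show ?case by (rule pos_le_divide_eq[OF elim(1), THEN iffD2])
    qed
    have "(\<lambda>j. lb (X j) * (exp (- r * (v j * X j)) / r) / (K j / X j)) \<longlonglongrightarrow> 1 * (exp (- r * 0) / r) / (1 + r\<^sup>2 / 2 + r * c)"
      by (intro tendsto_intros lb v0 K) (use pos r in auto)
    then show "(\<lambda>j. lb (X j) * (exp (- r * (v j * X j)) / r) / (K j / X j)) \<longlonglongrightarrow> (1 / r) / (1 + r\<^sup>2 / 2 + r * c)" by simp
    show "(\<lambda>j. ub (X j) / (K j / X j)) \<longlonglongrightarrow> (1 / r) / (1 + r\<^sup>2 / 2 + r * c)"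
      by (intro tendsto_divide ub K) (use pos in auto)
  qed
  moreover have "(1 / r) / (1 + r\<^sup>2 / 2 + r * c) = 2 / (r * (r\<^sup>2 + 2 * c * r + 2))"
  proof -
    have "r * (r\<^sup>2 + 2 * c * r + 2) = 2 * (r * (1 + r\<^sup>2 / 2 + r * c))" by (simp add: algebra_simps)
    then show ?thesis by (simp only: divide_divide_eq_left) simp
  qed
  ultimately show ?thesis by simp
qed

section \<open>From Laplace transforms to weak convergence\<close>

lemma integrable_exp_bounded:
  fixes D :: "real \<Rightarrow> real"
  assumes [measurable]: "D \<in> borel_measurable borel" and D: "\<And>x. 0 < x \<Longrightarrow> \<bar>D x\<bar> \<le> C" "\<And>x. x \<le> 0 \<Longrightarrow> D x = 0"
    and r: "0 < r" and f[measurable]: "f \<in> borel_measurable borel" and fb: "\<And>x. 0 < x \<Longrightarrow> \<bar>f x\<bar> \<le> B"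
  shows "integrable lborel (\<lambda>x. exp (- r * x) * f x * D x)"
proof (rule Bochner_Integration.integrable_bound)
  show "integrable lborel (\<lambda>x. B * C * (exp (- r * x) * indicator {0<..} x))"
    using nn_integral_exp_Ioi[OF r, of 0]
    by (intro integrable_mult_right integrableI_nonneg) (auto simp: ennreal_mult' ennreal_indicator)
  have B: "0 \<le> B" "0 \<le> C" using fb[of 1] D(1)[of 1] by auto
  show "AE x in lborel. norm (exp (- r * x) * f x * D x) \<le> norm (B * C * (exp (- r * x) * indicator {0<..} x))"
  proof (intro AE_I2)
    fix x
    show "norm (exp (- r * x) * f x * D x) \<le> norm (B * C * (exp (- r * x) * indicator {0<..} x))"
    proof (cases "0 < x")
      case True
      have "\<bar>f x\<bar> * \<bar>D x\<bar> \<le> B * C" using fb[OF True] D(1)[OF True] B by (intro mult_mono) auto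
      then have "exp (- r * x) * (\<bar>f x\<bar> * \<bar>D x\<bar>) \<le> exp (- r * x) * (B * C)" by (intro mult_left_mono) auto
      then show ?thesis using True B by (simp add: abs_mult mult_ac)
    qed (use D(2) in simp)
  qed
qed simp

text \<open>Weierstrass approximation in the variable \<open>exp (-x)\<close> turns convergence of Laplace
  transforms at the positive integers into weak convergence.\<close>
lemma laplace_weak_convergence:
  fixes D :: "nat \<Rightarrow> real \<Rightarrow> real"
  assumes [measurable]: "\<And>j. D j \<in> borel_measurable borel" "E \<in> borel_measurable borel"
    and D: "\<And>j x. 0 < x \<Longrightarrow> \<bar>D j x\<bar> \<le> C" "\<And>j x. x \<le> 0 \<Longrightarrow> D j x = 0"
    and E: "\<And>x. 0 < x \<Longrightarrow> \<bar>E x\<bar> \<le> C" "\<And>x. x \<le> 0 \<Longrightarrow> E x = 0"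
    and lim: "\<And>r. 0 < r \<Longrightarrow> (\<lambda>j. \<integral>x. exp (- r * x) * D j x \<partial>lborel) \<longlonglongrightarrow> (\<integral>x. exp (- r * x) * E x \<partial>lborel)"
    and f: "continuous_on UNIV f"
  shows "(\<lambda>j. \<integral>x. exp (- 1 * x) * f (exp (- x)) * D j x \<partial>lborel) \<longlonglongrightarrow> (\<integral>x. exp (- 1 * x) * f (exp (- x)) * E x \<partial>lborel)"
proof (rule LIMSEQ_I)
  fix e :: real assume e: "0 < e"
  have C: "0 \<le> C" using E(1)[of 1] by auto
  \<comment> \<open>The weight exp (-x) has integral 1 on the positive half-line, so each of the two
    approximations costs at most e / 4; C + 1 avoids a division by zero.\<close>
  define e' where "e' = e / 4 / (C + 1)"
  have e': "0 < e'" using e C by (simp add: e'_def)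
  have [measurable]: "f \<in> borel_measurable borel" using f by (rule borel_measurable_continuous_onI)
  have "continuous_on {0..1} f" using f by (rule continuous_on_subset) simp
  then obtain g where g: "real_polynomial_function g" "\<And>u. u \<in> {0..1} \<Longrightarrow> \<bar>f u - g u\<bar> < e'"
    using Stone_Weierstrass_real_polynomial_function[of "{0..1}" f e'] e' by auto
  then obtain a n where gs: "g = (\<lambda>u. \<Sum>i\<le>n. a i * u ^ i)"
    by (auto simp: real_polynomial_function_iff_sum)
  have [measurable]: "g \<in> borel_measurable borel" unfolding gs by measurable
  have compactbound: "\<exists>B. \<forall>u\<in>{0..1}. \<bar>h u\<bar> \<le> B" if "continuous_on {0..1} h" for h :: "real \<Rightarrow> real"
    using compact_imp_bounded[OF compact_continuous_image[OF that compact_Icc]]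
    by (auto simp: bounded_iff)
  have gc: "continuous_on {0..1} g" unfolding gs by (intro continuous_intros)
  obtain B where B: "\<And>u. u \<in> {0..1} \<Longrightarrow> \<bar>f u\<bar> \<le> B" using compactbound[OF \<open>continuous_on {0..1} f\<close>] by blast
  obtain B' where B': "\<And>u. u \<in> {0..1} \<Longrightarrow> \<bar>g u\<bar> \<le> B'" using compactbound[OF gc] by blast
  define I where "I h F = (\<integral>x. exp (- 1 * x) * h (exp (- x)) * F x \<partial>lborel)" for h :: "real \<Rightarrow> real" and F :: "real \<Rightarrow> real"
  have int1: "(\<integral>x. exp (- 1 * x) * indicator {0<..} x \<partial>lborel) = (1::real)"
    using nn_integral_exp_Ioi[of 1 0]
    by (subst integral_eq_nn_integral) (auto simp: ennreal_mult' ennreal_indicator)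
  have close: "\<bar>I f F - I g F\<bar> \<le> e / 4"
    if F[measurable]: "F \<in> borel_measurable borel" and Fb: "\<And>x. 0 < x \<Longrightarrow> \<bar>F x\<bar> \<le> C" "\<And>x. x \<le> 0 \<Longrightarrow> F x = 0" for F
  proof -
    have i: "integrable lborel (\<lambda>x. exp (- 1 * x) * f (exp (- x)) * F x)"
      "integrable lborel (\<lambda>x. exp (- 1 * x) * g (exp (- x)) * F x)"
      by (rule integrable_exp_bounded[OF F Fb _ _ B] integrable_exp_bounded[OF F Fb _ _ B']; simp)+
    have eq: "I f F - I g F = (\<integral>x. exp (- 1 * x) * f (exp (- x)) * F x - exp (- 1 * x) * g (exp (- x)) * F x \<partial>lborel)"
      unfolding I_def by (rule Bochner_Integration.integral_diff[symmetric]) (rule i)+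
    have "\<bar>I f F - I g F\<bar> \<le> (\<integral>x. e' * C * (exp (- 1 * x) * indicator {0<..} x) \<partial>lborel)"
      unfolding eq
    proof (rule Bochner_Integration.integral_abs_bound_integral)
      show "integrable lborel (\<lambda>x. exp (- 1 * x) * f (exp (- x)) * F x - exp (- 1 * x) * g (exp (- x)) * F x)"
        using i by (rule Bochner_Integration.integrable_diff)
      show "integrable lborel (\<lambda>x. e' * C * (exp (- 1 * x) * indicator {0<..} x))"
        using nn_integral_exp_Ioi[of 1 0]
        by (intro integrable_mult_right integrableI_nonneg) (auto simp: ennreal_mult' ennreal_indicator)
      fix x :: real
      show "\<bar>exp (- 1 * x) * f (exp (- x)) * F x - exp (- 1 * x) * g (exp (- x)) * F x\<bar> \<le> e' * C * (exp (- 1 * x) * indicator {0<..} x)"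
      proof (cases "0 < x")
        case True
        have "\<bar>f (exp (- x)) - g (exp (- x))\<bar> * \<bar>F x\<bar> \<le> e' * C"
          using g(2)[of "exp (-x)"] Fb(1)[OF True] True e' by (intro mult_mono) auto
        then have "exp (- 1 * x) * (\<bar>f (exp (- x)) - g (exp (- x))\<bar> * \<bar>F x\<bar>) \<le> exp (- 1 * x) * (e' * C)"
          by (intro mult_left_mono) auto
        moreover have "\<bar>exp (- 1 * x) * f (exp (- x)) * F x - exp (- 1 * x) * g (exp (- x)) * F x\<bar>
            = exp (- 1 * x) * (\<bar>f (exp (- x)) - g (exp (- x))\<bar> * \<bar>F x\<bar>)"
        proof -
          have "exp (- 1 * x) * f (exp (- x)) * F x - exp (- 1 * x) * g (exp (- x)) * F x
            = exp (- 1 * x) * ((f (exp (- x)) - g (exp (- x))) * F x)" by (simp add: algebra_simps)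
          then show ?thesis by (simp add: abs_mult)
        qed
        ultimately show ?thesis using True by (simp add: mult_ac)
      qed (use Fb(2) in simp)
    qed
    also have "\<dots> = e' * C" by (simp only: Bochner_Integration.integral_mult_right_zero int1 mult_1_right)
    also have "\<dots> \<le> e / 4"
    proof -
      have "e' * C \<le> e' * (C + 1)" using e' by simp
      also have "\<dots> = e / 4"
      proof -
        have "4 * C + 4 \<noteq> 0" using C by linarith
        then show ?thesis by (simp add: e'_def field_simps)
      qed
      finally show ?thesis .
    qed
    finally show ?thesis .
  qed
  \<comment> \<open>Together with the weight exp (-x), the monomial of degree i in exp (-x) becomes
    the Laplace kernel at i + 1, which is positive also for i = 0.\<close>
  have Ig: "I g F = (\<Sum>i\<le>n. a i * (\<integral>x. exp (- real (Suc i) * x) * F x \<partial>lborel))"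
    if F[measurable]: "F \<in> borel_measurable borel" and Fb: "\<And>x. 0 < x \<Longrightarrow> \<bar>F x\<bar> \<le> C" "\<And>x. x \<le> 0 \<Longrightarrow> F x = 0" for F
  proof -
    have e: "exp (- 1 * x) * g (exp (- x)) * F x = (\<Sum>i\<le>n. a i * (exp (- real (Suc i) * x) * F x))" for x
    proof -
      have "exp (- 1 * x) * exp (- x) ^ i = exp (- real (Suc i) * x)" for i
        by (simp add: exp_of_nat_mult[symmetric] algebra_simps flip: exp_add)
      then have "exp (- 1 * x) * (a i * exp (- x) ^ i) * F x = a i * (exp (- real (Suc i) * x) * F x)" for i
        by (metis mult.assoc mult.commute)
      then show ?thesis unfolding gs sum_distrib_left sum_distrib_right by (rule sum.cong[OF refl])
    qed
    have "integrable lborel (\<lambda>x. exp (- real (Suc i) * x) * F x)" for i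
      using integrable_exp_bounded[OF F Fb, of "real (Suc i)" "\<lambda>_. 1" 1] by simp
    then show ?thesis unfolding I_def e by (simp add: Bochner_Integration.integral_sum)
  qed
  have "(\<lambda>j. \<Sum>i\<le>n. a i * (\<integral>x. exp (- real (Suc i) * x) * D j x \<partial>lborel)) \<longlonglongrightarrow> (\<Sum>i\<le>n. a i * (\<integral>x. exp (- real (Suc i) * x) * E x \<partial>lborel))"
    by (intro tendsto_intros lim) simp
  then have "(\<lambda>j. I g (D j)) \<longlonglongrightarrow> I g E" using Ig D E by simp
  then obtain j0 where j0: "\<And>j. j0 \<le> j \<Longrightarrow> \<bar>I g (D j) - I g E\<bar> < e / 4"
    using LIMSEQ_D[of "\<lambda>j. I g (D j)" "I g E" "e / 4"] e by auto
  have "\<bar>I f (D j) - I f E\<bar> < e" if "j0 \<le> j" for j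
  proof -
    have "\<bar>I f (D j) - I g (D j)\<bar> \<le> e / 4" by (rule close) (use D in auto)
    moreover have "\<bar>I f E - I g E\<bar> \<le> e / 4" by (rule close) (use E in auto)
    ultimately show ?thesis using j0[OF that] e by linarith
  qed
  then show "\<exists>no. \<forall>n\<ge>no. norm ((\<integral>x. exp (- 1 * x) * f (exp (- x)) * D n x \<partial>lborel) - (\<integral>x. exp (- 1 * x) * f (exp (- x)) * E x \<partial>lborel)) < e"
    unfolding I_def by auto
qed

lemma laplace_wave_ode:
  fixes D D1 :: "real \<Rightarrow> real"
  assumes D: "\<And>x. (D has_real_derivative D1 x) (at x)"
    and D1: "\<And>x. (D1 has_real_derivative 2 - 2 * c * D1 x - 2 * D x) (at x)"
    and z: "D 0 = 0" "D1 0 = 0"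
    and b: "\<And>x. 0 < x \<Longrightarrow> \<bar>D x\<bar> \<le> C" "\<And>x. 0 < x \<Longrightarrow> \<bar>D1 x\<bar> \<le> C"
    and r: "0 < r" and c: "0 \<le> c"
  shows "(\<integral>x. exp (- r * x) * (D x * indicator {0<..} x) \<partial>lborel) = 2 / (r * (r\<^sup>2 + 2 * c * r + 2))"
proof -
  define \<beta> where "\<beta> = 1 / (r\<^sup>2 + 2 * c * r + 2)"
  have pos: "0 < r\<^sup>2 + 2 * c * r + 2" using r c by (intro add_nonneg_pos) auto
  define E where "E x = - (exp (- r * x) * ((r + 2 * c) * \<beta> * D x + \<beta> * D1 x + - (2 * \<beta> / r)))" for x
  \<comment> \<open>From here on \<open>E\<close> is an antiderivative of exp (- r * x) * D x. It
    comes from an ansatz linear in D, D1 and 1, whose coefficients the differential equation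
    determines.\<close>
  define E where "E x = - (exp (- r * x) * ((r + 2 * c) * \<beta> * D x + \<beta> * D1 x + 2 * \<beta> / r))" for x
  have cD: "continuous_on UNIV D" using D by (meson DERIV_isCont continuous_at_imp_continuous_on)
  have [measurable]: "D \<in> borel_measurable borel" using cD by (rule borel_measurable_continuous_onI)
  have \<beta>: "\<beta> * (r\<^sup>2 + 2 * c * r + 2) = 1" using pos by (simp add: \<beta>_def)
  have E': "(E has_real_derivative exp (- r * x) * D x) (at x)" for x
  proof -
    have "(E has_real_derivative - (exp (- r * x) * (- r) * ((r + 2 * c) * \<beta> * D x + \<beta> * D1 x + 2 * \<beta> / r)
        + exp (- r * x) * ((r + 2 * c) * \<beta> * D1 x + \<beta> * (2 - 2 * c * D1 x - 2 * D x)))) (at x)"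
      unfolding E_def by (auto intro!: derivative_eq_intros D D1)
    moreover have "- (exp (- r * x) * (- r) * ((r + 2 * c) * \<beta> * D x + \<beta> * D1 x + 2 * \<beta> / r)
        + exp (- r * x) * ((r + 2 * c) * \<beta> * D1 x + \<beta> * (2 - 2 * c * D1 x - 2 * D x)))
      = exp (- r * x) * D x * (\<beta> * (r\<^sup>2 + 2 * c * r + 2))"
      using r by (simp add: algebra_simps power2_eq_square)
    ultimately show ?thesis by (simp add: \<beta>)
  qed
  have fin: "(\<integral>x. indicator {0..y} x *\<^sub>R (exp (- r * x) * D x) \<partial>lborel) = E y - E 0" if "0 \<le> y" for y
  proof (rule integral_FTC_Icc[OF that])
    show "(E has_vector_derivative exp (- r * x) * D x) (at x within {0..y})" for x
      using E'[of x] by (auto simp: has_real_derivative_iff_has_vector_derivative intro: has_vector_derivative_at_within)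
    show "continuous_on {0..y} (\<lambda>x. exp (- r * x) * D x)"
      by (intro continuous_intros continuous_on_subset[OF cD]) auto
  qed
  define f where "f x = exp (- r * x) * (D x * indicator {0<..} x)" for x
  have i: "integrable lborel f"
    using integrable_exp_bounded[of "\<lambda>x. D x * indicator {0<..} x" C r "\<lambda>_. 1" 1] b(1) r
    by (simp add: f_def[abs_def])
  have "((\<lambda>y. \<integral>x. indicator {..y} x *\<^sub>R f x \<partial>lborel) \<longlongrightarrow> (\<integral>x. f x \<partial>lborel)) at_top"
    by (rule tendsto_integral_at_top[OF _ i]) simp
  moreover have "\<forall>\<^sub>F y in at_top. (\<integral>x. indicator {..y} x *\<^sub>R f x \<partial>lborel) = E y - E 0"
    using eventually_ge_at_top[of 0]
  proof eventually_elim
    case (elim y)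
    have "(\<integral>x. indicator {..y} x *\<^sub>R f x \<partial>lborel) = (\<integral>x. indicator {0..y} x *\<^sub>R (exp (- r * x) * D x) \<partial>lborel)"
      by (intro Bochner_Integration.integral_cong) (auto simp: f_def z split: split_indicator)
    then show ?case using fin[OF elim] by simp
  qed
  ultimately have 1: "((\<lambda>y. E y - E 0) \<longlongrightarrow> (\<integral>x. f x \<partial>lborel)) at_top"
    by (rule Lim_transform_eventually)
  have "(E \<longlongrightarrow> 0) at_top"
  proof (rule Lim_null_comparison)
    define M where "M = (r + 2 * c) * \<beta> * C + \<beta> * C + 2 * \<beta> / r"
    have "0 < \<beta>" using pos by (simp add: \<beta>_def)
    show "\<forall>\<^sub>F x in at_top. norm (E x) \<le> exp (- r * x) * M"
      using eventually_gt_at_top[of 0]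
    proof eventually_elim
      case (elim x)
      have "\<bar>(r + 2 * c) * \<beta> * D x + \<beta> * D1 x + 2 * \<beta> / r\<bar> \<le> \<bar>(r + 2 * c) * \<beta> * D x\<bar> + \<bar>\<beta> * D1 x\<bar> + \<bar>2 * \<beta> / r\<bar>"
        by linarith
      also have "\<dots> = (r + 2 * c) * \<beta> * \<bar>D x\<bar> + \<beta> * \<bar>D1 x\<bar> + 2 * \<beta> / r"
        using \<open>0 < \<beta>\<close> r c by (simp add: abs_mult)
      also have "\<dots> \<le> M" unfolding M_def
        using \<open>0 < \<beta>\<close> r c b[OF elim] by (intro add_mono mult_left_mono) auto
      finally show ?case by (simp add: E_def abs_mult)
    qed
    show "((\<lambda>x. exp (- r * x) * M) \<longlongrightarrow> 0) at_top" using r by real_asymp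
  qed
  then have "((\<lambda>y. E y - E 0) \<longlongrightarrow> 0 - E 0) at_top" by (intro tendsto_intros)
  then have "(\<integral>x. f x \<partial>lborel) = - E 0"
    using tendsto_unique[OF _ 1] by simp
  also have "\<dots> = 2 / (r * (r\<^sup>2 + 2 * c * r + 2))" by (simp add: E_def z \<beta>_def mult.commute)
  finally show ?thesis by (simp add: f_def)
qed

text \<open>A continuous test function of u = exp (-x), as the Weierstrass argument requires. For a
  < b, its pullback to x vanishes outside the open interval from a to b.\<close>

definition bump :: "real \<Rightarrow> real \<Rightarrow> real \<Rightarrow> real" where
  "bump a b u = max 0 ((u - exp (- b)) * (exp (- a) - u))"

lemma continuous_bump: "continuous_on UNIV (bump a b)"
  unfolding bump_def by (intro continuous_intros)

lemma bump_nonneg: "0 \<le> bump a b u" by (simp add: bump_def)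

lemma bump_eq_0: "a < b \<Longrightarrow> x \<notin> {a<..<b} \<Longrightarrow> bump a b (exp (- x)) = 0"
proof -
  assume "a < b" "x \<notin> {a<..<b}"
  then consider "x \<le> a" | "b \<le> x" by fastforce
  then show ?thesis
  proof cases
    case 1
    then have "exp (- a) - exp (- x) \<le> 0" "0 \<le> exp (- x) - exp (- b)" using \<open>a < b\<close> by auto
    then show ?thesis by (simp add: bump_def mult_nonneg_nonpos)
  next
    case 2
    then have "0 \<le> exp (- a) - exp (- x)" "exp (- x) - exp (- b) \<le> 0" using \<open>a < b\<close> by auto
    then show ?thesis by (simp add: bump_def mult_nonpos_nonneg)
  qed
qed

lemma bump_le: "a < b \<Longrightarrow> 0 < a \<Longrightarrow> 0 < x \<Longrightarrow> \<bar>bump a b (exp (- x))\<bar> \<le> 1"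
proof -
  assume "a < b" "0 < a" "0 < x"
  have "(exp (- x) - exp (- b)) * (exp (- a) - exp (- x)) \<le> 1"
  proof (cases "x \<in> {a<..<b}")
    case True
    have "exp (- x) \<le> 1" "exp (- a) \<le> 1" using True \<open>0 < a\<close> by auto
    then have "exp (- x) - exp (- b) \<le> 1" "exp (- a) - exp (- x) \<le> 1"
      using exp_gt_zero[of "-b"] exp_gt_zero[of "-x"] by linarith+
    then have "(exp (- x) - exp (- b)) * (exp (- a) - exp (- x)) \<le> 1 * 1"
      using True by (intro mult_mono) auto
    then show ?thesis by simp
  next
    case False
    have "(exp (- x) - exp (- b)) * (exp (- a) - exp (- x)) \<le> bump a b (exp (- x))" by (simp add: bump_def)
    then show ?thesis using bump_eq_0[OF \<open>a < b\<close> False] by simp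
  qed
  then show ?thesis by (simp add: bump_def)
qed

lemma bump_integral_pos:
  assumes "0 < a" "a < b"
  shows "0 < (\<integral>x. exp (- 1 * x) * bump a b (exp (- x)) * indicator {0<..} x \<partial>lborel)"
proof -
  have [measurable]: "bump a b \<in> borel_measurable borel"
    using continuous_bump by (rule borel_measurable_continuous_onI)
  \<comment> \<open>On the middle third both factors of the bump stay away from 0.\<close>
  define a' b' where "a' = (2 * a + b) / 3" and "b' = (a + 2 * b) / 3"
  have ab: "a < a'" "a' < b'" "b' < b" using assms by (auto simp: a'_def b'_def)
  define k where "k = exp (- b) * ((exp (- b') - exp (- b)) * (exp (- a) - exp (- a')))"
  have k: "0 < k" using ab by (simp add: k_def)
  have "k * indicator {a'..b'} x \<le> exp (- 1 * x) * bump a b (exp (- x)) * indicator {0<..} x" for x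
  proof (cases "x \<in> {a'..b'}")
    case True
    have "k \<le> exp (- 1 * x) * ((exp (- x) - exp (- b)) * (exp (- a) - exp (- x)))"
      unfolding k_def using True ab by (intro mult_mono mult_nonneg_nonneg) auto
    also have "\<dots> \<le> exp (- 1 * x) * bump a b (exp (- x))" by (intro mult_left_mono) (auto simp: bump_def)
    finally show ?thesis using True assms ab by simp
  qed (simp add: bump_nonneg)
  moreover have "integrable lborel (\<lambda>x. exp (- 1 * x) * bump a b (exp (- x)) * indicator {0<..} x)"
    by (rule integrable_exp_bounded[where C=1 and B=1]) (use assms bump_le in auto)
  moreover have "integrable lborel (\<lambda>x. k * indicator {a'..b'} x)"
    by (intro integrable_mult_right integrable_real_indicator) (auto simp: emeasure_lborel_Icc_eq)
  ultimately have "(\<integral>x. k * indicator {a'..b'} x \<partial>lborel) \<le> (\<integral>x. exp (- 1 * x) * bump a b (exp (- x)) * indicator {0<..} x \<partial>lborel)"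
    by (intro integral_mono)
  moreover have "(\<integral>x. k * indicator {a'..b'} x \<partial>lborel) = k * (b' - a')" using ab by simp
  ultimately show ?thesis using k ab by (smt (verit) mult_pos_pos)
qed

definition pi_tail :: "real \<Rightarrow> real" where
  "pi_tail x = exp (- sqrt 2 * x) * (1 + sqrt 2 * x)"

text \<open>Velocities lie between 0 and sqrt 2, so from any vanishing sequence of step lengths one
  with convergent velocities can be extracted. Inside the locale the limit c and the limiting waves
  are identified.\<close>

locale vanishing_step =
  fixes X :: "nat \<Rightarrow> real" and c :: real
  assumes X: "\<And>j. 0 < X j" "X \<longlonglongrightarrow> 0" and c: "(\<lambda>j. speed (X j) / X j) \<longlonglongrightarrow> c"
begin

lemma c_bounds: "0 \<le> c" "c \<le> sqrt 2"
proof -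
  have "0 \<le> speed (X j) / X j" "speed (X j) / X j \<le> sqrt 2" for j
    using X(1)[of j] speed_nonneg[OF X(1), of j] speed_le[OF X(1), of j] by (auto simp: divide_le_eq)
  then show "0 \<le> c" "c \<le> sqrt 2"
    using LIMSEQ_le_const[OF c, of 0] LIMSEQ_le_const2[OF c, of "sqrt 2"] by auto
qed

text \<open>The transforms of the waves converge to the transform of any bounded solution D of the
  limiting equation with vanishing initial data, so that in each regime of c an explicit solution
  can be inserted.\<close>

lemma wave_weak_limit:
  fixes D D1 :: "real \<Rightarrow> real"
  assumes D: "\<And>x. (D has_real_derivative D1 x) (at x)"
    and D1: "\<And>x. (D1 has_real_derivative 2 - 2 * c * D1 x - 2 * D x) (at x)"
    and z: "D 0 = 0" "D1 0 = 0"
    and b: "\<And>x. 0 < x \<Longrightarrow> \<bar>D x\<bar> \<le> C" "\<And>x. 0 < x \<Longrightarrow> \<bar>D1 x\<bar> \<le> C" and C: "1 \<le> C"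
  shows "(\<lambda>j. \<integral>x. exp (- 1 * x) * bump p q (exp (- x)) * wave_cdf (X j) x \<partial>lborel)
     \<longlonglongrightarrow> (\<integral>x. exp (- 1 * x) * bump p q (exp (- x)) * (D x * indicator {0<..} x) \<partial>lborel)"
proof (rule laplace_weak_convergence[where C=C])
  have "continuous_on UNIV D" using D by (meson DERIV_isCont continuous_at_imp_continuous_on)
  then have [measurable]: "D \<in> borel_measurable borel" by (rule borel_measurable_continuous_onI)
  show "(\<lambda>x. D x * indicator {0<..} x) \<in> borel_measurable borel" by measurable
  show "wave_cdf (X j) \<in> borel_measurable borel" for j
    by (rule borel_measurable_mono[OF mono_wave_cdf[OF X(1)]])
  show "\<bar>wave_cdf (X j) x\<bar> \<le> C" for j x
    using wave_cdf_bounds[OF X(1), of j x] C by simp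
  show "wave_cdf (X j) x = 0" if "x \<le> 0" for j x using that by (rule wave_cdf_nonpos[OF X(1)])
  show "\<bar>D x * indicator {0<..} x\<bar> \<le> C" if "0 < x" for x using b(1)[OF that] that by simp
  fix r :: real assume r: "0 < r"
  have "(\<integral>x. exp (- r * x) * wave_cdf (X j) x \<partial>lborel) = wave_lap (X j) r" for j
    using borel_measurable_mono[OF mono_wave_cdf[OF X(1)], of j] wave_cdf_bounds[OF X(1)]
    by (subst integral_eq_nn_integral) (auto simp: wave_lap_def[OF X(1)] lap_def)
  then show "(\<lambda>j. \<integral>x. exp (- r * x) * wave_cdf (X j) x \<partial>lborel) \<longlonglongrightarrow> (\<integral>x. exp (- r * x) * (D x * indicator {0<..} x) \<partial>lborel)"
    using wave_lap_tendsto[OF X c r] laplace_wave_ode[OF D D1 z b r c_bounds(1)] by simp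
qed (auto simp: continuous_bump)

lemma integrable_bump:
  assumes "D \<in> borel_measurable borel" "\<And>x. 0 < x \<Longrightarrow> \<bar>D x\<bar> \<le> C" "\<And>x. x \<le> 0 \<Longrightarrow> D x = 0" "0 < p" "p < q"
  shows "integrable lborel (\<lambda>x. exp (- 1 * x) * bump p q (exp (- x)) * D x)"
proof (rule integrable_exp_bounded[where B=1 and C=C])
  have "bump p q \<in> borel_measurable borel"
    using continuous_bump by (rule borel_measurable_continuous_onI)
  then show "(\<lambda>x. bump p q (exp (- x))) \<in> borel_measurable borel" by measurable
qed (use assms bump_le in auto)

text \<open>For c < sqrt 2 the characteristic roots are -c + i * w and -c - i * w with w^2 = 2 -
  c^2, and the solution overshoots the value 1. The functions \<open>wave_cdf\<close> are at most 1,
  and a weak limit inherits this bound.\<close>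

lemma speed_limit: "c = sqrt 2"
proof (rule ccontr)
  assume "c \<noteq> sqrt 2"
  then have cs: "c < sqrt 2" using c_bounds by simp
  then have "c\<^sup>2 < 2" using c_bounds(1) by (metis power_strict_mono real_sqrt_pow2 zero_le_numeral zero_less_numeral)
  define w where "w = sqrt (2 - c\<^sup>2)"
  have w: "0 < w" "w\<^sup>2 = 2 - c\<^sup>2" using \<open>c\<^sup>2 < 2\<close> by (auto simp: w_def)
  \<comment> \<open>k removes the cosine from the derivative of D, which therefore vanishes at 0; m
    is the remaining coefficient of the sine.\<close>
  define k m where "k = c / w" and "m = 2 / w"
  have km: "k * w = c" "m * w = 2" "c * k + w = m"
    using w by (auto simp: k_def m_def field_simps power2_eq_square)
  have km0: "0 \<le> k" "0 < m" using c_bounds(1) w(1) by (auto simp: k_def m_def)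
  define D where "D x = 1 - exp (- c * x) * (cos (w * x) + k * sin (w * x))" for x
  define D1 where "D1 x = m * (exp (- c * x) * sin (w * x))" for x
  define C where "C = 2 + k + m"
  have D: "(D has_real_derivative D1 x) (at x)" for x
  proof -
    have "(D has_real_derivative exp (- c * x) * (c * cos (w * x) - (k * w) * cos (w * x) + (c * k + w) * sin (w * x))) (at x)"
      unfolding D_def by (auto intro!: derivative_eq_intros simp: algebra_simps)
    then show ?thesis unfolding km D1_def by (simp add: mult.left_commute)
  qed
  have D1: "(D1 has_real_derivative 2 - 2 * c * D1 x - 2 * D x) (at x)" for x
  proof -
    have "(D1 has_real_derivative exp (- c * x) * ((m * w) * cos (w * x) - c * m * sin (w * x))) (at x)"
      unfolding D1_def by (auto intro!: derivative_eq_intros simp: algebra_simps)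
    moreover have "c * m = 2 * k"
      using w(1) by (simp add: k_def m_def)
    ultimately have 1: "(D1 has_real_derivative exp (- c * x) * (2 * cos (w * x) - 2 * k * sin (w * x))) (at x)"
      by (simp add: km)
    have "2 * c * D1 x = 4 * k * (exp (- c * x) * sin (w * x))"
      unfolding D1_def using \<open>c * m = 2 * k\<close> by (metis mult.assoc mult_2 numeral_Bit0 distrib_right mult.left_commute)
    then have "2 - 2 * c * D1 x - 2 * D x = exp (- c * x) * (2 * cos (w * x) - 2 * k * sin (w * x))"
      by (simp add: D_def algebra_simps)
    then show ?thesis using 1 by simp
  qed
  have e1: "exp (- c * x) \<le> 1" if "0 < x" for x using that c_bounds(1) by simp
  have C: "1 \<le> C" using km0 by (simp add: C_def)
  have bD: "\<bar>D x\<bar> \<le> C" if "0 < x" for x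
  proof -
    have "\<bar>k * sin (w * x)\<bar> \<le> k * 1" unfolding abs_mult using km0 by (intro mult_mono) auto
    then have "\<bar>cos (w * x) + k * sin (w * x)\<bar> \<le> 1 + k" using abs_cos_le_one[of "w * x"] by linarith
    then have "\<bar>exp (- c * x) * (cos (w * x) + k * sin (w * x))\<bar> \<le> 1 * (1 + k)"
      unfolding abs_mult using e1[OF that] by (intro mult_mono) auto
    moreover have "\<bar>D x\<bar> \<le> \<bar>1\<bar> + \<bar>exp (- c * x) * (cos (w * x) + k * sin (w * x))\<bar>"
      unfolding D_def by (rule abs_triangle_ineq4)
    ultimately show ?thesis unfolding C_def using km0 by simp
  qed
  have bD1: "\<bar>D1 x\<bar> \<le> C" if "0 < x" for x
  proof -
    have "\<bar>exp (- c * x) * sin (w * x)\<bar> \<le> 1 * 1" unfolding abs_mult using e1[OF that] by (intro mult_mono) auto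
    then have "\<bar>D1 x\<bar> \<le> m * 1" unfolding D1_def abs_mult[of m] using km0 by (intro mult_mono) auto
    then show ?thesis using km0 by (simp add: C_def)
  qed
  \<comment> \<open>Half a period: the cosine is -1, so D x0 = 1 + exp (- c * x0).\<close>
  define x0 where "x0 = pi / w"
  have x0: "0 < x0" using w by (simp add: x0_def)
  have Dx0: "1 < D x0" using w(1) by (simp add: D_def x0_def)
  define e where "e = (D x0 - 1) / 2"
  have "0 < e" using Dx0 by (simp add: e_def)
  have "isCont D x0" using D DERIV_isCont by blast
  then obtain \<delta> where \<delta>: "0 < \<delta>" "\<And>x. \<bar>x - x0\<bar> < \<delta> \<Longrightarrow> \<bar>D x - D x0\<bar> < e"
    using \<open>0 < e\<close> unfolding continuous_at_eps_delta dist_real_def by metis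
  have Dge: "1 + e \<le> D x" if "x \<in> {x0<..<x0 + \<delta>}" for x
  proof -
    have "\<bar>x - x0\<bar> < \<delta>" using that by simp
    from \<delta>(2)[OF this] have "D x0 - e < D x" by linarith
    moreover have "1 + e = D x0 - e" by (simp add: e_def field_simps)
    ultimately show ?thesis by linarith
  qed
  define I where "I = (\<integral>x. exp (- 1 * x) * bump x0 (x0 + \<delta>) (exp (- x)) * indicator {0<..} x \<partial>lborel)"
  have I: "0 < I" unfolding I_def using x0 \<delta>(1) by (intro bump_integral_pos) auto
  have "continuous_on UNIV D" using D by (meson DERIV_isCont continuous_at_imp_continuous_on)
  then have [measurable]: "D \<in> borel_measurable borel" by (rule borel_measurable_continuous_onI)
  have iI: "integrable lborel (\<lambda>x. exp (- 1 * x) * bump x0 (x0 + \<delta>) (exp (- x)) * indicator {0<..} x)"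
    using x0 \<delta>(1) by (intro integrable_bump[where C=1]) auto
  have lim: "(\<lambda>j. \<integral>x. exp (- 1 * x) * bump x0 (x0 + \<delta>) (exp (- x)) * wave_cdf (X j) x \<partial>lborel)
     \<longlonglongrightarrow> (\<integral>x. exp (- 1 * x) * bump x0 (x0 + \<delta>) (exp (- x)) * (D x * indicator {0<..} x) \<partial>lborel)"
    by (rule wave_weak_limit[OF D D1 _ _ bD bD1 C]) (simp_all add: D_def D1_def)
  have le: "(\<integral>x. exp (- 1 * x) * bump x0 (x0 + \<delta>) (exp (- x)) * wave_cdf (X j) x \<partial>lborel) \<le> I" for j
    unfolding I_def
  proof (intro integral_mono iI integrable_bump[where C=1])
    show "wave_cdf (X j) \<in> borel_measurable borel" by (rule borel_measurable_mono[OF mono_wave_cdf[OF X(1)]])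
    show "exp (- 1 * x) * bump x0 (x0 + \<delta>) (exp (- x)) * wave_cdf (X j) x \<le> exp (- 1 * x) * bump x0 (x0 + \<delta>) (exp (- x)) * indicator {0<..} x" for x
      using wave_cdf_bounds[OF X(1), of j x] wave_cdf_nonpos[OF X(1), of x j]
      by (intro mult_left_mono) (auto simp: bump_nonneg split: split_indicator)
  qed (use wave_cdf_bounds[OF X(1)] wave_cdf_nonpos[OF X(1)] x0 \<delta>(1) in auto)
  have "(1 + e) * I = (\<integral>x. (1 + e) * (exp (- 1 * x) * bump x0 (x0 + \<delta>) (exp (- x)) * indicator {0<..} x) \<partial>lborel)"
    by (simp add: I_def)
  also have "\<dots> \<le> (\<integral>x. exp (- 1 * x) * bump x0 (x0 + \<delta>) (exp (- x)) * (D x * indicator {0<..} x) \<partial>lborel)"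
  proof (intro integral_mono integrable_mult_right iI integrable_bump[where C=C])
    fix x
    show "(1 + e) * (exp (- 1 * x) * bump x0 (x0 + \<delta>) (exp (- x)) * indicator {0<..} x)
        \<le> exp (- 1 * x) * bump x0 (x0 + \<delta>) (exp (- x)) * (D x * indicator {0<..} x)"
    proof (cases "x \<in> {x0<..<x0 + \<delta>}")
      case True
      have "(exp (- 1 * x) * bump x0 (x0 + \<delta>) (exp (- x))) * (1 + e) \<le> (exp (- 1 * x) * bump x0 (x0 + \<delta>) (exp (- x))) * D x"
        using Dge[OF True] by (intro mult_left_mono) (auto simp: bump_nonneg)
      then show ?thesis using True x0 by (simp add: mult_ac)
    next
      case False
      then show ?thesis using bump_eq_0[of x0 "x0 + \<delta>" x] \<delta>(1) by simp
    qed
  qed (use bD x0 \<delta>(1) in auto)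
  also have "\<dots> \<le> I" by (rule LIMSEQ_le_const2[OF lim]) (use le in auto)
  finally have "e * I \<le> 0" by (simp add: distrib_right)
  then show False using mult_pos_pos[OF \<open>0 < e\<close> I] by linarith
qed

text \<open>At c = sqrt 2 the double root - sqrt 2 gives D = 1 - \<open>pi_tail\<close>. Weak
  convergence becomes a pointwise bound because \<open>wave_cdf\<close> is monotone: its value at a
  is at most its average over a short interval to the right of a.\<close>

lemma wave_cdf_limsup:
  assumes a: "0 < a" and e: "0 < e"
  shows "\<forall>\<^sub>F j in sequentially. wave_cdf (X j) a < 1 - pi_tail a + e"
proof -
  define D where "D x = 1 - exp (- sqrt 2 * x) * (1 + sqrt 2 * x)" for x
  define D1 where "D1 x = 2 * x * exp (- sqrt 2 * x)" for x :: real
  have D: "(D has_real_derivative D1 x) (at x)" for x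
  proof -
    have "(D has_real_derivative - ((- sqrt 2) * exp (- sqrt 2 * x) * (1 + sqrt 2 * x) + exp (- sqrt 2 * x) * sqrt 2)) (at x)"
      unfolding D_def by (auto intro!: derivative_eq_intros simp: algebra_simps)
    moreover have "- ((- sqrt 2) * exp (- sqrt 2 * x) * (1 + sqrt 2 * x) + exp (- sqrt 2 * x) * sqrt 2) = D1 x"
      by (simp add: D1_def algebra_simps flip: mult.assoc)
    ultimately show ?thesis by simp
  qed
  have D1: "(D1 has_real_derivative 2 - 2 * c * D1 x - 2 * D x) (at x)" for x
  proof -
    have "(D1 has_real_derivative 2 * exp (- sqrt 2 * x) + 2 * x * ((- sqrt 2) * exp (- sqrt 2 * x))) (at x)"
      unfolding D1_def by (auto intro!: derivative_eq_intros simp: algebra_simps)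
    moreover have "2 * exp (- sqrt 2 * x) + 2 * x * ((- sqrt 2) * exp (- sqrt 2 * x)) = 2 - 2 * c * D1 x - 2 * D x"
      by (simp add: D_def D1_def speed_limit algebra_simps)
    ultimately show ?thesis by simp
  qed
  have ex: "sqrt 2 * x \<le> exp (sqrt 2 * x)" for x
    using exp_ge_add_one_self[of "sqrt 2 * x"] by linarith
  have q: "exp (- sqrt 2 * x) * (1 + sqrt 2 * x) \<le> 1" for x
    using mult_left_mono[OF exp_ge_add_one_self[of "sqrt 2 * x"], of "exp (- sqrt 2 * x)"]
    by (simp flip: exp_add)
  have bD: "\<bar>D x\<bar> \<le> 2" if "0 < x" for x
  proof -
    have "0 \<le> exp (- sqrt 2 * x) * (1 + sqrt 2 * x)" using that by simp
    then show ?thesis using q[of x] unfolding D_def abs_le_iff by simp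
  qed
  have bD1: "\<bar>D1 x\<bar> \<le> 2" if "0 < x" for x
  proof -
    have "x * exp (- sqrt 2 * x) \<le> exp (- sqrt 2 * x) * (1 + sqrt 2 * x)"
    proof -
      have "1 * x \<le> sqrt 2 * x" using that by (intro mult_right_mono) auto
      then have "exp (- sqrt 2 * x) * x \<le> exp (- sqrt 2 * x) * (1 + sqrt 2 * x)" by (intro mult_left_mono) auto
      then show ?thesis by (simp add: mult.commute)
    qed
    also note q
    finally show ?thesis using that by (simp add: D1_def abs_mult)
  qed
  have "continuous_on UNIV D" using D by (meson DERIV_isCont continuous_at_imp_continuous_on)
  then have [measurable]: "D \<in> borel_measurable borel" by (rule borel_measurable_continuous_onI)
  have "isCont D a" using D DERIV_isCont by blast
  moreover have "0 < e / 2" using e by simp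
  ultimately obtain \<delta> where \<delta>: "0 < \<delta>" "\<And>x. \<bar>x - a\<bar> < \<delta> \<Longrightarrow> \<bar>D x - D a\<bar> < e / 2"
    unfolding continuous_at_eps_delta dist_real_def by metis
  have Dle: "D x \<le> D a + e / 2" if "x \<in> {a<..<a + \<delta>}" for x
  proof -
    have "\<bar>x - a\<bar> < \<delta>" using that by simp
    from \<delta>(2)[OF this] show ?thesis by linarith
  qed
  define g where "g x = exp (- 1 * x) * bump a (a + \<delta>) (exp (- x))" for x
  have g0: "0 \<le> g x" for x by (simp add: g_def bump_nonneg)
  define I where "I = (\<integral>x. g x * indicator {0<..} x \<partial>lborel)"
  have I: "0 < I" unfolding I_def g_def using a \<delta>(1) by (intro bump_integral_pos) auto
  have iI: "integrable lborel (\<lambda>x. g x * indicator {0<..} x)"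
    unfolding g_def using a \<delta>(1) by (intro integrable_bump[where C=1]) auto
  have lim: "(\<lambda>j. \<integral>x. g x * wave_cdf (X j) x \<partial>lborel) \<longlonglongrightarrow> (\<integral>x. g x * (D x * indicator {0<..} x) \<partial>lborel)"
    unfolding g_def by (rule wave_weak_limit[OF D D1 _ _ bD bD1]) (simp_all add: D_def D1_def)
  have "(\<integral>x. g x * (D x * indicator {0<..} x) \<partial>lborel) \<le> (\<integral>x. (D a + e / 2) * (g x * indicator {0<..} x) \<partial>lborel)"
  proof (intro integral_mono integrable_mult_right iI)
    show "integrable lborel (\<lambda>x. g x * (D x * indicator {0<..} x))"
      unfolding g_def by (rule integrable_bump[where C=2]) (use bD a \<delta>(1) in auto)
    fix x
    show "g x * (D x * indicator {0<..} x) \<le> (D a + e / 2) * (g x * indicator {0<..} x)"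
    proof (cases "x \<in> {a<..<a + \<delta>}")
      case True
      have "g x * D x \<le> g x * (D a + e / 2)" using Dle[OF True] g0 by (rule mult_left_mono)
      then show ?thesis using True a by (simp add: mult_ac)
    next
      case False
      then show ?thesis using bump_eq_0[of a "a + \<delta>" x] \<delta>(1) by (simp add: g_def)
    qed
  qed
  also have "\<dots> = (D a + e / 2) * I" by (simp add: I_def)
  also have "\<dots> < (D a + e) * I" using I e by simp
  finally have "\<forall>\<^sub>F j in sequentially. (\<integral>x. g x * wave_cdf (X j) x \<partial>lborel) < (D a + e) * I"
    by (rule order_tendstoD(2)[OF lim])
  then show ?thesis
  proof eventually_elim
    case (elim j)
    have "wave_cdf (X j) a * I = (\<integral>x. wave_cdf (X j) a * (g x * indicator {0<..} x) \<partial>lborel)"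
      by (simp add: I_def)
    also have "\<dots> \<le> (\<integral>x. g x * wave_cdf (X j) x \<partial>lborel)"
    proof (intro integral_mono integrable_mult_right iI)
      show "integrable lborel (\<lambda>x. g x * wave_cdf (X j) x)"
        unfolding g_def
        by (rule integrable_bump[where C=1])
           (use wave_cdf_bounds[OF X(1)] wave_cdf_nonpos[OF X(1)] borel_measurable_mono[OF mono_wave_cdf[OF X(1)]] a \<delta>(1) in auto)
      fix x
      show "wave_cdf (X j) a * (g x * indicator {0<..} x) \<le> g x * wave_cdf (X j) x"
      proof (cases "x \<in> {a<..<a + \<delta>}")
        case True
        then have "wave_cdf (X j) a \<le> wave_cdf (X j) x" by (intro monoD[OF mono_wave_cdf[OF X(1)]]) simp
        then have "g x * wave_cdf (X j) a \<le> g x * wave_cdf (X j) x" using g0 by (rule mult_left_mono)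
        then show ?thesis using True a by (simp add: mult_ac)
      next
        case False
        then show ?thesis using bump_eq_0[of a "a + \<delta>" x] \<delta>(1) by (simp add: g_def)
      qed
    qed
    also note elim
    finally have "wave_cdf (X j) a < D a + e" using I by simp
    then show ?case by (simp add: D_def pi_tail_def)
  qed
qed

end

text \<open>The parameters are found in the order: convergent velocities, a small step length d, a
  large number n of steps. Finally z is moved slightly to the right of the front, so that prof d n z
  < 1 holds strictly; this is the room later used for random errors.\<close>

theorem heaviside_profile:
  assumes a: "0 \<le> a" and e: "0 < e"
  shows "\<exists>d n z. 0 < d \<and> d < e \<and> prof d n z < 1 \<and> pi_tail a - e < prof d n (z + a)"
proof -
  define Y where "Y j = inverse (real (Suc j))" for j
  have Y: "0 < Y j" for j by (simp add: Y_def)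
  have Y0: "Y \<longlonglongrightarrow> 0" unfolding Y_def by (rule LIMSEQ_inverse_real_of_nat)
  have "speed (Y j) / Y j \<in> {0..sqrt 2}" for j
    using Y[of j] speed_nonneg[OF Y, of j] speed_le[OF Y, of j] by (auto simp: divide_le_eq)
  then have "\<forall>j. speed (Y j) / Y j \<in> {0..sqrt 2}" by blast
  then obtain c r where r: "strict_mono r" "((\<lambda>j. speed (Y j) / Y j) \<circ> r) \<longlonglongrightarrow> c"
    by (rule seq_compactE[OF compact_imp_seq_compact[OF compact_Icc]])
  interpret vanishing_step "Y \<circ> r" c
    using Y LIMSEQ_subseq_LIMSEQ[OF Y0 r(1)] r(2) by unfold_locales (auto simp: comp_def)
  have "\<forall>\<^sub>F j in sequentially. Y (r j) < e"
    using order_tendstoD(2)[OF LIMSEQ_subseq_LIMSEQ[OF Y0 r(1)] e] by (simp add: comp_def)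
  moreover have "\<forall>\<^sub>F j in sequentially. wave_cdf (Y (r j)) a < 1 - pi_tail a + e"
  proof (cases "a = 0")
    case True
    then show ?thesis using wave_cdf_nonpos[OF Y, of 0] e by (simp add: pi_tail_def)
  next
    case False
    then show ?thesis using wave_cdf_limsup[of a e] a e by simp
  qed
  ultimately have "\<forall>\<^sub>F j in sequentially. Y (r j) < e \<and> wave_cdf (Y (r j)) a < 1 - pi_tail a + e"
    by (rule eventually_conj)
  then obtain j where j: "Y (r j) < e" "wave_cdf (Y (r j)) a < 1 - pi_tail a + e"
    by (auto simp: eventually_sequentially)
  define d where "d = Y (r j)"
  have d: "0 < d" "d < e" using j Y by (auto simp: d_def)
  have "\<forall>\<^sub>F n in sequentially. prof_cdf d n a < 1 - pi_tail a + e"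
    using order_tendstoD(2)[OF wave_cdf_tendsto[OF d(1)] j(2)[folded d_def]] .
  then obtain n where n: "prof_cdf d n a < 1 - pi_tail a + e" by (auto simp: eventually_sequentially)
  define f where "f = front (prof d n)"
  have sat: "saturated (prof d n)" by (rule saturated_prof[OF d(1)])
  have "pi_tail a - e < prof d n (f + a)" using n by (simp add: prof_cdf_def f_def)
  moreover have "isCont (\<lambda>z. prof d n (z + a)) f"
    using sat by (intro isCont_o2[where g="prof d n" and f="\<lambda>z. z + a"]) (simp_all add: saturated_def)
  then have "((\<lambda>z. prof d n (z + a)) \<longlongrightarrow> prof d n (f + a)) (at_right f)"
    unfolding isCont_def by (simp add: filterlim_at_split)
  ultimately have "\<forall>\<^sub>F z in at_right f. pi_tail a - e < prof d n (z + a)"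
    using order_tendstoD(1) by blast
  moreover have "\<forall>\<^sub>F z in at_right f. prof d n z < 1"
    using eventually_at_right_less[of f] by eventually_elim (use front_less[OF sat] in \<open>simp add: f_def\<close>)
  ultimately have "\<forall>\<^sub>F z in at_right f. pi_tail a - e < prof d n (z + a) \<and> prof d n z < 1"
    by (rule eventually_conj)
  then obtain z where "pi_tail a - e < prof d n (z + a)" "prof d n z < 1"
    using eventually_happens[of _ "at_right f"] by (auto simp: trivial_limit_at_right_real)
  then show ?thesis using d by blast
qed

section \<open>Measurability and renewal for the particle system\<close>

abbreviation gauss_vec :: "nat \<Rightarrow> (nat \<Rightarrow> real) measure" where
  "gauss_vec N \<equiv> PiM {..<N} (\<lambda>_. std_gauss)"

lemma prob_space_gauss_vec: "prob_space (gauss_vec N)"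
  by (rule prob_space_PiM) (rule gauss.prob_space_axioms)

lemma prob_space_noise_step:
  assumes "0 < N" shows "prob_space (noise_step N)"
  unfolding noise_step_def
  by (intro prob_space_pair prob_space_exponential_density prob_space_gauss_vec prob_space_uniform_count_measure)
     (use assms in auto)

lemma prob_space_noise: "0 < N \<Longrightarrow> prob_space (noise N)"
  unfolding noise_def by (rule prob_space.prob_space_stream_space[OF prob_space_noise_step])

lemma sets_noise_step [measurable_cong]:
  "sets (noise_step N) = sets (borel \<Otimes>\<^sub>M (PiM {..<N} (\<lambda>_. borel) \<Otimes>\<^sub>M count_space {..<N}))"
  unfolding noise_step_def by (intro sets_pair_measure_cong sets_PiM_cong) (auto simp: sets_uniform_count_measure)

lemma sets_state_space [measurable_cong]: "sets (state_space N) = sets (PiM {..<N} (\<lambda>_. borel))"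
  by (simp add: state_space_def)

lemma space_state_space: "x \<in> space (state_space N) \<longleftrightarrow> x \<in> extensional {..<N}"
  by (auto simp: state_space_def space_PiM PiE_def)

lemma measurable_state_component:
  assumes "f \<in> measurable M (state_space N)" "i < N"
  shows "(\<lambda>w. f w i) \<in> borel_measurable M"
  using measurable_compose[OF assms(1)[unfolded state_space_def] measurable_component_singleton[of i]] assms(2) by simp

lemma measurable_diffuse [measurable (raw)]:
  assumes f: "f \<in> measurable M (state_space N)" and s[measurable]: "s \<in> borel_measurable M"
    and z: "z \<in> measurable M (PiM {..<N} (\<lambda>_. borel))"
  shows "(\<lambda>w. diffuse N (f w) (s w) (z w)) \<in> measurable M (state_space N)"
  unfolding diffuse_def state_space_def
proof (rule measurable_restrict)
  fix i assume i: "i \<in> {..<N}"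
  have [measurable]: "(\<lambda>w. f w i) \<in> borel_measurable M" using f i by (intro measurable_state_component) auto
  have [measurable]: "(\<lambda>w. z w i) \<in> borel_measurable M"
    using z i by (intro measurable_state_component[of z M N]) (auto simp: state_space_def)
  show "(\<lambda>w. f w i + sqrt (s w) * z w i) \<in> borel_measurable M" by measurable
qed

lemma leftmost_props:
  assumes "0 < N" shows "leftmost N x < N" "j < N \<Longrightarrow> x (leftmost N x) \<le> x j"
proof -
  have "\<exists>i. i < N \<and> (\<forall>j<N. x i \<le> x j)"
    using ex_min_if_finite[of "x ` {..<N}"] assms by (auto simp: not_less)
  then have "leftmost N x < N \<and> (\<forall>j<N. x (leftmost N x) \<le> x j)"
    unfolding leftmost_def by (rule LeastI_ex)
  then show "leftmost N x < N" "j < N \<Longrightarrow> x (leftmost N x) \<le> x j" by auto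
qed

lemma measurable_leftmost [measurable (raw)]:
  assumes f: "f \<in> measurable M (state_space N)"
  shows "(\<lambda>w. leftmost N (f w)) \<in> measurable M (count_space UNIV)"
  unfolding leftmost_def
proof (rule measurable_Least)
  fix i
  show "Measurable.pred M (\<lambda>w. i < N \<and> (\<forall>j<N. f w i \<le> f w j))"
  proof (cases "i < N")
    case True
    have "Measurable.pred M (\<lambda>w. \<forall>j\<in>{..<N}. f w i \<le> f w j)"
    proof (rule pred_intros_finite)
      fix j assume "j \<in> {..<N}"
      then have [measurable]: "(\<lambda>w. f w i) \<in> borel_measurable M" "(\<lambda>w. f w j) \<in> borel_measurable M"
        using measurable_state_component[OF f] True by auto
      show "Measurable.pred M (\<lambda>w. f w i \<le> f w j)" by measurable
    qed simp
    then show ?thesis by (simp only: True simp_thms Ball_def lessThan_iff)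
  qed simp
qed

lemma branch_extensional:
  assumes "0 < N" "x \<in> extensional {..<N}" shows "branch N x u \<in> extensional {..<N}"
  using assms leftmost_props(1)[of N x] by (auto simp: branch_def extensional_def)

lemma measurable_branch [measurable (raw)]:
  assumes N: "0 < N" and f: "f \<in> measurable M (state_space N)" and u: "u \<in> measurable M (count_space {..<N})"
  shows "(\<lambda>w. branch N (f w) (u w)) \<in> measurable M (state_space N)"
proof -
  have [measurable]: "(\<lambda>w. f w j) \<in> borel_measurable M" if "j < N" for j
    using f that by (rule measurable_state_component)
  have um[measurable]: "u \<in> measurable M (count_space UNIV)"
    using u by (rule measurable_compose) (simp add: measurable_count_space_eq1)
  have uN: "u w < N" if "w \<in> space M" for w using measurable_space[OF u that] by simp
  have fe: "f w \<in> extensional {..<N}" if "w \<in> space M" for w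
    using measurable_space[OF f that] by (simp add: space_state_space)
  have [measurable]: "(\<lambda>w. leftmost N (f w)) \<in> measurable M (count_space UNIV)" by (rule measurable_leftmost[OF f])
  \<comment> \<open>The random index is resolved into a finite sum over its possible values, each
    summand being measurable.\<close>
  have "(\<lambda>w. restrict (\<lambda>i. if i = leftmost N (f w) then (\<Sum>j<N. if u w = j then f w j else 0) else f w i) {..<N}) \<in> measurable M (state_space N)"
    unfolding state_space_def by (rule measurable_restrict) measurable
  also have "?this \<longleftrightarrow> ?thesis"
  proof (rule measurable_cong)
    fix w assume w: "w \<in> space M"
    show "restrict (\<lambda>i. if i = leftmost N (f w) then (\<Sum>j<N. if u w = j then f w j else 0) else f w i) {..<N} = branch N (f w) (u w)"
      using uN[OF w] fe[OF w] leftmost_props(1)[OF N, of "f w"]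
      by (auto simp: branch_def fun_eq_iff extensional_def)
  qed
  finally show ?thesis .
qed

lemma measurable_noise_snth:
  "(\<lambda>\<omega>. \<omega> !! k) \<in> measurable (noise N) (noise_step N)"
  unfolding noise_def by (rule measurable_snth)

lemma measurable_noise_parts [measurable]:
  "(\<lambda>\<omega>. fst (\<omega> !! k)) \<in> borel_measurable (noise N)"
  "(\<lambda>\<omega>. fst (snd (\<omega> !! k))) \<in> measurable (noise N) (PiM {..<N} (\<lambda>_. borel))"
  "(\<lambda>\<omega>. snd (snd (\<omega> !! k))) \<in> measurable (noise N) (count_space {..<N})"
proof -
  have "(\<lambda>\<omega>. \<omega> !! k) \<in> measurable (noise N) (borel \<Otimes>\<^sub>M (PiM {..<N} (\<lambda>_. borel) \<Otimes>\<^sub>M count_space {..<N}))"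
    using measurable_noise_snth[of k N] by (simp add: measurable_cong_sets[OF refl sets_noise_step])
  note m = this
  show "(\<lambda>\<omega>. fst (\<omega> !! k)) \<in> borel_measurable (noise N)" using m by measurable
  show "(\<lambda>\<omega>. fst (snd (\<omega> !! k))) \<in> measurable (noise N) (PiM {..<N} (\<lambda>_. borel))" using m by measurable
  show "(\<lambda>\<omega>. snd (snd (\<omega> !! k))) \<in> measurable (noise N) (count_space {..<N})" using m by measurable
qed

lemma measurable_after_jumps:
  assumes N: "0 < N" and f: "f \<in> measurable M (state_space N)" and g: "g \<in> measurable M (noise N)"
  shows "(\<lambda>w. after_jumps N (f w) (g w) k) \<in> measurable M (state_space N)"
proof (induction k)
  case (Suc k)
  note [measurable] = Suc measurable_compose[OF g measurable_noise_parts(1)]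
    measurable_compose[OF g measurable_noise_parts(2)] measurable_compose[OF g measurable_noise_parts(3)]
  have "(\<lambda>w. branch N (diffuse N (after_jumps N (f w) (g w) k) (fst (g w !! k)) (fst (snd (g w !! k)))) (snd (snd (g w !! k)))) \<in> measurable M (state_space N)"
    using N by measurable
  then show ?case by (simp add: case_prod_beta)
qed (use f in simp)

lemma measurable_jump_time [measurable]: "(\<lambda>\<omega>. jump_time \<omega> k) \<in> borel_measurable (noise N)"
  unfolding jump_time_def by measurable

lemma measurable_num_jumps [measurable]: "(\<lambda>\<omega>. num_jumps t \<omega>) \<in> measurable (noise N) (count_space UNIV)"
  unfolding num_jumps_def by measurable

lemma measurable_NBBM:
  assumes N: "0 < N" and f: "f \<in> measurable M (state_space N)" and g: "g \<in> measurable M (noise N)"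
  shows "(\<lambda>w. NBBM N (f w) t (g w)) \<in> measurable M (state_space N)"
proof -
  note [measurable] = f measurable_after_jumps[OF N f g]
    measurable_compose[OF g measurable_noise_parts(2)] measurable_compose[OF g measurable_jump_time]
    measurable_compose[OF g measurable_num_jumps]
  show ?thesis
    unfolding NBBM_def Let_def
  proof (rule measurable_compose_countable[where g="\<lambda>w. num_jumps t (g w)"])
    show "(\<lambda>w. diffuse N (after_jumps N (f w) (g w) k) (t - jump_time (g w) k) (fst (snd (g w !! k)))) \<in> measurable M (state_space N)" for k
      by measurable
  qed measurable
qed

lemma measurable_recentre:
  assumes N: "0 < N" shows "recentre N \<in> measurable (state_space N) (state_space N)"
proof -
  have "Min (x ` {..<N}) = x (leftmost N x)" for x :: "nat \<Rightarrow> real"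
    using leftmost_props[OF N, where x=x] by (intro Min_eqI) auto
  then have "recentre N = (\<lambda>x. restrict (\<lambda>i. x i - (\<Sum>j<N. if leftmost N x = j then x j else 0)) {..<N})"
    using leftmost_props(1)[OF N] by (auto simp: recentre_def fun_eq_iff)
  moreover have "(\<lambda>x. restrict (\<lambda>i. x i - (\<Sum>j<N. if leftmost N x = j then x j else 0)) {..<N}) \<in> measurable (state_space N) (state_space N)"
  proof -
    have [measurable]: "(\<lambda>x. x j) \<in> borel_measurable (state_space N)" if "j < N" for j
      using that by (intro measurable_state_component[where f="\<lambda>x. x"]) auto
    have [measurable]: "(\<lambda>x. leftmost N x) \<in> measurable (state_space N) (count_space UNIV)"
      by (rule measurable_leftmost) simp
    show ?thesis unfolding state_space_def[of N]
      by (rule measurable_restrict) (unfold state_space_def[symmetric], measurable)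
  qed
  ultimately show ?thesis by simp
qed

section \<open>Shifting the noise, and renewal at the first branching event\<close>

lemma jump_time_Stream:
  "jump_time (s ## \<omega>) 0 = 0" "jump_time (s ## \<omega>) (Suc k) = fst s + jump_time \<omega> k"
  by (simp_all add: jump_time_def sum.lessThan_Suc_shift del: sum.lessThan_Suc)

lemma after_jumps_Stream:
  "after_jumps N x ((\<tau>, z, u) ## \<omega>) (Suc k) = after_jumps N (branch N (diffuse N x \<tau> z) u) \<omega> k"
  by (induction k) simp_all

text \<open>One of the first k branching events happens after t, so that the state at time t depends
  on finitely many entries of the noise. Only if this holds for some k is the \<open>LEAST\<close>
  in \<open>num_jumps\<close> meaningful.\<close>

definition jumps_before :: "nat \<Rightarrow> real \<Rightarrow> (real \<times> (nat \<Rightarrow> real) \<times> nat) stream \<Rightarrow> bool" where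
  "jumps_before k t \<omega> \<longleftrightarrow> (\<exists>j<k. t < jump_time \<omega> (Suc j))"

lemma jumps_before_0: "\<not> jumps_before 0 t \<omega>"
  by (simp add: jumps_before_def)

lemma jumps_before_Stream:
  "jumps_before (Suc k) t ((\<tau>, z, u) ## \<omega>) \<longleftrightarrow> t < \<tau> \<or> jumps_before k (t - \<tau>) \<omega>"
  unfolding jumps_before_def
  by (simp add: Ex_less_Suc2 jump_time_Stream jump_time_def[of _ 0] diff_less_eq add.commute)

lemma NBBM_Stream_less:
  "t < \<tau> \<Longrightarrow> NBBM N x t ((\<tau>, z, u) ## \<omega>) = diffuse N x t z"
proof -
  assume "t < \<tau>"
  then have "num_jumps t ((\<tau>, z, u) ## \<omega>) = 0"
    unfolding num_jumps_def by (intro Least_eq_0) (simp add: jump_time_Stream jump_time_def[of _ 0])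
  then show ?thesis by (simp add: NBBM_def jump_time_Stream)
qed

text \<open>Renewal: from the first event on, the system restarts with the remaining noise. The
  second assumption makes the least index well defined on both sides.\<close>

lemma NBBM_Stream_ge:
  assumes "\<not> t < \<tau>" "jumps_before k (t - \<tau>) \<omega>"
  shows "NBBM N x t ((\<tau>, z, u) ## \<omega>) = NBBM N (branch N (diffuse N x \<tau> z) u) (t - \<tau>) \<omega>"
proof -
  let ?P = "\<lambda>k. t < jump_time ((\<tau>, z, u) ## \<omega>) (Suc k)"
  obtain j where j: "t - \<tau> < jump_time \<omega> (Suc j)" using assms(2) by (auto simp: jumps_before_def)
  have "?P (Suc j)" using j by (simp add: jump_time_Stream)
  moreover have "\<not> ?P 0" using assms(1) by (simp add: jump_time_Stream jump_time_def[of _ 0])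
  ultimately have "(LEAST k. ?P k) = Suc (LEAST m. ?P (Suc m))" by (rule Least_Suc)
  then have "num_jumps t ((\<tau>, z, u) ## \<omega>) = Suc (num_jumps (t - \<tau>) \<omega>)"
    by (simp add: num_jumps_def jump_time_Stream less_diff_eq[symmetric] diff_less_eq add.commute)
  then show ?thesis
    by (simp add: NBBM_def after_jumps_Stream jump_time_Stream Let_def algebra_simps del: after_jumps.simps)
qed

lemma nn_integral_noise_step:
  assumes N: "0 < N" and g: "g \<in> borel_measurable (noise_step N)"
  shows "(\<integral>\<^sup>+s. g s \<partial>noise_step N)
    = (\<integral>\<^sup>+\<tau>. ennreal (exponential_density (real N) \<tau>) * (\<integral>\<^sup>+z. (\<Sum>u<N. ennreal (1 / N) * g (\<tau>, z, u)) \<partial>gauss_vec N) \<partial>lborel)"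
proof -
  let ?E = "density lborel (exponential_density (real N))" and ?U = "uniform_count_measure {..<N}"
  interpret U: prob_space ?U using N by (intro prob_space_uniform_count_measure) auto
  interpret V: prob_space "gauss_vec N" by (rule prob_space_gauss_vec)
  interpret VU: prob_space "gauss_vec N \<Otimes>\<^sub>M ?U"
    by (intro prob_space_pair V.prob_space_axioms U.prob_space_axioms)
  have gm: "g \<in> borel_measurable (?E \<Otimes>\<^sub>M (gauss_vec N \<Otimes>\<^sub>M ?U))" using g by (simp add: noise_step_def)
  have gE: "(\<lambda>\<tau>. \<integral>\<^sup>+w. g (\<tau>, w) \<partial>(gauss_vec N \<Otimes>\<^sub>M ?U)) \<in> borel_measurable ?E"
    using gm by (rule VU.borel_measurable_nn_integral_fst)
  have "(\<integral>\<^sup>+s. g s \<partial>noise_step N) = (\<integral>\<^sup>+\<tau>. \<integral>\<^sup>+w. g (\<tau>, w) \<partial>(gauss_vec N \<Otimes>\<^sub>M ?U) \<partial>?E)"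
    unfolding noise_step_def using gm by (rule VU.nn_integral_fst[symmetric])
  also have "\<dots> = (\<integral>\<^sup>+\<tau>. ennreal (exponential_density (real N) \<tau>) * (\<integral>\<^sup>+w. g (\<tau>, w) \<partial>(gauss_vec N \<Otimes>\<^sub>M ?U)) \<partial>lborel)"
    using gE by (intro nn_integral_density) auto
  also have "\<dots> = (\<integral>\<^sup>+\<tau>. ennreal (exponential_density (real N) \<tau>) * (\<integral>\<^sup>+z. (\<Sum>u<N. ennreal (1 / N) * g (\<tau>, z, u)) \<partial>gauss_vec N) \<partial>lborel)"
  proof (intro nn_integral_cong arg_cong2[where f="(*)"] refl)
    fix \<tau> :: real
    have gt: "(\<lambda>w. g (\<tau>, w)) \<in> borel_measurable (gauss_vec N \<Otimes>\<^sub>M ?U)"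
      using gm by (rule measurable_Pair2) simp
    have "(\<integral>\<^sup>+w. g (\<tau>, w) \<partial>(gauss_vec N \<Otimes>\<^sub>M ?U)) = (\<integral>\<^sup>+z. \<integral>\<^sup>+u. g (\<tau>, z, u) \<partial>?U \<partial>gauss_vec N)"
      using U.nn_integral_fst[OF gt] by simp
    also have "\<dots> = (\<integral>\<^sup>+z. (\<Sum>u<N. ennreal (1 / N) * g (\<tau>, z, u)) \<partial>gauss_vec N)"
      unfolding uniform_count_measure_def by (simp add: nn_integral_point_measure_finite)
    finally show "(\<integral>\<^sup>+w. g (\<tau>, w) \<partial>(gauss_vec N \<Otimes>\<^sub>M ?U)) = (\<integral>\<^sup>+z. (\<Sum>u<N. ennreal (1 / N) * g (\<tau>, z, u)) \<partial>gauss_vec N)" .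
  qed
  finally show ?thesis .
qed

lemma AE_noise_step_nonneg:
  assumes N: "0 < N" shows "AE s in noise_step N. 0 \<le> fst s"
proof -
  interpret prob_space "noise_step N" by (rule prob_space_noise_step[OF N])
  have [measurable]: "fst \<in> borel_measurable (noise_step N)" by measurable
  have "(\<integral>\<^sup>+s. indicator {s \<in> space (noise_step N). fst s < 0} s \<partial>noise_step N) = emeasure (noise_step N) {s \<in> space (noise_step N). fst s < 0}"
    by (intro nn_integral_indicator) measurable
  then have "emeasure (noise_step N) {s \<in> space (noise_step N). fst s < 0} = (\<integral>\<^sup>+s. indicator {..<0} (fst s) \<partial>noise_step N)"
    by (subst (asm) nn_integral_cong[where v="\<lambda>s. indicator {..<0} (fst s)"]) (auto split: split_indicator)
  also have "\<dots> = (\<integral>\<^sup>+\<tau>. ennreal (exponential_density (real N) \<tau>)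
      * (\<integral>\<^sup>+z. (\<Sum>u<N. ennreal (1 / N) * indicator {..<0} (fst (\<tau>, z, u))) \<partial>gauss_vec N) \<partial>lborel)"
    by (rule nn_integral_noise_step[OF N]) measurable
  also have "\<dots> = (\<integral>\<^sup>+\<tau>. 0 \<partial>(lborel :: real measure))"
  proof (rule nn_integral_cong)
    fix \<tau> :: real
    show "ennreal (exponential_density (real N) \<tau>)
      * (\<integral>\<^sup>+z. (\<Sum>u<N. ennreal (1 / N) * indicator {..<0} (fst (\<tau>, z, u))) \<partial>gauss_vec N) = 0"
      by (cases "\<tau> < 0") (simp_all add: exponential_density_def)
  qed
  finally show ?thesis by (subst AE_iff_measurable) (auto simp: not_le)
qed

lemma nn_integral_exponential_exp:
  assumes N: "0 < N"
  shows "(\<integral>\<^sup>+\<tau>. ennreal (exponential_density (real N) \<tau>) * ennreal (exp (- \<tau>)) \<partial>lborel) = ennreal (real N / (real N + 1))"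
proof -
  define m where "m = real N + 1"
  have m: "0 < m" by (simp add: m_def)
  have "(\<integral>\<^sup>+\<tau>. ennreal (exponential_density (real N) \<tau>) * ennreal (exp (- \<tau>)) \<partial>lborel)
      = (\<integral>\<^sup>+\<tau>. ennreal (real N * exp (- m * \<tau>)) * indicator {0..} \<tau> \<partial>lborel)"
    by (intro nn_integral_cong)
       (auto simp: m_def exponential_density_def ennreal_mult'[symmetric] algebra_simps split: split_indicator simp flip: exp_add)
  also have "\<dots> = ennreal (0 - (- (real N / m) * exp (- m * 0)))"
  proof (rule nn_integral_FTC_atLeast)
    show "((\<lambda>\<tau>. - (real N / m) * exp (- m * \<tau>)) has_real_derivative real N * exp (- m * x)) (at x)" for x :: real
      using m by (auto intro!: derivative_eq_intros)
    show "((\<lambda>\<tau>. - (real N / m) * exp (- m * \<tau>)) \<longlongrightarrow> 0) at_top"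
      using m by real_asymp
  qed (use m in auto)
  finally show ?thesis by (simp add: m_def)
qed

text \<open>Non-explosion: the expectation of exp (- jump_time) is geometric in the number of
  events, with ratio N / (N + 1), so by Markov's inequality the event times almost surely do not all
  stay below t.\<close>

lemma AE_jumps_before:
  assumes N: "0 < N" shows "AE \<omega> in noise N. \<exists>k. jumps_before k t \<omega>"
proof -
  interpret S: prob_space "noise_step N" by (rule prob_space_noise_step[OF N])
  interpret prob_space "noise N" by (rule prob_space_noise[OF N])
  let ?q = "real N / (real N + 1)"
  have q: "0 \<le> ?q" "?q < 1" by auto
  have G: "(\<integral>\<^sup>+\<omega>. ennreal (exp (- jump_time \<omega> k)) \<partial>noise N) = ennreal (?q ^ k)" for k
  proof (induction k)
    case 0
    then show ?case by (simp add: jump_time_def emeasure_space_1)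
  next
    case (Suc k)
    have "(\<integral>\<^sup>+\<omega>. ennreal (exp (- jump_time \<omega> (Suc k))) \<partial>noise N)
        = (\<integral>\<^sup>+s. \<integral>\<^sup>+\<omega>. ennreal (exp (- jump_time (s ## \<omega>) (Suc k))) \<partial>noise N \<partial>noise_step N)"
      unfolding noise_def using measurable_jump_time[of "Suc k" N]
      by (intro S.nn_integral_stream_space) (simp add: noise_def)
    also have "\<dots> = (\<integral>\<^sup>+s. ennreal (exp (- fst s)) * ennreal (?q ^ k) \<partial>noise_step N)"
      by (intro nn_integral_cong)
         (simp add: jump_time_Stream exp_diff exp_minus divide_inverse ennreal_mult' nn_integral_cmult Suc[unfolded exp_minus])
    also have "\<dots> = (\<integral>\<^sup>+s. ennreal (exp (- fst s)) \<partial>noise_step N) * ennreal (?q ^ k)"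
      by (rule nn_integral_multc) measurable
    also have "(\<integral>\<^sup>+s. ennreal (exp (- fst s)) \<partial>noise_step N)
        = (\<integral>\<^sup>+\<tau>. ennreal (exponential_density (real N) \<tau>) * ennreal (exp (- \<tau>)) \<partial>lborel)"
    proof (subst nn_integral_noise_step[OF N])
      interpret V: prob_space "gauss_vec N" by (rule prob_space_gauss_vec)
      have 1: "(\<Sum>u<N. ennreal (1 / N) * ennreal (exp (- \<tau>))) = ennreal (exp (- \<tau>))" for \<tau>
        using N by (simp add: ennreal_of_nat_eq_real_of_nat ennreal_mult'[symmetric])
      show "(\<integral>\<^sup>+\<tau>. ennreal (exponential_density (real N) \<tau>) * (\<integral>\<^sup>+z. (\<Sum>u<N. ennreal (1 / N) * ennreal (exp (- fst (\<tau>, z, u)))) \<partial>gauss_vec N) \<partial>lborel)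
        = (\<integral>\<^sup>+\<tau>. ennreal (exponential_density (real N) \<tau>) * ennreal (exp (- \<tau>)) \<partial>lborel)"
        unfolding fst_conv 1 by (simp add: V.emeasure_space_1)
    qed measurable
    also note nn_integral_exponential_exp[OF N]
    also have "ennreal ?q * ennreal (?q ^ k) = ennreal (?q ^ Suc k)"
      using q by (subst ennreal_mult'[symmetric]) auto
    finally show ?case .
  qed
  have "emeasure (noise N) {\<omega> \<in> space (noise N). \<not> (\<exists>k. jumps_before k t \<omega>)} \<le> ennreal (exp t * ?q ^ Suc k)" for k
  proof -
    have "emeasure (noise N) {\<omega> \<in> space (noise N). \<not> (\<exists>k. jumps_before k t \<omega>)}
        \<le> emeasure (noise N) {\<omega> \<in> space (noise N). ennreal (exp t) * ennreal (exp (- jump_time \<omega> (Suc k))) \<ge> 1}"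
    proof (intro emeasure_mono subsetI)
      fix \<omega> assume w: "\<omega> \<in> {\<omega> \<in> space (noise N). \<not> (\<exists>k. jumps_before k t \<omega>)}"
      then have "\<not> jumps_before (Suc k) t \<omega>" by blast
      then have "jump_time \<omega> (Suc k) \<le> t" unfolding jumps_before_def by (meson lessI not_less)
      then have "1 \<le> exp t * exp (- jump_time \<omega> (Suc k))" by (simp flip: exp_add)
      then show "\<omega> \<in> {\<omega> \<in> space (noise N). ennreal (exp t) * ennreal (exp (- jump_time \<omega> (Suc k))) \<ge> 1}"
        using w by (simp add: ennreal_mult'[symmetric])
    qed measurable
    also have "\<dots> \<le> ennreal (exp t) * (\<integral>\<^sup>+\<omega>. ennreal (exp (- jump_time \<omega> (Suc k))) * indicator (space (noise N)) \<omega> \<partial>noise N)"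
      by (rule nn_integral_Markov_inequality) measurable
    also have "(\<integral>\<^sup>+\<omega>. ennreal (exp (- jump_time \<omega> (Suc k))) * indicator (space (noise N)) \<omega> \<partial>noise N) = ennreal (?q ^ Suc k)"
      unfolding G[symmetric] by (intro nn_integral_cong) simp
    finally show ?thesis by (simp add: ennreal_mult'[symmetric])
  qed
  moreover have "(\<lambda>k. ennreal (exp t * ?q ^ Suc k)) \<longlonglongrightarrow> ennreal (exp t * 0)"
    using q by (intro tendsto_ennrealI tendsto_mult tendsto_const LIMSEQ_Suc LIMSEQ_power_zero) auto
  ultimately have "emeasure (noise N) {\<omega> \<in> space (noise N). \<not> (\<exists>k. jumps_before k t \<omega>)} \<le> 0"
    by (intro LIMSEQ_le_const) auto
  moreover have "{\<omega> \<in> space (noise N). \<not> (\<exists>k. jumps_before k t \<omega>)} \<in> sets (noise N)"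
    unfolding jumps_before_def by measurable
  ultimately show ?thesis by (subst AE_iff_measurable) auto
qed

lemma branch_diffuse_space:
  "0 < N \<Longrightarrow> branch N (diffuse N x s z) u \<in> space (state_space N)"
  by (simp add: space_state_space branch_extensional diffuse_def)

text \<open>Iterates the renewal inequality at the first branching event. Not asking \<open>\<Psi>\<close> to be measurable
  allows infima over subsets of particles.\<close>
lemma NBBM_domination:
  assumes N: "0 < N" and f: "f \<in> borel_measurable (state_space N)"
    and step: "\<And>t x. 0 \<le> t \<Longrightarrow> t \<le> T \<Longrightarrow> x \<in> space (state_space N) \<Longrightarrow>
      (\<integral>\<^sup>+s. (case s of (\<tau>, z, u) \<Rightarrow> if t < \<tau> then f (diffuse N x t z) else \<Psi> (t - \<tau>) (branch N (diffuse N x \<tau> z) u)) \<partial>noise_step N) \<le> \<Psi> t x"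
    and t: "0 \<le> t" "t \<le> T" and x: "x \<in> space (state_space N)"
  shows "(\<integral>\<^sup>+\<omega>. f (NBBM N x t \<omega>) \<partial>noise N) \<le> \<Psi> t x"
proof -
  interpret S: prob_space "noise_step N" by (rule prob_space_noise_step[OF N])
  interpret prob_space "noise N" by (rule prob_space_noise[OF N])
  have fm: "(\<lambda>\<omega>. f (NBBM N x t \<omega>)) \<in> borel_measurable (noise N)" if "x \<in> space (state_space N)" for x t
    using that by (intro measurable_compose[OF measurable_NBBM[OF N] f]) auto
  have jm: "{\<omega> \<in> space (noise N). jumps_before k t \<omega>} \<in> sets (noise N)" for k t
    unfolding jumps_before_def by measurable
  \<comment> \<open>Truncation to the noise with an event beyond t among the first k. Splitting off
    the first event lowers k by one, which makes an induction possible; monotone convergence removes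
    the truncation.\<close>
  let ?I = "\<lambda>k t \<omega>. indicator {\<omega> \<in> space (noise N). jumps_before k t \<omega>} \<omega> :: ennreal"
  have IM: "(\<lambda>\<omega>. f (NBBM N x t \<omega>) * ?I k t \<omega>) \<in> borel_measurable (noise N)" if "x \<in> space (state_space N)" for x t k
    using fm[OF that] jm by measurable
  have k: "(\<integral>\<^sup>+\<omega>. f (NBBM N x t \<omega>) * ?I k t \<omega> \<partial>noise N) \<le> \<Psi> t x"
    if "0 \<le> t" "t \<le> T" "x \<in> space (state_space N)" for k t x
    using that
  proof (induction k arbitrary: t x)
    case 0
    then show ?case by (simp add: jumps_before_0)
  next
    case (Suc k)
    have "(\<integral>\<^sup>+\<omega>. f (NBBM N x t \<omega>) * ?I (Suc k) t \<omega> \<partial>noise N)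
        = (\<integral>\<^sup>+s. \<integral>\<^sup>+\<omega>. f (NBBM N x t (s ## \<omega>)) * ?I (Suc k) t (s ## \<omega>) \<partial>noise N \<partial>noise_step N)"
      using IM[OF Suc.prems(3), of t "Suc k"] unfolding noise_def by (rule S.nn_integral_stream_space)
    also have "\<dots> \<le> (\<integral>\<^sup>+s. (case s of (\<tau>, z, u) \<Rightarrow> if t < \<tau> then f (diffuse N x t z) else \<Psi> (t - \<tau>) (branch N (diffuse N x \<tau> z) u)) \<partial>noise_step N)"
    proof (rule nn_integral_mono_AE)
      show "AE s in noise_step N. (\<integral>\<^sup>+\<omega>. f (NBBM N x t (s ## \<omega>)) * ?I (Suc k) t (s ## \<omega>) \<partial>noise N)
          \<le> (case s of (\<tau>, z, u) \<Rightarrow> if t < \<tau> then f (diffuse N x t z) else \<Psi> (t - \<tau>) (branch N (diffuse N x \<tau> z) u))"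
        using AE_noise_step_nonneg[OF N] AE_space
      proof eventually_elim
        case (elim s)
        obtain \<tau> z u where s: "s = (\<tau>, z, u)" by (cases s)
        have sp: "(s ## \<omega>) \<in> space (noise N)" if "\<omega> \<in> space (noise N)" for \<omega>
          using elim(2) that by (simp add: noise_def stream_space_Stream)
        show ?case
        proof (cases "t < \<tau>")
          case True
          have "(\<integral>\<^sup>+\<omega>. f (NBBM N x t (s ## \<omega>)) * ?I (Suc k) t (s ## \<omega>) \<partial>noise N)
              \<le> (\<integral>\<^sup>+\<omega>. f (diffuse N x t z) \<partial>noise N)"
            using True by (intro nn_integral_mono) (auto simp: s NBBM_Stream_less split: split_indicator)
          then show ?thesis using True by (simp add: s emeasure_space_1)
        next
          case False
          let ?x = "branch N (diffuse N x \<tau> z) u"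
          have "(\<integral>\<^sup>+\<omega>. f (NBBM N x t (s ## \<omega>)) * ?I (Suc k) t (s ## \<omega>) \<partial>noise N)
              = (\<integral>\<^sup>+\<omega>. f (NBBM N ?x (t - \<tau>) \<omega>) * ?I k (t - \<tau>) \<omega> \<partial>noise N)"
          proof (rule nn_integral_cong)
            fix \<omega> assume w: "\<omega> \<in> space (noise N)"
            show "f (NBBM N x t (s ## \<omega>)) * ?I (Suc k) t (s ## \<omega>) = f (NBBM N ?x (t - \<tau>) \<omega>) * ?I k (t - \<tau>) \<omega>"
              using False w sp[OF w] NBBM_Stream_ge[OF False, of k \<omega> N x z u]
              by (cases "jumps_before k (t - \<tau>) \<omega>") (simp_all add: s jumps_before_Stream)
          qed
          also have "\<dots> \<le> \<Psi> (t - \<tau>) ?x"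
            using False elim(1) Suc.prems by (intro Suc.IH branch_diffuse_space N) (auto simp: s)
          finally show ?thesis using False by (simp add: s)
        qed
      qed
    qed
    also have "\<dots> \<le> \<Psi> t x" by (rule step[OF Suc.prems])
    finally show ?case .
  qed
  have "(\<integral>\<^sup>+\<omega>. f (NBBM N x t \<omega>) \<partial>noise N) = (\<integral>\<^sup>+\<omega>. (SUP k. f (NBBM N x t \<omega>) * ?I k t \<omega>) \<partial>noise N)"
  proof (rule nn_integral_cong_AE)
    show "AE \<omega> in noise N. f (NBBM N x t \<omega>) = (SUP k. f (NBBM N x t \<omega>) * ?I k t \<omega>)"
      using AE_jumps_before[OF N, of t] AE_space
    proof eventually_elim
      case (elim \<omega>)
      then obtain k where k: "jumps_before k t \<omega>" by blast
      show ?case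
      proof (rule antisym)
        show "f (NBBM N x t \<omega>) \<le> (SUP k. f (NBBM N x t \<omega>) * ?I k t \<omega>)"
          using k elim(2) by (intro SUP_upper2[of k]) auto
        show "(SUP k. f (NBBM N x t \<omega>) * ?I k t \<omega>) \<le> f (NBBM N x t \<omega>)"
          by (intro SUP_least) (auto split: split_indicator)
      qed
    qed
  qed
  also have "\<dots> = (SUP k. \<integral>\<^sup>+\<omega>. f (NBBM N x t \<omega>) * ?I k t \<omega> \<partial>noise N)"
  proof (rule nn_integral_monotone_convergence_SUP)
    show "incseq (\<lambda>k \<omega>. f (NBBM N x t \<omega>) * ?I k t \<omega>)"
      by (intro incseq_SucI le_funI mult_left_mono)
         (auto simp: jumps_before_def split: split_indicator intro: less_SucI)
  qed (rule IM[OF x])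
  also have "\<dots> \<le> \<Psi> t x" by (intro SUP_least k t x)
  finally show ?thesis .
qed

text \<open>The one-event image of a supersolution lies below it and is therefore a supersolution
  too. This permits a sharper estimate at the first event than at the later ones.\<close>

lemma NBBM_first_event:
  assumes N: "0 < N" and f: "f \<in> borel_measurable (state_space N)"
    and dom: "\<And>t x. 0 \<le> t \<Longrightarrow> t \<le> T \<Longrightarrow> x \<in> space (state_space N) \<Longrightarrow>
      (\<integral>\<^sup>+s. (case s of (\<tau>, z, u) \<Rightarrow> if t < \<tau> then f (diffuse N x t z) else \<Psi> (t - \<tau>) (branch N (diffuse N x \<tau> z) u)) \<partial>noise_step N) \<le> \<Psi> t x"
    and t: "0 \<le> t" "t \<le> T" and x: "x \<in> space (state_space N)"
  shows "(\<integral>\<^sup>+\<omega>. f (NBBM N x t \<omega>) \<partial>noise N)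
    \<le> (\<integral>\<^sup>+s. (case s of (\<tau>, z, u) \<Rightarrow> if t < \<tau> then f (diffuse N x t z) else \<Psi> (t - \<tau>) (branch N (diffuse N x \<tau> z) u)) \<partial>noise_step N)"
proof -
  define \<Phi> where "\<Phi> t x = (\<integral>\<^sup>+s. (case s of (\<tau>, z, u) \<Rightarrow> if t < \<tau> then f (diffuse N x t z) else \<Psi> (t - \<tau>) (branch N (diffuse N x \<tau> z) u)) \<partial>noise_step N)" for t x
  have "(\<integral>\<^sup>+\<omega>. f (NBBM N x t \<omega>) \<partial>noise N) \<le> \<Phi> t x"
  proof (rule NBBM_domination[OF N f _ t x])
    fix t x assume t: "0 \<le> t" "t \<le> T" and x: "x \<in> space (state_space N)"
    show "(\<integral>\<^sup>+s. (case s of (\<tau>, z, u) \<Rightarrow> if t < \<tau> then f (diffuse N x t z) else \<Phi> (t - \<tau>) (branch N (diffuse N x \<tau> z) u)) \<partial>noise_step N) \<le> \<Phi> t x"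
      unfolding \<Phi>_def[of t x]
    proof (rule nn_integral_mono_AE)
      show "AE s in noise_step N. (case s of (\<tau>, z, u) \<Rightarrow> if t < \<tau> then f (diffuse N x t z) else \<Phi> (t - \<tau>) (branch N (diffuse N x \<tau> z) u))
        \<le> (case s of (\<tau>, z, u) \<Rightarrow> if t < \<tau> then f (diffuse N x t z) else \<Psi> (t - \<tau>) (branch N (diffuse N x \<tau> z) u))"
        using AE_noise_step_nonneg[OF N]
      proof eventually_elim
        case (elim s)
        obtain \<tau> z u where s: "s = (\<tau>, z, u)" by (cases s)
        have "\<Phi> (t - \<tau>) (branch N (diffuse N x \<tau> z) u) \<le> \<Psi> (t - \<tau>) (branch N (diffuse N x \<tau> z) u)" if "\<not> t < \<tau>"
          unfolding \<Phi>_def using that elim t by (intro dom branch_diffuse_space[OF N]) (auto simp: s)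
        then show ?case by (simp add: s)
      qed
    qed
  qed
  then show ?thesis by (simp add: \<Phi>_def)
qed

lemma prod_mono_ennreal:
  fixes f g :: "'a \<Rightarrow> ennreal"
  assumes "\<And>i. i \<in> A \<Longrightarrow> f i \<le> g i" shows "prod f A \<le> prod g A"
  using assms by (induction A rule: infinite_finite_induct) (auto intro!: mult_mono)

section \<open>Exponential moments over one time step\<close>

text \<open>The probability that a Brownian motion from x is in A at time r, not that it has visited
  A before.\<close>

definition hit :: "real set \<Rightarrow> real \<Rightarrow> real \<Rightarrow> real" where
  "hit A r x = (\<integral>z. indicator A (x + sqrt r * z) \<partial>std_gauss)"

lemma measurable_hit [measurable (raw)]:
  assumes [measurable]: "A \<in> sets borel" "f \<in> borel_measurable M" "g \<in> borel_measurable M"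
  shows "(\<lambda>w. hit A (f w) (g w)) \<in> borel_measurable M"
  unfolding hit_def by measurable

lemma integrable_hit:
  assumes [measurable]: "A \<in> sets borel"
  shows "integrable std_gauss (\<lambda>z. indicator A (x + sqrt r * z) :: real)"
  by (rule gauss.integrable_const_bound[where B=1]) auto

lemma hit_nonneg: "0 \<le> hit A r x"
  unfolding hit_def by (intro Bochner_Integration.integral_nonneg) simp

lemma hit_le_1:
  assumes "A \<in> sets borel" shows "hit A r x \<le> 1"
proof -
  have "hit A r x \<le> (\<integral>z. 1 \<partial>std_gauss)"
    unfolding hit_def by (intro integral_mono integrable_hit assms) (auto split: split_indicator)
  then show ?thesis by simp
qed

lemma hit_0: "hit A 0 x = indicator A x"
  by (simp add: hit_def)

lemma hit_UNIV: "hit UNIV r x = 1"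
  by (simp add: hit_def)

lemma ennreal_hit:
  assumes "A \<in> sets borel"
  shows "ennreal (hit A r x) = (\<integral>\<^sup>+z. indicator A (x + sqrt r * z) \<partial>std_gauss)"
  unfolding hit_def using nn_integral_eq_integral[OF integrable_hit[OF assms, of x r]]
  by (simp add: ennreal_indicator)

lemma nn_integral_gauss_scale:
  assumes s: "0 < s" and [measurable]: "h \<in> borel_measurable borel"
  shows "(\<integral>\<^sup>+z. h (sqrt s * z) \<partial>std_gauss) = (\<integral>\<^sup>+y. ennreal (normal_density 0 (sqrt s) y) * h y \<partial>lborel)"
proof -
  have e: "normal_density 0 (sqrt s) (sqrt s * z) = std_normal_density z / sqrt s" for z
    using s by (simp add: normal_density_def power_mult_distrib real_sqrt_mult)
  have "(\<integral>\<^sup>+y. ennreal (normal_density 0 (sqrt s) y) * h y \<partial>lborel)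
      = ennreal \<bar>sqrt s\<bar> * (\<integral>\<^sup>+z. ennreal (normal_density 0 (sqrt s) (0 + sqrt s * z)) * h (0 + sqrt s * z) \<partial>lborel)"
    using s by (intro nn_integral_real_affine) auto
  also have "\<dots> = (\<integral>\<^sup>+z. ennreal (sqrt s) * (ennreal (std_normal_density z / sqrt s) * h (sqrt s * z)) \<partial>lborel)"
    using s by (simp add: e nn_integral_cmult)
  also have "\<dots> = (\<integral>\<^sup>+z. ennreal (std_normal_density z) * h (sqrt s * z) \<partial>lborel)"
    using s by (intro nn_integral_cong) (simp add: mult.assoc[symmetric] ennreal_mult'[symmetric])
  also have "\<dots> = (\<integral>\<^sup>+z. h (sqrt s * z) \<partial>std_gauss)"
    by (intro nn_integral_density[symmetric]) auto
  finally show ?thesis by simp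
qed

text \<open>Semigroup property of the Gaussian kernels. Degenerate variances have no density and are
  treated apart.\<close>

lemma nn_integral_gauss_add:
  assumes r: "0 \<le> r" and s: "0 \<le> s" and [measurable]: "g \<in> borel_measurable borel"
  shows "(\<integral>\<^sup>+z. \<integral>\<^sup>+w. g (sqrt s * z + sqrt r * w) \<partial>std_gauss \<partial>std_gauss) = (\<integral>\<^sup>+z. g (sqrt (s + r) * z) \<partial>std_gauss)"
proof (cases "r = 0 \<or> s = 0")
  case True
  have "emeasure std_gauss UNIV = 1" using gauss.emeasure_space_1 by simp
  then show ?thesis using True by auto
next
  case False
  then have r: "0 < r" and s: "0 < s" using assms by auto
  let ?nd = "\<lambda>s y. normal_density 0 (sqrt s) y"
  have "(\<integral>\<^sup>+z. \<integral>\<^sup>+w. g (sqrt s * z + sqrt r * w) \<partial>std_gauss \<partial>std_gauss)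
      = (\<integral>\<^sup>+z. \<integral>\<^sup>+w. ennreal (?nd r w) * g (sqrt s * z + w) \<partial>lborel \<partial>std_gauss)"
    by (intro nn_integral_cong nn_integral_gauss_scale r) measurable
  also have "\<dots> = (\<integral>\<^sup>+y. ennreal (?nd s y) * (\<integral>\<^sup>+w. ennreal (?nd r w) * g (y + w) \<partial>lborel) \<partial>lborel)"
    by (rule nn_integral_gauss_scale[OF s]) measurable
  also have "\<dots> = (\<integral>\<^sup>+y. \<integral>\<^sup>+v. ennreal (?nd s y) * (ennreal (?nd r (v - y)) * g v) \<partial>lborel \<partial>lborel)"
  proof (intro nn_integral_cong)
    fix y :: real
    have "(\<integral>\<^sup>+v. ennreal (?nd r (v - y)) * g v \<partial>lborel)
        = ennreal \<bar>1\<bar> * (\<integral>\<^sup>+w. ennreal (?nd r (y + 1 * w - y)) * g (y + 1 * w) \<partial>lborel)"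
      by (rule nn_integral_real_affine) auto
    then show "ennreal (?nd s y) * (\<integral>\<^sup>+w. ennreal (?nd r w) * g (y + w) \<partial>lborel)
        = (\<integral>\<^sup>+v. ennreal (?nd s y) * (ennreal (?nd r (v - y)) * g v) \<partial>lborel)"
      by (simp add: nn_integral_cmult)
  qed
  also have "\<dots> = (\<integral>\<^sup>+v. \<integral>\<^sup>+y. ennreal (?nd s y) * (ennreal (?nd r (v - y)) * g v) \<partial>lborel \<partial>lborel)"
    by (rule lborel_pair.Fubini') measurable
  also have "\<dots> = (\<integral>\<^sup>+v. (\<integral>\<^sup>+y. ennreal (?nd r (v - y) * ?nd s y) \<partial>lborel) * g v \<partial>lborel)"
  proof (intro nn_integral_cong)
    fix v :: real
    have "(\<integral>\<^sup>+y. ennreal (?nd s y) * (ennreal (?nd r (v - y)) * g v) \<partial>lborel)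
        = (\<integral>\<^sup>+y. ennreal (?nd r (v - y) * ?nd s y) * g v \<partial>lborel)"
      by (intro nn_integral_cong) (simp add: ennreal_mult' mult_ac)
    also have "\<dots> = (\<integral>\<^sup>+y. ennreal (?nd r (v - y) * ?nd s y) \<partial>lborel) * g v"
      by (rule nn_integral_multc) measurable
    finally show "(\<integral>\<^sup>+y. ennreal (?nd s y) * (ennreal (?nd r (v - y)) * g v) \<partial>lborel)
        = (\<integral>\<^sup>+y. ennreal (?nd r (v - y) * ?nd s y) \<partial>lborel) * g v" .
  qed
  also have "\<dots> = (\<integral>\<^sup>+v. ennreal (?nd (s + r) v) * g v \<partial>lborel)"
  proof (intro nn_integral_cong arg_cong2[where f="(*)"] refl)
    fix v :: real
    have "(\<lambda>x. \<integral>\<^sup>+y. ennreal (?nd r (x - y) * ?nd s y) \<partial>lborel) = normal_density 0 (sqrt ((sqrt r)\<^sup>2 + (sqrt s)\<^sup>2))"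
      using r s by (intro conv_normal_density_zero_mean) auto
    from fun_cong[OF this, of v] show "(\<integral>\<^sup>+y. ennreal (?nd r (v - y) * ?nd s y) \<partial>lborel) = ennreal (?nd (s + r) v)"
      using r s by (simp add: add.commute)
  qed
  also have "\<dots> = (\<integral>\<^sup>+z. g (sqrt (s + r) * z) \<partial>std_gauss)"
    using r s by (intro nn_integral_gauss_scale[symmetric]) auto
  finally show ?thesis .
qed

lemma nn_integral_hit:
  assumes A[measurable]: "A \<in> sets borel" and r: "0 \<le> r" and s: "0 \<le> s"
  shows "(\<integral>\<^sup>+z. ennreal (hit A r (x + sqrt s * z)) \<partial>std_gauss) = ennreal (hit A (s + r) x)"
  using nn_integral_gauss_add[OF r s, of "\<lambda>y. indicator A (x + y)"]
  by (simp add: ennreal_hit[OF A] add.assoc)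

lemma integral_hit:
  assumes A[measurable]: "A \<in> sets borel" and r: "0 \<le> r" and s: "0 \<le> s"
  shows "integrable std_gauss (\<lambda>z. hit A r (x + sqrt s * z))"
    and "(\<integral>z. hit A r (x + sqrt s * z) \<partial>std_gauss) = hit A (s + r) x"
proof -
  show "integrable std_gauss (\<lambda>z. hit A r (x + sqrt s * z))"
    by (rule gauss.integrable_const_bound[where B=1]) (auto simp: hit_nonneg hit_le_1)
  show "(\<integral>z. hit A r (x + sqrt s * z) \<partial>std_gauss) = hit A (s + r) x"
    by (subst integral_eq_nn_integral) (auto simp: hit_nonneg nn_integral_hit[OF assms])
qed

text \<open>\<open>yule C\<close> solves the Riccati equation of the generating function of a rate one Yule process.\<close>
definition yule :: "real \<Rightarrow> real \<Rightarrow> real" where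
  "yule C r = C * exp r / (1 - C * exp r)"

lemma yule_add_1: "C * exp r < 1 \<Longrightarrow> 1 + yule C r = 1 / (1 - C * exp r)"
  by (simp add: yule_def field_simps)

lemma yule_gt: "C * exp r < 1 \<Longrightarrow> 0 < 1 + yule C r"
  by (simp add: yule_add_1)

lemma measurable_yule [measurable]: "yule C \<in> borel_measurable borel"
  unfolding yule_def by measurable

lemma DERIV_yule:
  assumes "C * exp r < 1"
  shows "(yule C has_real_derivative yule C r * (1 + yule C r)) (at r)"
proof -
  have "((\<lambda>r. C * exp r / (1 - C * exp r)) has_real_derivative
     (C * exp r * (1 - C * exp r) - C * exp r * (- (C * exp r))) / ((1 - C * exp r) * (1 - C * exp r))) (at r)"
    using assms by (auto intro!: derivative_eq_intros)
  moreover have "(C * exp r * (1 - C * exp r) - C * exp r * (- (C * exp r))) / ((1 - C * exp r) * (1 - C * exp r)) = yule C r * (1 + yule C r)"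
    unfolding yule_add_1[OF assms] by (simp add: yule_def algebra_simps)
  ultimately show ?thesis by (simp add: yule_def[abs_def])
qed

text \<open>Without selection, the generating function u of the number of descendants in A solves u'
  = u_xx / 2 + u^2 - u. With a = \<open>yule\<close> and h = \<open>hit\<close> one has a' = a * (1
  + a), and since h^2 \<le> h the expression 1 + a * h is a supersolution, whatever the sign of
  C.\<close>

definition yule_hit :: "real \<Rightarrow> real set \<Rightarrow> real \<Rightarrow> real \<Rightarrow> real" where
  "yule_hit C A r x = 1 + yule C r * hit A r x"

lemma measurable_yule_hit [measurable (raw)]:
  assumes [measurable]: "A \<in> sets borel" "f \<in> borel_measurable M" "g \<in> borel_measurable M"
  shows "(\<lambda>w. yule_hit C A (f w) (g w)) \<in> borel_measurable M"
  unfolding yule_hit_def by measurable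

lemma one_plus_mult_pos:
  fixes a y :: real assumes "0 < 1 + a" "0 \<le> y" "y \<le> 1" shows "0 < 1 + a * y"
proof (cases "0 \<le> a")
  case True then show ?thesis using assms by (intro add_pos_nonneg) auto
next
  case False
  then have "a * 1 \<le> a * y" using assms by (intro mult_left_mono_neg) auto
  then show ?thesis using assms by simp
qed

lemma yule_hit_pos:
  assumes "C * exp r < 1" "A \<in> sets borel" shows "0 < yule_hit C A r x"
  unfolding yule_hit_def using assms by (intro one_plus_mult_pos yule_gt hit_nonneg hit_le_1)

lemma nn_integral_yule_hit:
  assumes C: "C * exp r < 1" and A[measurable]: "A \<in> sets borel" and r: "0 \<le> r" and s: "0 \<le> s"
  shows "(\<integral>\<^sup>+z. ennreal (yule_hit C A r (x + sqrt s * z)) \<partial>std_gauss) = ennreal (1 + yule C r * hit A (s + r) x)"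
proof -
  have "(\<integral>\<^sup>+z. ennreal (yule_hit C A r (x + sqrt s * z)) \<partial>std_gauss) = ennreal (\<integral>z. yule_hit C A r (x + sqrt s * z) \<partial>std_gauss)"
    unfolding yule_hit_def using yule_hit_pos[OF C A] integral_hit(1)[OF A r s]
    by (intro nn_integral_eq_integral) (auto simp: yule_hit_def less_imp_le)
  also have "(\<integral>z. yule_hit C A r (x + sqrt s * z) \<partial>std_gauss) = 1 + yule C r * hit A (s + r) x"
    unfolding yule_hit_def using integral_hit[OF A r s] by simp
  finally show ?thesis .
qed

text \<open>A branching particle contributes a square, and h^2 \<le> h makes it linear in h. The
  bound is the value 1 + a * y with y frozen plus its time derivative a * (1 + a) * y.\<close>

lemma nn_integral_yule_hit_square_le:
  fixes x :: real
  assumes C: "C * exp r < 1" and A[measurable]: "A \<in> sets borel" and r: "0 \<le> r" and s: "0 \<le> s"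
  defines "y \<equiv> hit A (s + r) x"
  shows "(\<integral>\<^sup>+z. ennreal (yule_hit C A r (x + sqrt s * z) * yule_hit C A r (x + sqrt s * z)) \<partial>std_gauss)
    \<le> ennreal ((1 + yule C r * y) + yule C r * (1 + yule C r) * y)"
proof -
  let ?a = "yule C r"
  let ?h = "\<lambda>z. hit A r (x + sqrt s * z)"
  have "(\<integral>\<^sup>+z. ennreal (yule_hit C A r (x + sqrt s * z) * yule_hit C A r (x + sqrt s * z)) \<partial>std_gauss)
      \<le> (\<integral>\<^sup>+z. ennreal (1 + (2 * ?a + ?a\<^sup>2) * ?h z) \<partial>std_gauss)"
  proof (intro nn_integral_mono ennreal_leI)
    fix z
    have "?h z * ?h z \<le> 1 * ?h z" by (intro mult_right_mono hit_le_1 hit_nonneg A)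
    then have "?a\<^sup>2 * (?h z * ?h z) \<le> ?a\<^sup>2 * ?h z" by (intro mult_left_mono) auto
    then show "yule_hit C A r (x + sqrt s * z) * yule_hit C A r (x + sqrt s * z) \<le> 1 + (2 * ?a + ?a\<^sup>2) * ?h z"
      by (simp add: yule_hit_def algebra_simps power2_eq_square)
  qed
  also have "\<dots> = ennreal (\<integral>z. 1 + (2 * ?a + ?a\<^sup>2) * ?h z \<partial>std_gauss)"
  proof (intro nn_integral_eq_integral AE_I2)
    show "integrable std_gauss (\<lambda>z. 1 + (2 * ?a + ?a\<^sup>2) * ?h z)" using integral_hit(1)[OF A r s] by simp
    fix z
    have "0 < 1 + (2 * ?a + ?a\<^sup>2)"
      using mult_pos_pos[OF yule_gt[OF C] yule_gt[OF C]] by (simp add: algebra_simps power2_eq_square)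
    from one_plus_mult_pos[OF this hit_nonneg hit_le_1[OF A]]
    show "0 \<le> 1 + (2 * ?a + ?a\<^sup>2) * ?h z" by (simp add: less_imp_le)
  qed
  also have "(\<integral>z. 1 + (2 * ?a + ?a\<^sup>2) * ?h z \<partial>std_gauss) = 1 + (2 * ?a + ?a\<^sup>2) * y"
    using integral_hit[OF A r s] by (simp add: y_def)
  finally show ?thesis by (simp add: algebra_simps power2_eq_square)
qed

text \<open>Contribution of particle i at the first event when nobody is removed: the branching
  particle u is counted twice, once for each child.\<close>

definition event_factor :: "real \<Rightarrow> real set \<Rightarrow> real \<Rightarrow> (nat \<Rightarrow> real) \<Rightarrow> real \<Rightarrow> real \<Rightarrow> nat \<Rightarrow> nat \<Rightarrow> real" where
  "event_factor C A t x \<tau> z u i = (if t < \<tau> then yule_hit C A 0 (x i + sqrt t * z)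
      else yule_hit C A (t - \<tau>) (x i + sqrt \<tau> * z) * (if u = i then yule_hit C A (t - \<tau>) (x i + sqrt \<tau> * z) else 1))"

lemma measurable_event_factor:
  assumes R: "R \<subseteq> {..<N}" and [measurable]: "A \<in> sets borel"
  shows "(\<lambda>s. case s of (\<tau>, z, u) \<Rightarrow> (\<Prod>i\<in>R. ennreal (event_factor C A t x \<tau> (z i) u i))) \<in> borel_measurable (noise_step N)"
proof -
  have "(\<lambda>s. \<Prod>i\<in>R. ennreal (event_factor C A t x (fst s) (fst (snd s) i) (snd (snd s)) i)) \<in> borel_measurable (noise_step N)"
  proof (rule borel_measurable_prod_ennreal)
    fix i assume "i \<in> R"
    then have [measurable]: "(\<lambda>s. fst (snd s) i) \<in> borel_measurable (noise_step N)"
      using R by (intro measurable_state_component[of "\<lambda>s. fst (snd s)" _ N]) (auto simp: state_space_def)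
    show "(\<lambda>s. ennreal (event_factor C A t x (fst s) (fst (snd s) i) (snd (snd s)) i)) \<in> borel_measurable (noise_step N)"
      unfolding event_factor_def by measurable
  qed
  then show ?thesis by (simp add: case_prod_beta)
qed

text \<open>Let G r be the product at remaining time r with the probabilities y frozen. An event at
  time \<tau> contributes at most G + G' / N at t - \<tau>. Weighted with the exponential waiting
  time this is an exact derivative in \<tau>, and together with the case of no event before t it
  integrates to G t.\<close>

lemma yule_hit_first_event:
  assumes N: "0 < N" and x: "x \<in> space (state_space N)" and R: "R \<subseteq> {..<N}" and t: "0 \<le> t"
    and C: "C * exp t < 1" and A[measurable]: "A \<in> sets borel"
  defines "g \<equiv> event_factor C A t x"
  shows "(\<integral>\<^sup>+s. (case s of (\<tau>, z, u) \<Rightarrow> (\<Prod>i\<in>R. ennreal (g \<tau> (z i) u i))) \<partial>noise_step N)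
    \<le> ennreal (\<Prod>i\<in>R. yule_hit C A t (x i))"
proof -
  have finR: "finite R" using R finite_subset by blast
  interpret V: product_sigma_finite "\<lambda>_::nat. std_gauss"
    by (intro product_sigma_finite.intro gauss.sigma_finite_measure_axioms)
  define y where "y i = hit A t (x i)" for i
  have y: "0 \<le> y i" "y i \<le> 1" for i by (auto simp: y_def hit_nonneg hit_le_1)
  define G where "G r = (\<Prod>i\<in>R. 1 + yule C r * y i)" for r
  define G' where "G' r = (\<Sum>u\<in>R. (yule C r * (1 + yule C r) * y u) * (\<Prod>i\<in>R - {u}. 1 + yule C r * y i))" for r
  have Cr: "C * exp r < 1" if "r \<le> t" for r
  proof (cases "0 \<le> C")
    case True
    then have "C * exp r \<le> C * exp t" using that by (intro mult_left_mono) auto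
    then show ?thesis using C by simp
  next
    case False
    then have "C * exp r < 0" by (simp add: mult_neg_pos)
    then show ?thesis by simp
  qed
  have pos: "0 < 1 + yule C r * y i" if "r \<le> t" for r i
    using y yule_gt[OF Cr[OF that]] by (intro one_plus_mult_pos)
  have G': "(G has_real_derivative G' r) (at r)" if "r \<le> t" for r
    unfolding G_def[abs_def] G'_def
    by (intro has_field_derivative_prod) (auto intro!: derivative_eq_intros DERIV_yule Cr that)
  have gm: "(\<lambda>s. case s of (\<tau>, z, u) \<Rightarrow> (\<Prod>i\<in>R. ennreal (g \<tau> (z i) u i))) \<in> borel_measurable (noise_step N)"
    unfolding g_def by (rule measurable_event_factor[OF R A])
  have prod: "(\<integral>\<^sup>+z. (\<Prod>i\<in>R. ennreal (g \<tau> (z i) u i)) \<partial>gauss_vec N) = (\<Prod>i\<in>R. \<integral>\<^sup>+z. ennreal (g \<tau> z u i) \<partial>std_gauss)" for \<tau> u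
  proof -
    have eq: "(\<Prod>i\<in>R. ennreal (g \<tau> (z i) u i)) = (\<Prod>i<N. if i \<in> R then ennreal (g \<tau> (z i) u i) else 1)" for z
      using R by (subst prod.inter_restrict[symmetric]) (auto simp: Int_absorb1)
    have "(\<integral>\<^sup>+z. (\<Prod>i\<in>R. ennreal (g \<tau> (z i) u i)) \<partial>gauss_vec N)
       = (\<Prod>i<N. \<integral>\<^sup>+z. (if i \<in> R then ennreal (g \<tau> z u i) else 1) \<partial>std_gauss)"
      unfolding eq
    proof (rule V.product_nn_integral_prod)
      fix i
      have "(\<lambda>z. ennreal (g \<tau> z u i)) \<in> borel_measurable borel" unfolding g_def event_factor_def by measurable
      then show "(\<lambda>z. if i \<in> R then ennreal (g \<tau> z u i) else 1) \<in> borel_measurable std_gauss"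
        by (cases "i \<in> R") simp_all
    qed simp
    also have "\<dots> = (\<Prod>i<N. if i \<in> R then \<integral>\<^sup>+z. ennreal (g \<tau> z u i) \<partial>std_gauss else 1)"
      using gauss.emeasure_space_1 by (intro prod.cong) auto
    also have "\<dots> = (\<Prod>i\<in>R. \<integral>\<^sup>+z. ennreal (g \<tau> z u i) \<partial>std_gauss)"
      using R by (subst prod.inter_restrict[symmetric]) (auto simp: Int_absorb1)
    finally show ?thesis .
  qed
  have sum: "(\<integral>\<^sup>+z. (\<Sum>u<N. ennreal (1 / N) * (\<Prod>i\<in>R. ennreal (g \<tau> (z i) u i))) \<partial>gauss_vec N)
      = (\<Sum>u<N. ennreal (1 / N) * (\<Prod>i\<in>R. \<integral>\<^sup>+z. ennreal (g \<tau> z u i) \<partial>std_gauss))" for \<tau>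
  proof -
    have [measurable]: "(\<lambda>z. \<Prod>i\<in>R. ennreal (g \<tau> (z i) u i)) \<in> borel_measurable (gauss_vec N)" for u
    proof (rule borel_measurable_prod_ennreal)
      fix i assume "i \<in> R"
      then have [measurable]: "(\<lambda>z. z i) \<in> borel_measurable (gauss_vec N)"
        using R measurable_component_singleton[of i "{..<N}" "\<lambda>_. std_gauss"] by auto
      show "(\<lambda>z. ennreal (g \<tau> (z i) u i)) \<in> borel_measurable (gauss_vec N)"
        unfolding g_def event_factor_def by measurable
    qed
    show ?thesis by (simp add: nn_integral_sum nn_integral_cmult prod)
  qed
  have late: "(\<Sum>u<N. ennreal (1 / N) * (\<Prod>i\<in>R. \<integral>\<^sup>+z. ennreal (g \<tau> z u i) \<partial>std_gauss)) = ennreal (G 0)" if "t < \<tau>" for \<tau>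
  proof -
    have "(\<integral>\<^sup>+z. ennreal (g \<tau> z u i) \<partial>std_gauss) = ennreal (1 + yule C 0 * y i)" for u i
      using nn_integral_yule_hit[of C 0 A t "x i"] that t Cr[OF t] by (simp add: g_def event_factor_def y_def)
    then have "(\<Prod>i\<in>R. \<integral>\<^sup>+z. ennreal (g \<tau> z u i) \<partial>std_gauss) = ennreal (G 0)" for u
      using pos[OF t] by (simp add: G_def prod_ennreal less_imp_le)
    then show ?thesis using N by (simp add: ennreal_of_nat_eq_real_of_nat ennreal_mult'[symmetric] mult.assoc[symmetric])
  qed
  have early: "(\<Sum>u<N. ennreal (1 / N) * (\<Prod>i\<in>R. \<integral>\<^sup>+z. ennreal (g \<tau> z u i) \<partial>std_gauss)) \<le> ennreal (G (t - \<tau>) + G' (t - \<tau>) / N)"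
    and early0: "0 \<le> G (t - \<tau>) + G' (t - \<tau>) / N" if "0 \<le> \<tau>" "\<tau> \<le> t" for \<tau>
  proof -
    let ?r = "t - \<tau>"
    let ?a = "yule C ?r"
    have r: "0 \<le> ?r" "?r \<le> t" using that by auto
    let ?b = "\<lambda>u i. (1 + ?a * y i) + (if u = i then ?a * (1 + ?a) * y i else 0)"
    have b0: "0 \<le> ?b u i" for u i
    proof -
      have "0 \<le> 1 + ?a * y i + ?a * (1 + ?a) * y i"
      proof -
        have "0 < 1 + (2 * ?a + ?a * ?a)" using mult_pos_pos[OF yule_gt yule_gt, OF Cr Cr, OF r(2) r(2)] by (simp add: algebra_simps)
        from one_plus_mult_pos[OF this y[of i]] show ?thesis by (simp add: algebra_simps)
      qed
      then show ?thesis using pos[OF r(2), of i] by simp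
    qed
    have "(\<integral>\<^sup>+z. ennreal (g \<tau> z u i) \<partial>std_gauss) \<le> ennreal (?b u i)" for u i
      using nn_integral_yule_hit[OF Cr[OF r(2)] A r(1) that(1), of "x i"]
        nn_integral_yule_hit_square_le[OF Cr[OF r(2)] A r(1) that(1), of "x i"] that
      by (auto simp: g_def event_factor_def y_def)
    then have "(\<Prod>i\<in>R. \<integral>\<^sup>+z. ennreal (g \<tau> z u i) \<partial>std_gauss) \<le> ennreal (\<Prod>i\<in>R. ?b u i)" for u
      unfolding prod_ennreal[OF b0, symmetric] by (intro prod_mono_ennreal)
    then have "(\<Sum>u<N. ennreal (1 / N) * (\<Prod>i\<in>R. \<integral>\<^sup>+z. ennreal (g \<tau> z u i) \<partial>std_gauss))
        \<le> (\<Sum>u<N. ennreal (1 / N) * ennreal (\<Prod>i\<in>R. ?b u i))"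
      by (intro sum_mono mult_left_mono) auto
    also have "\<dots> = (\<Sum>u<N. ennreal (1 / N * (\<Prod>i\<in>R. ?b u i)))"
      by (intro sum.cong refl ennreal_mult'[symmetric]) simp
    also have "\<dots> = ennreal (\<Sum>u<N. 1 / N * (\<Prod>i\<in>R. ?b u i))"
      by (intro sum_ennreal mult_nonneg_nonneg prod_nonneg b0) auto
    also have "(\<Sum>u<N. 1 / N * (\<Prod>i\<in>R. ?b u i)) = G ?r + G' ?r / N"
    proof -
      \<comment> \<open>The extra factor of the branching particle, averaged over u, reproduces the
        product rule for G'.\<close>
      have pu: "(\<Prod>i\<in>R. ?b u i) = G ?r + (if u \<in> R then (?a * (1 + ?a) * y u) * (\<Prod>i\<in>R - {u}. 1 + ?a * y i) else 0)" for u
      proof (cases "u \<in> R")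
        case True
        have "(\<Prod>i\<in>R. ?b u i) = ?b u u * (\<Prod>i\<in>R - {u}. ?b u i)" using True finR by (simp add: prod.remove)
        also have "(\<Prod>i\<in>R - {u}. ?b u i) = (\<Prod>i\<in>R - {u}. 1 + ?a * y i)" by (intro prod.cong) auto
        also have "?b u u * \<dots> = (1 + ?a * y u) * (\<Prod>i\<in>R - {u}. 1 + ?a * y i) + (?a * (1 + ?a) * y u) * (\<Prod>i\<in>R - {u}. 1 + ?a * y i)"
          by (simp add: distrib_right)
        also have "(1 + ?a * y u) * (\<Prod>i\<in>R - {u}. 1 + ?a * y i) = G ?r" unfolding G_def using True finR by (simp add: prod.remove)
        finally show ?thesis using True by simp
      next
        case False
        then show ?thesis by (auto simp: G_def intro!: prod.cong)
      qed
      have "(\<Sum>u<N. (\<Prod>i\<in>R. ?b u i)) = N * G ?r + G' ?r"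
        unfolding pu sum.distrib G'_def using R
        by (simp add: sum.inter_restrict[symmetric] Int_absorb1)
      then have "(\<Sum>u<N. 1 / N * (\<Prod>i\<in>R. ?b u i)) = 1 / N * (N * G ?r + G' ?r)" by (simp only: sum_distrib_left[symmetric])
      then show ?thesis using N by (simp add: distrib_left)
    qed
    finally show "(\<Sum>u<N. ennreal (1 / N) * (\<Prod>i\<in>R. \<integral>\<^sup>+z. ennreal (g \<tau> z u i) \<partial>std_gauss)) \<le> ennreal (G ?r + G' ?r / N)" .
    show "0 \<le> G ?r + G' ?r / N"
      unfolding \<open>(\<Sum>u<N. 1 / N * (\<Prod>i\<in>R. ?b u i)) = G ?r + G' ?r / N\<close>[symmetric]
      by (intro sum_nonneg mult_nonneg_nonneg prod_nonneg b0) auto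
  qed
  have [measurable]: "G \<in> borel_measurable borel" "G' \<in> borel_measurable borel"
    unfolding G_def[abs_def] G'_def[abs_def] by measurable
  have DF: "((\<lambda>\<tau>. - exp (- real N * \<tau>) * G (t - \<tau>)) has_real_derivative real N * exp (- real N * \<tau>) * (G (t - \<tau>) + G' (t - \<tau>) / N)) (at \<tau>)"
    if "0 \<le> \<tau>" "\<tau> \<le> t" for \<tau>
  proof -
    have 1: "(G has_real_derivative G' (t - \<tau>)) (at (t - \<tau>))" using that by (intro G') simp
    have 2: "((\<lambda>\<tau>. t - \<tau>) has_real_derivative - 1) (at \<tau>)" by (auto intro!: derivative_eq_intros)
    have 3: "((\<lambda>\<tau>. G (t - \<tau>)) has_real_derivative G' (t - \<tau>) * - 1) (at \<tau>)"
      by (rule DERIV_chain2[where f=G and g="\<lambda>\<tau>. t - \<tau>", OF 1 2])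
    show ?thesis using N by (auto intro!: derivative_eq_intros 3 simp: field_simps)
  qed
  have G0: "0 \<le> G 0" unfolding G_def by (intro prod_nonneg less_imp_le pos t)
  have "(\<integral>\<^sup>+s. (case s of (\<tau>, z, u) \<Rightarrow> (\<Prod>i\<in>R. ennreal (g \<tau> (z i) u i))) \<partial>noise_step N)
      = (\<integral>\<^sup>+\<tau>. ennreal (exponential_density (real N) \<tau>) * (\<Sum>u<N. ennreal (1 / N) * (\<Prod>i\<in>R. \<integral>\<^sup>+z. ennreal (g \<tau> z u i) \<partial>std_gauss)) \<partial>lborel)"
    by (subst nn_integral_noise_step[OF N gm]) (simp add: sum)
  also have "\<dots> \<le> (\<integral>\<^sup>+\<tau>. ennreal (real N * exp (- real N * \<tau>) * (G (t - \<tau>) + G' (t - \<tau>) / N)) * indicator {0..t} \<tau>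
      + ennreal (real N * G 0) * (ennreal (exp (- real N * \<tau>)) * indicator {t<..} \<tau>) \<partial>lborel)"
  proof (intro nn_integral_mono)
    fix \<tau> :: real
    consider "\<tau> < 0" | "0 \<le> \<tau>" "\<tau> \<le> t" | "t < \<tau>" by linarith
    then show "ennreal (exponential_density (real N) \<tau>) * (\<Sum>u<N. ennreal (1 / N) * (\<Prod>i\<in>R. \<integral>\<^sup>+z. ennreal (g \<tau> z u i) \<partial>std_gauss))
      \<le> ennreal (real N * exp (- real N * \<tau>) * (G (t - \<tau>) + G' (t - \<tau>) / N)) * indicator {0..t} \<tau>
      + ennreal (real N * G 0) * (ennreal (exp (- real N * \<tau>)) * indicator {t<..} \<tau>)"
    proof cases
      case 1
      then show ?thesis by (simp add: exponential_density_def)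
    next
      case 2
      have "ennreal (exponential_density (real N) \<tau>) * (\<Sum>u<N. ennreal (1 / N) * (\<Prod>i\<in>R. \<integral>\<^sup>+z. ennreal (g \<tau> z u i) \<partial>std_gauss))
         \<le> ennreal (real N * exp (- real N * \<tau>)) * ennreal (G (t - \<tau>) + G' (t - \<tau>) / N)"
        using 2 early[OF 2] by (intro mult_mono) (auto simp: exponential_density_def mult.commute)
      also have "\<dots> = ennreal (real N * exp (- real N * \<tau>) * (G (t - \<tau>) + G' (t - \<tau>) / N))"
        by (rule ennreal_mult'[symmetric]) simp
      finally show ?thesis using 2 by simp
    next
      case 3
      then show ?thesis using t G0 N unfolding late[OF 3]
        by (simp add: exponential_density_def ennreal_mult'[symmetric] mult_ac)
    qed
  qed
  also have "\<dots> = (\<integral>\<^sup>+\<tau>. ennreal (real N * exp (- real N * \<tau>) * (G (t - \<tau>) + G' (t - \<tau>) / N)) * indicator {0..t} \<tau> \<partial>lborel)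
      + ennreal (real N * G 0) * (\<integral>\<^sup>+\<tau>. ennreal (exp (- real N * \<tau>)) * indicator {t<..} \<tau> \<partial>lborel)"
    by (subst nn_integral_add) (auto simp: nn_integral_cmult)
  also have "(\<integral>\<^sup>+\<tau>. ennreal (exp (- real N * \<tau>)) * indicator {t<..} \<tau> \<partial>lborel) = ennreal (exp (- real N * t) / N)"
    using N by (intro nn_integral_exp_Ioi) simp
  also have "(\<integral>\<^sup>+\<tau>. ennreal (real N * exp (- real N * \<tau>) * (G (t - \<tau>) + G' (t - \<tau>) / N)) * indicator {0..t} \<tau> \<partial>lborel)
      = ennreal ((- exp (- real N * t) * G (t - t)) - (- exp (- real N * 0) * G (t - 0)))"
  proof (rule nn_integral_FTC_Icc)
    show "(\<lambda>\<tau>. real N * exp (- real N * \<tau>) * (G (t - \<tau>) + G' (t - \<tau>) / N)) \<in> borel_measurable borel"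
      by measurable
    fix \<tau> :: real assume a: "\<tau> \<in> {0..t}"
    then show "((\<lambda>\<tau>. - exp (- real N * \<tau>) * G (t - \<tau>)) has_real_derivative real N * exp (- real N * \<tau>) * (G (t - \<tau>) + G' (t - \<tau>) / N)) (at \<tau>)"
      by (intro DF) auto
    show "0 \<le> real N * exp (- real N * \<tau>) * (G (t - \<tau>) + G' (t - \<tau>) / N)"
      using early0[of \<tau>] a by simp
  qed (use t in auto)
  also have "\<dots> + ennreal (real N * G 0) * ennreal (exp (- real N * t) / N) = ennreal (G t)"
  proof -
    have "ennreal (real N * G 0) * ennreal (exp (- real N * t) / N) = ennreal (exp (- real N * t) * G 0)"
      using N G0 by (subst ennreal_mult'[symmetric]) (auto simp: mult_ac)
    \<comment> \<open>The first integral is the \<open>ennreal\<close> of G t - exp (- N * t) * G 0;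
      this inequality rules out truncation at 0 when the two parts are added.\<close>
    moreover have "exp (- real N * t) * G 0 \<le> G t"
    proof (rule ccontr)
      assume "\<not> ?thesis"
      then have neg: "- exp (- real N * t) * G (t - t) - (- exp (- real N * 0) * G (t - 0)) < 0" by simp
      let ?F = "\<lambda>\<tau>. - exp (- real N * \<tau>) * G (t - \<tau>)"
      have "?F 0 \<le> ?F t"
      proof (rule DERIV_nonneg_imp_nondecreasing[OF t])
        fix \<tau> :: real assume a: "0 \<le> \<tau>" "\<tau> \<le> t"
        have "(?F has_real_derivative real N * exp (- real N * \<tau>) * (G (t - \<tau>) + G' (t - \<tau>) / N)) (at \<tau>)"
          using a by (intro DF)
        moreover have "0 \<le> real N * exp (- real N * \<tau>) * (G (t - \<tau>) + G' (t - \<tau>) / N)"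
          using early0[OF a] by simp
        ultimately show "\<exists>y. (?F has_real_derivative y) (at \<tau>) \<and> 0 \<le> y" by blast
      qed
      then show False using neg by simp
    qed
    ultimately show ?thesis using G0 by (simp add: ennreal_plus[symmetric] del: ennreal_plus)
  qed
  also have "G t = (\<Prod>i\<in>R. yule_hit C A t (x i))" by (simp add: G_def yule_hit_def y_def)
  finally show ?thesis .
qed

section \<open>The effect of selection on product functionals\<close>

lemma hit_mono: "x \<le> x' \<Longrightarrow> hit {a<..} r x \<le> hit {a<..} r x'"
  unfolding hit_def by (intro integral_mono integrable_hit) (auto split: split_indicator)

lemma yule_hit_antimono:
  assumes "C \<le> 0" "x \<le> x'" shows "yule_hit C {a<..} r x' \<le> yule_hit C {a<..} r x"
proof -
  have "C * exp r \<le> 0" using assms(1) by (simp add: mult_nonpos_nonneg)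
  then have "yule C r \<le> 0" by (simp add: yule_def divide_nonpos_pos)
  then have "yule C r * hit {a<..} r x' \<le> yule C r * hit {a<..} r x"
    using assms(2) by (intro mult_left_mono_neg hit_mono)
  then show ?thesis by (simp add: yule_hit_def)
qed

lemma yule_hit_UNIV: "yule_hit C UNIV r x = 1 + yule C r"
  by (simp add: yule_hit_def hit_UNIV)

lemma yule_hit_le_1: "C \<le> 0 \<Longrightarrow> yule_hit C {a<..} r x \<le> 1"
proof -
  assume "C \<le> 0"
  then have "C * exp r \<le> 0" by (simp add: mult_nonpos_nonneg)
  then have "yule C r \<le> 0" by (simp add: yule_def divide_nonpos_pos)
  then show ?thesis using hit_nonneg[of "{a<..}" r x] by (simp add: yule_hit_def mult_nonpos_nonneg)
qed

lemma yule_hit_ge_1: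
  assumes "0 \<le> C" "C * exp r < 1" shows "1 \<le> yule_hit C A r x"
proof -
  have "0 \<le> yule C r" using assms by (simp add: yule_def)
  then show ?thesis using hit_nonneg[of A r x] by (simp add: yule_hit_def)
qed

lemma mult_exp_less_1:
  fixes C :: real assumes "C * exp t < 1" "r \<le> t" shows "C * exp r < 1"
proof (cases "0 \<le> C")
  case True
  then have "C * exp r \<le> C * exp t" using assms by (intro mult_left_mono) auto
  then show ?thesis using assms by simp
next
  case False
  then have "C * exp r < 0" by (simp add: mult_neg_pos)
  then show ?thesis by simp
qed

lemma diffuse_apply: "i < N \<Longrightarrow> diffuse N x s z i = x i + sqrt s * z i"
  by (simp add: diffuse_def)

text \<open>The factor of the removed particle is at least 1, so restoring it only increases the
  product: for such functionals selection may be dropped in an upper bound.\<close>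

lemma prod_branch_le:
  fixes \<phi> :: "real \<Rightarrow> real"
  assumes N: "0 < N" and u: "u < N" and \<phi>: "\<And>x. 1 \<le> \<phi> x"
  shows "(\<Prod>i<N. \<phi> (branch N y u i)) \<le> (\<Prod>i<N. \<phi> (y i)) * \<phi> (y u)"
proof -
  let ?l = "leftmost N y"
  have l: "?l \<in> {..<N}" using leftmost_props(1)[OF N] by simp
  have 0: "0 \<le> \<phi> x" for x using \<phi>[of x] by linarith
  have "(\<Prod>i<N. \<phi> (branch N y u i)) = \<phi> (y u) * (\<Prod>i\<in>{..<N} - {?l}. \<phi> (branch N y u i))"
    using l by (subst prod.remove[of _ ?l]) (auto simp: branch_def)
  also have "(\<Prod>i\<in>{..<N} - {?l}. \<phi> (branch N y u i)) = (\<Prod>i\<in>{..<N} - {?l}. \<phi> (y i))"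
    by (intro prod.cong) (auto simp: branch_def)
  also have "\<phi> (y u) * \<dots> \<le> \<phi> (y u) * (\<phi> (y ?l) * (\<Prod>i\<in>{..<N} - {?l}. \<phi> (y i)))"
    using mult_right_mono[OF \<phi>[of "y ?l"], of "\<Prod>i\<in>{..<N} - {?l}. \<phi> (y i)"] 0
    by (intro mult_left_mono) (auto intro: prod_nonneg)
  also have "\<phi> (y ?l) * (\<Prod>i\<in>{..<N} - {?l}. \<phi> (y i)) = (\<Prod>i<N. \<phi> (y i))"
    using l by (subst prod.remove[of "{..<N}" ?l]) auto
  finally show ?thesis by (simp add: mult.commute)
qed

text \<open>A subset of particles evolving as branching Brownian motion without selection can be embedded
  in the system as long as some particle lies outside it: if the removed particle was selected,
  an unselected one, which lies further to the right, takes over its role.\<close>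
lemma branch_select:
  fixes \<phi> :: "real \<Rightarrow> real"
  assumes N: "0 < N" and u: "u < N" and R: "R \<subseteq> {..<N}"
    and \<phi>: "\<And>x x'. x \<le> x' \<Longrightarrow> \<phi> x' \<le> \<phi> x" and pos: "\<And>x. 0 < \<phi> x"
    and free: "\<not> (u \<in> R \<and> R = {..<N})"
  shows "\<exists>R'\<subseteq>{..<N}. card R' = card R + (if u \<in> R then 1 else 0) \<and>
    (\<Prod>i\<in>R'. \<phi> (branch N y u i)) \<le> (\<Prod>i\<in>R. \<phi> (y i)) * (if u \<in> R then \<phi> (y u) else 1)"
proof -
  let ?l = "leftmost N y"
  have l: "?l < N" "\<And>j. j < N \<Longrightarrow> y ?l \<le> y j" using leftmost_props[OF N] by auto
  have fin: "finite R" using R finite_subset by blast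
  have bl: "branch N y u ?l = y u" "\<And>i. i \<noteq> ?l \<Longrightarrow> branch N y u i = y i" by (auto simp: branch_def)
  have p0: "0 \<le> (\<Prod>i\<in>A. \<phi> (y i))" for A using pos by (intro prod_nonneg) (auto intro: less_imp_le)
  show ?thesis
  proof (cases "u \<in> R")
    \<comment> \<open>The set is kept. If it contains the leftmost label, that particle moves to the
      right, where \<phi> is no larger.\<close>
    case False
    have "(\<Prod>i\<in>R. \<phi> (branch N y u i)) \<le> (\<Prod>i\<in>R. \<phi> (y i))"
    proof (intro prod_mono conjI)
      fix i assume "i \<in> R"
      show "\<phi> (branch N y u i) \<le> \<phi> (y i)" using \<phi> l(2)[OF u] by (auto simp: branch_def)
    qed (use pos in \<open>auto intro: less_imp_le\<close>)
    then show ?thesis using False R by (intro exI[of _ R]) auto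
  next
    case True
    show ?thesis
    proof (cases "?l \<in> R")
      case False
      have "(\<Prod>i\<in>R. \<phi> (branch N y u i)) = (\<Prod>i\<in>R. \<phi> (y i))"
        using False by (intro prod.cong) (auto simp: branch_def)
      then have "(\<Prod>i\<in>insert ?l R. \<phi> (branch N y u i)) = (\<Prod>i\<in>R. \<phi> (y i)) * \<phi> (y u)"
        using False fin bl(1) by simp
      then show ?thesis using True False R fin l(1) by (intro exI[of _ "insert ?l R"]) auto
    next
      case lR: True
      \<comment> \<open>The label \<open>?l\<close> now carries the copy of u, so the old position
        of \<open>?l\<close> is lost; w, which lies no further left, replaces it.\<close>
      obtain w where w: "w < N" "w \<notin> R" using free True R by blast
      have wl: "w \<noteq> ?l" using w(2) lR by blast
      have "(\<Prod>i\<in>insert w R. \<phi> (branch N y u i)) = \<phi> (y w) * (\<Prod>i\<in>R. \<phi> (branch N y u i))"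
        using w fin bl(2)[OF wl] by simp
      also have "(\<Prod>i\<in>R. \<phi> (branch N y u i)) = \<phi> (y u) * (\<Prod>i\<in>R - {?l}. \<phi> (branch N y u i))"
        using lR fin bl(1) by (subst prod.remove[of _ ?l]) auto
      also have "(\<Prod>i\<in>R - {?l}. \<phi> (branch N y u i)) = (\<Prod>i\<in>R - {?l}. \<phi> (y i))"
        by (intro prod.cong) (auto simp: branch_def)
      also have "\<phi> (y w) * (\<phi> (y u) * (\<Prod>i\<in>R - {?l}. \<phi> (y i))) \<le> \<phi> (y ?l) * (\<phi> (y u) * (\<Prod>i\<in>R - {?l}. \<phi> (y i)))"
        using \<phi>[OF l(2)[OF w(1)]] pos[of "y u"] p0 by (intro mult_right_mono) auto
      also have "\<dots> = (\<phi> (y ?l) * (\<Prod>i\<in>R - {?l}. \<phi> (y i))) * \<phi> (y u)" by simp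
      also have "\<phi> (y ?l) * (\<Prod>i\<in>R - {?l}. \<phi> (y i)) = (\<Prod>i\<in>R. \<phi> (y i))"
        using lR fin by (subst prod.remove[of R ?l]) auto
      finally show ?thesis using True w R fin by (intro exI[of _ "insert w R"]) auto
    qed
  qed
qed

lemma measurable_prod_yule_hit:
  assumes [measurable]: "A \<in> sets borel"
  shows "(\<lambda>x. \<Prod>i<N. ennreal (yule_hit C A r (x i))) \<in> borel_measurable (state_space N)"
proof (rule borel_measurable_prod_ennreal)
  fix i assume "i \<in> {..<N}"
  then have [measurable]: "(\<lambda>x. x i) \<in> borel_measurable (state_space N)"
    by (intro measurable_state_component[of "\<lambda>x. x" _ N]) auto
  show "(\<lambda>x. ennreal (yule_hit C A r (x i))) \<in> borel_measurable (state_space N)" by measurable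
qed

lemma event_factor_prod:
  assumes R: "R \<subseteq> {..<N}" and tau: "\<not> t < \<tau>" and nn: "\<And>x. 0 \<le> yule_hit C A (t - \<tau>) x"
  shows "(\<Prod>i\<in>R. ennreal (event_factor C A t x \<tau> (z i) u i))
    = ennreal ((\<Prod>i\<in>R. yule_hit C A (t - \<tau>) (diffuse N x \<tau> z i)) * (if u \<in> R then yule_hit C A (t - \<tau>) (diffuse N x \<tau> z u) else 1))"
proof -
  let ?p = "\<lambda>i. yule_hit C A (t - \<tau>) (diffuse N x \<tau> z i)"
  have fin: "finite R" using R finite_subset by blast
  have "(\<Prod>i\<in>R. ennreal (event_factor C A t x \<tau> (z i) u i)) = ennreal (\<Prod>i\<in>R. event_factor C A t x \<tau> (z i) u i)"
    using tau nn by (intro prod_ennreal) (auto simp: event_factor_def)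
  also have "(\<Prod>i\<in>R. event_factor C A t x \<tau> (z i) u i) = (\<Prod>i\<in>R. ?p i * (if u = i then ?p i else 1))"
    using R tau by (intro prod.cong) (auto simp: event_factor_def diffuse_apply subset_iff)
  also have "\<dots> = (\<Prod>i\<in>R. ?p i) * (if u \<in> R then ?p u else 1)"
    using fin by (simp add: prod.distrib prod.delta)
  finally show ?thesis .
qed

lemma event_factor_late:
  assumes R: "R \<subseteq> {..<N}" and tau: "t < \<tau>"
  shows "(\<Prod>i\<in>R. ennreal (event_factor C A t x \<tau> (z i) u i)) = (\<Prod>i\<in>R. ennreal (yule_hit C A 0 (diffuse N x t z i)))"
  using R tau by (intro prod.cong) (auto simp: event_factor_def diffuse_apply subset_iff)

text \<open>For C \<ge> 0 every factor is at least 1, so the removal of a particle lowers the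
  product, and the supersolution without selection remains one for the system with
  selection.\<close>

lemma NBBM_exp_moment_le:
  assumes N: "0 < N" and x: "x \<in> space (state_space N)" and t: "0 \<le> t"
    and C: "0 \<le> C" "C * exp t < 1" and A: "A \<in> sets borel"
  shows "(\<integral>\<^sup>+\<omega>. (\<Prod>i<N. ennreal (yule_hit C A 0 (NBBM N x t \<omega> i))) \<partial>noise N) \<le> ennreal (\<Prod>i<N. yule_hit C A t (x i))"
proof (rule NBBM_domination[where T=t and \<Psi>="\<lambda>t x. ennreal (\<Prod>i<N. yule_hit C A t (x i))" and f="\<lambda>x. \<Prod>i<N. ennreal (yule_hit C A 0 (x i))", OF N measurable_prod_yule_hit[OF A] _ t order_refl x])
  fix r x assume r: "0 \<le> r" "r \<le> t" and x: "x \<in> space (state_space N)"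
  have C': "C * exp s < 1" if "s \<le> r" for s using that r by (intro mult_exp_less_1[OF C(2)]) auto
  have "(\<integral>\<^sup>+s. (case s of (\<tau>, z, u) \<Rightarrow> if r < \<tau> then (\<Prod>i<N. ennreal (yule_hit C A 0 (diffuse N x r z i)))
          else ennreal (\<Prod>i<N. yule_hit C A (r - \<tau>) (branch N (diffuse N x \<tau> z) u i))) \<partial>noise_step N)
      \<le> (\<integral>\<^sup>+s. (case s of (\<tau>, z, u) \<Rightarrow> (\<Prod>i<N. ennreal (event_factor C A r x \<tau> (z i) u i))) \<partial>noise_step N)"
  proof (rule nn_integral_mono_AE)
    show "AE s in noise_step N. (case s of (\<tau>, z, u) \<Rightarrow> if r < \<tau> then (\<Prod>i<N. ennreal (yule_hit C A 0 (diffuse N x r z i)))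
          else ennreal (\<Prod>i<N. yule_hit C A (r - \<tau>) (branch N (diffuse N x \<tau> z) u i)))
       \<le> (case s of (\<tau>, z, u) \<Rightarrow> (\<Prod>i<N. ennreal (event_factor C A r x \<tau> (z i) u i)))"
      using AE_noise_step_nonneg[OF N] AE_space
    proof eventually_elim
      case (elim s)
      obtain \<tau> z u where s: "s = (\<tau>, z, u)" by (cases s)
      have u: "u < N" using elim(2) by (simp add: s noise_step_def space_pair_measure space_uniform_count_measure)
      show ?case
      proof (cases "r < \<tau>")
        case True
        then show ?thesis by (simp add: s event_factor_late[OF order_refl])
      next
        case False
        have g: "1 \<le> yule_hit C A (r - \<tau>) y" for y
          using elim(1) by (intro yule_hit_ge_1 C(1) C') (simp add: s)
        then have "0 \<le> yule_hit C A (r - \<tau>) y" for y using order_trans[OF zero_le_one] by blast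
        from event_factor_prod[OF order_refl False this, where N=N and x=x and z=z and u=u]
          prod_branch_le[where \<phi>="yule_hit C A (r - \<tau>)" and y="diffuse N x \<tau> z", OF N u g]
        show ?thesis using False u by (simp add: s ennreal_leI)
      qed
    qed
  qed
  also have "\<dots> \<le> ennreal (\<Prod>i<N. yule_hit C A r (x i))"
    by (rule yule_hit_first_event[OF N x order_refl r(1) C'[OF order_refl] A])
  finally show "(\<integral>\<^sup>+s. (case s of (\<tau>, z, u) \<Rightarrow> if r < \<tau> then (\<Prod>i<N. ennreal (yule_hit C A 0 (diffuse N x r z i)))
          else ennreal (\<Prod>i<N. yule_hit C A (r - \<tau>) (branch N (diffuse N x \<tau> z) u i))) \<partial>noise_step N)
      \<le> ennreal (\<Prod>i<N. yule_hit C A r (x i))" .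
qed

text \<open>The second summand bounds the probability that a Yule process started from \<open>card R\<close>
  particles reaches size \<open>N\<close>.\<close>
lemma NBBM_neg_exp_moment_le:
  assumes N: "0 < N" and x: "x \<in> space (state_space N)" and t: "0 \<le> t"
    and C: "C \<le> 0" and D: "0 \<le> D" "D * exp t < 1" and R: "R \<subseteq> {..<N}"
  shows "(\<integral>\<^sup>+\<omega>. (\<Prod>i<N. ennreal (yule_hit C {a<..} 0 (NBBM N x t \<omega> i))) \<partial>noise N)
    \<le> ennreal (\<Prod>i\<in>R. yule_hit C {a<..} t (x i)) + ennreal ((1 - D) ^ N * (1 + yule D t) ^ card R)"
proof -
  let ?A = "{a<..}"
  define K where "K = (1 - D) ^ N"
  define B where "B t x R = ennreal (\<Prod>i\<in>R. yule_hit C ?A t (x i)) + ennreal (K * (1 + yule D t) ^ card R)" for t and x :: "nat \<Rightarrow> real" and R :: "nat set"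
  \<comment> \<open>The infimum lets the selected set depend on the noise, as it must since
    \<open>branch_select\<close> changes it at the events. The cap at 1 is the trivial bound for C
    \<le> 0.\<close>
  define \<Psi> where "\<Psi> t x = min 1 (INF R\<in>Pow {..<N}. B t x R)" for t x
  have D1: "D < 1" using mult_exp_less_1[OF D(2) t] by simp
  have K: "0 \<le> K" using D1 by (simp add: K_def)
  have Cr: "C * exp r < 1" for r
  proof -
    have "C * exp r \<le> 0" using C by (simp add: mult_nonpos_nonneg)
    then show ?thesis by simp
  qed
  have pos: "0 < yule_hit C ?A r y" for r y by (rule yule_hit_pos[OF Cr]) simp
  have "(\<integral>\<^sup>+\<omega>. (\<Prod>i<N. ennreal (yule_hit C ?A 0 (NBBM N x t \<omega> i))) \<partial>noise N) \<le> \<Psi> t x"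
  proof (rule NBBM_domination[where T=t and f="\<lambda>x. \<Prod>i<N. ennreal (yule_hit C ?A 0 (x i))", OF N measurable_prod_yule_hit _ t order_refl x])
    fix r x assume r: "0 \<le> r" "r \<le> t" and x: "x \<in> space (state_space N)"
    interpret S: prob_space "noise_step N" by (rule prob_space_noise_step[OF N])
    have Dr: "D * exp s < 1" if "s \<le> r" for s using that r by (intro mult_exp_less_1[OF D(2)]) auto
    let ?L = "\<lambda>s. (case s of (\<tau>, z, u) \<Rightarrow> if r < \<tau> then (\<Prod>i<N. ennreal (yule_hit C ?A 0 (diffuse N x r z i)))
          else \<Psi> (r - \<tau>) (branch N (diffuse N x \<tau> z) u))"
    have f1: "(\<Prod>i\<in>R. ennreal (yule_hit C ?A 0 (y i))) \<le> 1" for y :: "nat \<Rightarrow> real" and R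
      using prod_mono_ennreal[of R "\<lambda>i. ennreal (yule_hit C ?A 0 (y i))" "\<lambda>_. 1"] yule_hit_le_1[OF C] by simp
    have "(\<integral>\<^sup>+s. ?L s \<partial>noise_step N) \<le> (\<integral>\<^sup>+s. 1 \<partial>noise_step N)"
      by (intro nn_integral_mono) (auto simp: \<Psi>_def f1)
    then have le1: "(\<integral>\<^sup>+s. ?L s \<partial>noise_step N) \<le> 1" by (simp add: S.emeasure_space_1)
    have leB: "(\<integral>\<^sup>+s. ?L s \<partial>noise_step N) \<le> B r x R" if R: "R \<subseteq> {..<N}" for R
    proof -
      let ?E1 = "\<lambda>s. (case s of (\<tau>, z, u) \<Rightarrow> (\<Prod>i\<in>R. ennreal (event_factor C ?A r x \<tau> (z i) u i)))"
      let ?E2 = "\<lambda>s. (case s of (\<tau>, z, u) \<Rightarrow> (\<Prod>i\<in>R. ennreal (event_factor D UNIV r x \<tau> (z i) u i)))"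
      have fin: "finite R" using R finite_subset by blast
      have "(\<integral>\<^sup>+s. ?L s \<partial>noise_step N) \<le> (\<integral>\<^sup>+s. ?E1 s + ennreal K * ?E2 s \<partial>noise_step N)"
      proof (rule nn_integral_mono_AE)
        show "AE s in noise_step N. ?L s \<le> ?E1 s + ennreal K * ?E2 s"
          using AE_noise_step_nonneg[OF N] AE_space
        proof eventually_elim
          case (elim s)
          obtain \<tau> z u where s: "s = (\<tau>, z, u)" by (cases s)
          have u: "u < N" using elim(2) by (simp add: s noise_step_def space_pair_measure space_uniform_count_measure)
          show ?case
          proof (cases "r < \<tau>")
            case True
            \<comment> \<open>No event happens up to the remaining time; the factors outside R are
              at most 1 and are dropped.\<close>
            have "(\<Prod>i<N. ennreal (yule_hit C ?A 0 (diffuse N x r z i))) = (\<Prod>i\<in>R. ennreal (yule_hit C ?A 0 (diffuse N x r z i))) * (\<Prod>i\<in>{..<N} - R. ennreal (yule_hit C ?A 0 (diffuse N x r z i)))"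
              using R by (subst prod.subset_diff[of R]) (auto simp: mult.commute)
            also have "\<dots> \<le> (\<Prod>i\<in>R. ennreal (yule_hit C ?A 0 (diffuse N x r z i))) * 1"
              by (intro mult_left_mono f1) auto
            finally show ?thesis using True by (simp add: s event_factor_late[OF R True] add_increasing2)
          next
            case False
            define y where "y = diffuse N x \<tau> z"
            define \<phi> where "\<phi> = yule_hit C ?A (r - \<tau>)"
            define \<psi> where "\<psi> = 1 + yule D (r - \<tau>)"
            have sr: "r - \<tau> \<le> r" using elim(1) by (simp add: s)
            have \<psi>0: "1 / (1 - D) \<le> \<psi>"
            proof -
              have "1 - D * exp (r - \<tau>) \<le> 1 - D" using D(1) False by (simp add: mult_le_cancel_left1)
              then show ?thesis unfolding \<psi>_def yule_add_1[OF Dr[OF sr]]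
                using Dr[OF sr] by (intro divide_left_mono) auto
            qed
            have \<psi>1: "0 \<le> \<psi>" using \<psi>0 D1 by (meson divide_nonneg_pos diff_gt_0_iff_gt order_trans zero_le_one)
            have E1: "?E1 s = ennreal ((\<Prod>i\<in>R. \<phi> (y i)) * (if u \<in> R then \<phi> (y u) else 1))"
              using event_factor_prod[OF R False, of C ?A x z u] pos by (simp add: s y_def \<phi>_def less_imp_le)
            have E2: "?E2 s = ennreal (\<psi> ^ card R * (if u \<in> R then \<psi> else 1))"
              using event_factor_prod[OF R False, of D UNIV x z u] \<psi>1 by (simp add: s yule_hit_UNIV \<psi>_def)
            have L: "?L s = \<Psi> (r - \<tau>) (branch N y u)" using False by (simp add: s y_def)
            show ?thesis
            proof (cases "u \<in> R \<and> R = {..<N}")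
              case True
              \<comment> \<open>All N particles are selected and one of them branches, so there is
                no outsider to make room. In this case the second summand is at least 1, by the
                choice of K, and the trivial bound suffices.\<close>
              have "1 = K * (1 / (1 - D)) ^ N" using D1 by (simp add: K_def power_divide)
              also have "\<dots> \<le> K * \<psi> ^ N" using \<psi>0 D1 K by (intro mult_left_mono power_mono) auto
              also have "\<dots> \<le> K * (\<psi> ^ N * \<psi>)"
              proof -
                have "1 \<le> 1 / (1 - D)" using D1 D(1) by simp
                then have "1 \<le> \<psi>" using \<psi>0 by linarith
                then show ?thesis using K \<psi>1 by (intro mult_left_mono) (auto simp: mult_le_cancel_left1)
              qed
              also have "\<dots> = K * (\<psi> ^ card R * (if u \<in> R then \<psi> else 1))" using True u by simp
              finally have "1 \<le> ennreal (K * (\<psi> ^ card R * (if u \<in> R then \<psi> else 1)))" by simp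
              also have "\<dots> = ennreal K * ?E2 s" unfolding E2 using K by (rule ennreal_mult')
              finally have "1 \<le> ennreal K * ?E2 s" .
              note K1 = this
              have "?L s \<le> 1" unfolding L by (simp add: \<Psi>_def)
              also note K1
              also have "ennreal K * ?E2 s \<le> ?E1 s + ennreal K * ?E2 s" by (rule add_increasing) simp_all
              finally show ?thesis .
            next
              case free: False
              obtain R' where R': "R' \<subseteq> {..<N}" "card R' = card R + (if u \<in> R then 1 else 0)"
                "(\<Prod>i\<in>R'. \<phi> (branch N y u i)) \<le> (\<Prod>i\<in>R. \<phi> (y i)) * (if u \<in> R then \<phi> (y u) else 1)"
                using branch_select[OF N u R _ _ free, of \<phi> y] yule_hit_antimono[OF C] pos unfolding \<phi>_def by blast
              have "\<Psi> (r - \<tau>) (branch N y u) \<le> B (r - \<tau>) (branch N y u) R'"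
                unfolding \<Psi>_def using R'(1) by (intro min.coboundedI2 INF_lower) auto
              also have "\<dots> \<le> ?E1 s + ennreal K * ?E2 s"
                unfolding B_def E1 E2
              proof (intro add_mono)
                show "ennreal (\<Prod>i\<in>R'. yule_hit C ?A (r - \<tau>) (branch N y u i)) \<le> ennreal ((\<Prod>i\<in>R. \<phi> (y i)) * (if u \<in> R then \<phi> (y u) else 1))"
                  using R'(3) by (intro ennreal_leI) (simp add: \<phi>_def)
                show "ennreal (K * (1 + yule D (r - \<tau>)) ^ card R') \<le> ennreal K * ennreal (\<psi> ^ card R * (if u \<in> R then \<psi> else 1))"
                  using K R'(2) by (simp add: \<psi>_def[symmetric] ennreal_mult'[symmetric] mult.commute)
              qed
              finally show ?thesis by (simp add: L)
            qed
          qed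
        qed
      qed
      also have "\<dots> = (\<integral>\<^sup>+s. ?E1 s \<partial>noise_step N) + ennreal K * (\<integral>\<^sup>+s. ?E2 s \<partial>noise_step N)"
        using measurable_event_factor[OF R, of ?A C r x] measurable_event_factor[OF R, of UNIV D r x]
        by (simp add: nn_integral_add nn_integral_cmult)
      also have "\<dots> \<le> ennreal (\<Prod>i\<in>R. yule_hit C ?A r (x i)) + ennreal K * ennreal (\<Prod>i\<in>R. yule_hit D UNIV r (x i))"
        by (intro add_mono mult_left_mono yule_hit_first_event N x R r(1) Cr Dr) auto
      also have "\<dots> = B r x R" using K by (simp add: B_def yule_hit_UNIV ennreal_mult')
      finally show ?thesis .
    qed
    show "(\<integral>\<^sup>+s. ?L s \<partial>noise_step N) \<le> \<Psi> r x"
      unfolding \<Psi>_def[of r x] using le1 leB by (intro min.boundedI INF_greatest) auto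
  qed simp
  also have "\<dots> \<le> B t x R" unfolding \<Psi>_def using R by (intro min.coboundedI2 INF_lower) auto
  finally show ?thesis by (simp add: B_def K_def)
qed

section \<open>Empirical tails and Chernoff bounds\<close>

definition emp_tail :: "nat \<Rightarrow> (nat \<Rightarrow> real) \<Rightarrow> real \<Rightarrow> real" where
  "emp_tail N x a = real (card {i\<in>{..<N}. a < x i}) / real N"

lemma emp_tail_bounds: "0 \<le> emp_tail N x a" "emp_tail N x a \<le> 1"
proof -
  have "card {i\<in>{..<N}. a < x i} \<le> card {..<N}" by (rule card_mono) auto
  then show "0 \<le> emp_tail N x a" "emp_tail N x a \<le> 1"
    by (auto simp: emp_tail_def divide_le_eq)
qed

lemma antimono_emp_tail: "antimono (emp_tail N x)"
  unfolding emp_tail_def by (intro antimonoI divide_right_mono of_nat_mono card_mono) auto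

lemma tailfn_emp_tail:
  assumes N: "0 < N" shows "tailfn (emp_tail N x)"
proof -
  obtain l where l: "\<And>i. i < N \<Longrightarrow> l < x i"
  proof -
    have "finite (x ` {..<N})" by simp
    then obtain m where "\<And>y. y \<in> x ` {..<N} \<Longrightarrow> m \<le> y" using bdd_below_finite[of "x ` {..<N}"] by (auto simp: bdd_below_def)
    then show ?thesis using that[of "m - 1"] by fastforce
  qed
  obtain u where u: "\<And>i. i < N \<Longrightarrow> x i \<le> u"
  proof -
    have "finite (x ` {..<N})" by simp
    then obtain m where "\<And>y. y \<in> x ` {..<N} \<Longrightarrow> y \<le> m" using bdd_above_finite[of "x ` {..<N}"] by (auto simp: bdd_above_def)
    then show ?thesis using that by blast
  qed
  have "emp_tail N x a = 1" if "a \<le> l" for a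
  proof -
    have "{i\<in>{..<N}. a < x i} = {..<N}" using l that by force
    then show ?thesis using N by (simp add: emp_tail_def)
  qed
  moreover have "emp_tail N x a = 0" if "u \<le> a" for a
  proof -
    have "{i\<in>{..<N}. a < x i} = {}" using u that by force
    then show ?thesis by (simp add: emp_tail_def)
  qed
  ultimately have "\<forall>\<^sub>F a in at_bot. emp_tail N x a = 1" "\<forall>\<^sub>F a in at_top. emp_tail N x a = 0"
    unfolding eventually_at_bot_linorder eventually_at_top_linorder by blast+
  then show ?thesis
    using antimono_emp_tail emp_tail_bounds by (auto simp: tailfn_def intro: tendsto_eventually)
qed

lemma card_eq_sum_indicator:
  "finite R \<Longrightarrow> real (card {i\<in>R. b < x i}) = (\<Sum>i\<in>R. indicator {b<..} (x i))"
  by (simp add: indicator_def sum.If_cases Int_def)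

text \<open>The exponent in the moment bounds is a sum of \<open>hit\<close> probabilities; through
  this identity the heat flow of the empirical tail enters.\<close>

lemma sum_hit:
  assumes "finite R"
  shows "(\<Sum>i\<in>R. hit {a<..} d (x i)) = heat d (\<lambda>b. real (card {i\<in>R. b < x i})) a"
proof -
  have "indicator {a - sqrt d * z<..} (x i) = (indicator {a<..} (x i + sqrt d * z) :: real)" for z i
    by (auto split: split_indicator)
  then show ?thesis
    unfolding heat_def card_eq_sum_indicator[OF assms] hit_def
    by (subst Bochner_Integration.integral_sum) (auto intro!: integrable_hit)
qed

lemma heat_mult_left: "heat d (\<lambda>x. c * F x) a = c * heat d F a"
  by (simp add: heat_def)

lemma sum_hit_emp_tail:
  assumes "0 < N" shows "(\<Sum>i<N. hit {a<..} d (x i)) = N * heat d (emp_tail N x) a"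
proof -
  have "(\<lambda>b. real (card {i\<in>{..<N}. b < x i})) = (\<lambda>b. real N * emp_tail N x b)"
    using assms by (simp add: emp_tail_def fun_eq_iff)
  then show ?thesis by (simp add: sum_hit heat_mult_left)
qed

lemma measurable_emp_tail [measurable]: "(\<lambda>x. emp_tail N x a) \<in> borel_measurable (state_space N)"
proof -
  have "(\<lambda>x. \<Sum>i<N. indicator {a<..} (x i) :: real) \<in> borel_measurable (state_space N)"
  proof (rule borel_measurable_sum)
    fix i assume "i \<in> {..<N}"
    then have [measurable]: "(\<lambda>x. x i) \<in> borel_measurable (state_space N)"
      by (intro measurable_state_component[of "\<lambda>x. x" _ N]) auto
    show "(\<lambda>x. indicator {a<..} (x i) :: real) \<in> borel_measurable (state_space N)" by measurable
  qed
  then show ?thesis unfolding emp_tail_def using card_eq_sum_indicator[of "{..<N}" a] by simp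
qed

lemma prod_yule_hit_0:
  fixes x :: "nat \<Rightarrow> real"
  shows "(\<Prod>i<N. yule_hit C {a<..} 0 (x i)) = (1 + yule C 0) ^ card {i\<in>{..<N}. a < x i}"
proof -
  have "(\<Prod>i<N. yule_hit C {a<..} 0 (x i)) = (\<Prod>i<N. if a < x i then 1 + yule C 0 else 1)"
    by (intro prod.cong) (auto simp: yule_hit_def hit_0)
  also have "\<dots> = (\<Prod>i\<in>{i\<in>{..<N}. a < x i}. 1 + yule C 0)"
    by (subst prod.inter_filter) auto
  finally show ?thesis by simp
qed

lemma prod_le_exp_sum:
  fixes f :: "'a \<Rightarrow> real"
  assumes "\<And>i. i \<in> R \<Longrightarrow> 0 \<le> 1 + f i" shows "(\<Prod>i\<in>R. 1 + f i) \<le> exp (\<Sum>i\<in>R. f i)"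
proof (cases "finite R")
  case True
  have "(\<Prod>i\<in>R. 1 + f i) \<le> (\<Prod>i\<in>R. exp (f i))"
    using assms by (intro prod_mono) (auto simp: exp_ge_add_one_self)
  then show ?thesis using True by (simp add: exp_sum)
qed simp

lemma emeasure_le_by_exp:
  assumes [measurable]: "f \<in> borel_measurable M" "{\<omega>\<in>space M. P \<omega>} \<in> sets M"
    and le: "\<And>\<omega>. \<omega> \<in> space M \<Longrightarrow> P \<omega> \<Longrightarrow> ennreal c \<le> f \<omega>" and c: "0 < c" and B: "(\<integral>\<^sup>+\<omega>. f \<omega> \<partial>M) \<le> ennreal b" and b: "0 \<le> b"
  shows "emeasure M {\<omega>\<in>space M. P \<omega>} \<le> ennreal (b / c)"
proof -
  have "ennreal c * emeasure M {\<omega>\<in>space M. P \<omega>} = (\<integral>\<^sup>+\<omega>. ennreal c * indicator {\<omega>\<in>space M. P \<omega>} \<omega> \<partial>M)"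
    by (simp add: nn_integral_cmult_indicator)
  also have "\<dots> \<le> (\<integral>\<^sup>+\<omega>. f \<omega> \<partial>M)"
    using le by (intro nn_integral_mono) (auto split: split_indicator)
  also have "\<dots> \<le> ennreal b" by (rule B)
  finally have "ennreal (1 / c) * (ennreal c * emeasure M {\<omega>\<in>space M. P \<omega>}) \<le> ennreal (1 / c) * ennreal b"
    by (intro mult_left_mono) auto
  then show ?thesis
    using c b by (simp add: mult.assoc[symmetric] ennreal_mult'[symmetric])
qed

text \<open>Chernoff bound. The rate \<kappa> depends neither on the configuration nor on the
  threshold, so it can be averaged over an unknown stationary law.\<close>

lemma upper_tail_bound:
  assumes t: "0 \<le> t" and e: "0 < \<epsilon>"
  shows "\<exists>\<kappa>>0. \<forall>N>0. \<forall>x\<in>space (state_space N). \<forall>a.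
    emeasure (noise N) {\<omega>\<in>space (noise N). exp t * heat t (emp_tail N x) a + \<epsilon> \<le> emp_tail N (NBBM N x t \<omega>) a} \<le> ennreal (exp (- \<kappa> * N))"
proof -
  \<comment> \<open>The first entry keeps v = C * exp t at most 1/2, where v / (1 - v) \<le> v + 2 *
    v^2; the second keeps the quadratic term below C * \<epsilon> / 2, half of the gain.\<close>
  define C where "C = min (exp (- t) / 2) (\<epsilon> * exp (- (2 * t)) / 4)"
  have C: "0 < C" using e by (simp add: C_def)
  have Ct: "C * exp t \<le> 1 / 2"
  proof -
    have "C * exp t \<le> exp (- t) / 2 * exp t" by (intro mult_right_mono) (auto simp: C_def)
    then show ?thesis by (simp flip: exp_add)
  qed
  have C2: "C * exp (2 * t) \<le> \<epsilon> / 4"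
  proof -
    have "C * exp (2 * t) \<le> \<epsilon> * exp (- (2 * t)) / 4 * exp (2 * t)" by (intro mult_right_mono) (auto simp: C_def)
    then show ?thesis by (simp add: mult.assoc flip: exp_add)
  qed
  have C1: "C < 1" using mult_exp_less_1[of C t 0] Ct t by simp
  have main: "emeasure (noise N) {\<omega>\<in>space (noise N). exp t * heat t (emp_tail N x) a + \<epsilon> \<le> emp_tail N (NBBM N x t \<omega>) a} \<le> ennreal (exp (- (C * \<epsilon> / 2) * N))"
    if N: "0 < N" and x: "x \<in> space (state_space N)" for N x a
  proof -
    define Y where "Y = heat t (emp_tail N x) a"
    have Y: "0 \<le> Y" "Y \<le> 1"
      using heat_bounds[of "emp_tail N x" t a] tailfnD[OF tailfn_emp_tail[OF N, of x]] by (auto simp: Y_def)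
    define al where "al = yule C t"
    have al: "0 \<le> al" "al \<le> C * exp t + 2 * (C * exp t)\<^sup>2"
    proof -
      define v where "v = C * exp t"
      have v: "0 < v" "v \<le> 1 / 2" using C Ct by (auto simp: v_def)
      have alv: "al = v / (1 - v)" by (simp add: al_def yule_def v_def)
      show "0 \<le> al" using v by (simp add: alv)
      have "v \<le> (v + 2 * v\<^sup>2) * (1 - v)"
      proof -
        have "(v + 2 * v\<^sup>2) * (1 - v) - v = v\<^sup>2 * (1 - 2 * v)" by (simp add: algebra_simps power2_eq_square)
        moreover have "0 \<le> v\<^sup>2 * (1 - 2 * v)" using v by simp
        ultimately show ?thesis by linarith
      qed
      then show "al \<le> C * exp t + 2 * (C * exp t)\<^sup>2" using v by (simp add: alv v_def[symmetric] pos_divide_le_eq)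
    qed
    have NB: "(\<lambda>\<omega>. NBBM N x t \<omega>) \<in> measurable (noise N) (state_space N)"
      using x by (intro measurable_NBBM[OF N]) auto
    have "emeasure (noise N) {\<omega>\<in>space (noise N). exp t * Y + \<epsilon> \<le> emp_tail N (NBBM N x t \<omega>) a} \<le> ennreal (exp (al * (N * Y)) / exp (C * (N * (exp t * Y + \<epsilon>))))"
    proof (rule emeasure_le_by_exp[where f="\<lambda>\<omega>. \<Prod>i<N. ennreal (yule_hit C {a<..} 0 (NBBM N x t \<omega> i))"])
      show "(\<lambda>\<omega>. \<Prod>i<N. ennreal (yule_hit C {a<..} 0 (NBBM N x t \<omega> i))) \<in> borel_measurable (noise N)"
        using measurable_compose[OF NB measurable_prod_yule_hit] by simp
      have "(\<lambda>\<omega>. emp_tail N (NBBM N x t \<omega>) a) \<in> borel_measurable (noise N)"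
        using measurable_compose[OF NB measurable_emp_tail] by simp
      then show "{\<omega>\<in>space (noise N). exp t * Y + \<epsilon> \<le> emp_tail N (NBBM N x t \<omega>) a} \<in> sets (noise N)" by measurable
      fix \<omega> assume le: "exp t * Y + \<epsilon> \<le> emp_tail N (NBBM N x t \<omega>) a"
      let ?S = "card {i\<in>{..<N}. a < NBBM N x t \<omega> i}"
      have "C * (N * (exp t * Y + \<epsilon>)) \<le> C * ?S"
        using le C N by (intro mult_left_mono) (auto simp: emp_tail_def field_simps)
      then have "exp (C * (N * (exp t * Y + \<epsilon>))) \<le> exp (C * ?S)" by simp
      also have "\<dots> = exp C ^ ?S" by (simp add: exp_of_nat_mult[symmetric] mult.commute)
      also have "\<dots> \<le> (1 + yule C 0) ^ ?S"
      proof (intro power_mono)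
        have "1 + yule C 0 = 1 / (1 - C)" using yule_add_1[of C 0] C1 by simp
        moreover have "exp C * (1 - C) \<le> exp C * exp (- C)"
          using exp_ge_add_one_self[of "- C"] by (intro mult_left_mono) auto
        ultimately show "exp C \<le> 1 + yule C 0" using C1 by (simp add: pos_le_divide_eq flip: exp_add)
      qed simp
      also have "\<dots> = (\<Prod>i<N. yule_hit C {a<..} 0 (NBBM N x t \<omega> i))" by (simp add: prod_yule_hit_0)
      also have "ennreal \<dots> = (\<Prod>i<N. ennreal (yule_hit C {a<..} 0 (NBBM N x t \<omega> i)))"
        using yule_hit_pos[of C 0 "{a<..}"] C1 by (intro prod_ennreal[symmetric]) (auto intro: less_imp_le)
      finally show "ennreal (exp (C * (N * (exp t * Y + \<epsilon>)))) \<le> (\<Prod>i<N. ennreal (yule_hit C {a<..} 0 (NBBM N x t \<omega> i)))"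
        by (simp add: ennreal_leI)
    next
      have "(\<integral>\<^sup>+\<omega>. (\<Prod>i<N. ennreal (yule_hit C {a<..} 0 (NBBM N x t \<omega> i))) \<partial>noise N) \<le> ennreal (\<Prod>i<N. yule_hit C {a<..} t (x i))"
        using C Ct by (intro NBBM_exp_moment_le N x t) auto
      also have "(\<Prod>i<N. yule_hit C {a<..} t (x i)) \<le> exp (\<Sum>i<N. al * hit {a<..} t (x i))"
        unfolding yule_hit_def al_def[symmetric] using al hit_nonneg[of "{a<..}" t] by (intro prod_le_exp_sum) auto
      also have "(\<Sum>i<N. al * hit {a<..} t (x i)) = al * (N * Y)"
        by (simp add: sum_distrib_left[symmetric] sum_hit_emp_tail[OF N] Y_def)
      finally show "(\<integral>\<^sup>+\<omega>. (\<Prod>i<N. ennreal (yule_hit C {a<..} 0 (NBBM N x t \<omega> i))) \<partial>noise N) \<le> ennreal (exp (al * (N * Y)))"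
        by (simp add: ennreal_leI)
    qed auto
    also have "exp (al * (N * Y)) / exp (C * (N * (exp t * Y + \<epsilon>))) \<le> exp (- (C * \<epsilon> / 2) * N)"
    proof -
      have "al * Y \<le> (C * exp t + 2 * (C * exp t)\<^sup>2) * Y" using al Y by (intro mult_right_mono) auto
      also have "\<dots> \<le> C * exp t * Y + 2 * (C * exp t)\<^sup>2 * 1"
        unfolding distrib_right using Y by (intro add_left_mono mult_left_mono) auto
      also have "2 * (C * exp t)\<^sup>2 = 2 * C * (C * exp (2 * t))"
        by (simp add: power_mult_distrib exp_double power2_eq_square[of C])
      also have "2 * C * (C * exp (2 * t)) \<le> 2 * C * (\<epsilon> / 4)" using C2 C by (intro mult_left_mono) auto
      finally have "al * Y - C * (exp t * Y + \<epsilon>) \<le> - (C * \<epsilon> / 2)" by (simp add: algebra_simps)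
      then have "real N * (al * Y - C * (exp t * Y + \<epsilon>)) \<le> real N * - (C * \<epsilon> / 2)" by (intro mult_left_mono) auto
      then show ?thesis by (simp add: exp_diff[symmetric] algebra_simps)
    qed
    finally show ?thesis by (simp add: Y_def ennreal_leI)
  qed
  show ?thesis using C e main by (intro exI[of _ "C * \<epsilon> / 2"]) auto
qed

lemma top_subset:
  fixes x :: "nat \<Rightarrow> real"
  shows "n \<le> N \<Longrightarrow> \<exists>R\<subseteq>{..<N}. card R = n \<and> (\<forall>i\<in>R. \<forall>j\<in>{..<N} - R. x j \<le> x i)"
proof (induction n)
  case 0
  then show ?case by (intro exI[of _ "{}"]) auto
next
  case (Suc n)
  then obtain R where R: "R \<subseteq> {..<N}" "card R = n" "\<And>i j. i \<in> R \<Longrightarrow> j \<in> {..<N} - R \<Longrightarrow> x j \<le> x i" by auto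
  have finR: "finite R" using R(1) finite_subset by blast
  have "{..<N} - R \<noteq> {}"
  proof
    assume "{..<N} - R = {}"
    then have "card {..<N} \<le> card R" using finR by (intro card_mono) auto
    then show False using R(2) Suc.prems by simp
  qed
  then have "Max (x ` ({..<N} - R)) \<in> x ` ({..<N} - R)" by (intro Max_in) auto
  then obtain k where k: "k \<in> {..<N} - R" "x k = Max (x ` ({..<N} - R))" by auto
  have kmax: "x j \<le> x k" if "j \<in> {..<N} - R" for j unfolding k(2) using that by (intro Max_ge) auto
  show ?case
  proof (intro exI[of _ "insert k R"] conjI ballI)
    show "card (insert k R) = Suc n" using k finR R(2) by simp
    fix i j assume "i \<in> insert k R" "j \<in> {..<N} - insert k R"
    then show "x j \<le> x i" using kmax R(3) by auto
  qed (use R k in auto)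
qed

text \<open>Restriction to the rightmost particles caps the counts at card R, the discrete
  counterpart of the cap in \<open>grow\<close>.\<close>

lemma card_top_subset_ge:
  fixes x :: "nat \<Rightarrow> real"
  assumes R: "R \<subseteq> {..<N}" "\<forall>i\<in>R. \<forall>j\<in>{..<N} - R. x j \<le> x i"
  shows "min (card {i\<in>{..<N}. b < x i}) (card R) \<le> card {i\<in>R. b < x i}"
proof -
  have finR: "finite R" using R(1) finite_subset by blast
  show ?thesis
  proof (cases "\<exists>j\<in>{..<N} - R. b < x j")
    case True
    then have "{i\<in>R. b < x i} = R" using R(2) by force
    then show ?thesis by simp
  next
    case False
    then have "{i\<in>{..<N}. b < x i} \<subseteq> {i\<in>R. b < x i}" using R(1) by auto
    then have "card {i\<in>{..<N}. b < x i} \<le> card {i\<in>R. b < x i}" using finR by (intro card_mono) auto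
    then show ?thesis by simp
  qed
qed

text \<open>Only the n rightmost particles are followed, with n close to (1 - \<epsilon>) * exp (-t)
  * N. Branching freely they number about (1 - \<epsilon>) * N at time t, so up to exponentially
  small probability they do not fill the system. Discarding the others before the growth is what
  produces \<open>lo\<close> instead of \<open>up\<close>.\<close>

lemma lower_tail_bound:
  assumes t: "0 \<le> t" and e: "0 < \<epsilon>" "\<epsilon> < 1"
  shows "\<exists>\<kappa>>0. \<forall>N>0. exp t \<le> \<epsilon> * N \<longrightarrow> (\<forall>x\<in>space (state_space N). \<forall>a.
    emeasure (noise N) {\<omega>\<in>space (noise N). emp_tail N (NBBM N x t \<omega>) a \<le> lo t (emp_tail N x) a - 3 * \<epsilon>} \<le> ennreal (2 * exp (- \<kappa> * N)))"
proof -
  \<comment> \<open>Chernoff parameter for the size of the Yule process. The bound D * exp t \<le>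
    \<epsilon> / 4 keeps the growth exponent below (1 - \<epsilon> / 2) * D * N, strictly less than
    the D * N gained from (1 - D)^N.\<close>
  define D where "D = min (\<epsilon> * exp (- t) / 4) (exp (- t) / 2)"
  have D: "0 < D" using e by (simp add: D_def)
  have Dt: "D * exp t \<le> 1 / 2" "D * exp t \<le> \<epsilon> / 4"
  proof -
    have "D * exp t \<le> exp (- t) / 2 * exp t" by (intro mult_right_mono) (auto simp: D_def)
    then show "D * exp t \<le> 1 / 2" by (simp flip: exp_add)
    have "D * exp t \<le> \<epsilon> * exp (- t) / 4 * exp t" by (intro mult_right_mono) (auto simp: D_def)
    then show "D * exp t \<le> \<epsilon> / 4" by (simp add: mult.assoc flip: exp_add)
  qed
  have D1: "D < 1" using mult_exp_less_1[of D t 0] Dt t by simp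
  \<comment> \<open>The factor exp (C * N) of Markov's inequality also multiplies the Yule error, so
    C has to be small compared with \<epsilon> * D; the other entry controls the quadratic term as
    in the upper bound.\<close>
  define C where "C = min (\<epsilon> * D / 4) (\<epsilon> * exp (- (2 * t)) / 2)"
  have C: "0 < C" "C \<le> \<epsilon> * D / 4" using e D by (auto simp: C_def)
  have C2: "C * exp (2 * t) \<le> \<epsilon> / 2"
  proof -
    have "C * exp (2 * t) \<le> \<epsilon> * exp (- (2 * t)) / 2 * exp (2 * t)" by (intro mult_right_mono) (auto simp: C_def)
    then show ?thesis by (simp add: mult.assoc flip: exp_add)
  qed
  define \<kappa> where "\<kappa> = min (C * \<epsilon> / 2) (\<epsilon> * D / 4)"
  have \<kappa>: "0 < \<kappa>" using C D e by (simp add: \<kappa>_def)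
  have main: "emeasure (noise N) {\<omega>\<in>space (noise N). emp_tail N (NBBM N x t \<omega>) a \<le> lo t (emp_tail N x) a - 3 * \<epsilon>} \<le> ennreal (2 * exp (- \<kappa> * N))"
    if N: "0 < N" and Nt: "exp t \<le> \<epsilon> * N" and x: "x \<in> space (state_space N)" for N x a
  proof -
    define F where "F = emp_tail N x"
    define q where "q = lo t F a"
    have tF: "tailfn F" unfolding F_def by (rule tailfn_emp_tail[OF N])
    have q: "0 \<le> q" "q \<le> 1" using tailfnD(2,3)[OF tailfn_lo[OF tF t], of a] by (auto simp: q_def)
    \<comment> \<open>Rounding down loses at most one particle, which amounts to exp t after the
      growth; the assumption exp t \<le> \<epsilon> * N covers it.\<close>
    define n where "n = nat \<lfloor>N * (1 - \<epsilon>) * exp (- t)\<rfloor>"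
    have nn: "0 \<le> N * (1 - \<epsilon>) * exp (- t)" using e by simp
    have n: "real n \<le> N * (1 - \<epsilon>) * exp (- t)" "N * (1 - \<epsilon>) * exp (- t) - 1 \<le> real n"
      using nn by (auto simp: n_def)
    have "real N * (1 - \<epsilon>) * exp (- t) \<le> real N * 1 * 1" using e t by (intro mult_mono) auto
    then have nN: "n \<le> N" using n(1) by linarith
    obtain R where R: "R \<subseteq> {..<N}" "card R = n" "\<forall>i\<in>R. \<forall>j\<in>{..<N} - R. x j \<le> x i"
      using top_subset[OF nN, of x] by blast
    have finR: "finite R" using R(1) finite_subset by blast
    define H where "H = (\<Sum>i\<in>R. hit {a<..} t (x i))"
    have H: "0 \<le> H" "H \<le> N"
    proof -
      show "0 \<le> H" unfolding H_def by (intro sum_nonneg hit_nonneg)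
      have "H \<le> (\<Sum>i\<in>R. 1)" unfolding H_def by (intro sum_mono hit_le_1) simp
      then show "H \<le> N" using R(2) nN by simp
    qed
    have Hq: "N * (q - 2 * \<epsilon>) \<le> exp t * H"
    proof -
      define K where "K = N * \<epsilon> * exp (- t) + 1"
      have tg: "tailfn (grow t F)" by (rule tailfn_grow[OF tF t])
      have pw: "N * exp (- t) * grow t F b + - K \<le> real (card {i\<in>R. b < x i})" for b
      proof -
        have "exp (- t) * grow t F b = min (exp (- t) * (exp t * F b)) (exp (- t) * 1)"
          unfolding grow_def by (rule min_mult_distrib_left[THEN trans]) simp
        also have "exp (- t) * (exp t * F b) = F b" by (simp add: mult.assoc[symmetric] flip: exp_add)
        finally have g: "exp (- t) * grow t F b = min (F b) (exp (- t))" by simp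
        have "real (min (card {i\<in>{..<N}. b < x i}) (card R)) \<le> real (card {i\<in>R. b < x i})"
          using card_top_subset_ge[OF R(1,3), of b] by (rule of_nat_mono)
        then have "min (N * F b) (real n) \<le> real (card {i\<in>R. b < x i})"
          using N R(2) by (simp add: F_def emp_tail_def of_nat_min)
        moreover have "N * min (F b) (exp (- t)) - K \<le> min (N * F b) (real n)"
        proof -
          have "N * min (F b) (exp (- t)) \<le> N * F b" "N * min (F b) (exp (- t)) \<le> N * exp (- t)"
            by (intro mult_left_mono; simp)+
          moreover have "N * exp (- t) - K \<le> n" using n(2) by (simp add: K_def algebra_simps)
          moreover have "0 \<le> K" using e by (simp add: K_def)
          ultimately show ?thesis by simp
        qed
        ultimately have "N * min (F b) (exp (- t)) - K \<le> real (card {i\<in>R. b < x i})" by linarith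
        then show ?thesis by (simp add: mult.assoc g)
      qed
      have m1: "(\<lambda>b. N * exp (- t) * grow t F b) \<in> borel_measurable borel" using tailfnD(5)[OF tg] by measurable
      have b1: "\<bar>N * exp (- t) * grow t F b\<bar> \<le> N * exp (- t)" for b
        using tailfnD(2,3)[OF tg, of b] by (simp add: abs_mult mult_left_le)
      have "heat t (\<lambda>b. N * exp (- t) * grow t F b + - K) a \<le> heat t (\<lambda>b. real (card {i\<in>R. b < x i})) a"
      proof (rule heat_mono[where C="N * exp (- t) + K" and C'="N"])
        show "\<bar>N * exp (- t) * grow t F b + - K\<bar> \<le> N * exp (- t) + K" for b
        proof -
          have "0 \<le> K" using e by (simp add: K_def)
          then show ?thesis using b1[of b] by linarith
        qed
        show "(\<lambda>b. real (card {i\<in>R. b < x i})) \<in> borel_measurable borel"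
          using finR by (intro borel_measurable_antimono antimonoI of_nat_mono card_mono) auto
        show "\<bar>real (card {i\<in>R. b < x i})\<bar> \<le> N" for b
          using card_mono[OF finR, of "{i\<in>R. b < x i}"] R(2) nN by auto
      qed (use m1 pw in auto)
      also have "heat t (\<lambda>b. N * exp (- t) * grow t F b + - K) a = N * exp (- t) * q + - K"
        by (subst heat_add_const[OF m1 b1]) (simp add: heat_mult_left q_def lo_def)
      also have "heat t (\<lambda>b. real (card {i\<in>R. b < x i})) a = H" by (simp add: H_def sum_hit[OF finR])
      finally have "exp t * (N * exp (- t) * q + - K) \<le> exp t * H" by simp
      also have "exp t * (N * exp (- t) * q + - K) = N * q - N * \<epsilon> - exp t"
        by (simp add: K_def algebra_simps flip: exp_add)
      finally show ?thesis using Nt by (simp add: algebra_simps)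
    qed
    define v where "v = C * exp t"
    have v: "0 < v" using C by (simp add: v_def)
    define \<beta> where "\<beta> = v / (1 + v)"
    have \<beta>: "yule (- C) t = - \<beta>" by (simp add: yule_def \<beta>_def v_def)
    have \<beta>1: "0 \<le> \<beta>" "\<beta> \<le> 1" "v - v\<^sup>2 \<le> \<beta>"
    proof -
      have "(v - v\<^sup>2) * (1 + v) = v - v * v\<^sup>2" by (simp add: algebra_simps power2_eq_square)
      also have "\<dots> \<le> v" using v by simp
      finally show "v - v\<^sup>2 \<le> \<beta>" using v by (simp add: \<beta>_def pos_le_divide_eq)
    qed (use v in \<open>auto simp: \<beta>_def\<close>)
    define E1 where "E1 = exp (- (\<beta> * H))"
    define E2 where "E2 = (1 - D) ^ N * (1 + yule D t) ^ n"
    have Cr: "- C * exp r < 1" for r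
      using mult_pos_pos[OF C(1) exp_gt_zero[of r]] by linarith
    have Dt1: "D * exp t < 1" using Dt by simp
    have E20: "0 \<le> E2" using D1 yule_gt[OF Dt1] by (simp add: E2_def)
    have NB: "(\<lambda>\<omega>. NBBM N x t \<omega>) \<in> measurable (noise N) (state_space N)"
      using x by (intro measurable_NBBM[OF N]) auto
    have "emeasure (noise N) {\<omega>\<in>space (noise N). emp_tail N (NBBM N x t \<omega>) a \<le> q - 3 * \<epsilon>} \<le> ennreal ((E1 + E2) / exp (- (C * (N * (q - 3 * \<epsilon>)))))"
    proof (rule emeasure_le_by_exp[where f="\<lambda>\<omega>. \<Prod>i<N. ennreal (yule_hit (- C) {a<..} 0 (NBBM N x t \<omega> i))"])
      show "(\<lambda>\<omega>. \<Prod>i<N. ennreal (yule_hit (- C) {a<..} 0 (NBBM N x t \<omega> i))) \<in> borel_measurable (noise N)"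
        using measurable_compose[OF NB measurable_prod_yule_hit] by simp
      have "(\<lambda>\<omega>. emp_tail N (NBBM N x t \<omega>) a) \<in> borel_measurable (noise N)"
        using measurable_compose[OF NB measurable_emp_tail] by simp
      then show "{\<omega>\<in>space (noise N). emp_tail N (NBBM N x t \<omega>) a \<le> q - 3 * \<epsilon>} \<in> sets (noise N)" by measurable
      fix \<omega> assume le: "emp_tail N (NBBM N x t \<omega>) a \<le> q - 3 * \<epsilon>"
      let ?S = "card {i\<in>{..<N}. a < NBBM N x t \<omega> i}"
      have "C * ?S \<le> C * (N * (q - 3 * \<epsilon>))"
        using le C N by (intro mult_left_mono) (auto simp: emp_tail_def field_simps)
      then have "exp (- (C * (N * (q - 3 * \<epsilon>)))) \<le> exp (- (C * ?S))" by simp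
      also have "\<dots> = exp (- C) ^ ?S" by (simp add: exp_of_nat_mult[symmetric] mult.commute)
      also have "\<dots> \<le> (1 + yule (- C) 0) ^ ?S"
      proof (intro power_mono)
        have y0: "1 + yule (- C) 0 = 1 / (1 + C)" using yule_add_1[of "- C" 0] C by simp
        have "exp (- C) * (1 + C) \<le> exp (- C) * exp C"
          by (intro mult_left_mono exp_ge_add_one_self) auto
        then have "exp (- C) * (1 + C) \<le> 1" by (simp flip: exp_add)
        then show "exp (- C) \<le> 1 + yule (- C) 0" unfolding y0 using C by (simp add: pos_le_divide_eq)
      qed simp
      also have "\<dots> = (\<Prod>i<N. yule_hit (- C) {a<..} 0 (NBBM N x t \<omega> i))" by (simp add: prod_yule_hit_0)
      also have "ennreal \<dots> = (\<Prod>i<N. ennreal (yule_hit (- C) {a<..} 0 (NBBM N x t \<omega> i)))"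
        using yule_hit_pos[OF Cr, of "{a<..}"] by (intro prod_ennreal[symmetric]) (auto intro: less_imp_le)
      finally show "ennreal (exp (- (C * (N * (q - 3 * \<epsilon>))))) \<le> (\<Prod>i<N. ennreal (yule_hit (- C) {a<..} 0 (NBBM N x t \<omega> i)))"
        by (simp add: ennreal_leI)
    next
      have "(\<integral>\<^sup>+\<omega>. (\<Prod>i<N. ennreal (yule_hit (- C) {a<..} 0 (NBBM N x t \<omega> i))) \<partial>noise N)
          \<le> ennreal (\<Prod>i\<in>R. yule_hit (- C) {a<..} t (x i)) + ennreal ((1 - D) ^ N * (1 + yule D t) ^ card R)"
        using C D Dt1 by (intro NBBM_neg_exp_moment_le N x t R(1)) auto
      also have "(\<Prod>i\<in>R. yule_hit (- C) {a<..} t (x i)) \<le> exp (\<Sum>i\<in>R. - \<beta> * hit {a<..} t (x i))"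
        unfolding yule_hit_def \<beta>
      proof (rule prod_le_exp_sum)
        fix i
        have "\<beta> * hit {a<..} t (x i) \<le> 1 * 1" using \<beta>1 by (intro mult_mono hit_le_1 hit_nonneg) auto
        then show "0 \<le> 1 + - \<beta> * hit {a<..} t (x i)" by simp
      qed
      also have "(\<Sum>i\<in>R. - \<beta> * hit {a<..} t (x i)) = - (\<beta> * H)" by (simp add: H_def sum_distrib_left sum_negf)
      also have "ennreal (exp (- (\<beta> * H))) + ennreal ((1 - D) ^ N * (1 + yule D t) ^ card R) = ennreal (E1 + E2)"
        using E20 by (simp add: E1_def E2_def R(2) ennreal_plus)
      finally show "(\<integral>\<^sup>+\<omega>. (\<Prod>i<N. ennreal (yule_hit (- C) {a<..} 0 (NBBM N x t \<omega> i))) \<partial>noise N) \<le> ennreal (E1 + E2)"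
        by (simp add: ennreal_leI)
    qed (use E20 in \<open>auto simp: E1_def\<close>)
    also have "(E1 + E2) / exp (- (C * (N * (q - 3 * \<epsilon>)))) = E1 * exp (C * (N * (q - 3 * \<epsilon>))) + E2 * exp (C * (N * (q - 3 * \<epsilon>)))"
      by (simp add: exp_minus divide_inverse distrib_right)
    also have "\<dots> \<le> exp (- \<kappa> * N) + exp (- \<kappa> * N)"
    proof (rule add_mono)
      have "C * (N * (q - 2 * \<epsilon>)) - C * (C * exp (2 * t)) * N \<le> \<beta> * H"
      proof -
        have "C * (N * (q - 2 * \<epsilon>)) \<le> C * (exp t * H)" using Hq C by (intro mult_left_mono) auto
        moreover have "v\<^sup>2 * H \<le> v\<^sup>2 * N" using H by (intro mult_left_mono) auto
        moreover have "v\<^sup>2 = C * (C * exp (2 * t))" by (simp add: v_def power_mult_distrib exp_double power2_eq_square[of C])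
        moreover have "(v - v\<^sup>2) * H \<le> \<beta> * H" using \<beta>1 H by (intro mult_right_mono) auto
        ultimately show ?thesis by (simp add: v_def algebra_simps)
      qed
      moreover have "C * (C * exp (2 * t)) * N \<le> C * (\<epsilon> / 2) * N"
        using C2 C by (intro mult_right_mono mult_left_mono) auto
      moreover have "\<kappa> * N \<le> C * \<epsilon> / 2 * N" by (intro mult_right_mono) (auto simp: \<kappa>_def)
      ultimately have "- (\<beta> * H) + C * (N * (q - 3 * \<epsilon>)) \<le> - \<kappa> * N" by (simp add: algebra_simps)
      then show "E1 * exp (C * (N * (q - 3 * \<epsilon>))) \<le> exp (- \<kappa> * N)" by (simp add: E1_def flip: exp_add)
      define w where "w = D * exp t"
      have w: "0 < w" "w \<le> 1 / 2" "w \<le> \<epsilon> / 4" using D Dt by (auto simp: w_def)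
      have "1 + yule D t = 1 + w / (1 - w)" by (simp add: yule_def w_def)
      also have "w / (1 - w) \<le> w + 2 * w\<^sup>2"
      proof -
        have "(w + 2 * w\<^sup>2) * (1 - w) - w = w\<^sup>2 * (1 - 2 * w)" by (simp add: algebra_simps power2_eq_square)
        moreover have "0 \<le> w\<^sup>2 * (1 - 2 * w)" using w by simp
        ultimately have "w \<le> (w + 2 * w\<^sup>2) * (1 - w)" by linarith
        then show ?thesis using w by (simp add: pos_divide_le_eq)
      qed
      also have "1 + (w + 2 * w\<^sup>2) \<le> exp (w + 2 * w\<^sup>2)" by (rule exp_ge_add_one_self)
      finally have y: "1 + yule D t \<le> exp (w + 2 * w\<^sup>2)" by simp
      have "E2 \<le> exp (- D) ^ N * exp (w + 2 * w\<^sup>2) ^ n"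
        unfolding E2_def using y D1 yule_gt[OF Dt1] exp_ge_add_one_self[of "- D"] by (intro mult_mono power_mono) auto
      also have "\<dots> = exp (- (D * N) + n * (w + 2 * w\<^sup>2))"
        by (simp only: exp_of_nat_mult[symmetric] exp_add[symmetric] mult_minus_right mult.commute[of D])
      finally have "E2 * exp (C * (N * (q - 3 * \<epsilon>))) \<le> exp (- (D * N) + n * (w + 2 * w\<^sup>2)) * exp (C * (N * (q - 3 * \<epsilon>)))"
        by (intro mult_right_mono) auto
      also have "\<dots> = exp (- (D * N) + n * (w + 2 * w\<^sup>2) + C * (N * (q - 3 * \<epsilon>)))" by (simp add: exp_add)
      also have "\<dots> \<le> exp (- \<kappa> * N)"
      proof -
        have "q - 3 * \<epsilon> \<le> 1" using q e by linarith
        then have "C * (N * (q - 3 * \<epsilon>)) \<le> C * (real N * 1)" using C(1) by (intro mult_left_mono) auto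
        also have "\<dots> \<le> \<epsilon> * D / 4 * (real N * 1)" using C by (intro mult_right_mono) auto
        finally have "C * (N * (q - 3 * \<epsilon>)) \<le> \<epsilon> * D / 4 * (real N * 1)" .
        moreover have "n * (w + 2 * w\<^sup>2) \<le> N * (1 - \<epsilon>) * exp (- t) * (w + 2 * w\<^sup>2)"
          using n(1) w by (intro mult_right_mono) auto
        moreover have "N * (1 - \<epsilon>) * exp (- t) * (w + 2 * w\<^sup>2) = N * (1 - \<epsilon>) * (D + 2 * w * D)"
          by (simp add: w_def power2_eq_square algebra_simps flip: exp_add)
        moreover have "N * (1 - \<epsilon>) * (D + 2 * w * D) \<le> N * (D - \<epsilon> * D + \<epsilon> / 2 * D)"
        proof -
          have "(1 - \<epsilon>) * (2 * w * D) \<le> 1 * (\<epsilon> / 2 * D)" using w e D by (intro mult_mono) auto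
          then have "(1 - \<epsilon>) * (D + 2 * w * D) \<le> D - \<epsilon> * D + \<epsilon> / 2 * D" by (simp add: algebra_simps)
          then have "N * ((1 - \<epsilon>) * (D + 2 * w * D)) \<le> N * (D - \<epsilon> * D + \<epsilon> / 2 * D)" by (intro mult_left_mono) auto
          then show ?thesis by (simp add: mult.assoc)
        qed
        moreover have "\<kappa> * N \<le> \<epsilon> * D / 4 * N" by (intro mult_right_mono) (auto simp: \<kappa>_def)
        ultimately have "- (D * N) + n * (w + 2 * w\<^sup>2) + C * (N * (q - 3 * \<epsilon>)) \<le> - \<kappa> * N" by (simp add: algebra_simps)
        then show ?thesis by simp
      qed
      finally show "E2 * exp (C * (N * (q - 3 * \<epsilon>))) \<le> exp (- \<kappa> * N)" .
    qed
    finally show ?thesis by (simp add: q_def F_def ennreal_leI)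
  qed
  show ?thesis using \<kappa> main by blast
qed

section \<open>Lower bound for the stationary tail\<close>

text \<open>Polya's argument for monotone functions: a comparison with a continuous tail h at its
  quantiles extends to all points at the cost of 1 / m. The points may depend on h, but their number
  will not, so a union bound over them is uniform in the configuration.\<close>

definition quantile_grid :: "(real \<Rightarrow> real) \<Rightarrow> nat \<Rightarrow> real set \<Rightarrow> bool" where
  "quantile_grid h m A \<longleftrightarrow> (\<forall>F e. antimono F \<longrightarrow> (\<forall>a. 0 \<le> F a \<and> F a \<le> 1) \<longrightarrow> 0 \<le> e \<longrightarrow>
    ((\<forall>a\<in>A. F a \<le> h a + e) \<longrightarrow> (\<forall>a. F a \<le> h a + e + 1 / real m)) \<and>
    ((\<forall>a\<in>A. h a - e \<le> F a) \<longrightarrow> (\<forall>a. h a - e - 1 / real m \<le> F a)))"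

lemma quantile_gridD:
  assumes "quantile_grid h m A" "antimono F" "\<And>a. 0 \<le> F a \<and> F a \<le> 1" "0 \<le> e"
  shows "(\<And>a. a \<in> A \<Longrightarrow> F a \<le> h a + e) \<Longrightarrow> F a \<le> h a + e + 1 / real m"
    and "(\<And>a. a \<in> A \<Longrightarrow> h a - e \<le> F a) \<Longrightarrow> h a - e - 1 / real m \<le> F a"
  using assms unfolding quantile_grid_def by simp_all

lemma ex_quantile_grid:
  assumes h: "tailfn h" "\<And>a. isCont h a" and m: "0 < m"
  shows "\<exists>A. finite A \<and> card A \<le> m \<and> quantile_grid h m A"
proof -
  have "\<forall>j\<in>{0<..<m}. \<exists>a. h a = real j / real m"
  proof
    fix j assume "j \<in> {0<..<m}"
    then show "\<exists>a. h a = real j / real m" using IVT_tailfn[OF h, of "real j / real m"] by (auto simp: divide_less_eq)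
  qed
  then obtain p where p: "\<And>j. j \<in> {0<..<m} \<Longrightarrow> h (p j) = real j / real m" by metis
  let ?A = "p ` {0<..<m}"
  have "card ?A \<le> card {0<..<m}" by (rule card_image_le) simp
  then have card: "card ?A \<le> m" by simp
  have ha: "antimono h" and hb: "\<And>a. 0 \<le> h a" "\<And>a. h a \<le> 1" using tailfnD[OF h(1)] by auto
  have mr: "0 < real m" using m by simp
  have "quantile_grid h m ?A"
    unfolding quantile_grid_def
  proof (intro conjI allI impI)
    fix F :: "real \<Rightarrow> real" and e a :: real
    assume F: "antimono F" "\<forall>a. 0 \<le> F a \<and> F a \<le> 1" and e: "0 \<le> e"
    {
      assume le: "\<forall>a\<in>?A. F a \<le> h a + e"
      show "F a \<le> h a + e + 1 / real m"
      proof (cases "real m - 1 \<le> h a * real m")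
        case True
        then have "1 \<le> h a + 1 / real m" using mr by (simp add: field_simps)
        then show ?thesis using F(2)[rule_format, of a] e by linarith
      next
        case False
        \<comment> \<open>The first multiple of 1 / m strictly above h a; its quantile lies to the
          left of a.\<close>
        define j where "j = Suc (nat \<lfloor>h a * real m\<rfloor>)"
        have fl: "real (nat \<lfloor>h a * real m\<rfloor>) = of_int \<lfloor>h a * real m\<rfloor>" using hb[of a] by simp
        have j: "h a * real m < real j" "real j \<le> h a * real m + 1" unfolding j_def of_nat_Suc fl by linarith+
        then have "real j < real m" using False by linarith
        then have jm: "j \<in> {0<..<m}" by (simp add: j_def)
        have "h a < h (p j)" using j(1) mr by (simp add: p[OF jm] pos_less_divide_eq)
        then have "p j \<le> a" using antimonoD[OF ha, of a "p j"] by linarith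
        then have "F a \<le> F (p j)" by (rule antimonoD[OF F(1)])
        also have "\<dots> \<le> h (p j) + e" using le jm by blast
        also have "h (p j) \<le> h a + 1 / real m" using j(2) mr by (simp add: p[OF jm] field_simps)
        finally show ?thesis by simp
      qed
    }
    {
      assume le: "\<forall>a\<in>?A. h a - e \<le> F a"
      show "h a - e - 1 / real m \<le> F a"
      proof (cases "h a * real m \<le> 1")
        case True
        then have "h a \<le> 1 / real m" using mr by (simp add: pos_le_divide_eq)
        then show ?thesis using F(2)[rule_format, of a] e by linarith
      next
        case False
        \<comment> \<open>The last multiple of 1 / m strictly below h a; its quantile lies to the
          right of a.\<close>
        define j where "j = nat (\<lceil>h a * real m\<rceil> - 1)"
        have "real j = of_int (\<lceil>h a * real m\<rceil> - 1)" unfolding j_def using False by simp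
        then have j: "real j < h a * real m" "h a * real m \<le> real j + 1" by linarith+
        have "h a * real m \<le> 1 * real m" using hb(2)[of a] by (intro mult_right_mono) auto
        then have "real j < real m" using j(1) by linarith
        moreover have "0 < real j" using j(2) False by linarith
        ultimately have jm: "j \<in> {0<..<m}" by simp
        have "h (p j) < h a" using j(1) mr by (simp add: p[OF jm] pos_divide_less_eq)
        then have "a \<le> p j" using antimonoD[OF ha, of "p j" a] by linarith
        then have "F (p j) \<le> F a" by (rule antimonoD[OF F(1)])
        moreover have "h (p j) - e \<le> F (p j)" using le jm by blast
        moreover have "h a \<le> (real j + 1) / real m" using j(2) mr by (simp add: pos_le_divide_eq)
        then have "h a - 1 / real m \<le> h (p j)" by (simp add: p[OF jm] add_divide_distrib)
        ultimately show ?thesis by simp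
      qed
    }
  qed
  then show ?thesis using card by blast
qed

text \<open>The Chernoff bounds at the grids of the two flows are combined by a union bound. The
  exceptional set of noises depends on x, the bound on its probability does not.\<close>

lemma one_step_sandwich:
  assumes t: "0 < t" and e: "0 < \<epsilon>"
  shows "\<exists>err. err \<longlonglongrightarrow> 0 \<and> (\<forall>N. 0 \<le> err N) \<and> (\<forall>\<^sub>F N in sequentially. \<forall>x\<in>space (state_space N). \<exists>B\<in>sets (noise N).
    emeasure (noise N) B \<le> ennreal (err N) \<and>
    (\<forall>\<omega>\<in>space (noise N) - B. \<forall>a. lo t (emp_tail N x) a - \<epsilon> \<le> emp_tail N (NBBM N x t \<omega>) a \<and>
       emp_tail N (NBBM N x t \<omega>) a \<le> up t (emp_tail N x) a + \<epsilon>))"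
proof -
  \<comment> \<open>The lower tail bound loses 3 * e1 and the grid another \<epsilon> / 2; the entry
    1 / 2 keeps e1 below 1.\<close>
  define e1 where "e1 = min (\<epsilon> / 6) (1 / 2)"
  have e1: "0 < e1" "e1 < 1" "3 * e1 \<le> \<epsilon> / 2" "e1 \<le> \<epsilon> / 2" using e by (auto simp: e1_def)
  obtain \<kappa>1 where k1: "0 < \<kappa>1" "\<And>N x a. 0 < N \<Longrightarrow> x \<in> space (state_space N) \<Longrightarrow>
    emeasure (noise N) {\<omega>\<in>space (noise N). exp t * heat t (emp_tail N x) a + e1 \<le> emp_tail N (NBBM N x t \<omega>) a} \<le> ennreal (exp (- \<kappa>1 * N))"
    using upper_tail_bound[of t e1] t e1 by (meson less_imp_le)
  obtain \<kappa>2 where k2: "0 < \<kappa>2" "\<And>N x a. 0 < N \<Longrightarrow> exp t \<le> e1 * N \<Longrightarrow> x \<in> space (state_space N) \<Longrightarrow>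
    emeasure (noise N) {\<omega>\<in>space (noise N). emp_tail N (NBBM N x t \<omega>) a \<le> lo t (emp_tail N x) a - 3 * e1} \<le> ennreal (2 * exp (- \<kappa>2 * N))"
    using lower_tail_bound[of t e1] t e1 by (meson less_imp_le)
  obtain m where m: "0 < m" "1 / real m \<le> \<epsilon> / 2"
  proof -
    obtain n where "inverse (real (Suc n)) < \<epsilon> / 2" using reals_Archimedean[of "\<epsilon> / 2"] e by auto
    then show ?thesis using that[of "Suc n"] by (simp add: inverse_eq_divide)
  qed
  define err where "err N = real m * exp (- \<kappa>1 * real N) + real m * (2 * exp (- \<kappa>2 * real N))" for N
  have "err \<longlonglongrightarrow> real m * 0 + real m * (2 * 0)"
  proof -
    have "(\<lambda>N. exp (- \<kappa> * real N)) \<longlonglongrightarrow> 0" if "0 < \<kappa>" for \<kappa> using that by real_asymp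
    then show ?thesis unfolding err_def using k1(1) k2(1) by (intro tendsto_intros) auto
  qed
  then have "err \<longlonglongrightarrow> 0" by simp
  moreover have "0 \<le> err N" for N by (simp add: err_def)
  moreover have "\<forall>\<^sub>F N in sequentially. \<forall>x\<in>space (state_space N). \<exists>B\<in>sets (noise N).
    emeasure (noise N) B \<le> ennreal (err N) \<and>
    (\<forall>\<omega>\<in>space (noise N) - B. \<forall>a. lo t (emp_tail N x) a - \<epsilon> \<le> emp_tail N (NBBM N x t \<omega>) a \<and>
       emp_tail N (NBBM N x t \<omega>) a \<le> up t (emp_tail N x) a + \<epsilon>)"
  proof -
    have "\<forall>\<^sub>F N in sequentially. exp t \<le> e1 * real N" using e1(1) by real_asymp
    then show ?thesis using eventually_gt_at_top[of "0::nat"]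
    proof eventually_elim
      case (elim N)
      then have N: "0 < N" "exp t \<le> e1 * N" by auto
      show ?case
      proof
        fix x assume x: "x \<in> space (state_space N)"
        define F where "F = emp_tail N x"
        have tF: "tailfn F" unfolding F_def by (rule tailfn_emp_tail[OF N(1)])
        have tu: "tailfn (up t F)" "\<And>a. isCont (up t F) a" and tl: "tailfn (lo t F)" "\<And>a. isCont (lo t F) a"
          using t tF by (auto intro: tailfn_up tailfn_lo isCont_up isCont_lo)
        obtain A1 where A1: "finite A1" "card A1 \<le> m" "quantile_grid (up t F) m A1"
          using ex_quantile_grid[OF tu m(1)] by blast
        obtain A2 where A2: "finite A2" "card A2 \<le> m" "quantile_grid (lo t F) m A2"
          using ex_quantile_grid[OF tl m(1)] by blast
        let ?X = "\<lambda>\<omega>. emp_tail N (NBBM N x t \<omega>)"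
        have NB: "(\<lambda>\<omega>. NBBM N x t \<omega>) \<in> measurable (noise N) (state_space N)"
          using x by (intro measurable_NBBM[OF N(1)]) auto
        have Xm[measurable]: "(\<lambda>\<omega>. ?X \<omega> a) \<in> borel_measurable (noise N)" for a
          using measurable_compose[OF NB measurable_emp_tail] by simp
        define B1 where "B1 a = {\<omega>\<in>space (noise N). exp t * heat t F a + e1 \<le> ?X \<omega> a}" for a
        define B2 where "B2 a = {\<omega>\<in>space (noise N). ?X \<omega> a \<le> lo t F a - 3 * e1}" for a
        have Bm: "B1 a \<in> sets (noise N)" "B2 a \<in> sets (noise N)" for a
          unfolding B1_def B2_def by measurable
        let ?B = "(\<Union>a\<in>A1. B1 a) \<union> (\<Union>a\<in>A2. B2 a)"
        have Bs: "(\<Union>a\<in>A1. B1 a) \<in> sets (noise N)" "(\<Union>a\<in>A2. B2 a) \<in> sets (noise N)"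
          using Bm A1(1) A2(1) by auto
        have "emeasure (noise N) (\<Union>a\<in>A1. B1 a) \<le> (\<Sum>a\<in>A1. emeasure (noise N) (B1 a))"
          using Bm A1(1) by (intro emeasure_subadditive_finite) auto
        also have "\<dots> \<le> (\<Sum>a\<in>A1. ennreal (exp (- \<kappa>1 * N)))"
          unfolding B1_def F_def by (intro sum_mono k1(2) N x)
        also have "\<dots> = ennreal (card A1 * exp (- \<kappa>1 * N))"
          by (simp add: ennreal_of_nat_eq_real_of_nat ennreal_mult'[symmetric])
        also have "\<dots> \<le> ennreal (m * exp (- \<kappa>1 * N))" using A1(2) by (intro ennreal_leI mult_right_mono) auto
        finally have b1: "emeasure (noise N) (\<Union>a\<in>A1. B1 a) \<le> ennreal (m * exp (- \<kappa>1 * N))" .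
        have "emeasure (noise N) (\<Union>a\<in>A2. B2 a) \<le> (\<Sum>a\<in>A2. emeasure (noise N) (B2 a))"
          using Bm A2(1) by (intro emeasure_subadditive_finite) auto
        also have "\<dots> \<le> (\<Sum>a\<in>A2. ennreal (2 * exp (- \<kappa>2 * N)))"
          unfolding B2_def F_def by (intro sum_mono k2(2) N x)
        also have "\<dots> = ennreal (card A2 * (2 * exp (- \<kappa>2 * N)))"
          by (simp add: ennreal_of_nat_eq_real_of_nat ennreal_mult'[symmetric])
        also have "\<dots> \<le> ennreal (m * (2 * exp (- \<kappa>2 * N)))" using A2(2) by (intro ennreal_leI mult_right_mono) auto
        finally have b2: "emeasure (noise N) (\<Union>a\<in>A2. B2 a) \<le> ennreal (m * (2 * exp (- \<kappa>2 * N)))" .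
        have "emeasure (noise N) ?B \<le> emeasure (noise N) (\<Union>a\<in>A1. B1 a) + emeasure (noise N) (\<Union>a\<in>A2. B2 a)"
          by (rule emeasure_subadditive[OF Bs])
        also have "\<dots> \<le> ennreal (m * exp (- \<kappa>1 * N)) + ennreal (m * (2 * exp (- \<kappa>2 * N)))"
          by (intro add_mono b1 b2)
        also have "\<dots> = ennreal (err N)" unfolding err_def by (intro ennreal_plus[symmetric]) auto
        finally have B: "emeasure (noise N) ?B \<le> ennreal (err N)" .
        show "\<exists>B\<in>sets (noise N). emeasure (noise N) B \<le> ennreal (err N) \<and>
          (\<forall>\<omega>\<in>space (noise N) - B. \<forall>a. lo t (emp_tail N x) a - \<epsilon> \<le> ?X \<omega> a \<and> ?X \<omega> a \<le> up t (emp_tail N x) a + \<epsilon>)"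
        proof (intro bexI[of _ ?B] conjI ballI allI)
          fix \<omega> a assume w: "\<omega> \<in> space (noise N) - ?B"
          have X: "antimono (?X \<omega>)" "\<And>a. 0 \<le> ?X \<omega> a \<and> ?X \<omega> a \<le> 1"
            by (auto intro: antimono_emp_tail emp_tail_bounds)
          have "?X \<omega> a \<le> up t F a + e1 + 1 / real m"
          proof (rule quantile_gridD(1)[OF A1(3) X])
            fix a assume "a \<in> A1"
            then have "?X \<omega> a < exp t * heat t F a + e1" using w by (force simp: B1_def)
            then show "?X \<omega> a \<le> up t F a + e1"
              using e1(1) emp_tail_bounds(2)[of N "NBBM N x t \<omega>" a] by (simp add: up_def grow_def min_def)
          qed (use e1(1) in simp)
          then show "?X \<omega> a \<le> up t (emp_tail N x) a + \<epsilon>" using m(2) e1(4) by (simp add: F_def)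
          have "lo t F a - 3 * e1 - 1 / real m \<le> ?X \<omega> a"
          proof (rule quantile_gridD(2)[OF A2(3) X])
            fix a assume "a \<in> A2"
            then show "lo t F a - 3 * e1 \<le> ?X \<omega> a" using w by (force simp: B2_def)
          qed (use e1(1) in simp)
          then show "lo t (emp_tail N x) a - \<epsilon> \<le> ?X \<omega> a" using m(2) e1(3) by (simp add: F_def)
        qed (use Bs B in auto)
      qed
    qed
  qed
  ultimately show ?thesis by blast
qed

section \<open>The chain of recentred time steps\<close>

definition step :: "nat \<Rightarrow> real \<Rightarrow> (nat \<Rightarrow> real) \<Rightarrow> (real \<times> (nat \<Rightarrow> real) \<times> nat) stream \<Rightarrow> (nat \<Rightarrow> real)" where
  "step N d y \<omega> = recentre N (NBBM N y d \<omega>)"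

lemma emp_tail_recentre:
  "emp_tail N (recentre N x) a = emp_tail N x (a + Min (x ` {..<N}))"
proof -
  have "{i\<in>{..<N}. a < recentre N x i} = {i\<in>{..<N}. a + Min (x ` {..<N}) < x i}"
    by (auto simp: recentre_def)
  then show ?thesis by (simp add: emp_tail_def)
qed

lemma recentre_Gamma:
  assumes "0 < N" shows "recentre N x \<in> Gamma N"
proof -
  have "Min (x ` {..<N}) \<in> x ` {..<N}" using assms by (intro Min_in) auto
  then obtain i where "i < N" "x i = Min (x ` {..<N})" by auto
  moreover have "Min (x ` {..<N}) \<le> x j" if "j < N" for j using that by (intro Min_le) auto
  ultimately show ?thesis by (auto simp: Gamma_def recentre_def)
qed

lemma Gamma_space: "y \<in> Gamma N \<Longrightarrow> y \<in> space (state_space N)"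
  by (simp add: Gamma_def space_state_space)

lemma measurable_step:
  assumes N: "0 < N" and f: "f \<in> measurable M (state_space N)" and g: "g \<in> measurable M (noise N)"
  shows "(\<lambda>w. step N d (f w) (g w)) \<in> measurable M (state_space N)"
  unfolding step_def by (rule measurable_compose[OF measurable_NBBM[OF N f g] measurable_recentre[OF N]])

text \<open>The probability of being outside \<open>E\<close> after \<open>k\<close> steps.\<close>
primrec miss :: "nat \<Rightarrow> real \<Rightarrow> (nat \<Rightarrow> real) set \<Rightarrow> nat \<Rightarrow> (nat \<Rightarrow> real) \<Rightarrow> ennreal" where
  "miss N d E 0 y = indicator (- E) y"
| "miss N d E (Suc k) y = (\<integral>\<^sup>+\<omega>. miss N d E k (step N d y \<omega>) \<partial>noise N)"

lemma miss_le_1: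
  assumes "0 < N" shows "miss N d E k y \<le> 1"
proof (induction k arbitrary: y)
  case (Suc k)
  interpret prob_space "noise N" by (rule prob_space_noise[OF assms])
  have "miss N d E (Suc k) y \<le> (\<integral>\<^sup>+\<omega>. 1 \<partial>noise N)" unfolding miss.simps by (intro nn_integral_mono Suc)
  then show ?case by (simp add: emeasure_space_1)
qed (auto split: split_indicator)

lemma measurable_miss:
  assumes N: "0 < N" and E: "E \<in> sets (state_space N)"
  shows "miss N d E k \<in> borel_measurable (state_space N)"
proof (induction k)
  case 0
  have "(\<lambda>y. 1 - indicator E y :: ennreal) \<in> borel_measurable (state_space N)" using E by measurable
  moreover have "(1 :: ennreal) - indicator E y = indicator (- E) y" for y :: "nat \<Rightarrow> real" by (auto split: split_indicator)
  ultimately show ?case by (simp add: fun_eq_iff cong: measurable_cong)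
next
  case (Suc k)
  interpret prob_space "noise N" by (rule prob_space_noise[OF N])
  have "(\<lambda>p. miss N d E k (step N d (fst p) (snd p))) \<in> borel_measurable (state_space N \<Otimes>\<^sub>M noise N)"
    by (rule measurable_compose[OF measurable_step[OF N] Suc]) measurable
  from borel_measurable_nn_integral_fst[OF this] show ?case by simp
qed

lemma nn_integral_stationary:
  assumes N: "0 < N" and st: "NBBM_stationary N \<psi>" and d: "0 \<le> d" and f: "f \<in> borel_measurable (state_space N)"
  shows "(\<integral>\<^sup>+y. \<integral>\<^sup>+\<omega>. f (step N d y \<omega>) \<partial>noise N \<partial>\<psi>) = (\<integral>\<^sup>+y. f y \<partial>\<psi>)"
proof -
  interpret prob_space "noise N" by (rule prob_space_noise[OF N])
  have s: "sets \<psi> = sets (state_space N)" and D: "distr (\<psi> \<Otimes>\<^sub>M noise N) (state_space N) (\<lambda>(y, \<omega>). recentre N (NBBM N y d \<omega>)) = \<psi>"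
    using st d by (auto simp: NBBM_stationary_def)
  have m: "(\<lambda>p. step N d (fst p) (snd p)) \<in> measurable (\<psi> \<Otimes>\<^sub>M noise N) (state_space N)"
  proof (rule measurable_step[OF N])
    have "fst \<in> measurable (\<psi> \<Otimes>\<^sub>M noise N) \<psi>" by measurable
    then show "fst \<in> measurable (\<psi> \<Otimes>\<^sub>M noise N) (state_space N)" using measurable_cong_sets[OF refl s] by blast
  qed measurable
  have "(\<integral>\<^sup>+y. f y \<partial>\<psi>) = (\<integral>\<^sup>+y. f y \<partial>distr (\<psi> \<Otimes>\<^sub>M noise N) (state_space N) (\<lambda>p. step N d (fst p) (snd p)))"
  proof -
    have "(\<lambda>(y, \<omega>). recentre N (NBBM N y d \<omega>)) = (\<lambda>p. step N d (fst p) (snd p))" by (auto simp: step_def)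
    from D[unfolded this] show ?thesis by (simp only:)
  qed
  also have "\<dots> = (\<integral>\<^sup>+p. f (step N d (fst p) (snd p)) \<partial>(\<psi> \<Otimes>\<^sub>M noise N))"
    using f by (intro nn_integral_distr[OF m]) simp
  also have "\<dots> = (\<integral>\<^sup>+y. \<integral>\<^sup>+\<omega>. f (step N d y \<omega>) \<partial>noise N \<partial>\<psi>)"
    using nn_integral_fst[of "\<lambda>p. f (step N d (fst p) (snd p))" \<psi>] measurable_compose[OF m f] by simp
  finally show ?thesis by simp
qed

text \<open>Each step with fresh noise preserves \<psi>. Iterating the one-step identity takes the
  place of a Markov property of \<open>NBBM\<close> over k steps.\<close>

lemma nn_integral_miss:
  assumes N: "0 < N" and st: "NBBM_stationary N \<psi>" and d: "0 \<le> d" and E: "E \<in> sets (state_space N)"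
  shows "(\<integral>\<^sup>+y. miss N d E k y \<partial>\<psi>) = (\<integral>\<^sup>+y. indicator (- E) y \<partial>\<psi>)"
  by (induction k) (simp_all add: nn_integral_stationary[OF N st d measurable_miss[OF N E]])

text \<open>The shift \<open>b\<close> absorbs the recentring.\<close>
definition near :: "nat \<Rightarrow> real \<Rightarrow> nat \<Rightarrow> real \<Rightarrow> (real \<Rightarrow> real) \<Rightarrow> (nat \<Rightarrow> real) \<Rightarrow> bool" where
  "near N d k e G y \<longleftrightarrow> (\<exists>b. \<forall>a. (lo d ^^ k) G (a + b) - e \<le> emp_tail N y a \<and> emp_tail N y a \<le> (up d ^^ k) G (a + b) + e)"

lemma lo_shift: "lo d (\<lambda>x. F (x + b)) a = lo d F (a + b)"
proof -
  have "grow d (\<lambda>x. F (x + b)) = (\<lambda>x. grow d F (x + b))" by (simp add: grow_def fun_eq_iff)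
  then show ?thesis by (simp add: lo_def heat_shift)
qed

text \<open>The old error is multiplied by exp d, the new step adds \<epsilon>, and the position of
  the leftmost particle is added to the shift b.\<close>

lemma near_step:
  assumes N: "0 < N" and d: "0 \<le> d" and G: "tailfn G" and y: "near N d k e G y" and e: "0 \<le> e"
    and X: "\<And>a. lo d (emp_tail N y) a - \<epsilon> \<le> emp_tail N (NBBM N y d \<omega>) a \<and> emp_tail N (NBBM N y d \<omega>) a \<le> up d (emp_tail N y) a + \<epsilon>"
  shows "near N d (Suc k) (exp d * e + \<epsilon>) G (step N d y \<omega>)"
proof -
  obtain b where b: "\<And>a. (lo d ^^ k) G (a + b) - e \<le> emp_tail N y a" "\<And>a. emp_tail N y a \<le> (up d ^^ k) G (a + b) + e"
    using y by (auto simp: near_def)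
  have tl: "tailfn ((lo d ^^ k) G)" and tu: "tailfn ((up d ^^ k) G)" and ty: "tailfn (emp_tail N y)"
    using tailfn_lo_iter[OF G d] tailfn_up_iter[OF G d] tailfn_emp_tail[OF N] by auto
  have am: "antimono (\<lambda>x. (lo d ^^ k) G (x + b))" "antimono (\<lambda>x. (up d ^^ k) G (x + b))"
    using antimonoD[OF tailfnD(1)[OF tl]] antimonoD[OF tailfnD(1)[OF tu]] by (auto intro!: antimonoI)
  have 1: "lo d (\<lambda>x. (lo d ^^ k) G (x + b)) a \<le> lo d (emp_tail N y) a + exp d * e" for a
    by (rule lo_mono_err[where C=1 and C'=1])
       (use am tailfnD(4)[OF tl] tailfnD(1,4)[OF ty] b(1) e in \<open>auto simp: diff_le_eq\<close>)
  have 2: "up d (emp_tail N y) a \<le> up d (\<lambda>x. (up d ^^ k) G (x + b)) a + exp d * e" for a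
    by (rule up_mono_err[where C=1 and C'=1])
       (use borel_measurable_antimono[OF am(2)] tailfnD(4)[OF tu] tailfnD(4,5)[OF ty] b(2) e in auto)
  let ?M = "Min (NBBM N y d \<omega> ` {..<N})"
  show ?thesis
    unfolding near_def
  proof (intro exI[of _ "?M + b"] allI conjI)
    fix a
    have "(lo d ^^ Suc k) G (a + ?M + b) \<le> lo d (emp_tail N y) (a + ?M) + exp d * e"
      using 1[of "a + ?M"] by (simp add: lo_shift)
    also have "\<dots> \<le> emp_tail N (NBBM N y d \<omega>) (a + ?M) + \<epsilon> + exp d * e" using X[of "a + ?M"] by simp
    finally show "(lo d ^^ Suc k) G (a + (?M + b)) - (exp d * e + \<epsilon>) \<le> emp_tail N (step N d y \<omega>) a"
      by (simp add: step_def emp_tail_recentre add.assoc)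
    have "emp_tail N (NBBM N y d \<omega>) (a + ?M) \<le> up d (emp_tail N y) (a + ?M) + \<epsilon>" using X[of "a + ?M"] by simp
    also have "\<dots> \<le> (up d ^^ Suc k) G (a + ?M + b) + exp d * e + \<epsilon>"
      using 2[of "a + ?M"] by (simp add: up_shift)
    finally show "emp_tail N (step N d y \<omega>) a \<le> (up d ^^ Suc k) G (a + (?M + b)) + (exp d * e + \<epsilon>)"
      by (simp add: step_def emp_tail_recentre add.assoc)
  qed
qed

primrec acc_err :: "real \<Rightarrow> real \<Rightarrow> nat \<Rightarrow> real" where
  "acc_err d \<epsilon> 0 = 0"
| "acc_err d \<epsilon> (Suc k) = exp d * acc_err d \<epsilon> k + \<epsilon>"

lemma acc_err_nonneg: "0 \<le> \<epsilon> \<Longrightarrow> 0 \<le> acc_err d \<epsilon> k"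
  by (induction k) auto

lemma acc_err_scale: "acc_err d \<epsilon> k = \<epsilon> * acc_err d 1 k"
  by (induction k) (auto simp: algebra_simps)

text \<open>A union bound over the steps: j counts those already made, and E has to contain the
  configurations that are near the flow after all j + k steps.\<close>

lemma miss_le:
  assumes N: "0 < N" and d: "0 \<le> d" and G: "tailfn G" and eps: "0 \<le> \<epsilon>" and err: "0 \<le> err"
    and one: "\<And>x. x \<in> space (state_space N) \<Longrightarrow> \<exists>B\<in>sets (noise N). emeasure (noise N) B \<le> ennreal err \<and>
      (\<forall>\<omega>\<in>space (noise N) - B. \<forall>a. lo d (emp_tail N x) a - \<epsilon> \<le> emp_tail N (NBBM N x d \<omega>) a \<and>
       emp_tail N (NBBM N x d \<omega>) a \<le> up d (emp_tail N x) a + \<epsilon>)"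
    and y: "y \<in> Gamma N" "near N d j (acc_err d \<epsilon> j) G y"
    and E: "\<And>y'. y' \<in> Gamma N \<Longrightarrow> near N d (j + k) (acc_err d \<epsilon> (j + k)) G y' \<Longrightarrow> y' \<in> E"
  shows "miss N d E k y \<le> ennreal (k * err)"
  using y E
proof (induction k arbitrary: j y)
  case 0
  then show ?case by simp
next
  case (Suc k)
  interpret prob_space "noise N" by (rule prob_space_noise[OF N])
  obtain B where B: "B \<in> sets (noise N)" "emeasure (noise N) B \<le> ennreal err"
    "\<And>\<omega> a. \<omega> \<in> space (noise N) - B \<Longrightarrow> lo d (emp_tail N y) a - \<epsilon> \<le> emp_tail N (NBBM N y d \<omega>) a \<and>
       emp_tail N (NBBM N y d \<omega>) a \<le> up d (emp_tail N y) a + \<epsilon>"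
    using one[OF Gamma_space[OF Suc.prems(1)]] by blast
  have "miss N d E (Suc k) y \<le> (\<integral>\<^sup>+\<omega>. ennreal (k * err) + indicator B \<omega> \<partial>noise N)"
    unfolding miss.simps
  proof (rule nn_integral_mono)
    fix \<omega> assume w: "\<omega> \<in> space (noise N)"
    show "miss N d E k (step N d y \<omega>) \<le> ennreal (k * err) + indicator B \<omega>"
    proof (cases "\<omega> \<in> B")
      case True
      then show ?thesis using miss_le_1[OF N] by (simp add: add_increasing)
    next
      case False
      have "near N d (Suc j) (acc_err d \<epsilon> (Suc j)) G (step N d y \<omega>)"
        unfolding acc_err.simps
        by (rule near_step[OF N d G Suc.prems(2) acc_err_nonneg[OF eps]]) (use B(3) w False in auto)
      moreover have "step N d y \<omega> \<in> Gamma N" unfolding step_def by (rule recentre_Gamma[OF N])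
      ultimately have "miss N d E k (step N d y \<omega>) \<le> ennreal (k * err)"
        using Suc.prems(3) by (intro Suc.IH[of _ "Suc j"]) auto
      then show ?thesis using False by simp
    qed
  qed
  also have "\<dots> = ennreal (k * err) + emeasure (noise N) B"
    using B(1) by (simp add: nn_integral_add emeasure_space_1)
  also have "\<dots> \<le> ennreal (k * err) + ennreal err" using B(2) by (rule add_left_mono)
  also have "\<dots> = ennreal (Suc k * err)" using err by (simp add: ennreal_plus[symmetric] algebra_simps del: ennreal_plus)
  finally show ?case .
qed

lemma near_0: "near N d 0 0 (emp_tail N y) y"
  unfolding near_def by (intro exI[of _ 0]) simp

lemma emp_tail_Gamma: "0 < N \<Longrightarrow> y \<in> Gamma N \<Longrightarrow> a < 0 \<Longrightarrow> emp_tail N y a = 1"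
proof -
  assume "0 < N" "y \<in> Gamma N" "a < 0"
  then have "{i\<in>{..<N}. a < y i} = {..<N}" by (force simp: Gamma_def)
  then show ?thesis using \<open>0 < N\<close> by (simp add: emp_tail_def)
qed

text \<open>The shift b is unknown, but a configuration in \<open>Gamma\<close> has no particle to
  the left of 0. A point where the upper flow takes a value below 1 - e corresponds to one where the
  empirical tail is below 1, hence to a nonnegative one. Monotonicity then eliminates b, and
  stretching compares the flow with the step profile.\<close>

lemma near_imp_profile:
  assumes N: "0 < N" and d: "0 < d" and G: "tailfn G" and y: "y \<in> Gamma N" "near N d (Suc n) e G y"
    and e: "0 \<le> e" "e < 1 - prof d n z" and w: "0 \<le> w"
  shows "prof d n (z + w) - d - e \<le> emp_tail N y w"
proof -
  let ?G = "(up d ^^ Suc n) G"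
  obtain b where b: "\<And>a. (lo d ^^ Suc n) G (a + b) - e \<le> emp_tail N y a" "\<And>a. emp_tail N y a \<le> ?G (a + b) + e"
    using y(2) by (auto simp: near_def simp del: funpow.simps)
  \<comment> \<open>q has to exceed the step profile at z for the stretching and to stay below 1 - e
    for the error.\<close>
  obtain q where q: "prof d n z < q" "q < 1 - e" using dense[of "prof d n z" "1 - e"] e(2) by auto
  have "0 \<le> prof d n z" using tailfnD(2)[OF tailfn_prof[OF d]] .
  then have q01: "0 < q" "q < 1" using q e(1) by auto
  have tG: "tailfn ?G" using G d by (intro tailfn_up_iter) auto
  have "isCont ?G a" for a using G d by (auto intro!: isCont_up tailfn_up_iter)
  from IVT_tailfn[OF tG this q01] obtain x where x: "?G x = q" by blast
  have "emp_tail N y (x - b) < 1" using b(2)[of "x - b"] x q(2) by simp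
  then have "0 \<le> x - b" using emp_tail_Gamma[OF N y(1), of "x - b"] by linarith
  then have "emp_tail N y (x - b + w) \<le> emp_tail N y w" by (intro antimonoD[OF antimono_emp_tail]) simp
  moreover have "(lo d ^^ Suc n) G (x + w) - e \<le> emp_tail N y (x - b + w)" using b(1)[of "x - b + w"] by (simp add: algebra_simps)
  moreover have "?G (x + w) \<le> (lo d ^^ Suc n) G (x + w) + d" using d by (intro up_iter_le_lo_iter G) simp
  moreover have "prof d n (z + w) \<le> ?G (x + w)"
  proof (rule stretch_profile)
    show "stretch ?G (prof d n)" unfolding prof_def
      by (rule stretch_up_iter[OF G tailfn_heaviside d stretch_heaviside[OF G]])
    show "prof d n z < ?G x" unfolding x by (rule q(1))
  qed (rule w)
  ultimately show ?thesis by linarith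
qed

text \<open>The flow is started from the empirical tail of the random configuration itself, so
  nothing about its shape has to be known. The choices are made in the order \<eta>, then d, n and
  z, then \<epsilon>, and last N; stationarity carries the estimate after k steps back to
  \<psi>.\<close>

theorem emp_tail_lower_bound:
  fixes \<psi> :: "nat \<Rightarrow> (nat \<Rightarrow> real) measure"
  assumes st: "\<forall>N\<ge>2. NBBM_stationary N (\<psi> N)" and w: "0 \<le> w" and eta: "0 < \<eta>"
  shows "(\<lambda>N. measure (\<psi> N) {y\<in>space (\<psi> N). emp_tail N y w < pi_tail w - \<eta>}) \<longlonglongrightarrow> 0"
proof -
  obtain d n z where d: "0 < d" "d < \<eta> / 3" and z: "prof d n z < 1" "pi_tail w - \<eta> / 3 < prof d n (z + w)"
    using heaviside_profile[OF w, of "\<eta> / 3"] eta by auto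
  define k where "k = Suc n"
  define c where "c = acc_err d 1 k"
  have c: "0 \<le> c" by (simp add: c_def acc_err_nonneg)
  \<comment> \<open>The accumulated error is linear in the one-step error, so for fixed d and k it
    can be pushed below \<eta> / 3 and below the room 1 - prof d n z.\<close>
  define \<epsilon> where "\<epsilon> = min (\<eta> / 3) ((1 - prof d n z) / 2) / (c + 1)"
  have eps: "0 < \<epsilon>" using eta z(1) c by (simp add: \<epsilon>_def)
  define e where "e = acc_err d \<epsilon> k"
  have e0: "0 \<le> e" unfolding e_def using eps by (intro acc_err_nonneg) simp
  have "e \<le> \<epsilon> * (c + 1)" using eps by (simp add: e_def acc_err_scale[of d \<epsilon>] c_def)
  also have "\<dots> = min (\<eta> / 3) ((1 - prof d n z) / 2)" using c by (simp add: \<epsilon>_def)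
  finally have e: "e \<le> \<eta> / 3" "e < 1 - prof d n z" using z(1) by auto
  obtain err where err: "err \<longlonglongrightarrow> 0" "\<And>N. 0 \<le> err N" and ev: "\<forall>\<^sub>F N in sequentially. \<forall>x\<in>space (state_space N). \<exists>B\<in>sets (noise N).
    emeasure (noise N) B \<le> ennreal (err N) \<and>
    (\<forall>\<omega>\<in>space (noise N) - B. \<forall>a. lo d (emp_tail N x) a - \<epsilon> \<le> emp_tail N (NBBM N x d \<omega>) a \<and>
       emp_tail N (NBBM N x d \<omega>) a \<le> up d (emp_tail N x) a + \<epsilon>)"
    using one_step_sandwich[OF d(1) eps] by blast
  have "\<forall>\<^sub>F N in sequentially. measure (\<psi> N) {y\<in>space (\<psi> N). emp_tail N y w < pi_tail w - \<eta>} \<le> k * err N"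
    using ev eventually_ge_at_top[of 2]
  proof eventually_elim
    case (elim N)
    then have N: "0 < N" "2 \<le> N" by auto
    have stN: "NBBM_stationary N (\<psi> N)" using st N(2) by blast
    interpret P: prob_space "\<psi> N" using stN by (simp add: NBBM_stationary_def)
    have s: "sets (\<psi> N) = sets (state_space N)" using stN by (simp add: NBBM_stationary_def)
    have sp: "space (\<psi> N) = space (state_space N)" using s by (rule sets_eq_imp_space_eq)
    define E where "E = {y\<in>space (state_space N). pi_tail w - \<eta> \<le> emp_tail N y w}"
    have E: "E \<in> sets (state_space N)" unfolding E_def by measurable
    have m: "miss N d E k y \<le> ennreal (k * err N)" if y: "y \<in> Gamma N" for y
    proof (rule miss_le[OF N(1) _ tailfn_emp_tail[OF N(1)] _ err(2) _ y, where j=0 and \<epsilon>=\<epsilon>])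
      show "near N d 0 (acc_err d \<epsilon> 0) (emp_tail N y) y" by (simp add: near_0)
      fix y' assume y': "y' \<in> Gamma N" "near N d (0 + k) (acc_err d \<epsilon> (0 + k)) (emp_tail N y) y'"
      then have "near N d (Suc n) e (emp_tail N y) y'" by (simp add: e_def k_def)
      from near_imp_profile[OF N(1) d(1) tailfn_emp_tail[OF N(1)] y'(1) this e0 e(2) w]
      show "y' \<in> E" using z(2) d(2) e(1) Gamma_space[OF y'(1)] by (simp add: E_def)
    qed (use d eps elim(1) in auto)
    have "emeasure (\<psi> N) {y\<in>space (\<psi> N). emp_tail N y w < pi_tail w - \<eta>} = (\<integral>\<^sup>+y. indicator (- E) y \<partial>\<psi> N)"
    proof -
      have "{y\<in>space (\<psi> N). emp_tail N y w < pi_tail w - \<eta>} = space (\<psi> N) - E" by (auto simp: E_def sp)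
      moreover have "(\<integral>\<^sup>+y. indicator (- E) y \<partial>\<psi> N) = (\<integral>\<^sup>+y. indicator (space (\<psi> N) - E) y \<partial>\<psi> N)"
        by (intro nn_integral_cong) (auto split: split_indicator)
      moreover have "space (\<psi> N) - E \<in> sets (\<psi> N)" using E s by auto
      ultimately show ?thesis by simp
    qed
    also have "\<dots> = (\<integral>\<^sup>+y. miss N d E k y \<partial>\<psi> N)"
      using nn_integral_miss[OF N(1) stN _ E, of d k] d(1) by simp
    also have "\<dots> \<le> (\<integral>\<^sup>+y. ennreal (k * err N) \<partial>\<psi> N)"
    proof (rule nn_integral_mono_AE)
      have "AE y in \<psi> N. y \<in> Gamma N" using stN by (simp add: NBBM_stationary_def)
      then show "AE y in \<psi> N. miss N d E k y \<le> ennreal (k * err N)" using m by (auto elim!: eventually_mono)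
    qed
    also have "\<dots> = ennreal (k * err N)" by (simp add: P.emeasure_space_1)
    finally show ?case using err(2)[of N] by (simp add: P.emeasure_eq_measure)
  qed
  note bound = this
  have lim: "(\<lambda>N. real k * err N) \<longlonglongrightarrow> 0" using tendsto_mult[OF tendsto_const err(1)] by simp
  show ?thesis by (rule tendsto_sandwich[OF _ bound tendsto_const lim]) simp
qed

section \<open>Drift bound for the stationary mean\<close>

lemma nn_integral_exp_gauss_vec:
  "(\<integral>\<^sup>+z. ennreal (exp (\<Sum>j<N. c j * z j)) \<partial>gauss_vec N) = ennreal (exp ((\<Sum>j<N. (c j)\<^sup>2) / 2))"
proof -
  interpret V: product_sigma_finite "\<lambda>_::nat. std_gauss"
    by (intro product_sigma_finite.intro gauss.sigma_finite_measure_axioms)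
  have "(\<integral>\<^sup>+z. ennreal (exp (\<Sum>j<N. c j * z j)) \<partial>gauss_vec N) = (\<integral>\<^sup>+z. (\<Prod>j<N. ennreal (exp (c j * z j))) \<partial>gauss_vec N)"
    by (simp add: exp_sum prod_ennreal)
  also have "\<dots> = (\<Prod>j<N. \<integral>\<^sup>+z. ennreal (exp (c j * z)) \<partial>std_gauss)"
    by (rule V.product_nn_integral_prod) auto
  also have "\<dots> = ennreal (exp ((\<Sum>j<N. (c j)\<^sup>2) / 2))"
    by (simp add: nn_integral_exp_gauss prod_ennreal exp_sum[symmetric] sum_divide_distrib)
  finally show ?thesis .
qed

definition avg :: "nat \<Rightarrow> (nat \<Rightarrow> real) \<Rightarrow> real" where
  "avg N x = (\<Sum>i<N. x i) / N"

text \<open>The Lyapunov function of the drift argument; being invariant under translations, it does not see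
  the recentring.\<close>
definition expo_sum :: "nat \<Rightarrow> (nat \<Rightarrow> real) \<Rightarrow> real" where
  "expo_sum N x = (\<Sum>i<N. exp (sqrt 2 * (x i - avg N x)))"

text \<open>The centred coordinates sum to 0, so 1 + x \<le> exp x gives even the bound N. It makes
  the logarithm of the Lyapunov function nonnegative.\<close>

lemma expo_sum_ge_1:
  assumes N: "0 < N" shows "1 \<le> expo_sum N x"
proof -
  have "real N = (\<Sum>i<N. 1 + sqrt 2 * (x i - avg N x))"
    using N by (simp add: sum.distrib sum_distrib_left[symmetric] sum_subtractf avg_def)
  also have "\<dots> \<le> expo_sum N x" unfolding expo_sum_def by (intro sum_mono exp_ge_add_one_self)
  finally show ?thesis using N by linarith
qed

lemma measurable_state_proj: "i < N \<Longrightarrow> (\<lambda>x. x i) \<in> borel_measurable (state_space N)"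
  by (intro measurable_state_component[of "\<lambda>x. x" _ N]) auto

lemma measurable_avg [measurable]: "avg N \<in> borel_measurable (state_space N)"
  unfolding avg_def[abs_def] by (intro borel_measurable_divide borel_measurable_sum measurable_state_proj) auto

lemma measurable_expo_sum [measurable]: "expo_sum N \<in> borel_measurable (state_space N)"
  unfolding expo_sum_def[abs_def]
proof (rule borel_measurable_sum)
  fix i assume "i \<in> {..<N}"
  then have [measurable]: "(\<lambda>x. x i) \<in> borel_measurable (state_space N)" by (simp add: measurable_state_proj)
  show "(\<lambda>x. exp (sqrt 2 * (x i - avg N x))) \<in> borel_measurable (state_space N)" by measurable
qed

lemma avg_branch:
  assumes N: "0 < N" shows "avg N (branch N y u) = avg N y + (y u - y (leftmost N y)) / N"
proof -
  let ?l = "leftmost N y"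
  have l: "?l \<in> {..<N}" using leftmost_props(1)[OF N] by simp
  have "(\<Sum>i<N. branch N y u i) = y u + (\<Sum>i\<in>{..<N} - {?l}. branch N y u i)"
    using l by (subst sum.remove[of _ ?l]) (auto simp: branch_def)
  also have "(\<Sum>i\<in>{..<N} - {?l}. branch N y u i) = (\<Sum>i\<in>{..<N} - {?l}. y i)"
    by (intro sum.cong) (auto simp: branch_def)
  also have "\<dots> = (\<Sum>i<N. y i) - y ?l" using l by (subst sum.remove[of "{..<N}" ?l]) auto
  finally show ?thesis by (simp add: avg_def add_divide_distrib diff_divide_distrib)
qed

text \<open>The mean moves right by 1 / N times the jump, which multiplies all summands by a common
  factor. In the sharp version a fixed label k replaces the leftmost one: after diffusion the
  leftmost label is random, while with k the exponent stays linear in the Gaussian vector.\<close>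

lemma expo_sum_branch_le:
  assumes N: "0 < N" and u: "u < N" and k: "k < N"
  shows "expo_sum N (branch N y u) \<le> exp (- (sqrt 2 * (y u - y k) / N)) * (expo_sum N y + exp (sqrt 2 * (y u - avg N y)))"
    and "expo_sum N (branch N y u) \<le> expo_sum N y + exp (sqrt 2 * (y u - avg N y))"
proof -
  let ?l = "leftmost N y" and ?b = "branch N y u"
  have l: "?l \<in> {..<N}" "y ?l \<le> y u" "y ?l \<le> y k" using leftmost_props[OF N, where x=y] u k by auto
  define g where "g = exp (- (sqrt 2 * (y u - y ?l) / N))"
  have e: "exp (sqrt 2 * (v - avg N ?b)) = g * exp (sqrt 2 * (v - avg N y))" for v
    by (simp add: g_def avg_branch[OF N] algebra_simps flip: exp_add)
  have "expo_sum N ?b = g * (\<Sum>i<N. exp (sqrt 2 * (?b i - avg N y)))"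
    by (simp add: expo_sum_def e sum_distrib_left)
  also have "(\<Sum>i<N. exp (sqrt 2 * (?b i - avg N y))) \<le> expo_sum N y + exp (sqrt 2 * (y u - avg N y))"
  proof -
    have "(\<Sum>i<N. exp (sqrt 2 * (?b i - avg N y))) = exp (sqrt 2 * (y u - avg N y)) + (\<Sum>i\<in>{..<N} - {?l}. exp (sqrt 2 * (?b i - avg N y)))"
      using l(1) by (subst sum.remove[of _ ?l]) (auto simp: branch_def)
    also have "(\<Sum>i\<in>{..<N} - {?l}. exp (sqrt 2 * (?b i - avg N y))) = (\<Sum>i\<in>{..<N} - {?l}. exp (sqrt 2 * (y i - avg N y)))"
      by (intro sum.cong) (auto simp: branch_def)
    also have "\<dots> \<le> expo_sum N y" unfolding expo_sum_def by (intro sum_mono2) auto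
    finally show ?thesis by simp
  qed
  finally have b: "expo_sum N ?b \<le> g * (expo_sum N y + exp (sqrt 2 * (y u - avg N y)))" by (simp add: g_def)
  have pos: "0 \<le> expo_sum N y + exp (sqrt 2 * (y u - avg N y))"
    using expo_sum_ge_1[OF N, of y] exp_gt_zero[of "sqrt 2 * (y u - avg N y)"] by linarith
  have "g \<le> exp (- (sqrt 2 * (y u - y k) / N))"
    unfolding g_def using l N by (simp add: divide_right_mono)
  then show "expo_sum N ?b \<le> exp (- (sqrt 2 * (y u - y k) / N)) * (expo_sum N y + exp (sqrt 2 * (y u - avg N y)))"
    using mult_right_mono[OF _ pos] b by (meson order_trans)
  have "g \<le> 1" using l by (simp add: g_def)
  then show "expo_sum N ?b \<le> expo_sum N y + exp (sqrt 2 * (y u - avg N y))"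
    using mult_right_mono[OF _ pos, of g 1] b by simp
qed

section \<open>Gaussian moments of centred linear forms\<close>

lemma nn_integral_exp_diffuse:
  assumes s: "0 \<le> s"
  shows "(\<integral>\<^sup>+z. ennreal (exp (sqrt 2 * (\<Sum>j<N. c j * diffuse N x s z j))) \<partial>gauss_vec N)
    = ennreal (exp (sqrt 2 * (\<Sum>j<N. c j * x j) + s * (\<Sum>j<N. (c j)\<^sup>2)))"
proof -
  have "(\<integral>\<^sup>+z. ennreal (exp (sqrt 2 * (\<Sum>j<N. c j * diffuse N x s z j))) \<partial>gauss_vec N)
     = (\<integral>\<^sup>+z. ennreal (exp (sqrt 2 * (\<Sum>j<N. c j * x j))) * ennreal (exp (\<Sum>j<N. (sqrt 2 * sqrt s * c j) * z j)) \<partial>gauss_vec N)"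
  proof (intro nn_integral_cong)
    fix z :: "nat \<Rightarrow> real"
    have "sqrt 2 * (\<Sum>j<N. c j * diffuse N x s z j) = sqrt 2 * (\<Sum>j<N. c j * x j) + (\<Sum>j<N. (sqrt 2 * sqrt s * c j) * z j)"
      by (simp add: diffuse_apply sum_distrib_left sum.distrib algebra_simps)
    then show "ennreal (exp (sqrt 2 * (\<Sum>j<N. c j * diffuse N x s z j))) = ennreal (exp (sqrt 2 * (\<Sum>j<N. c j * x j))) * ennreal (exp (\<Sum>j<N. (sqrt 2 * sqrt s * c j) * z j))"
      by (simp add: exp_add ennreal_mult')
  qed
  also have "\<dots> = ennreal (exp (sqrt 2 * (\<Sum>j<N. c j * x j))) * ennreal (exp ((\<Sum>j<N. (sqrt 2 * sqrt s * c j)\<^sup>2) / 2))"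
    unfolding nn_integral_exp_gauss_vec[symmetric]
  proof (rule nn_integral_cmult)
    have [measurable]: "(\<lambda>z. z j) \<in> borel_measurable (gauss_vec N)" if "j < N" for j
      using measurable_component_singleton[of j "{..<N}" "\<lambda>_. std_gauss"] that by auto
    have "(\<lambda>z. \<Sum>j<N. (sqrt 2 * sqrt s * c j) * z j) \<in> borel_measurable (gauss_vec N)"
      by (rule borel_measurable_sum) (auto intro!: borel_measurable_times)
    then show "(\<lambda>z. ennreal (exp (\<Sum>j<N. (sqrt 2 * sqrt s * c j) * z j))) \<in> borel_measurable (gauss_vec N)" by measurable
  qed
  also have "(\<Sum>j<N. (sqrt 2 * sqrt s * c j)\<^sup>2) / 2 = s * (\<Sum>j<N. (c j)\<^sup>2)"
    using s by (simp add: power_mult_distrib sum_distrib_left sum_divide_distrib)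
  finally show ?thesis by (simp add: exp_add ennreal_mult')
qed

lemma measurable_diffuse_vec: "(\<lambda>z. diffuse N x s z) \<in> measurable (gauss_vec N) (state_space N)" if "x \<in> space (state_space N)"
proof (rule measurable_diffuse)
  show "(\<lambda>z. z) \<in> measurable (gauss_vec N) (PiM {..<N} (\<lambda>_. borel))"
    using measurable_cong_sets[of "gauss_vec N" "gauss_vec N" "PiM {..<N} (\<lambda>_. borel)" "gauss_vec N", OF refl] sets_PiM_cong[of "{..<N}" "{..<N}" "\<lambda>_. borel" "\<lambda>_. std_gauss"] by auto
qed (use that in auto)

lemma sum_single_minus_avg:
  assumes "i < N" shows "(\<Sum>j<N. ((if j = i then 1 else 0) - 1 / N) * y j) = y i - avg N y"
  using assms by (simp add: left_diff_distrib sum_subtractf avg_def sum_divide_distrib if_distrib[of "\<lambda>c. c * _"] cong: if_cong)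

text \<open>Centring lowers the variance factor to 1 - 1 / N; the bound 1 is the growth rate due to
  diffusion.\<close>

lemma nn_integral_exp_centred_le:
  assumes s: "0 \<le> s" and i: "i < N"
  shows "(\<integral>\<^sup>+z. ennreal (exp (sqrt 2 * (diffuse N x s z i - avg N (diffuse N x s z)))) \<partial>gauss_vec N)
    \<le> ennreal (exp s * exp (sqrt 2 * (x i - avg N x)))"
proof -
  let ?c = "\<lambda>j. (if j = i then 1 else 0) - 1 / real N"
  have N: "0 < real N" using i by simp
  have "(\<Sum>j<N. (?c j)\<^sup>2) = (\<Sum>j<N. (if j = i then 1 - 2 / real N else 0) + (1 / real N)\<^sup>2)"
    by (intro sum.cong) (auto simp: power2_eq_square algebra_simps)
  also have "\<dots> = 1 - 2 / real N + real N * (1 / real N)\<^sup>2" using i by (simp add: sum.distrib)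
  also have "\<dots> \<le> 1" using N by (simp add: power2_eq_square)
  finally have c: "(\<Sum>j<N. (?c j)\<^sup>2) \<le> 1" .
  have "(\<integral>\<^sup>+z. ennreal (exp (sqrt 2 * (diffuse N x s z i - avg N (diffuse N x s z)))) \<partial>gauss_vec N)
      = ennreal (exp (sqrt 2 * (x i - avg N x) + s * (\<Sum>j<N. (?c j)\<^sup>2)))"
    unfolding sum_single_minus_avg[OF i, symmetric] by (rule nn_integral_exp_diffuse[OF s])
  also have "\<dots> \<le> ennreal (exp s * exp (sqrt 2 * (x i - avg N x)))"
    using mult_left_mono[OF c s] by (intro ennreal_leI) (simp flip: exp_add)
  finally show ?thesis .
qed

text \<open>The factor 16 * N is crude, each coefficient being at most 4 in absolute value; it
  disappears in the limit of short times.\<close>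

lemma nn_integral_exp_centred_gap_le:
  assumes s: "0 \<le> s" and i: "i < N" and u: "u < N" and k: "k < N"
  shows "(\<integral>\<^sup>+z. ennreal (exp (sqrt 2 * (diffuse N x s z i - avg N (diffuse N x s z))) * exp (- (sqrt 2 * (diffuse N x s z u - diffuse N x s z k) / N))) \<partial>gauss_vec N)
    \<le> ennreal (exp (16 * real N * s) * (exp (sqrt 2 * (x i - avg N x)) * exp (- (sqrt 2 * (x u - x k) / N))))"
proof -
  let ?c = "\<lambda>j. ((if j = i then 1 else 0) - 1 / real N) - ((if j = u then 1 / real N else 0) - (if j = k then 1 / real N else 0))"
  have N: "1 \<le> real N" using i by simp
  have "(?c j)\<^sup>2 \<le> 16" for j
  proof -
    have "1 / real N \<le> 1" using N by simp
    moreover have "0 \<le> 1 / real N" by simp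
    moreover have "(((if p then 1 else 0) - r) - ((if q then r else 0) - (if w then r else 0)))\<^sup>2 \<le> 16" if "r \<le> 1" "0 \<le> r" for p q w and r :: real
    proof -
      have "\<bar>((if p then 1 else 0) - r) - ((if q then r else 0) - (if w then r else 0))\<bar> \<le> 4" using that by auto
      from power_mono[OF this, of 2] show ?thesis by (simp del: power2_abs add: power2_abs)
    qed
    ultimately show ?thesis by blast
  qed
  then have "(\<Sum>j<N. (?c j)\<^sup>2) \<le> (\<Sum>j<N. 16)" by (rule sum_mono)
  then have c: "(\<Sum>j<N. (?c j)\<^sup>2) \<le> 16 * real N" by simp
  have lin: "(\<Sum>j<N. ?c j * y j) = (y i - avg N y) - (y u - y k) / N" for y
    using u k by (simp add: left_diff_distrib sum_subtractf sum_single_minus_avg[OF i, unfolded left_diff_distrib sum_subtractf, symmetric]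
       if_distrib[of "\<lambda>c. c * _"] diff_divide_distrib cong: if_cong)
  have e: "exp (sqrt 2 * (y i - avg N y)) * exp (- (sqrt 2 * (y u - y k) / N)) = exp (sqrt 2 * (\<Sum>j<N. ?c j * y j))" for y
    unfolding lin by (simp add: right_diff_distrib flip: exp_add)
  have "(\<integral>\<^sup>+z. ennreal (exp (sqrt 2 * (\<Sum>j<N. ?c j * diffuse N x s z j))) \<partial>gauss_vec N) = ennreal (exp (sqrt 2 * (\<Sum>j<N. ?c j * x j) + s * (\<Sum>j<N. (?c j)\<^sup>2)))"
    by (rule nn_integral_exp_diffuse[OF s])
  also have "\<dots> \<le> ennreal (exp (16 * real N * s) * exp (sqrt 2 * (\<Sum>j<N. ?c j * x j)))"
    using mult_left_mono[OF c s] by (intro ennreal_leI) (simp add: mult.commute flip: exp_add)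
  finally show ?thesis unfolding e .
qed

section \<open>The Lyapunov function at and after the first event\<close>

lemma nn_integral_event_le:
  assumes N: "0 < N" and t: "0 \<le> t" and x: "x \<in> space (state_space N)"
    and Z[measurable]: "Z \<in> borel_measurable (state_space N)" and c[measurable]: "c \<in> borel_measurable borel"
    and c0: "\<And>r. 0 \<le> c r" and b[measurable]: "b \<in> borel_measurable borel"
    and A: "(\<integral>\<^sup>+z. ennreal (Z (diffuse N x t z)) \<partial>gauss_vec N) \<le> ennreal A"
    and B: "\<And>\<tau>. 0 \<le> \<tau> \<Longrightarrow> (\<integral>\<^sup>+z. (\<Sum>u<N. ennreal (1 / N) * ennreal (Z (branch N (diffuse N x \<tau> z) u))) \<partial>gauss_vec N) \<le> ennreal (b \<tau>)"
  shows "(\<integral>\<^sup>+s. (case s of (\<tau>, z, u) \<Rightarrow> if t < \<tau> then ennreal (Z (diffuse N x t z))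
        else ennreal (c (t - \<tau>) * Z (branch N (diffuse N x \<tau> z) u))) \<partial>noise_step N)
    \<le> ennreal (exp (- real N * t)) * ennreal A
       + (\<integral>\<^sup>+\<tau>. ennreal (real N * exp (- real N * \<tau>)) * ennreal (c (t - \<tau>) * b \<tau>) * indicator {0..t} \<tau> \<partial>lborel)"
proof -
  interpret V: prob_space "gauss_vec N" by (rule prob_space_gauss_vec)
  let ?g = "\<lambda>s. case s of (\<tau>, z, u) \<Rightarrow> if t < \<tau> then ennreal (Z (diffuse N x t z))
        else ennreal (c (t - \<tau>) * Z (branch N (diffuse N x \<tau> z) u))"
  have gm: "?g \<in> borel_measurable (noise_step N)"
  proof -
    have [measurable]: "(\<lambda>s. diffuse N x (fst s) (fst (snd s))) \<in> measurable (noise_step N) (state_space N)"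
      "(\<lambda>s. diffuse N x t (fst (snd s))) \<in> measurable (noise_step N) (state_space N)"
      using x by (auto intro!: measurable_diffuse simp: measurable_cong_sets[OF sets_noise_step refl])
    have [measurable]: "fst \<in> borel_measurable (noise_step N)"
      by (simp add: measurable_cong_sets[OF sets_noise_step refl])
    have [measurable]: "(\<lambda>s. branch N (diffuse N x (fst s) (fst (snd s))) (snd (snd s))) \<in> measurable (noise_step N) (state_space N)"
      using N by (intro measurable_branch) (simp_all add: measurable_cong_sets[OF sets_noise_step refl])
    have "(\<lambda>s. if t < fst s then ennreal (Z (diffuse N x t (fst (snd s))))
        else ennreal (c (t - fst s) * Z (branch N (diffuse N x (fst s) (fst (snd s))) (snd (snd s))))) \<in> borel_measurable (noise_step N)"
      by measurable
    then show ?thesis by (simp add: case_prod_beta)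
  qed
  let ?I = "\<lambda>\<tau>. \<integral>\<^sup>+z. (\<Sum>u<N. ennreal (1 / N) * ?g (\<tau>, z, u)) \<partial>gauss_vec N"
  have I1: "?I \<tau> \<le> ennreal A" if "t < \<tau>" for \<tau>
  proof -
    have "(\<Sum>u<N. ennreal (1 / N) * a) = a" for a :: ennreal
      using N by (simp add: ennreal_of_nat_eq_real_of_nat mult.assoc[symmetric] ennreal_mult'[symmetric])
    then show ?thesis using A that by simp
  qed
  have I2: "?I \<tau> \<le> ennreal (c (t - \<tau>) * b \<tau>)" if "0 \<le> \<tau>" "\<tau> \<le> t" for \<tau>
  proof -
    have bd: "(\<lambda>z. branch N (diffuse N x \<tau> z) u) \<in> measurable (gauss_vec N) (state_space N)" if "u < N" for u
      using that by (intro measurable_branch[OF N measurable_diffuse_vec[OF x]]) simp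
    have "?I \<tau> = (\<integral>\<^sup>+z. ennreal (c (t - \<tau>)) * (\<Sum>u<N. ennreal (1 / N) * ennreal (Z (branch N (diffuse N x \<tau> z) u))) \<partial>gauss_vec N)"
      using that c0[of "t - \<tau>"] by (simp add: sum_distrib_left ennreal_mult' mult_ac)
    also have "\<dots> = ennreal (c (t - \<tau>)) * (\<integral>\<^sup>+z. (\<Sum>u<N. ennreal (1 / N) * ennreal (Z (branch N (diffuse N x \<tau> z) u))) \<partial>gauss_vec N)"
      by (intro nn_integral_cmult borel_measurable_sum borel_measurable_times_ennreal borel_measurable_const
          measurable_compose[OF measurable_compose[OF bd Z] measurable_ennreal]) auto
    also have "\<dots> \<le> ennreal (c (t - \<tau>)) * ennreal (b \<tau>)" by (intro mult_left_mono B that) auto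
    finally show ?thesis using c0[of "t - \<tau>"] by (simp add: ennreal_mult')
  qed
  have "(\<integral>\<^sup>+s. ?g s \<partial>noise_step N) = (\<integral>\<^sup>+\<tau>. ennreal (exponential_density (real N) \<tau>) * ?I \<tau> \<partial>lborel)"
    by (rule nn_integral_noise_step[OF N gm])
  also have "\<dots> \<le> (\<integral>\<^sup>+\<tau>. ennreal (real N) * ennreal A * (ennreal (exp (- real N * \<tau>)) * indicator {t<..} \<tau>)
      + ennreal (real N * exp (- real N * \<tau>)) * ennreal (c (t - \<tau>) * b \<tau>) * indicator {0..t} \<tau> \<partial>lborel)"
  proof (rule nn_integral_mono)
    fix \<tau> :: real
    consider "\<tau> < 0" | "0 \<le> \<tau>" "\<tau> \<le> t" | "t < \<tau>" by linarith
    then show "ennreal (exponential_density (real N) \<tau>) * ?I \<tau> \<le> ennreal (real N) * ennreal A * (ennreal (exp (- real N * \<tau>)) * indicator {t<..} \<tau>)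
      + ennreal (real N * exp (- real N * \<tau>)) * ennreal (c (t - \<tau>) * b \<tau>) * indicator {0..t} \<tau>"
    proof cases
      case 1 then show ?thesis by (simp add: exponential_density_def)
    next
      case 2
      have "ennreal (exponential_density (real N) \<tau>) * ?I \<tau> \<le> ennreal (exponential_density (real N) \<tau>) * ennreal (c (t - \<tau>) * b \<tau>)"
        by (intro mult_left_mono I2 2) auto
      then show ?thesis using 2 by (simp add: exponential_density_def mult.commute)
    next
      case 3
      have "ennreal (exponential_density (real N) \<tau>) * ?I \<tau> \<le> ennreal (exponential_density (real N) \<tau>) * ennreal A"
        by (intro mult_left_mono I1 3) auto
      then show ?thesis using 3 t by (simp add: exponential_density_def ennreal_mult' mult_ac)
    qed
  qed
  also have "\<dots> = ennreal (real N) * ennreal A * ennreal (exp (- real N * t) / N)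
      + (\<integral>\<^sup>+\<tau>. ennreal (real N * exp (- real N * \<tau>)) * ennreal (c (t - \<tau>) * b \<tau>) * indicator {0..t} \<tau> \<partial>lborel)"
  proof -
    have "(\<integral>\<^sup>+\<tau>. ennreal (exp (- real N * \<tau>)) * indicator {t<..} \<tau> \<partial>lborel) = ennreal (exp (- real N * t) / N)"
      using nn_integral_exp_Ioi[of "real N" t] N by simp
    then have "(\<integral>\<^sup>+\<tau>. ennreal (real N) * ennreal A * (ennreal (exp (- real N * \<tau>)) * indicator {t<..} \<tau>) \<partial>lborel)
        = ennreal (real N) * ennreal A * ennreal (exp (- real N * t) / N)"
      by (subst nn_integral_cmult) auto
    then show ?thesis by (subst nn_integral_add) auto
  qed
  also have "ennreal (real N) * ennreal A * ennreal (exp (- real N * t) / N) = (ennreal (real N) * ennreal (exp (- real N * t) / N)) * ennreal A"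
    by (simp add: mult_ac)
  also have "ennreal (real N) * ennreal (exp (- real N * t) / N) = ennreal (exp (- real N * t))"
    using N by (simp add: ennreal_mult'[symmetric])
  finally show ?thesis .
qed

lemma nn_integral_expo_sum_diffuse_le:
  assumes x: "x \<in> space (state_space N)" and s: "0 \<le> s"
  shows "(\<integral>\<^sup>+z. ennreal (expo_sum N (diffuse N x s z)) \<partial>gauss_vec N) \<le> ennreal (exp s * expo_sum N x)"
proof -
  have m: "(\<lambda>z. ennreal (exp (sqrt 2 * (diffuse N x s z i - avg N (diffuse N x s z))))) \<in> borel_measurable (gauss_vec N)" if "i < N" for i
  proof -
    note [measurable] = measurable_diffuse_vec[OF x, of s] measurable_state_component[OF measurable_diffuse_vec[OF x, of s] that]
    show ?thesis by (intro measurable_compose[OF _ measurable_ennreal] measurable_compose[OF _ borel_measurable_exp]) measurable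
  qed
  have "(\<integral>\<^sup>+z. ennreal (expo_sum N (diffuse N x s z)) \<partial>gauss_vec N) = (\<Sum>i<N. \<integral>\<^sup>+z. ennreal (exp (sqrt 2 * (diffuse N x s z i - avg N (diffuse N x s z)))) \<partial>gauss_vec N)"
    unfolding expo_sum_def by (subst nn_integral_sum[symmetric], rule m) (auto simp: sum_ennreal)
  also have "\<dots> \<le> (\<Sum>i<N. ennreal (exp s * exp (sqrt 2 * (x i - avg N x))))"
    by (intro sum_mono nn_integral_exp_centred_le[OF s]) auto
  also have "\<dots> = ennreal (exp s * expo_sum N x)" by (simp add: expo_sum_def sum_distrib_left)
  finally show ?thesis .
qed

lemma nn_integral_expo_sum_branch_le:
  assumes N: "0 < N" and x: "x \<in> space (state_space N)" and s: "0 \<le> s"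
  shows "(\<integral>\<^sup>+z. (\<Sum>u<N. ennreal (1 / N) * ennreal (expo_sum N (branch N (diffuse N x s z) u))) \<partial>gauss_vec N)
    \<le> ennreal ((1 + 1 / N) * (exp s * expo_sum N x))"
proof -
  have "(\<Sum>u<N. ennreal (1 / N) * ennreal (expo_sum N (branch N y u))) \<le> ennreal (1 + 1 / N) * ennreal (expo_sum N y)" for y
  proof -
    have "(\<Sum>u<N. ennreal (1 / N) * ennreal (expo_sum N (branch N y u)))
        \<le> (\<Sum>u<N. ennreal ((1 / N) * (expo_sum N y + exp (sqrt 2 * (y u - avg N y)))))"
      using expo_sum_branch_le(2)[OF N] N
      by (intro sum_mono) (auto simp: ennreal_mult'[symmetric] intro!: ennreal_leI divide_right_mono)
    also have "\<dots> = ennreal (\<Sum>u<N. (1 / N) * (expo_sum N y + exp (sqrt 2 * (y u - avg N y))))"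
      using expo_sum_ge_1[OF N, of y] by (intro sum_ennreal) (auto intro!: divide_nonneg_nonneg add_nonneg_nonneg)
    also have "(\<Sum>u<N. (1 / N) * (expo_sum N y + exp (sqrt 2 * (y u - avg N y)))) = (1 + 1 / N) * expo_sum N y"
    proof -
      have "(\<Sum>u<N. (1 / N) * (expo_sum N y + exp (sqrt 2 * (y u - avg N y)))) = (1 / N) * (N * expo_sum N y + expo_sum N y)"
        unfolding sum_distrib_left[symmetric] by (simp add: sum.distrib) (simp add: expo_sum_def)
      then show ?thesis using N by (simp add: field_simps)
    qed
    finally show ?thesis by (simp add: ennreal_mult')
  qed
  then have "(\<integral>\<^sup>+z. (\<Sum>u<N. ennreal (1 / N) * ennreal (expo_sum N (branch N (diffuse N x s z) u))) \<partial>gauss_vec N)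
    \<le> (\<integral>\<^sup>+z. ennreal (1 + 1 / N) * ennreal (expo_sum N (diffuse N x s z)) \<partial>gauss_vec N)"
    by (intro nn_integral_mono)
  also have "\<dots> = ennreal (1 + 1 / N) * (\<integral>\<^sup>+z. ennreal (expo_sum N (diffuse N x s z)) \<partial>gauss_vec N)"
    by (intro nn_integral_cmult measurable_compose[OF measurable_compose[OF measurable_diffuse_vec[OF x] measurable_expo_sum] measurable_ennreal])
  also have "\<dots> \<le> ennreal (1 + 1 / N) * ennreal (exp s * expo_sum N x)"
    by (intro mult_left_mono nn_integral_expo_sum_diffuse_le x s) auto
  finally show ?thesis by (simp add: ennreal_mult')
qed

text \<open>When u branches in a configuration whose leftmost particle is at 0, the centred
  exponentials shrink by the factor exp (- sqrt 2 * y u / N). Keeping the exponential instead of its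
  linearisation gives a functional that is bounded by N on \<open>Gamma\<close>, hence integrable
  without moment bounds on \<psi>.\<close>

definition exp_gap :: "nat \<Rightarrow> (nat \<Rightarrow> real) \<Rightarrow> real" where
  "exp_gap N y = (\<Sum>u<N. exp (- (sqrt 2 * y u / N)))"

lemma nn_integral_expo_sum_branch_Gamma_le:
  assumes N: "0 < N" and x: "x \<in> Gamma N" and s: "0 \<le> s"
  shows "(\<integral>\<^sup>+z. (\<Sum>u<N. ennreal (1 / N) * ennreal (expo_sum N (branch N (diffuse N x s z) u))) \<partial>gauss_vec N)
    \<le> ennreal (exp (16 * real N * s) * expo_sum N x * (exp_gap N x + 1) / N)"
proof -
  obtain k where k: "k < N" "x k = 0" using x by (auto simp: Gamma_def)
  have x0: "0 \<le> x i" if "i < N" for i using x that by (auto simp: Gamma_def)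
  have xs: "x \<in> space (state_space N)" by (rule Gamma_space[OF x])
  let ?d = "\<lambda>z. diffuse N x s z"
  let ?e = "\<lambda>y i. exp (sqrt 2 * (y i - avg N y))" and ?g = "\<lambda>y u. exp (- (sqrt 2 * (y u - y k) / N))"
  have m: "(\<lambda>z. ennreal (?e (?d z) i * ?g (?d z) u)) \<in> borel_measurable (gauss_vec N)" if "i < N" "u < N" for i u
  proof -
    note [measurable] = measurable_diffuse_vec[OF xs, of s] measurable_state_component[OF measurable_diffuse_vec[OF xs, of s] that(1)]
      measurable_state_component[OF measurable_diffuse_vec[OF xs, of s] that(2)]
      measurable_state_component[OF measurable_diffuse_vec[OF xs, of s] k(1)]
    show ?thesis by measurable
  qed
  have "(\<Sum>u<N. ennreal (1 / N) * ennreal (expo_sum N (branch N y u)))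
     \<le> ennreal (1 / N) * (\<Sum>u<N. (\<Sum>i<N. ennreal (?e y i * ?g y u)) + ennreal (?e y u * ?g y u))" for y
    unfolding sum_distrib_left
  proof (intro sum_mono)
    fix u assume u: "u \<in> {..<N}"
    have "ennreal (expo_sum N (branch N y u)) \<le> ennreal (?g y u * (expo_sum N y + ?e y u))"
      using expo_sum_branch_le(1)[OF N _ k(1), of u y] u by (intro ennreal_leI) auto
    also have "\<dots> = (\<Sum>i<N. ennreal (?e y i * ?g y u)) + ennreal (?e y u * ?g y u)"
      by (simp add: sum_ennreal expo_sum_def sum_distrib_left distrib_left mult.commute ennreal_plus[symmetric] sum_nonneg del: ennreal_plus)
    finally show "ennreal (1 / N) * ennreal (expo_sum N (branch N y u)) \<le> ennreal (1 / N) * ((\<Sum>i<N. ennreal (?e y i * ?g y u)) + ennreal (?e y u * ?g y u))"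
      by (intro mult_left_mono) auto
  qed
  then have "(\<integral>\<^sup>+z. (\<Sum>u<N. ennreal (1 / N) * ennreal (expo_sum N (branch N (?d z) u))) \<partial>gauss_vec N)
     \<le> (\<integral>\<^sup>+z. ennreal (1 / N) * (\<Sum>u<N. (\<Sum>i<N. ennreal (?e (?d z) i * ?g (?d z) u)) + ennreal (?e (?d z) u * ?g (?d z) u)) \<partial>gauss_vec N)"
    by (intro nn_integral_mono)
  also have "\<dots> = ennreal (1 / N) * (\<integral>\<^sup>+z. (\<Sum>u<N. (\<Sum>i<N. ennreal (?e (?d z) i * ?g (?d z) u)) + ennreal (?e (?d z) u * ?g (?d z) u)) \<partial>gauss_vec N)"
    by (intro nn_integral_cmult borel_measurable_sum borel_measurable_add m) auto
  also have "(\<integral>\<^sup>+z. (\<Sum>u<N. (\<Sum>i<N. ennreal (?e (?d z) i * ?g (?d z) u)) + ennreal (?e (?d z) u * ?g (?d z) u)) \<partial>gauss_vec N)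
     = (\<Sum>u<N. \<integral>\<^sup>+z. (\<Sum>i<N. ennreal (?e (?d z) i * ?g (?d z) u)) + ennreal (?e (?d z) u * ?g (?d z) u) \<partial>gauss_vec N)"
    by (intro nn_integral_sum borel_measurable_sum borel_measurable_add m) auto
  also have "\<dots> = (\<Sum>u<N. (\<Sum>i<N. \<integral>\<^sup>+z. ennreal (?e (?d z) i * ?g (?d z) u) \<partial>gauss_vec N) + (\<integral>\<^sup>+z. ennreal (?e (?d z) u * ?g (?d z) u) \<partial>gauss_vec N))"
  proof (intro sum.cong refl)
    fix u assume u: "u \<in> {..<N}"
    have "(\<integral>\<^sup>+z. (\<Sum>i<N. ennreal (?e (?d z) i * ?g (?d z) u)) + ennreal (?e (?d z) u * ?g (?d z) u) \<partial>gauss_vec N)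
      = (\<integral>\<^sup>+z. (\<Sum>i<N. ennreal (?e (?d z) i * ?g (?d z) u)) \<partial>gauss_vec N) + (\<integral>\<^sup>+z. ennreal (?e (?d z) u * ?g (?d z) u) \<partial>gauss_vec N)"
      using u by (intro nn_integral_add borel_measurable_sum m) auto
    also have "(\<integral>\<^sup>+z. (\<Sum>i<N. ennreal (?e (?d z) i * ?g (?d z) u)) \<partial>gauss_vec N) = (\<Sum>i<N. \<integral>\<^sup>+z. ennreal (?e (?d z) i * ?g (?d z) u) \<partial>gauss_vec N)"
      using u by (intro nn_integral_sum m) auto
    finally show "(\<integral>\<^sup>+z. (\<Sum>i<N. ennreal (?e (?d z) i * ?g (?d z) u)) + ennreal (?e (?d z) u * ?g (?d z) u) \<partial>gauss_vec N)
      = (\<Sum>i<N. \<integral>\<^sup>+z. ennreal (?e (?d z) i * ?g (?d z) u) \<partial>gauss_vec N) + (\<integral>\<^sup>+z. ennreal (?e (?d z) u * ?g (?d z) u) \<partial>gauss_vec N)" .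
  qed
  also have "\<dots> \<le> (\<Sum>u<N. (\<Sum>i<N. ennreal (exp (16 * real N * s) * (?e x i * ?g x u))) + ennreal (exp (16 * real N * s) * (?e x u * ?g x u)))"
    using k(1) by (intro sum_mono add_mono nn_integral_exp_centred_gap_le[OF s]) auto
  also have "\<dots> = ennreal (\<Sum>u<N. (\<Sum>i<N. exp (16 * real N * s) * (?e x i * ?g x u)) + exp (16 * real N * s) * (?e x u * ?g x u))"
    by (simp add: sum_ennreal sum_nonneg ennreal_plus[symmetric] del: ennreal_plus)
  also have "(\<Sum>u<N. (\<Sum>i<N. exp (16 * real N * s) * (?e x i * ?g x u)) + exp (16 * real N * s) * (?e x u * ?g x u))
     \<le> exp (16 * real N * s) * expo_sum N x * (exp_gap N x + 1)"
  proof -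
    \<comment> \<open>The newborn particles contribute at most one more copy of the sum; this is the
      1 added to \<open>exp_gap\<close>.\<close>
    have "(\<Sum>u<N. ?e x u * ?g x u) \<le> (\<Sum>u<N. ?e x u * 1)"
      using x0 k N by (intro sum_mono mult_left_mono) (auto intro!: divide_nonneg_nonneg)
    then have a: "(\<Sum>u<N. ?e x u * ?g x u) \<le> expo_sum N x" by (simp add: expo_sum_def)
    have b: "(\<Sum>u<N. \<Sum>i<N. ?e x i * ?g x u) = expo_sum N x * exp_gap N x"
      using k by (simp add: expo_sum_def exp_gap_def sum_distrib_left sum_distrib_right)
    have "(\<Sum>u<N. (\<Sum>i<N. exp (16 * real N * s) * (?e x i * ?g x u)) + exp (16 * real N * s) * (?e x u * ?g x u))
        = exp (16 * real N * s) * (expo_sum N x * exp_gap N x + (\<Sum>u<N. ?e x u * ?g x u))"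
      unfolding b[symmetric] by (simp add: sum.distrib sum_distrib_left distrib_left)
    also have "\<dots> \<le> exp (16 * real N * s) * (expo_sum N x * exp_gap N x + expo_sum N x)"
      using a by (intro mult_left_mono) auto
    finally show ?thesis by (simp add: algebra_simps)
  qed
  finally have "(\<integral>\<^sup>+z. (\<Sum>u<N. ennreal (1 / N) * ennreal (expo_sum N (branch N (?d z) u))) \<partial>gauss_vec N)
      \<le> ennreal (1 / N) * ennreal (exp (16 * real N * s) * expo_sum N x * (exp_gap N x + 1))"
    by this (auto intro!: mult_left_mono ennreal_leI)
  then show ?thesis by (simp add: ennreal_mult'[symmetric])
qed

lemma expo_sum_recentre: "0 < N \<Longrightarrow> expo_sum N (recentre N x) = expo_sum N x"
  by (simp add: expo_sum_def avg_def recentre_def sum_subtractf diff_divide_distrib)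

text \<open>The rate 2 is 1 from diffusion plus 1 from branching: N events per unit of time, each
  multiplying by at most 1 + 1 / N on average over u.\<close>

lemma nn_integral_expo_sum_event_le:
  assumes N: "0 < N" and t: "0 \<le> t" and x: "x \<in> space (state_space N)"
  shows "(\<integral>\<^sup>+s. (case s of (\<tau>, z, u) \<Rightarrow> if t < \<tau> then ennreal (expo_sum N (diffuse N x t z))
        else ennreal (exp (2 * (t - \<tau>)) * expo_sum N (branch N (diffuse N x \<tau> z) u))) \<partial>noise_step N)
    \<le> ennreal (exp (2 * t) * expo_sum N x)"
proof -
  let ?Z = "expo_sum N x" and ?m = "real N + 1"
  have Z: "0 \<le> ?Z" using expo_sum_ge_1[OF N, of x] by simp
  have I: "(\<integral>\<^sup>+\<tau>. ennreal (?m * exp (- ?m * \<tau>)) * indicator {0..t} \<tau> \<partial>lborel) = ennreal (1 - exp (- ?m * t))"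
  proof -
    have "((\<lambda>a. - exp (- ?m * a)) has_real_derivative ?m * exp (- ?m * \<tau>)) (at \<tau>)" for \<tau> :: real
      by (auto intro!: derivative_eq_intros simp: algebra_simps)
    then have "(\<integral>\<^sup>+\<tau>. ennreal (?m * exp (- ?m * \<tau>)) * indicator {0..t} \<tau> \<partial>lborel) = ennreal (- exp (- ?m * t) - (- exp (- ?m * 0)))"
      using t by (intro nn_integral_FTC_Icc) (auto intro: has_field_derivative_at_within simp: has_real_derivative_iff_has_vector_derivative[symmetric])
    then show ?thesis by simp
  qed
  have "(\<integral>\<^sup>+s. (case s of (\<tau>, z, u) \<Rightarrow> if t < \<tau> then ennreal (expo_sum N (diffuse N x t z))
        else ennreal (exp (2 * (t - \<tau>)) * expo_sum N (branch N (diffuse N x \<tau> z) u))) \<partial>noise_step N)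
    \<le> ennreal (exp (- real N * t)) * ennreal (exp t * ?Z)
       + (\<integral>\<^sup>+\<tau>. ennreal (real N * exp (- real N * \<tau>)) * ennreal (exp (2 * (t - \<tau>)) * ((1 + 1 / N) * (exp \<tau> * ?Z))) * indicator {0..t} \<tau> \<partial>lborel)"
    by (rule nn_integral_event_le[OF N t x, where c="\<lambda>r. exp (2 * r)"])
       (auto intro!: nn_integral_expo_sum_diffuse_le nn_integral_expo_sum_branch_le[OF N] t x)
  also have "(\<integral>\<^sup>+\<tau>. ennreal (real N * exp (- real N * \<tau>)) * ennreal (exp (2 * (t - \<tau>)) * ((1 + 1 / N) * (exp \<tau> * ?Z))) * indicator {0..t} \<tau> \<partial>lborel)
     = (\<integral>\<^sup>+\<tau>. ennreal (exp (2 * t) * ?Z) * (ennreal (?m * exp (- ?m * \<tau>)) * indicator {0..t} \<tau>) \<partial>lborel)"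
  proof (intro nn_integral_cong)
    fix \<tau> :: real
    have "real N * exp (- real N * \<tau>) * (exp (2 * (t - \<tau>)) * ((1 + 1 / N) * (exp \<tau> * ?Z)))
        = (real N * (1 + 1 / N)) * (exp (- real N * \<tau>) * exp (2 * (t - \<tau>)) * exp \<tau>) * ?Z" by simp
    also have "real N * (1 + 1 / N) = ?m" using N by (simp add: field_simps)
    also have "exp (- real N * \<tau>) * exp (2 * (t - \<tau>)) * exp \<tau> = exp (2 * t) * exp (- ?m * \<tau>)"
      by (simp add: algebra_simps flip: exp_add)
    finally have "real N * exp (- real N * \<tau>) * (exp (2 * (t - \<tau>)) * ((1 + 1 / N) * (exp \<tau> * ?Z))) = (exp (2 * t) * ?Z) * (?m * exp (- ?m * \<tau>))"
      by (simp add: mult_ac)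
    then have "ennreal (real N * exp (- real N * \<tau>)) * ennreal (exp (2 * (t - \<tau>)) * ((1 + 1 / N) * (exp \<tau> * ?Z))) = ennreal (exp (2 * t) * ?Z) * ennreal (?m * exp (- ?m * \<tau>))"
      using Z by (subst (1 2) ennreal_mult'[symmetric]) auto
    then show "ennreal (real N * exp (- real N * \<tau>)) * ennreal (exp (2 * (t - \<tau>)) * ((1 + 1 / N) * (exp \<tau> * ?Z))) * indicator {0..t} \<tau>
        = ennreal (exp (2 * t) * ?Z) * (ennreal (?m * exp (- ?m * \<tau>)) * indicator {0..t} \<tau>)" by (simp add: mult.assoc)
  qed
  also have "\<dots> = ennreal (exp (2 * t) * ?Z) * ennreal (1 - exp (- ?m * t))"
    unfolding I[symmetric] by (intro nn_integral_cmult) auto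
  also have "ennreal (exp (- real N * t)) * ennreal (exp t * ?Z) + \<dots> = ennreal (exp (- real N * t) * (exp t * ?Z) + exp (2 * t) * ?Z * (1 - exp (- ?m * t)))"
  proof -
    have "- ?m * t \<le> 0" using t mult_nonneg_nonneg[of ?m t] by (simp only: minus_mult_left[symmetric] neg_le_0_iff_le)
    then have "exp (- ?m * t) \<le> 1" by (simp only: exp_le_one_iff)
    then have "0 \<le> exp (2 * t) * ?Z * (1 - exp (- ?m * t))" using Z by (intro mult_nonneg_nonneg) auto
    moreover have "0 \<le> exp (- real N * t) * (exp t * ?Z)" using Z by (intro mult_nonneg_nonneg) auto
    ultimately show ?thesis using Z by (subst ennreal_plus) (simp_all only: ennreal_mult' ennreal_mult'' exp_ge_zero mult_nonneg_nonneg)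
  qed
  also have "exp (- real N * t) * (exp t * ?Z) + exp (2 * t) * ?Z * (1 - exp (- ?m * t)) = exp (2 * t) * ?Z"
  proof -
    have "exp (- real N * t) * exp t = exp (2 * t) * exp (- ?m * t)" by (simp add: algebra_simps flip: exp_add)
    then show ?thesis by (simp add: right_diff_distrib mult.assoc[symmetric])
  qed
  finally show ?thesis .
qed

text \<open>Only the linear order in t will matter. The sharp branching bound relies on a leftmost
  particle at 0, which is known at time 0 only, so it serves for the first event and the crude rate
  2 afterwards.\<close>

lemma nn_integral_expo_sum_NBBM_le:
  assumes N: "0 < N" and t: "0 \<le> t" and x: "x \<in> Gamma N"
  shows "(\<integral>\<^sup>+\<omega>. ennreal (expo_sum N (NBBM N x t \<omega>)) \<partial>noise N)
    \<le> ennreal (expo_sum N x * (exp (- (real N - 1) * t) + t * exp ((2 + 16 * real N) * t) * (exp_gap N x + 1)))"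
proof -
  let ?Z = "expo_sum N x" and ?G = "exp_gap N x + 1"
  have xs: "x \<in> space (state_space N)" by (rule Gamma_space[OF x])
  have Z: "0 \<le> ?Z" using expo_sum_ge_1[OF N, of x] by simp
  have G: "0 \<le> ?G" by (auto simp: exp_gap_def intro!: add_nonneg_nonneg sum_nonneg)
  have fm: "(\<lambda>x. ennreal (expo_sum N x)) \<in> borel_measurable (state_space N)" by measurable
  have "(\<integral>\<^sup>+\<omega>. ennreal (expo_sum N (NBBM N x t \<omega>)) \<partial>noise N)
    \<le> (\<integral>\<^sup>+s. (case s of (\<tau>, z, u) \<Rightarrow> if t < \<tau> then ennreal (expo_sum N (diffuse N x t z))
        else ennreal (exp (2 * (t - \<tau>)) * expo_sum N (branch N (diffuse N x \<tau> z) u))) \<partial>noise_step N)"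
    by (rule NBBM_first_event[OF N fm _ t order_refl xs, where \<Psi>="\<lambda>t x. ennreal (exp (2 * t) * expo_sum N x)"])
       (rule nn_integral_expo_sum_event_le[OF N])
  also have "\<dots> \<le> ennreal (exp (- real N * t)) * ennreal (exp t * ?Z)
       + (\<integral>\<^sup>+\<tau>. ennreal (real N * exp (- real N * \<tau>)) * ennreal (exp (2 * (t - \<tau>)) * (exp (16 * real N * \<tau>) * ?Z * ?G / N)) * indicator {0..t} \<tau> \<partial>lborel)"
    by (rule nn_integral_event_le[OF N t xs, where c="\<lambda>r. exp (2 * r)"])
       (auto intro!: nn_integral_expo_sum_diffuse_le nn_integral_expo_sum_branch_Gamma_le[OF N x] t xs)
  also have "(\<integral>\<^sup>+\<tau>. ennreal (real N * exp (- real N * \<tau>)) * ennreal (exp (2 * (t - \<tau>)) * (exp (16 * real N * \<tau>) * ?Z * ?G / N)) * indicator {0..t} \<tau> \<partial>lborel)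
     \<le> (\<integral>\<^sup>+\<tau>. ennreal (exp ((2 + 16 * real N) * t) * ?Z * ?G) * indicator {0..t} \<tau> \<partial>lborel)"
  proof (intro nn_integral_mono)
    fix \<tau> :: real
    have "ennreal (real N * exp (- real N * \<tau>)) * ennreal (exp (2 * (t - \<tau>)) * (exp (16 * real N * \<tau>) * ?Z * ?G / N)) \<le> ennreal (exp ((2 + 16 * real N) * t) * ?Z * ?G)"
      if "0 \<le> \<tau>" "\<tau> \<le> t"
    proof -
      have "real N * exp (- real N * \<tau>) * (exp (2 * (t - \<tau>)) * (exp (16 * real N * \<tau>) * ?Z * ?G / N))
         = exp (- real N * \<tau> + 2 * (t - \<tau>) + 16 * real N * \<tau>) * (?Z * ?G)"
        using N by (simp only: exp_add) simp
      also have "\<dots> \<le> exp ((2 + 16 * real N) * t) * (?Z * ?G)"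
      proof (intro mult_right_mono)
        have "real N * \<tau> \<le> real N * t" "0 \<le> real N * \<tau>" using that by (auto intro: mult_left_mono)
        moreover have "- real N * \<tau> + 2 * (t - \<tau>) + 16 * real N * \<tau> = 15 * (real N * \<tau>) + 2 * t - 2 * \<tau>" "(2 + 16 * real N) * t = 2 * t + 16 * (real N * t)"
          by (simp_all add: algebra_simps)
        ultimately have "- real N * \<tau> + 2 * (t - \<tau>) + 16 * real N * \<tau> \<le> (2 + 16 * real N) * t" using that by linarith
        then show "exp (- real N * \<tau> + 2 * (t - \<tau>) + 16 * real N * \<tau>) \<le> exp ((2 + 16 * real N) * t)" by simp
      qed (use Z G in simp)
      finally have "real N * exp (- real N * \<tau>) * (exp (2 * (t - \<tau>)) * (exp (16 * real N * \<tau>) * ?Z * ?G / N)) \<le> exp ((2 + 16 * real N) * t) * ?Z * ?G"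
        by (simp only: mult.assoc)
      then have "ennreal (real N * exp (- real N * \<tau>) * (exp (2 * (t - \<tau>)) * (exp (16 * real N * \<tau>) * ?Z * ?G / N))) \<le> ennreal (exp ((2 + 16 * real N) * t) * ?Z * ?G)"
        by (rule ennreal_leI)
      then show ?thesis by (simp only: ennreal_mult'[of "real N * exp (- real N * \<tau>)", symmetric] mult_nonneg_nonneg of_nat_0_le_iff exp_ge_zero)
    qed
    then show "ennreal (real N * exp (- real N * \<tau>)) * ennreal (exp (2 * (t - \<tau>)) * (exp (16 * real N * \<tau>) * ?Z * ?G / N)) * indicator {0..t} \<tau>
       \<le> ennreal (exp ((2 + 16 * real N) * t) * ?Z * ?G) * indicator {0..t} \<tau>" by (auto split: split_indicator)
  qed
  also have "\<dots> = ennreal (exp ((2 + 16 * real N) * t) * ?Z * ?G * t)"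
  proof -
    have "emeasure lborel {0..t} = ennreal t" using t by simp
    then have "(\<integral>\<^sup>+\<tau>. ennreal (exp ((2 + 16 * real N) * t) * ?Z * ?G) * indicator {0..t} \<tau> \<partial>lborel) = ennreal (exp ((2 + 16 * real N) * t) * ?Z * ?G) * ennreal t"
      by (simp only: nn_integral_cmult_indicator sets_lborel atLeastAtMost_borel)
    also have "\<dots> = ennreal (exp ((2 + 16 * real N) * t) * ?Z * ?G * t)" by (rule ennreal_mult''[OF t, symmetric])
    finally show ?thesis .
  qed
  also have "ennreal (exp (- real N * t)) * ennreal (exp t * ?Z) = ennreal (exp (- (real N - 1) * t) * ?Z)"
  proof -
    have "exp (- real N * t) * (exp t * ?Z) = exp (- real N * t + t) * ?Z" by (simp only: exp_add mult.assoc)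
    also have "- real N * t + t = - (real N - 1) * t" by (simp add: algebra_simps)
    finally show ?thesis by (subst ennreal_mult'[symmetric]) (simp_all only: exp_ge_zero)
  qed
  finally have "(\<integral>\<^sup>+\<omega>. ennreal (expo_sum N (NBBM N x t \<omega>)) \<partial>noise N)
    \<le> ennreal (exp (- (real N - 1) * t) * ?Z) + ennreal (exp ((2 + 16 * real N) * t) * ?Z * ?G * t)"
    by this auto
  also have "\<dots> = ennreal (?Z * (exp (- (real N - 1) * t) + t * exp ((2 + 16 * real N) * t) * ?G))"
  proof -
    have "a * ?Z + b * ?Z * ?G * t = ?Z * (a + t * b * ?G)" for a b :: real by (simp add: algebra_simps)
    moreover have "0 \<le> exp (- (real N - 1) * t) * ?Z" "0 \<le> exp ((2 + 16 * real N) * t) * ?Z * ?G * t"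
      by (intro mult_nonneg_nonneg Z G t exp_ge_zero)+
    ultimately show ?thesis by (simp only: ennreal_plus[symmetric])
  qed
  finally show ?thesis .
qed

text \<open>The logarithm of the Lyapunov function need not be integrable under \<open>\<psi>\<close>, hence the truncation
  in the proof.\<close>
lemma stationary_drift:
  assumes N: "0 < N" and st: "NBBM_stationary N \<psi>" and t: "0 \<le> t"
  shows "1 \<le> (\<integral>\<^sup>+y. ennreal (exp (- (real N - 1) * t) + t * exp ((2 + 16 * real N) * t) * (exp_gap N y + 1)) \<partial>\<psi>)"
proof -
  let ?\<beta> = "\<lambda>y. exp (- (real N - 1) * t) + t * exp ((2 + 16 * real N) * t) * (exp_gap N y + 1)"
  interpret P: prob_space \<psi> using st by (simp add: NBBM_stationary_def)
  interpret O: prob_space "noise N" by (rule prob_space_noise[OF N])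
  have s: "sets \<psi> = sets (state_space N)" using st by (simp add: NBBM_stationary_def)
  note mc = measurable_cong_sets[OF s refl]
  have b0: "0 \<le> ?\<beta> y" for y
    using t by (auto simp: exp_gap_def intro!: add_nonneg_nonneg mult_nonneg_nonneg sum_nonneg)
  have [measurable]: "expo_sum N \<in> borel_measurable \<psi>" "exp_gap N \<in> borel_measurable \<psi>"
  proof -
    show "exp_gap N \<in> borel_measurable \<psi>"
      unfolding exp_gap_def[abs_def] mc
      by (intro borel_measurable_sum measurable_compose[OF _ borel_measurable_exp] borel_measurable_uminus
         borel_measurable_divide borel_measurable_times measurable_state_proj) auto
  qed (simp add: mc)
  have Z1: "1 \<le> expo_sum N y" for y by (rule expo_sum_ge_1[OF N])
  define V where "V k y = min (ln (expo_sum N y)) (real k)" for k y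
  have V0: "0 \<le> V k y" "V k y \<le> k" for k y using Z1[of y] by (auto simp: V_def)
  \<comment> \<open>Drift of the logarithm truncated at k. Below the level, ln z \<le> z - 1 bounds
    the expected increment by \<beta> - 1; above it the truncated value is maximal and cannot rise.
    The measure on the left collects the -1.\<close>
  have bound: "emeasure \<psi> {y\<in>space \<psi>. ln (expo_sum N y) \<le> k} \<le> (\<integral>\<^sup>+y. ennreal (?\<beta> y) \<partial>\<psi>)" for k :: nat
  proof -
    have Vm: "V k \<in> borel_measurable (state_space N)" unfolding V_def[abs_def] by measurable
    then have [measurable]: "V k \<in> borel_measurable \<psi>" by (simp add: mc)
    let ?S = "{y\<in>space \<psi>. ln (expo_sum N y) \<le> k}"
    have pt: "(\<integral>\<^sup>+\<omega>. ennreal (V k (step N t y \<omega>)) \<partial>noise N) + indicator ?S y \<le> ennreal (V k y) + ennreal (?\<beta> y)"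
      if y: "y \<in> Gamma N" "y \<in> space \<psi>" for y
    proof -
      have ys: "y \<in> space (state_space N)" by (rule Gamma_space[OF y(1)])
      have Xm: "(\<lambda>\<omega>. NBBM N y t \<omega>) \<in> measurable (noise N) (state_space N)"
        using ys by (intro measurable_NBBM[OF N]) auto
      have V_step: "V k (step N t y \<omega>) = V k (NBBM N y t \<omega>)" for \<omega>
        by (simp add: V_def step_def expo_sum_recentre[OF N])
      have [measurable]: "(\<lambda>\<omega>. V k (NBBM N y t \<omega>)) \<in> borel_measurable (noise N)" "(\<lambda>\<omega>. expo_sum N (NBBM N y t \<omega>)) \<in> borel_measurable (noise N)"
        using measurable_compose[OF Xm Vm] measurable_compose[OF Xm measurable_expo_sum] by simp_all
      show ?thesis
      proof (cases "ln (expo_sum N y) \<le> k")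
        case True
        let ?z = "expo_sum N y"
        have z: "0 < ?z" using Z1[of y] by simp
        have "V k (NBBM N y t \<omega>) + 1 \<le> V k y + expo_sum N (NBBM N y t \<omega>) / ?z" for \<omega>
        proof -
          let ?X = "expo_sum N (NBBM N y t \<omega>)"
          have X: "0 < ?X" using Z1[of "NBBM N y t \<omega>"] by simp
          have "ln (?X / ?z) \<le> ?X / ?z - 1" using X z by (intro ln_le_minus_one) auto
          then have "ln ?X \<le> ln ?z + ?X / ?z - 1" using X z by (simp add: ln_div)
          then show ?thesis using True by (simp add: V_def)
        qed
        then have "(\<integral>\<^sup>+\<omega>. ennreal (V k (NBBM N y t \<omega>) + 1) \<partial>noise N) \<le> (\<integral>\<^sup>+\<omega>. ennreal (V k y + expo_sum N (NBBM N y t \<omega>) / ?z) \<partial>noise N)"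
          by (intro nn_integral_mono ennreal_leI)
        also have "(\<integral>\<^sup>+\<omega>. ennreal (V k (NBBM N y t \<omega>) + 1) \<partial>noise N) = (\<integral>\<^sup>+\<omega>. ennreal (V k (NBBM N y t \<omega>)) \<partial>noise N) + 1"
          using V0 by (subst ennreal_plus) (auto simp: nn_integral_add O.emeasure_space_1)
        also have "(\<integral>\<^sup>+\<omega>. ennreal (V k y + expo_sum N (NBBM N y t \<omega>) / ?z) \<partial>noise N)
            = (\<integral>\<^sup>+\<omega>. ennreal (V k y) + ennreal (1 / ?z) * ennreal (expo_sum N (NBBM N y t \<omega>)) \<partial>noise N)"
        proof (intro nn_integral_cong)
          fix \<omega>
          have "0 \<le> expo_sum N (NBBM N y t \<omega>)" using Z1[of "NBBM N y t \<omega>"] by linarith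
          then show "ennreal (V k y + expo_sum N (NBBM N y t \<omega>) / ?z) = ennreal (V k y) + ennreal (1 / ?z) * ennreal (expo_sum N (NBBM N y t \<omega>))"
            using V0 z by (subst ennreal_plus) (auto simp: ennreal_mult'[symmetric])
        qed
        also have "\<dots> = ennreal (V k y) + ennreal (1 / ?z) * (\<integral>\<^sup>+\<omega>. ennreal (expo_sum N (NBBM N y t \<omega>)) \<partial>noise N)"
          by (simp add: nn_integral_add nn_integral_cmult O.emeasure_space_1)
        also have "\<dots> \<le> ennreal (V k y) + ennreal (1 / ?z) * ennreal (?z * ?\<beta> y)"
          by (intro add_left_mono mult_left_mono nn_integral_expo_sum_NBBM_le N t y) auto
        also have "ennreal (1 / ?z) * ennreal (?z * ?\<beta> y) = ennreal (?\<beta> y)"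
          using z by (subst ennreal_mult'[symmetric]) auto
        finally show ?thesis using True y by (simp add: V_step)
      next
        case False
        then have "V k y = k" by (simp add: V_def)
        then have "(\<integral>\<^sup>+\<omega>. ennreal (V k (NBBM N y t \<omega>)) \<partial>noise N) \<le> (\<integral>\<^sup>+\<omega>. ennreal (V k y) \<partial>noise N)"
          using V0(2) by (intro nn_integral_mono ennreal_leI) simp
        then have "(\<integral>\<^sup>+\<omega>. ennreal (V k (NBBM N y t \<omega>)) \<partial>noise N) \<le> ennreal (V k y)" by (simp add: O.emeasure_space_1)
        then show ?thesis using False by (simp add: V_step add_increasing2)
      qed
    qed
    have stepm: "(\<lambda>p. step N t (fst p) (snd p)) \<in> measurable (\<psi> \<Otimes>\<^sub>M noise N) (state_space N)"
      by (intro measurable_step[OF N]) (auto simp: measurable_cong_sets[OF refl s, symmetric])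
    have [measurable]: "(\<lambda>y. \<integral>\<^sup>+\<omega>. ennreal (V k (step N t y \<omega>)) \<partial>noise N) \<in> borel_measurable \<psi>"
      using measurable_compose[OF measurable_compose[OF stepm Vm] measurable_ennreal]
      by (intro O.borel_measurable_nn_integral) (simp add: case_prod_beta)
    have "(\<integral>\<^sup>+y. ennreal (V k y) \<partial>\<psi>) + emeasure \<psi> ?S
      = (\<integral>\<^sup>+y. (\<integral>\<^sup>+\<omega>. ennreal (V k (step N t y \<omega>)) \<partial>noise N) + indicator ?S y \<partial>\<psi>)"
      using nn_integral_stationary[OF N st t measurable_compose[OF Vm measurable_ennreal]]
      by (subst nn_integral_add) auto
    also have "\<dots> \<le> (\<integral>\<^sup>+y. ennreal (V k y) + ennreal (?\<beta> y) \<partial>\<psi>)"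
    proof (rule nn_integral_mono_AE)
      have "AE y in \<psi>. y \<in> Gamma N" using st by (simp add: NBBM_stationary_def)
      then show "AE y in \<psi>. (\<integral>\<^sup>+\<omega>. ennreal (V k (step N t y \<omega>)) \<partial>noise N) + indicator ?S y \<le> ennreal (V k y) + ennreal (?\<beta> y)"
        using AE_space by eventually_elim (rule pt)
    qed
    also have "\<dots> = (\<integral>\<^sup>+y. ennreal (V k y) \<partial>\<psi>) + (\<integral>\<^sup>+y. ennreal (?\<beta> y) \<partial>\<psi>)"
      by (rule nn_integral_add) auto
    finally have "(\<integral>\<^sup>+y. ennreal (V k y) \<partial>\<psi>) + emeasure \<psi> ?S \<le> (\<integral>\<^sup>+y. ennreal (V k y) \<partial>\<psi>) + (\<integral>\<^sup>+y. ennreal (?\<beta> y) \<partial>\<psi>)" .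
    moreover have "(\<integral>\<^sup>+y. ennreal (V k y) \<partial>\<psi>) \<le> (\<integral>\<^sup>+y. ennreal (real k) \<partial>\<psi>)"
      using V0(2) by (intro nn_integral_mono ennreal_leI) simp
    \<comment> \<open>Finiteness, owed to the truncation, allows the same integral to be cancelled
      on both sides.\<close>
    then have "(\<integral>\<^sup>+y. ennreal (V k y) \<partial>\<psi>) \<noteq> \<infinity>" by (auto simp: P.emeasure_space_1 top_unique)
    ultimately show ?thesis by (simp add: ennreal_add_left_cancel_le)
  qed
  have "(\<lambda>k. emeasure \<psi> {y\<in>space \<psi>. ln (expo_sum N y) \<le> real k}) \<longlonglongrightarrow> emeasure \<psi> (\<Union>k. {y\<in>space \<psi>. ln (expo_sum N y) \<le> real k})"
    by (intro Lim_emeasure_incseq) (auto simp: incseq_def intro: order_trans)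
  moreover have "(\<Union>k. {y\<in>space \<psi>. ln (expo_sum N y) \<le> real k}) = space \<psi>" using real_arch_simple by auto
  ultimately have "(\<lambda>k. emeasure \<psi> {y\<in>space \<psi>. ln (expo_sum N y) \<le> real k}) \<longlonglongrightarrow> 1" by (simp add: P.emeasure_space_1)
  then show ?thesis by (rule LIMSEQ_le_const2) (use bound in blast)
qed

text \<open>The drift inequality is an equality at t = 0; differentiating it there gives N - 1 \<le>
  1 + the mean of \<open>exp_gap\<close>.\<close>

lemma stationary_gap_bound:
  assumes N: "0 < N" and st: "NBBM_stationary N \<psi>"
  shows "integrable \<psi> (exp_gap N)" "real N - 2 \<le> (\<integral>y. exp_gap N y \<partial>\<psi>)"
proof -
  interpret P: prob_space \<psi> using st by (simp add: NBBM_stationary_def)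
  have s: "sets \<psi> = sets (state_space N)" using st by (simp add: NBBM_stationary_def)
  have [measurable]: "exp_gap N \<in> borel_measurable \<psi>"
    unfolding exp_gap_def[abs_def] measurable_cong_sets[OF s refl]
    by (intro borel_measurable_sum measurable_compose[OF _ borel_measurable_exp] borel_measurable_uminus
         borel_measurable_divide borel_measurable_times measurable_state_proj) auto
  have g0: "0 \<le> exp_gap N y" for y by (simp add: exp_gap_def sum_nonneg)
  have G: "AE y in \<psi>. y \<in> Gamma N" using st by (simp add: NBBM_stationary_def)
  then have "AE y in \<psi>. norm (exp_gap N y) \<le> N"
  proof eventually_elim
    case (elim y)
    have "exp_gap N y \<le> (\<Sum>u<N. 1)" unfolding exp_gap_def
      using elim by (intro sum_mono) (auto simp: Gamma_def intro!: divide_nonneg_nonneg mult_nonneg_nonneg)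
    then show ?case using g0[of y] by simp
  qed
  then show i: "integrable \<psi> (exp_gap N)" by (intro P.integrable_const_bound) auto
  let ?E = "\<integral>y. exp_gap N y \<partial>\<psi>"
  have le: "1 \<le> exp (- (real N - 1) * t) + t * exp ((2 + 16 * real N) * t) * (?E + 1)" if t: "0 \<le> t" for t
  proof -
    have "1 \<le> (\<integral>\<^sup>+y. ennreal (exp (- (real N - 1) * t) + t * exp ((2 + 16 * real N) * t) * (exp_gap N y + 1)) \<partial>\<psi>)"
      by (rule stationary_drift[OF N st t])
    also have "\<dots> = ennreal (\<integral>y. exp (- (real N - 1) * t) + t * exp ((2 + 16 * real N) * t) * (exp_gap N y + 1) \<partial>\<psi>)"
      using i g0 t by (intro nn_integral_eq_integral) auto
    also have "(\<integral>y. exp (- (real N - 1) * t) + t * exp ((2 + 16 * real N) * t) * (exp_gap N y + 1) \<partial>\<psi>)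
        = exp (- (real N - 1) * t) + t * exp ((2 + 16 * real N) * t) * (?E + 1)"
      using i by (simp add: P.prob_space)
    finally show ?thesis by (simp add: ennreal_1[symmetric] ennreal_le_iff2 del: ennreal_1)
  qed
  define a where "a = real N - 1"
  define b where "b = 2 + 16 * real N"
  have lim1: "((\<lambda>t. (1 - exp (- a * t)) / t) \<longlongrightarrow> a) (at_right 0)" by real_asymp
  have lim2: "((\<lambda>t. exp (b * t) * (?E + 1)) \<longlongrightarrow> exp (b * 0) * (?E + 1)) (at_right 0)" by (intro tendsto_intros)
  have "\<forall>\<^sub>F t in at_right 0. (1 - exp (- a * t)) / t \<le> exp (b * t) * (?E + 1)"
    using eventually_at_right_less[of "0::real"]
  proof eventually_elim
    case (elim t)
    have "1 - exp (- a * t) \<le> exp (b * t) * (?E + 1) * t" using le[of t] elim by (simp add: a_def b_def mult_ac)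
    then show ?case using elim by (simp add: pos_divide_le_eq)
  qed
  then have "a \<le> exp (b * 0) * (?E + 1)" by (intro tendsto_le[OF _ lim2 lim1]) auto
  then show "real N - 2 \<le> ?E" by (simp add: a_def)
qed

section \<open>Convergence of the tails\<close>

lemma DERIV_pi_tail: "(pi_tail has_real_derivative - (2 * x * exp (- sqrt 2 * x))) (at x)"
  unfolding pi_tail_def[abs_def]
  by (auto intro!: derivative_eq_intros simp: algebra_simps)

lemma isCont_pi_tail: "isCont pi_tail x"
  using DERIV_pi_tail by (rule DERIV_isCont)

lemma pi_tail_antimono:
  assumes "0 \<le> x" "x \<le> y" shows "pi_tail y \<le> pi_tail x"
proof (rule DERIV_nonpos_imp_nonincreasing[OF assms(2)])
  fix t assume "x \<le> t"
  then show "\<exists>D. (pi_tail has_real_derivative D) (at t) \<and> D \<le> 0"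
    using DERIV_pi_tail[of t] assms(1) by (intro exI[of _ "- (2 * t * exp (- sqrt 2 * t))"]) auto
qed

lemma pi_tail_bounds:
  assumes "0 \<le> x" shows "0 \<le> pi_tail x" "pi_tail x \<le> 1"
proof -
  show "0 \<le> pi_tail x" using assms by (simp add: pi_tail_def)
  show "pi_tail x \<le> 1" using pi_tail_antimono[of 0 x] assms by (simp add: pi_tail_def)
qed

lemma pi_tail_at_top: "(pi_tail \<longlongrightarrow> 0) at_top"
  unfolding pi_tail_def[abs_def] by real_asymp

text \<open>\<open>pi_rest x\<close> is the integral of \<open>pi_tail\<close> over \<open>{x..}\<close>.\<close>
definition pi_rest :: "real \<Rightarrow> real" where
  "pi_rest x = exp (- sqrt 2 * x) * (x + sqrt 2)"

lemma pi_rest_at_top: "(pi_rest \<longlongrightarrow> 0) at_top"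
  unfolding pi_rest_def[abs_def] by real_asymp

lemma pi_rest_diff_le:
  assumes "0 \<le> x" "x \<le> y" shows "pi_rest x - pi_rest y \<le> (y - x) * pi_tail x"
proof (cases "x = y")
  case False
  then have xy: "x < y" using assms by simp
  have D: "(pi_rest has_real_derivative - pi_tail t) (at t)" for t
    unfolding pi_rest_def[abs_def] pi_tail_def
    by (auto intro!: derivative_eq_intros simp: algebra_simps)
  obtain z where z: "x < z" "z < y" "pi_rest y - pi_rest x = (y - x) * (- pi_tail z)"
    using MVT2[OF xy D] by auto
  have "(y - x) * pi_tail z \<le> (y - x) * pi_tail x" using pi_tail_antimono[of x z] assms z by (intro mult_left_mono) auto
  then show ?thesis using z(3) by simp
qed simp

text \<open>The total integral is sqrt 2, the value of \<open>pi_rest\<close> at 0. Each grid value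
  dominates the integral over the following cell, so what is lost is the first cell, of area at most
  h, and the rest beyond the grid.\<close>

lemma pi_tail_riemann_lower:
  assumes h: "0 \<le> h"
  shows "sqrt 2 - h - pi_rest (h * Suc M) \<le> h * (\<Sum>i<M. pi_tail (h * Suc i))"
proof -
  have "pi_rest h - pi_rest (h * Suc M) = (\<Sum>i<M. pi_rest (h * Suc i) - pi_rest (h * Suc (Suc i)))"
    using sum_lessThan_telescope'[of "\<lambda>i. pi_rest (h * Suc i)" M] by simp
  also have "\<dots> \<le> (\<Sum>i<M. h * pi_tail (h * Suc i))"
  proof (rule sum_mono)
    fix i
    have "h * Suc (Suc i) - h * Suc i = h" by (simp add: algebra_simps)
    then show "pi_rest (h * Suc i) - pi_rest (h * Suc (Suc i)) \<le> h * pi_tail (h * Suc i)"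
      using pi_rest_diff_le[of "h * Suc i" "h * Suc (Suc i)"] h by (simp add: mult_left_mono)
  qed
  finally have "pi_rest h - pi_rest (h * Suc M) \<le> h * (\<Sum>i<M. pi_tail (h * Suc i))" by (simp add: sum_distrib_left)
  moreover have "sqrt 2 - h \<le> pi_rest h"
    using pi_rest_diff_le[of 0 h] h by (simp add: pi_rest_def pi_tail_def)
  ultimately show ?thesis by simp
qed

text \<open>A tail whose lower limit dominates \<open>pi_tail\<close> but whose integral is asymptotically no larger
  must converge to it: any excess at \<open>w\<close> would, by monotonicity, occupy a block to the left of \<open>w\<close>.\<close>
lemma tail_upper_limit:
  fixes a :: "nat \<Rightarrow> real \<Rightarrow> real"
  assumes anti: "\<And>N x y. x \<le> y \<Longrightarrow> a N y \<le> a N x" and le1: "\<And>N x. a N x \<le> 1"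
    and lower: "\<And>x \<eta>. 0 \<le> x \<Longrightarrow> 0 < \<eta> \<Longrightarrow> \<forall>\<^sub>F N in sequentially. pi_tail x - \<eta> \<le> a N x"
    and upper: "\<And>h M \<eta>. 0 < h \<Longrightarrow> 0 < \<eta> \<Longrightarrow> \<forall>\<^sub>F N in sequentially. h * (\<Sum>i<M. a N (h * real (Suc i))) \<le> sqrt 2 + \<eta>"
    and w: "0 \<le> w" and eta: "0 < \<eta>"
  shows "\<forall>\<^sub>F N in sequentially. a N w \<le> pi_tail w + \<eta>"
proof (cases "w = 0")
  case True
  have "a N 0 \<le> 1 + \<eta>" for N using le1[of N 0] eta by linarith
  then show ?thesis using True by (simp add: pi_tail_def)
next
  case False
  then have w0: "0 < w" using w by simp
  have "((\<lambda>l. pi_tail (w - w / real (Suc l))) \<longlongrightarrow> pi_tail w) sequentially"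
  proof (rule isCont_tendsto_compose[OF isCont_pi_tail])
    have "(\<lambda>l. w - w / real (Suc l)) \<longlonglongrightarrow> w - 0"
      by (intro tendsto_diff tendsto_const LIMSEQ_Suc[OF lim_const_over_n])
    then show "(\<lambda>l. w - w / real (Suc l)) \<longlonglongrightarrow> w" by simp
  qed
  then have "\<forall>\<^sub>F l in sequentially. pi_tail (w - w / real (Suc l)) < pi_tail w + \<eta> / 4"
    using eta by (intro order_tendstoD) auto
  then obtain n where n: "pi_tail (w - w / real (Suc n)) < pi_tail w + \<eta> / 4"
    by (auto simp: eventually_sequentially)
  \<comment> \<open>Width of the block to the left of w: an exact fraction of w, so small that
    \<open>pi_tail\<close> varies by less than \<eta> / 4 over it.\<close>
  define b where "b = w / real (Suc n)"
  have b: "0 < b" "b \<le> w" "pi_tail (w - b) < pi_tail w + \<eta> / 4"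
    using w0 n by (auto simp: b_def divide_le_eq mult_le_cancel_left1 simp del: of_nat_Suc)
  have b\<eta>: "0 < b * \<eta> / 8" using b eta by simp
  obtain l where l: "0 < l" "1 / real l \<le> \<eta> / 8"
  proof -
    obtain m where "inverse (real (Suc m)) < \<eta> / 8" using reals_Archimedean[of "\<eta> / 8"] eta by auto
    then show ?thesis using that[of "Suc m"] by (simp add: inverse_eq_divide)
  qed
  \<comment> \<open>The mesh divides b, so the block consists of exactly l cells.\<close>
  define h where "h = b / real l"
  have h: "0 < h" "h * l = b" "h \<le> b * \<eta> / 8"
    using b l mult_left_mono[OF l(2), of b] by (auto simp: h_def)
  have hw: "h * real (l * Suc n) = w"
  proof -
    have "h * real (l * Suc n) = (h * real l) * real (Suc n)" by (simp only: of_nat_mult mult.assoc)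
    then show ?thesis unfolding h(2) b_def by simp
  qed
  let ?B = "{l * n..<l * Suc n}"
  have "(\<lambda>M. pi_rest (h * real (Suc M))) \<longlonglongrightarrow> 0"
  proof (rule filterlim_compose[OF pi_rest_at_top])
    show "filterlim (\<lambda>M. h * real (Suc M)) at_top sequentially" using h(1) by real_asymp
  qed
  then have "\<forall>\<^sub>F M in sequentially. pi_rest (h * real (Suc M)) < b * \<eta> / 8" by (rule order_tendstoD) (rule b\<eta>)
  then have "\<forall>\<^sub>F M in sequentially. pi_rest (h * real (Suc M)) < b * \<eta> / 8 \<and> l * Suc n \<le> M"
    using eventually_ge_at_top by (rule eventually_conj)
  then obtain M where M: "pi_rest (h * real (Suc M)) < b * \<eta> / 8" "l * Suc n \<le> M"
    by (auto simp: eventually_sequentially)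
  have BM: "?B \<subseteq> {..<M}" using M(2) by auto
  \<comment> \<open>Tolerance at each of the M grid points; weighted with h the tolerances add up to
    at most b * \<eta> / 8.\<close>
  define \<delta> where "\<delta> = (b * \<eta> / 8) / (h * (M + 1))"
  have \<delta>: "0 < \<delta>" using b\<eta> h by (simp add: \<delta>_def)
  have "h * (real M * \<delta>) \<le> h * (real (M + 1) * \<delta>)" using h \<delta> by (intro mult_left_mono mult_right_mono) auto
  also have "\<dots> = b * \<eta> / 8" using h(1) by (simp add: \<delta>_def add_nonneg_eq_0_iff)
  finally have hM: "h * (real M * \<delta>) \<le> b * \<eta> / 8" .
  have "\<forall>\<^sub>F N in sequentially. \<forall>i\<in>{..<M}. pi_tail (h * Suc i) - \<delta> \<le> a N (h * Suc i)"
    using h(1) \<delta> by (intro eventually_ball_finite ballI lower) auto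
  moreover note upper[OF h(1) b\<eta>, of M]
  ultimately show ?thesis
  proof eventually_elim
    case (elim N)
    have "b * a N w = h * (\<Sum>i\<in>?B. a N w)" by (simp add: h(2)[symmetric] mult.assoc)
    also have "\<dots> \<le> h * (\<Sum>i\<in>?B. a N (h * Suc i))"
    proof (intro mult_left_mono sum_mono anti)
      fix i assume "i \<in> ?B"
      then have "real (Suc i) \<le> real (l * Suc n)" by (intro of_nat_mono) auto
      then show "h * Suc i \<le> w" unfolding hw[symmetric] using h(1) by (intro mult_left_mono) auto
    qed (use h in simp)
    also have "\<dots> = h * (\<Sum>i<M. a N (h * Suc i)) - h * (\<Sum>i\<in>{..<M}-?B. a N (h * Suc i))"
      using BM by (simp add: sum_diff right_diff_distrib)
    also have "\<dots> \<le> (sqrt 2 + b * \<eta> / 8) - h * (\<Sum>i\<in>{..<M}-?B. pi_tail (h * Suc i) - \<delta>)"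
      using elim h(1) by (intro diff_mono mult_left_mono sum_mono) auto
    also have "h * (\<Sum>i\<in>{..<M}-?B. pi_tail (h * Suc i) - \<delta>) = h * (\<Sum>i<M. pi_tail (h * Suc i)) - h * (\<Sum>i\<in>?B. pi_tail (h * Suc i)) - h * (card ({..<M}-?B) * \<delta>)"
      using BM by (simp add: sum_subtractf sum_diff algebra_simps)
    finally have main: "b * a N w \<le> sqrt 2 + b * \<eta> / 8 - (h * (\<Sum>i<M. pi_tail (h * Suc i)) - h * (\<Sum>i\<in>?B. pi_tail (h * Suc i)) - h * (card ({..<M}-?B) * \<delta>))" .
    have "card ({..<M}-?B) \<le> card {..<M}" by (intro card_mono) auto
    then have "h * (card ({..<M}-?B) * \<delta>) \<le> h * (real M * \<delta>)" using h \<delta> by (intro mult_left_mono mult_right_mono) auto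
    moreover have "h * (\<Sum>i\<in>?B. pi_tail (h * Suc i)) \<le> b * pi_tail (w - b)"
    proof -
      have "(\<Sum>i\<in>?B. pi_tail (h * Suc i)) \<le> (\<Sum>i\<in>?B. pi_tail (w - b))"
      proof (intro sum_mono pi_tail_antimono)
        fix i assume "i \<in> ?B"
        then have "real (l * n) \<le> real (Suc i)" by (intro of_nat_mono) auto
        then have "h * real (l * n) \<le> h * real (Suc i)" using h(1) by (intro mult_left_mono) auto
        moreover have "h * real (l * n) = w - b" using hw h(2) by (simp add: algebra_simps)
        ultimately show "w - b \<le> h * Suc i" by simp
      qed (use b in simp)
      then have "h * (\<Sum>i\<in>?B. pi_tail (h * Suc i)) \<le> h * (\<Sum>i\<in>?B. pi_tail (w - b))" using h(1) by (intro mult_left_mono) auto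
      then show ?thesis by (simp add: h(2)[symmetric] mult.assoc)
    qed
    moreover have "sqrt 2 - h - pi_rest (h * Suc M) \<le> h * (\<Sum>i<M. pi_tail (h * Suc i))"
      using h(1) by (intro pi_tail_riemann_lower) simp
    \<comment> \<open>Four errors of at most b * \<eta> / 8 each: the slack of the upper bound, the
      first cell h, the rest beyond the grid, and the tolerances.\<close>
    ultimately have "b * a N w \<le> b * pi_tail (w - b) + 4 * (b * \<eta> / 8)"
      using main M(1) hM h(3) by linarith
    also have "\<dots> = b * (pi_tail (w - b) + \<eta> / 2)" by (simp add: algebra_simps)
    finally have "a N w \<le> pi_tail (w - b) + \<eta> / 2" using b(1) by simp
    then show ?case using b(3) eta by linarith
  qed
qed

section \<open>From the drift bound to the mean tail\<close>

lemma grid_count_le_min: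
  fixes v h :: real
  assumes h: "0 < h" and v: "0 \<le> v"
  shows "h * (\<Sum>i<M. indicator {h * real (Suc i)<..} v) \<le> min v (h * real M)"
proof (induction M)
  case 0 then show ?case using v by simp
next
  case (Suc M)
  show ?case
  proof (cases "h * real (Suc M) < v")
    case True
    have "(\<Sum>i<Suc M. indicator {h * real (Suc i)<..} v) \<le> (\<Sum>i<Suc M. 1::real)"
      by (intro sum_mono) (auto split: split_indicator)
    then have "h * (\<Sum>i<Suc M. indicator {h * real (Suc i)<..} v) \<le> h * real (Suc M)" using h by (intro mult_left_mono) auto
    then show ?thesis using True by simp
  next
    case False
    then have "h * (\<Sum>i<Suc M. indicator {h * real (Suc i)<..} v) = h * (\<Sum>i<M. indicator {h * real (Suc i)<..} v)" by simp
    also have "\<dots> \<le> min v (h * real M)" by (rule Suc.IH)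
    also have "\<dots> \<le> min v (h * real (Suc M))" using h by (intro min.mono) auto
    finally show ?thesis .
  qed
qed

text \<open>Truncating v at K turns the quadratic error of the linearised exponential into a
  relative error c * K, which vanishes for c = sqrt 2 / N and fixed K.\<close>

lemma one_minus_exp_lower:
  fixes v K c :: real
  assumes v: "0 \<le> v" and K: "0 \<le> K" and c: "0 \<le> c"
  shows "min v K * c * (1 - c * K) \<le> 1 - exp (- (c * v))"
proof -
  define x where "x = c * min v K"
  have x: "0 \<le> x" "x \<le> c * K" "x \<le> c * v" using assms by (auto simp: x_def intro: mult_left_mono)
  have "exp (- (c * v)) \<le> exp (- x)" using x by simp
  also have "\<dots> \<le> 1 - x + x * x"
  proof -
    have "1 \<le> 1 + x ^ 3" using x by simp
    also have "\<dots> = (1 - x + x * x) * (1 + x)" by (simp add: algebra_simps power3_eq_cube)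
    also have "\<dots> \<le> (1 - x + x * x) * exp x"
    proof (rule mult_left_mono[OF exp_ge_add_one_self])
      have "0 \<le> (1 - x / 2)\<^sup>2 + 3 / 4 * (x * x)" by simp
      then show "0 \<le> 1 - x + x * x" by (simp add: power2_eq_square algebra_simps)
    qed
    finally have "1 * exp (- x) \<le> (1 - x + x * x) * exp x * exp (- x)" by (intro mult_right_mono) auto
    then show ?thesis by (simp add: mult.assoc flip: exp_add)
  qed
  finally have "x * (1 - x) \<le> 1 - exp (- (c * v))" by (simp add: algebra_simps)
  moreover have "x * (1 - c * K) \<le> x * (1 - x)" using x by (intro mult_left_mono) auto
  ultimately show ?thesis by (simp add: x_def mult_ac)
qed

text \<open>Exchanging the sums turns a grid sum of tails into a sum over particles of truncated
  positions, which is compared with \<open>exp_gap\<close> particle by particle.\<close>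

lemma emp_tail_grid_le:
  assumes N: "0 < N" and y: "y \<in> Gamma N" and h: "0 < h" and K: "sqrt 2 * (h * real M) / N \<le> 1"
  shows "h * (\<Sum>i<M. emp_tail N y (h * real (Suc i))) * (sqrt 2 * (1 - sqrt 2 * (h * real M) / N)) \<le> real N - exp_gap N y"
proof -
  have y0: "0 \<le> y u" if "u < N" for u using y that by (auto simp: Gamma_def)
  let ?K = "h * real M" and ?c = "sqrt 2 / real N"
  let ?q = "?c * (1 - ?c * ?K)"
  have q: "0 \<le> ?q" using K by (intro mult_nonneg_nonneg) auto
  have "h * (\<Sum>i<M. emp_tail N y (h * real (Suc i))) * real N = (\<Sum>u<N. h * (\<Sum>i<M. indicator {h * real (Suc i)<..} (y u)))"
  proof -
    have "emp_tail N y b * real N = (\<Sum>u<N. indicator {b<..} (y u))" for b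
      using N card_eq_sum_indicator[of "{..<N}" b y] by (simp add: emp_tail_def)
    then have "h * (\<Sum>i<M. emp_tail N y (h * real (Suc i))) * real N = (\<Sum>i<M. \<Sum>u<N. h * indicator {h * real (Suc i)<..} (y u))"
      by (simp only: sum_distrib_right sum_distrib_left mult.assoc)
    also have "\<dots> = (\<Sum>u<N. h * (\<Sum>i<M. indicator {h * real (Suc i)<..} (y u)))"
      unfolding sum_distrib_left by (rule sum.swap)
    finally show ?thesis .
  qed
  also have "\<dots> \<le> (\<Sum>u<N. min (y u) ?K)" by (intro sum_mono grid_count_le_min h y0) auto
  finally have "h * (\<Sum>i<M. emp_tail N y (h * real (Suc i))) * real N * ?q \<le> (\<Sum>u<N. min (y u) ?K) * ?q"
    using q by (rule mult_right_mono)
  also have "\<dots> = (\<Sum>u<N. min (y u) ?K * ?c * (1 - ?c * ?K))" by (simp only: sum_distrib_right mult.assoc)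
  also have "\<dots> \<le> (\<Sum>u<N. 1 - exp (- (?c * y u)))"
    using h by (intro sum_mono one_minus_exp_lower y0) auto
  also have "\<dots> = real N - exp_gap N y" by (simp add: exp_gap_def sum_subtractf)
  finally have "h * (\<Sum>i<M. emp_tail N y (h * real (Suc i))) * (real N * ?q) \<le> real N - exp_gap N y" by (simp only: mult.assoc)
  moreover have "real N * ?q = sqrt 2 * (1 - sqrt 2 * (h * real M) / N)" using N by (simp add: mult.assoc[symmetric])
  ultimately show ?thesis by simp
qed

lemma stationary_emp_tail:
  assumes N: "0 < N" and st: "NBBM_stationary N \<psi>"
  shows "(\<lambda>y. emp_tail N y x) \<in> borel_measurable \<psi>" "integrable \<psi> (\<lambda>y. emp_tail N y x)"
proof -
  interpret P: prob_space \<psi> using st by (simp add: NBBM_stationary_def)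
  have s: "sets \<psi> = sets (state_space N)" using st by (simp add: NBBM_stationary_def)
  show m: "(\<lambda>y. emp_tail N y x) \<in> borel_measurable \<psi>" by (simp add: measurable_cong_sets[OF s refl])
  then show "integrable \<psi> (\<lambda>y. emp_tail N y x)"
    using emp_tail_bounds by (intro P.integrable_const_bound[of _ 1]) auto
qed

text \<open>The drift argument leaves a mean of at most 2 for N - \<open>exp_gap\<close>. Divided by
  the slope sqrt 2 of the linearisation, this becomes sqrt 2, the integral of
  \<open>pi_tail\<close>.\<close>

lemma mean_emp_tail_grid_le:
  assumes N: "0 < N" and st: "NBBM_stationary N \<psi>" and h: "0 < h" and K: "sqrt 2 * (h * real M) / N < 1"
  shows "h * (\<Sum>i<M. \<integral>y. emp_tail N y (h * real (Suc i)) \<partial>\<psi>) \<le> sqrt 2 / (1 - sqrt 2 * (h * real M) / N)"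
proof -
  interpret P: prob_space \<psi> using st by (simp add: NBBM_stationary_def)
  let ?q = "1 - sqrt 2 * (h * real M) / N" and ?S = "h * (\<Sum>i<M. \<integral>y. emp_tail N y (h * real (Suc i)) \<partial>\<psi>)"
  note int = stationary_emp_tail(2)[OF N st]
  have "(\<integral>y. h * (\<Sum>i<M. emp_tail N y (h * real (Suc i))) * (sqrt 2 * ?q) \<partial>\<psi>) \<le> (\<integral>y. real N - exp_gap N y \<partial>\<psi>)"
  proof (rule integral_mono_AE)
    have "AE y in \<psi>. y \<in> Gamma N" using st by (simp add: NBBM_stationary_def)
    then show "AE y in \<psi>. h * (\<Sum>i<M. emp_tail N y (h * real (Suc i))) * (sqrt 2 * ?q) \<le> real N - exp_gap N y"
      using emp_tail_grid_le[OF N _ h] K by (auto elim!: eventually_mono)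
  qed (use int stationary_gap_bound(1)[OF N st] in auto)
  also have "\<dots> = real N - (\<integral>y. exp_gap N y \<partial>\<psi>)" using stationary_gap_bound(1)[OF N st] by (simp add: P.prob_space)
  also have "\<dots> \<le> 2" using stationary_gap_bound(2)[OF N st] by simp
  also have "(\<integral>y. h * (\<Sum>i<M. emp_tail N y (h * real (Suc i))) * (sqrt 2 * ?q) \<partial>\<psi>) = ?S * (sqrt 2 * ?q)"
    using int by (simp add: Bochner_Integration.integral_sum)
  finally have "(?S * ?q) * sqrt 2 \<le> sqrt 2 * sqrt 2" by (simp add: mult_ac)
  then have "?S * ?q \<le> sqrt 2" by (rule mult_right_le_imp_le) simp
  then show ?thesis using K by (simp add: pos_le_divide_eq)
qed

lemma mean_emp_tail_lower:
  fixes \<psi> :: "nat \<Rightarrow> (nat \<Rightarrow> real) measure"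
  assumes st: "\<forall>N\<ge>2. NBBM_stationary N (\<psi> N)" and w: "0 \<le> w" and eta: "0 < \<eta>"
  shows "\<forall>\<^sub>F N in sequentially. pi_tail w - \<eta> \<le> (\<integral>y. emp_tail N y w \<partial>\<psi> N)"
proof -
  have e2: "0 < \<eta> / 2" using eta by simp
  have "\<forall>\<^sub>F N in sequentially. measure (\<psi> N) {y\<in>space (\<psi> N). emp_tail N y w < pi_tail w - \<eta> / 2} < \<eta> / 2"
    using emp_tail_lower_bound[OF st w e2] e2 by (rule order_tendstoD)
  then show ?thesis using eventually_ge_at_top[of 2]
  proof eventually_elim
    case (elim N)
    have N: "0 < N" using elim by simp
    have stN: "NBBM_stationary N (\<psi> N)" using st elim by blast
    interpret P: prob_space "\<psi> N" using stN by (simp add: NBBM_stationary_def)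
    note [measurable] = stationary_emp_tail(1)[OF N stN]
    let ?A = "{y\<in>space (\<psi> N). emp_tail N y w < pi_tail w - \<eta> / 2}"
    have A: "?A \<in> sets (\<psi> N)" by measurable
    have "(\<integral>y. pi_tail w - \<eta> / 2 - indicator ?A y \<partial>\<psi> N) \<le> (\<integral>y. emp_tail N y w \<partial>\<psi> N)"
    proof (rule integral_mono)
      fix y assume "y \<in> space (\<psi> N)"
      \<comment> \<open>Subtracting 1 on the exceptional event makes the left side negative there,
        because \<open>pi_tail\<close> is at most 1.\<close>
      then show "pi_tail w - \<eta> / 2 - indicator ?A y \<le> emp_tail N y w"
        using pi_tail_bounds[OF w] emp_tail_bounds(1)[of N y w] eta by (auto split: split_indicator)
    qed (use A stationary_emp_tail(2)[OF N stN] in \<open>auto simp: P.emeasure_eq_measure\<close>)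
    also have "(\<integral>y. pi_tail w - \<eta> / 2 - indicator ?A y \<partial>\<psi> N) = pi_tail w - \<eta> / 2 - measure (\<psi> N) ?A"
      using A by (simp add: P.prob_space P.emeasure_eq_measure)
    finally show ?case using elim by simp
  qed
qed

lemma mean_emp_tail_upper:
  fixes \<psi> :: "nat \<Rightarrow> (nat \<Rightarrow> real) measure"
  assumes st: "\<forall>N\<ge>2. NBBM_stationary N (\<psi> N)" and w: "0 \<le> w" and eta: "0 < \<eta>"
  shows "\<forall>\<^sub>F N in sequentially. (\<integral>y. emp_tail N y w \<partial>\<psi> N) \<le> pi_tail w + \<eta>"
proof -
  \<comment> \<open>Stationarity is available for N \<ge> 2; for smaller N the default 0 keeps the
    function monotone and bounded, and these N do not affect the limit.\<close>
  define a where "a N x = (if 2 \<le> N then \<integral>y. emp_tail N y x \<partial>\<psi> N else 0)" for N x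
  have ev: "\<forall>\<^sub>F N in sequentially. a N x = (\<integral>y. emp_tail N y x \<partial>\<psi> N)" for x
    using eventually_ge_at_top[of 2] by eventually_elim (simp add: a_def)
  have "\<forall>\<^sub>F N in sequentially. a N w \<le> pi_tail w + \<eta>"
  proof (rule tail_upper_limit[OF _ _ _ _ w eta])
    fix N :: nat and x y :: real assume xy: "x \<le> y"
    show "a N y \<le> a N x"
    proof (cases "2 \<le> N")
      case True
      have stN: "NBBM_stationary N (\<psi> N)" using st True by blast
      show ?thesis unfolding a_def using True xy stationary_emp_tail(2)[OF _ stN]
        by (auto intro!: integral_mono antimonoD[OF antimono_emp_tail])
    qed (simp add: a_def)
  next
    fix N :: nat and x :: real
    show "a N x \<le> 1"
    proof (cases "2 \<le> N")
      case True
      then have stN: "NBBM_stationary N (\<psi> N)" using st by blast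
      interpret P: prob_space "\<psi> N" using stN by (simp add: NBBM_stationary_def)
      have "(\<integral>y. emp_tail N y x \<partial>\<psi> N) \<le> (\<integral>y. 1 \<partial>\<psi> N)"
        using True stationary_emp_tail(2)[OF _ stN] emp_tail_bounds(2) by (intro integral_mono) auto
      then show ?thesis using True by (simp add: a_def P.prob_space)
    qed (simp add: a_def)
  next
    fix x e :: real assume "0 \<le> x" "0 < e"
    from mean_emp_tail_lower[OF st this] ev[of x] show "\<forall>\<^sub>F N in sequentially. pi_tail x - e \<le> a N x"
      by eventually_elim simp
  next
    fix h e :: real and M :: nat assume h: "0 < h" and e: "0 < e"
    have lim: "(\<lambda>N. sqrt 2 * (h * real M) / real N) \<longlonglongrightarrow> 0" by (rule lim_const_over_n)
    have "(\<lambda>N. sqrt 2 / (1 - sqrt 2 * (h * real M) / real N)) \<longlonglongrightarrow> sqrt 2 / (1 - 0)"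
      by (intro tendsto_divide tendsto_diff tendsto_const lim) auto
    then have "\<forall>\<^sub>F N in sequentially. sqrt 2 / (1 - sqrt 2 * (h * real M) / real N) < sqrt 2 + e"
      using e by (intro order_tendstoD) auto
    moreover have "\<forall>\<^sub>F N in sequentially. sqrt 2 * (h * real M) / real N < 1" by (rule order_tendstoD[OF lim]) simp
    ultimately show "\<forall>\<^sub>F N in sequentially. h * (\<Sum>i<M. a N (h * real (Suc i))) \<le> sqrt 2 + e"
      using eventually_ge_at_top[of 2]
    proof eventually_elim
      case (elim N)
      then have "h * (\<Sum>i<M. \<integral>y. emp_tail N y (h * real (Suc i)) \<partial>\<psi> N) \<le> sqrt 2 / (1 - sqrt 2 * (h * real M) / N)"
        using st by (intro mean_emp_tail_grid_le h) auto
      then show ?case using elim by (simp add: a_def)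
    qed
  qed
  then show ?thesis using ev[of w] by eventually_elim simp
qed

text \<open>A lower bound in probability together with an upper bound on the mean leaves no room for
  large positive deviations: off an event of small probability the deviation plus \<eta> is
  nonnegative, and its mean is small, so a Markov estimate applies.\<close>

theorem emp_tail_in_probability:
  fixes \<psi> :: "nat \<Rightarrow> (nat \<Rightarrow> real) measure"
  assumes st: "\<forall>N\<ge>2. NBBM_stationary N (\<psi> N)" and w: "0 \<le> w" and e: "0 < e"
  shows "(\<lambda>N. measure (\<psi> N) {y\<in>space (\<psi> N). e < \<bar>emp_tail N y w - pi_tail w\<bar>}) \<longlonglongrightarrow> 0"
proof (rule tendstoI)
  fix r :: real assume r: "0 < r"
  define \<eta> where "\<eta> = min (e / 2) (e * r / 8)"
  have eta: "0 < \<eta>" "\<eta> < e" "2 * \<eta> \<le> e * r / 4" using e r by (auto simp: \<eta>_def)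
  define q where "q = min (e * r / 4) (r / 4)"
  have q: "0 < q" "q \<le> e * r / 4" "q \<le> r / 4" using e r by (auto simp: q_def)
  have "\<forall>\<^sub>F N in sequentially. measure (\<psi> N) {y\<in>space (\<psi> N). emp_tail N y w < pi_tail w - \<eta>} < q"
    using emp_tail_lower_bound[OF st w eta(1)] q(1) by (rule order_tendstoD)
  then show "\<forall>\<^sub>F N in sequentially. dist (measure (\<psi> N) {y\<in>space (\<psi> N). e < \<bar>emp_tail N y w - pi_tail w\<bar>}) 0 < r"
    using mean_emp_tail_upper[OF st w eta(1)] eventually_ge_at_top[of 2]
  proof eventually_elim
    case (elim N)
    have N: "0 < N" using elim by simp
    have stN: "NBBM_stationary N (\<psi> N)" using st elim by blast
    interpret P: prob_space "\<psi> N" using stN by (simp add: NBBM_stationary_def)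
    note [measurable] = stationary_emp_tail(1)[OF N stN]
    note int = stationary_emp_tail(2)[OF N stN]
    let ?A = "{y\<in>space (\<psi> N). emp_tail N y w < pi_tail w - \<eta>}"
    let ?C = "{y\<in>space (\<psi> N). e < emp_tail N y w - pi_tail w}"
    let ?B = "{y\<in>space (\<psi> N). e < \<bar>emp_tail N y w - pi_tail w\<bar>}"
    have m: "?A \<in> sets (\<psi> N)" "?B \<in> sets (\<psi> N)" "?C \<in> sets (\<psi> N)" by measurable
    have "(\<integral>y. e * indicator ?C y \<partial>\<psi> N) \<le> (\<integral>y. (emp_tail N y w - pi_tail w + \<eta>) + indicator ?A y \<partial>\<psi> N)"
    proof (rule integral_mono)
      fix y assume "y \<in> space (\<psi> N)"
      then show "e * indicator ?C y \<le> (emp_tail N y w - pi_tail w + \<eta>) + indicator ?A y"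
        using pi_tail_bounds[OF w] emp_tail_bounds(1)[of N y w] eta e by (auto split: split_indicator)
    qed (use m int in \<open>auto simp: P.emeasure_eq_measure\<close>)
    also have "\<dots> = (\<integral>y. emp_tail N y w \<partial>\<psi> N) - pi_tail w + \<eta> + measure (\<psi> N) ?A"
      using m int by (simp add: P.prob_space P.emeasure_eq_measure)
    also have "\<dots> < 2 * \<eta> + q" using elim by simp
    also have "(\<integral>y. e * indicator ?C y \<partial>\<psi> N) = e * measure (\<psi> N) ?C" using m by (simp add: P.emeasure_eq_measure)
    finally have "e * measure (\<psi> N) ?C < e * (r / 2)" using eta(3) q(2) by simp
    then have C: "measure (\<psi> N) ?C < r / 2" using e by simp
    have "measure (\<psi> N) ?B \<le> measure (\<psi> N) (?A \<union> ?C)"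
      using m eta(2) by (intro P.finite_measure_mono) auto
    also have "\<dots> \<le> measure (\<psi> N) ?A + measure (\<psi> N) ?C" using m by (intro measure_Un_le) auto
    finally show ?case using C elim q(3) r by (simp add: dist_real_def)
  qed
qed

section \<open>The Levy metric\<close>

lemma prob_space_empirical:
  assumes N: "0 < N" shows "prob_space (empirical N y)"
  unfolding empirical_def
proof (rule prob_space.prob_space_distr)
  show "prob_space (uniform_count_measure {..<N})" using N by (intro prob_space_uniform_count_measure) auto
qed (simp add: measurable_cong_sets[OF sets_uniform_count_measure_count_space refl])

lemma measure_empirical:
  assumes N: "0 < N" shows "measure (empirical N y) {..x} = 1 - emp_tail N y x"
proof -
  have y: "y \<in> measurable (uniform_count_measure {..<N}) borel"
    by (simp add: measurable_cong_sets[OF sets_uniform_count_measure_count_space refl])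
  have "measure (empirical N y) {..x} = measure (uniform_count_measure {..<N}) {i\<in>{..<N}. y i \<le> x}"
    unfolding empirical_def by (subst measure_distr[OF y]) (auto simp: space_uniform_count_measure vimage_def Int_def intro!: arg_cong[where f="measure _"])
  also have "\<dots> = card {i\<in>{..<N}. y i \<le> x} / N" by (subst measure_uniform_count_measure) auto
  also have "{i\<in>{..<N}. y i \<le> x} = {..<N} - {i\<in>{..<N}. x < y i}" by auto
  also have "real (card \<dots>) = real N - card {i\<in>{..<N}. x < y i}"
  proof -
    have "card {i\<in>{..<N}. x < y i} \<le> card {..<N}" by (intro card_mono) auto
    then show ?thesis by (subst card_Diff_subset) (auto simp: of_nat_diff)
  qed
  finally show ?thesis using N by (simp add: emp_tail_def diff_divide_distrib)
qed

lemma emeasure_pi_min: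
  "emeasure pi_min {..x} = (if x < 0 then 0 else ennreal (1 - pi_tail x))"
proof -
  have [measurable]: "pi_min_density \<in> borel_measurable borel" unfolding pi_min_density_def[abs_def] by measurable
  have "emeasure pi_min {..x} = (\<integral>\<^sup>+t. ennreal (pi_min_density t) * indicator {..x} t \<partial>lborel)"
    unfolding pi_min_def by (rule emeasure_density) auto
  also have "\<dots> = (\<integral>\<^sup>+t. ennreal (2 * t * exp (- sqrt 2 * t)) * indicator {0..x} t \<partial>lborel)"
    by (intro nn_integral_cong) (auto simp: pi_min_density_def split: split_indicator)
  also have "\<dots> = (if x < 0 then 0 else ennreal (1 - pi_tail x))"
  proof (cases "x < 0")
    case False
    have "(\<integral>\<^sup>+t. ennreal (2 * t * exp (- sqrt 2 * t)) * indicator {0..x} t \<partial>lborel) = ennreal (- pi_tail x - (- pi_tail 0))"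
      using False DERIV_minus[OF DERIV_pi_tail]
      by (intro nn_integral_FTC_Icc) (auto intro: has_field_derivative_at_within simp: has_real_derivative_iff_has_vector_derivative[symmetric])
    then show ?thesis using False by (simp add: pi_tail_def)
  qed simp
  finally show ?thesis .
qed

lemma measure_pi_min: "measure pi_min {..x} = 1 - pi_tail (max 0 x)"
  using pi_tail_bounds[of x] by (auto simp: measure_def emeasure_pi_min max_def pi_tail_def)

lemma prob_space_pi_min: "prob_space pi_min"
proof
  have "(\<lambda>n. emeasure pi_min {..real n}) \<longlonglongrightarrow> emeasure pi_min (\<Union>n. {..real n})"
    by (intro Lim_emeasure_incseq) (auto simp: incseq_def pi_min_def)
  moreover have "(\<Union>n. {..real n}) = (UNIV :: real set)" using real_arch_simple by auto
  moreover have "(\<lambda>n. emeasure pi_min {..real n}) \<longlonglongrightarrow> ennreal (1 - 0)"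
  proof -
    have "(\<lambda>n. ennreal (1 - pi_tail (real n))) \<longlonglongrightarrow> ennreal (1 - 0)"
      by (intro tendsto_ennrealI tendsto_diff tendsto_const filterlim_compose[OF pi_tail_at_top filterlim_real_sequentially])
    then show ?thesis by (simp add: emeasure_pi_min)
  qed
  ultimately have "emeasure pi_min UNIV = ennreal (1 - 0)" using LIMSEQ_unique by metis
  then show "emeasure pi_min (space pi_min) = 1" by (simp add: pi_min_def)
qed

text \<open>Replacing the infimum by rational test radii and rational test points costs nothing, because
  enlarging the radius absorbs a shift of the test point.\<close>
lemma levy_dist_le_iff:
  assumes M: "prob_space M" "sets M = sets borel" and L: "prob_space L" "sets L = sets borel" and e: "0 \<le> e"
  shows "levy_dist M L \<le> e \<longleftrightarrow> (\<forall>q x :: rat. e < of_rat q \<longrightarrow>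
     measure M {..of_rat x - of_rat q} - of_rat q \<le> measure L {..of_rat x}
     \<and> measure L {..of_rat x} \<le> measure M {..of_rat x + of_rat q} + of_rat q)"
proof -
  interpret M: prob_space M by (rule M(1))
  interpret L: prob_space L by (rule L(1))
  define C where "C q x \<longleftrightarrow> measure M {..x - q} - q \<le> measure L {..x} \<and> measure L {..x} \<le> measure M {..x + q} + q" for q x :: real
  have mM: "measure M {..a} \<le> measure M {..b}" and mL: "measure L {..a} \<le> measure L {..b}" if "a \<le> b" for a b :: real
    using that M(2) L(2) by (auto intro!: M.finite_measure_mono L.finite_measure_mono)
  define S where "S = {q. 0 < q \<and> (\<forall>x. C q x)}"
  have levy: "levy_dist M L = Inf S" by (simp add: levy_dist_def S_def C_def)
  \<comment> \<open>The radius 1 is always admissible, as probabilities lie between 0 and 1; without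
    it the infimum would carry no information.\<close>
  have "1 \<in> S" using M.prob_le_1 L.prob_le_1 by (auto simp: S_def C_def intro: order_trans[OF _ measure_nonneg] add_increasing)
  then have ne: "S \<noteq> {}" by auto
  have bdd: "bdd_below S" by (rule bdd_belowI[of _ 0]) (simp add: S_def)
  have up: "C q' x" if "C q x1" "C q x2" "x - (q' - q) \<le> x1" "x1 \<le> x" "x \<le> x2" "x2 \<le> x + (q' - q)" for q q' x x1 x2
    using that mM[of "x - q'" "x1 - q"] mL[of x1 x] mL[of x x2] mM[of "x2 + q" "x + q'"]
    by (auto simp: C_def)
  have "Inf S \<le> e \<longleftrightarrow> (\<forall>q x :: rat. e < of_rat q \<longrightarrow> C (of_rat q) (of_rat x))"
  proof (intro iffI allI impI)
    fix q x :: rat assume "Inf S \<le> e" "e < of_rat q"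
    then have "Inf S < of_rat q" by linarith
    then have "\<exists>s\<in>S. s < of_rat q" by (rule iffD1[OF cInf_less_iff[OF ne bdd]])
    then obtain s where s: "s \<in> S" "s < of_rat q" by (elim bexE)
    from s show "C (of_rat q) (of_rat x)"
      by - (rule up[of s "of_rat x" "of_rat x"], auto simp: S_def)
  next
    assume rhs: "\<forall>q x :: rat. e < of_rat q \<longrightarrow> C (of_rat q) (of_rat x)"
    show "Inf S \<le> e"
    proof (rule dense_ge)
      fix r assume r: "e < r"
      obtain q :: rat where q: "e < of_rat q" "of_rat q < r" using of_rat_dense[OF r] by blast
      have "C r x" for x
      proof -
        obtain x1 :: rat where x1: "x - (r - of_rat q) < of_rat x1" "of_rat x1 < x" using of_rat_dense[of "x - (r - of_rat q)" x] q by auto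
        obtain x2 :: rat where x2: "x < of_rat x2" "of_rat x2 < x + (r - of_rat q)" using of_rat_dense[of x "x + (r - of_rat q)"] q by auto
        show ?thesis using x1 x2 q rhs by - (rule up[of "of_rat q" "of_rat x1" "of_rat x2"], auto)
      qed
      then have "r \<in> S" using r e by (auto simp: S_def)
      then show "Inf S \<le> r" by (intro cInf_lower bdd)
    qed
  qed
  then show ?thesis by (simp add: levy C_def)
qed

lemma levy_dist_nonneg:
  assumes M: "prob_space M" and L: "prob_space L"
  shows "0 \<le> levy_dist M L"
  unfolding levy_dist_def
proof (rule cInf_greatest)
  interpret M: prob_space M by (rule M)
  interpret L: prob_space L by (rule L)
  have "1 \<in> {e. 0 < e \<and> (\<forall>x. measure M {..x - e} - e \<le> measure L {..x} \<and> measure L {..x} \<le> measure M {..x + e} + e)}"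
    using M.prob_le_1 L.prob_le_1 by (auto intro: order_trans[OF _ measure_nonneg] add_increasing)
  then show "{e. 0 < e \<and> (\<forall>x. measure M {..x - e} - e \<le> measure L {..x} \<and> measure L {..x} \<le> measure M {..x + e} + e)} \<noteq> {}" by blast
qed auto

lemma levy_dist_le:
  assumes "0 < e" "\<And>x. measure M {..x - e} - e \<le> measure L {..x}" "\<And>x. measure L {..x} \<le> measure M {..x + e} + e"
  shows "levy_dist M L \<le> e"
  unfolding levy_dist_def using assms by (intro cInf_lower bdd_belowI[of _ 0]) auto

lemma sets_empirical: "sets (empirical N y) = sets borel" "sets pi_min = sets borel"
  by (simp_all add: empirical_def pi_min_def)

text \<open>The rational reformulation expresses the level set by countably many conditions on
  \<open>emp_tail\<close>; for negative levels it is the whole space.\<close>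

lemma levy_dist_level_measurable:
  assumes N: "0 < N" and s: "sets \<psi> = sets (state_space N)"
  shows "{y\<in>space \<psi>. \<epsilon> < levy_dist (empirical N y) pi_min} \<in> sets \<psi>"
proof (cases "\<epsilon> < 0")
  case True
  then have "{y\<in>space \<psi>. \<epsilon> < levy_dist (empirical N y) pi_min} = space \<psi>"
    using levy_dist_nonneg[OF prob_space_empirical[OF N] prob_space_pi_min] by (auto intro: less_le_trans)
  then show ?thesis by simp
next
  case False
  have [measurable]: "(\<lambda>y. emp_tail N y x) \<in> borel_measurable \<psi>" for x by (simp add: measurable_cong_sets[OF s refl])
  have "{y\<in>space \<psi>. \<epsilon> < levy_dist (empirical N y) pi_min} = {y\<in>space \<psi>. \<not> (\<forall>q x :: rat. \<epsilon> < of_rat q \<longrightarrow>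
     1 - emp_tail N y (of_rat x - of_rat q) - of_rat q \<le> measure pi_min {..of_rat x}
     \<and> measure pi_min {..of_rat x} \<le> 1 - emp_tail N y (of_rat x + of_rat q) + of_rat q)}"
    using levy_dist_le_iff[OF prob_space_empirical[OF N] sets_empirical(1) prob_space_pi_min sets_empirical(2), of \<epsilon>] False
    by (auto simp: measure_empirical[OF N] not_le[symmetric] simp del: not_le)
  also have "\<dots> \<in> sets \<psi>" by measurable
  finally show ?thesis .
qed

text \<open>The horizontal slack of the Levy metric absorbs a mesh of width e, so finitely many
  points suffice without a modulus of continuity. To the left of 0 the empirical tail is 1, and
  beyond e * M monotonicity and the last grid point keep both tails at most e.\<close>

lemma levy_dist_empirical_le:
  assumes N: "0 < N" and y: "y \<in> Gamma N" and e: "0 < e" and M: "pi_tail (e * real M) \<le> e / 2"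
    and grid: "\<And>i. i \<le> M \<Longrightarrow> \<bar>emp_tail N y (e * real i) - pi_tail (e * real i)\<bar> \<le> e / 2"
  shows "levy_dist (empirical N y) pi_min \<le> e"
proof (rule levy_dist_le[OF e])
  fix x :: real
  note F = antimonoD[OF antimono_emp_tail[of N y]]
  note bounds = emp_tail_bounds[of N y] pi_tail_bounds
  have g: "pi_tail (e * real i) \<le> emp_tail N y (e * real i) + e / 2" "emp_tail N y (e * real i) \<le> pi_tail (e * real i) + e / 2" if "i \<le> M" for i
    using grid[OF that] unfolding abs_le_iff by linarith+
  have "pi_tail (max 0 x) \<le> emp_tail N y (x - e) + e"
  proof -
    consider "x < e" | "e \<le> x" "x \<le> e * real M" | "e * real M \<le> x" by linarith
    then show ?thesis
    proof cases
      case 1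
      then show ?thesis using emp_tail_Gamma[OF N y, of "x - e"] e pi_tail_bounds(2)[of "max 0 x"] by simp
    next
      case 2
      define i where "i = nat \<lfloor>x / e\<rfloor>"
      have xe: "0 \<le> x / e" using 2 e by simp
      have "real i = of_int \<lfloor>x / e\<rfloor>" unfolding i_def using xe by simp
      then have i: "real i \<le> x / e" "x / e - 1 < real i" by linarith+
      then have i': "e * real i \<le> x" "x - e \<le> e * real i" using e by (auto simp: field_simps)
      have "e * real i \<le> e * real M" using i' 2 by linarith
      then have "i \<le> M" using e by simp
      have "pi_tail x \<le> pi_tail (e * real i)" using e by (intro pi_tail_antimono i') simp
      moreover have "max 0 x = x" using 2 e by simp
      ultimately show ?thesis using g(1)[OF \<open>i \<le> M\<close>] F[OF i'(2)] e by linarith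
    next
      case 3
      have "0 \<le> e * real M" using e by simp
      moreover from this have "max 0 x = x" using 3 by simp
      ultimately show ?thesis using pi_tail_antimono[OF _ 3] M e bounds(1)[of "x - e"] by simp
    qed
  qed
  then show "measure (empirical N y) {..x - e} - e \<le> measure pi_min {..x}"
    by (simp add: measure_empirical[OF N] measure_pi_min)
  have "emp_tail N y (x + e) \<le> pi_tail (max 0 x) + e"
  proof -
    consider "x < 0" | "0 \<le> x" "x \<le> e * real M" | "e * real M \<le> x" "0 \<le> x" by linarith
    then show ?thesis
    proof cases
      case 1
      then show ?thesis using bounds(2)[of "x + e"] e by (simp add: pi_tail_def)
    next
      case 2
      define i where "i = nat \<lceil>x / e\<rceil>"
      have xe: "0 \<le> x / e" using 2 e by simp
      have "real i = of_int \<lceil>x / e\<rceil>" unfolding i_def using xe by simp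
      then have i: "x / e \<le> real i" "real i < x / e + 1" by linarith+
      then have i': "x \<le> e * real i" "e * real i \<le> x + e" using e by (auto simp: field_simps)
      have "x / e \<le> real M" using 2 e by (simp add: field_simps)
      then have "i \<le> M" unfolding i_def by (simp add: nat_le_iff ceiling_le_iff)
      have "max 0 x = x" using 2 by simp
      then show ?thesis using g(2)[OF \<open>i \<le> M\<close>] F[OF i'(2)] pi_tail_antimono[OF 2(1) i'(1)] e by simp
    next
      case 3
      have "emp_tail N y (x + e) \<le> emp_tail N y (e * real M)" using 3 e by (intro F) simp
      moreover have "max 0 x = x" using 3 by simp
      ultimately show ?thesis using g(2)[of M] M e bounds(3)[OF 3(2)] by simp
    qed
  qed
  then show "measure pi_min {..x} \<le> measure (empirical N y) {..x + e} + e"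
    by (simp add: measure_empirical[OF N] measure_pi_min)
qed

theorem theorem1p2:
  fixes \<psi> :: "nat \<Rightarrow> (nat \<Rightarrow> real) measure"
  assumes stat: "\<forall>N\<ge>2. NBBM_stationary N (\<psi> N)"
  shows "(\<forall>N\<ge>2. \<forall>\<epsilon>. {y \<in> space (\<psi> N). \<epsilon> < levy_dist (empirical N y) pi_min} \<in> sets (\<psi> N))
       \<and> (\<forall>\<epsilon>>0. (\<lambda>N. measure (\<psi> N) {y \<in> space (\<psi> N). \<epsilon> < levy_dist (empirical N y) pi_min})
                 \<longlonglongrightarrow> 0)"
proof (intro conjI allI impI)
  fix N :: nat and \<epsilon> :: real assume "2 \<le> N"
  then show "{y \<in> space (\<psi> N). \<epsilon> < levy_dist (empirical N y) pi_min} \<in> sets (\<psi> N)"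
    using stat by (intro levy_dist_level_measurable) (auto simp: NBBM_stationary_def)
next
  fix \<epsilon> :: real assume e: "0 < \<epsilon>"
  then have e2: "0 < \<epsilon> / 2" by simp
  have "(\<lambda>M. pi_tail (\<epsilon> * real M)) \<longlonglongrightarrow> 0"
  proof (rule filterlim_compose[OF pi_tail_at_top])
    show "filterlim (\<lambda>M. \<epsilon> * real M) at_top sequentially" using e by real_asymp
  qed
  then have "\<forall>\<^sub>F M in sequentially. pi_tail (\<epsilon> * real M) < \<epsilon> / 2" using e2 by (rule order_tendstoD)
  then obtain M where M: "pi_tail (\<epsilon> * real M) < \<epsilon> / 2" by (auto simp: eventually_sequentially)
  \<comment> \<open>A distance above \<epsilon> forces a deviation above \<epsilon> / 2 at one of
    the M + 1 grid points, so the sum over the grid bounds its probability.\<close>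
  define p where "p N i = measure (\<psi> N) {y\<in>space (\<psi> N). \<epsilon> / 2 < \<bar>emp_tail N y (\<epsilon> * real i) - pi_tail (\<epsilon> * real i)\<bar>}" for N i
  have "(\<lambda>N. \<Sum>i\<le>M. p N i) \<longlonglongrightarrow> (\<Sum>i\<le>M. 0)"
    unfolding p_def using e by (intro tendsto_sum emp_tail_in_probability stat e2) simp
  then have lim: "(\<lambda>N. \<Sum>i\<le>M. p N i) \<longlonglongrightarrow> 0" by simp
  have bound: "\<forall>\<^sub>F N in sequentially. measure (\<psi> N) {y \<in> space (\<psi> N). \<epsilon> < levy_dist (empirical N y) pi_min} \<le> (\<Sum>i\<le>M. p N i)"
    using eventually_ge_at_top[of 2]
  proof eventually_elim
    case (elim N)
    then have N: "0 < N" by simp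
    have st: "NBBM_stationary N (\<psi> N)" using stat elim by blast
    interpret P: prob_space "\<psi> N" using st by (simp add: NBBM_stationary_def)
    note [measurable] = stationary_emp_tail(1)[OF N st]
    let ?A = "\<lambda>i. {y\<in>space (\<psi> N). \<epsilon> / 2 < \<bar>emp_tail N y (\<epsilon> * real i) - pi_tail (\<epsilon> * real i)\<bar>}"
    have A: "?A i \<in> sets (\<psi> N)" for i by measurable
    have "measure (\<psi> N) {y \<in> space (\<psi> N). \<epsilon> < levy_dist (empirical N y) pi_min} \<le> measure (\<psi> N) (\<Union>i\<le>M. ?A i)"
    proof (rule P.finite_measure_mono_AE)
      have "AE y in \<psi> N. y \<in> Gamma N" using st by (simp add: NBBM_stationary_def)
      then show "AE y in \<psi> N. y \<in> {y \<in> space (\<psi> N). \<epsilon> < levy_dist (empirical N y) pi_min} \<longrightarrow> y \<in> (\<Union>i\<le>M. ?A i)"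
      proof eventually_elim
        case (elim y)
        show ?case
        proof (rule impI, rule ccontr)
          assume y: "y \<in> {y \<in> space (\<psi> N). \<epsilon> < levy_dist (empirical N y) pi_min}" "y \<notin> (\<Union>i\<le>M. ?A i)"
          have "levy_dist (empirical N y) pi_min \<le> \<epsilon>"
            by (rule levy_dist_empirical_le[OF N elim e less_imp_le[OF M]]) (use y in \<open>auto simp: not_less\<close>)
          then show False using y(1) by simp
        qed
      qed
    qed (use A in auto)
    also have "\<dots> \<le> (\<Sum>i\<le>M. measure (\<psi> N) (?A i))" using A by (intro P.finite_measure_subadditive_finite) auto
    finally show ?case by (simp add: p_def)
  qed
  show "(\<lambda>N. measure (\<psi> N) {y \<in> space (\<psi> N). \<epsilon> < levy_dist (empirical N y) pi_min}) \<longlonglongrightarrow> 0"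
    by (rule tendsto_sandwich[OF _ bound tendsto_const lim]) simp
qed

end
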